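(* Let $H$ be a Hopf algebra over a field $\Bbbk$, let $G$ be a group, let $H=\bigoplus_{g\in G}H_g$ be the $G$-grading induced by a surjective cocentral Hopf algebra map $\pi:H\to\Bbbk G$, and let $(\gamma,\lambda,\omega)$ be an associative $G$-zesting datum for $H$ (with $\Gamma_0\le G(H^{\mathrm{co}\,\pi})$). Then $H$ can be endowed with a structure of coquasi-bialgebra, denoted $H^\lambda$, such that: - the coalgebra structure of $H^\lambda$ is the same as that of $H$; - the multiplication $m^\lambda:H^\lambda\otimes H^\lambda\to H^\lambda$ is given by $m^\lambda(h\otimes k)=hk\,\lambda(g_1,g_2)$ for $h\in H_{g_1}$, $k\in H_{g_2}$ (products on the right taken in $H$); - the associator $\Omega\in(H^{\otimes 3})^*$ is given by $\Omega(h\otimes k\otimes l)=\varepsilon(hk)\,\omega(g_1,g_2,g_3)\,\langle\gamma(\lambda(g_1,g_2)),l\rangle$ for $h\in H_{g_1}$, $k\in H_{g_2}$, $l\in H_{g_3}$. Furthermore, the category of left $H^\lambda$-comodules is tensor equivalent to the zested category: ${}^{H^\lambda}\mathcal{M}\simeq{}^{H}\mathcal{M}^{(\gamma,\lambda,\omega)}$.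
   Context: Sweedler notation $\Delta(h)=h_{(1)}\otimes h_{(2)}$ is used; $G(C)$ denotes the set of group-like elements of a coalgebra $C$. ${}^{H}\mathcal{M}$ is the category of left $H$-comodules, with coaction $x\mapsto x_{(-1)}\otimes x_{(0)}$. **Cocentral maps and gradings.** A Hopf algebra map $\pi:H\to K$ is cocentral if $h_{(1)}\otimes\pi(h_{(2)})=h_{(2)}\otimes\pi(h_{(1)})$ for all $h\in H$. For surjective cocentral $\pi:H\to\Bbbk G$, put $H_g=\{h\in H:(\pi\otimes\mathrm{id})\Delta(h)=g\otimes h\}$; then $H=\bigoplus_{g\in G}H_g$. $H^{\mathrm{co}\,\pi}$ is the Hopf subalgebra of coinvariants, equal to $H_e$. A left $H$-comodule $X$ decomposes as $X=\bigoplus_g X_g$, where $X_g=\{x:\pi(x_{(-1)})\otimes x_{(0)}=g\otimes x\}$, and $({}^H\mathcal M)_g$ is the full subcategory of comodules with $X=X_g$. **Associative $G$-zesting datum for $H$.** Let $\Gamma_0$ be a subgroup of $G(H^{\mathrm{co}\,\pi})$. Let $\mathrm{Alg}(H,\Bbbk)$ be the group of algebra maps $H\to\Bbbk$ under convolution. A datum is a triple $(\gamma,\lambda,\omega)$ with: 1. $\gamma:\Gamma_0\to\mathrm{Alg}(H,\Bbbk)$ a group homomorphism with $\langle\gamma(g),h_{(1)}\rangle\,g h_{(2)}g^{-1}=h_{(1)}\langle\gamma(g),h_{(2)}\rangle$ for all $g\in\Gamma_0$, $h\in H$; 2. $\lambda:G\times G\to\Gamma_0$ a normalized 2-cocycle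 (trivial action), i.e. $\lambda(g_1,g_2)\lambda(g_1g_2,g_3)=\lambda(g_2,g_3)\lambda(g_1,g_2g_3)$ and $\lambda(g,e)=\lambda(e,g)=1$; 3. $\omega:G^3\to\Bbbk^*$ a normalized 3-cochain (value $1$ if some argument is $e$) with $$\langle\gamma(\lambda(g_1,g_2)),\lambda(g_3,g_4)\rangle=\frac{\omega(g_1,g_2,g_3)\,\omega(g_1,g_2g_3,g_4)\,\omega(g_2,g_3,g_4)}{\omega(g_1g_2,g_3,g_4)\,\omega(g_1,g_2,g_3g_4)}$$ for all $g_1,\dots,g_4\in G$. **Coquasi-bialgebra.** A coalgebra $(H,\Delta,\varepsilon)$ with coalgebra maps $m:H\otimes H\to H$ and $u:\Bbbk\to H$ and a convolution invertible $\Omega\in(H^{\otimes3})^*$ such that, for all $h,k,l,t\in H$ (products denote $m$): $(h_{(1)}k_{(1)})l_{(1)}\Omega(h_{(2)},k_{(2)},l_{(2)})=\Omega(h_{(1)},k_{(1)},l_{(1)})h_{(2)}(k_{(2)}l_{(2)})$; $1h=h1=h$; $\Omega(h_{(1)}k_{(1)},l_{(1)},t_{(1)})\Omega(h_{(2)},k_{(2)},l_{(2)}t_{(2)})=\Omega(h_{(1)},k_{(1)},l_{(1)})\Omega(h_{(2)},k_{(2)}l_{(2)},t_{(1)})\Omega(k_{(3)},l_{(3)},t_{(2)})$; $\Omega(h,1,k)=\varepsilon(h)\varepsilon(k)$. Its left comodules form a monoidal category with tensor product over $\Bbbk$, coaction $x\otimes y\mapsto x_{(-1)}y_{(-1)}\otimes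 x_{(0)}\otimes y_{(0)}$ and associator $x\otimes y\otimes z\mapsto\Omega(x_{(-1)},y_{(-1)},z_{(-1)})\,x_{(0)}\otimes y_{(0)}\otimes z_{(0)}$. **Zested category.** ${}^H\mathcal M^{(\gamma,\lambda,\omega)}$ is the abelian category ${}^H\mathcal M$ with unit $\Bbbk$ and, for $X,Y,Z$ homogeneous of degrees $g_1,g_2,g_3$ (extended additively), tensor product $X\otimes^\lambda Y=X\otimes Y\otimes\Bbbk\lambda(g_1,g_2)$, where $\Bbbk\lambda(g_1,g_2)$ is the one-dimensional comodule of the group-like element $\lambda(g_1,g_2)$. The associator is the composite of $\mathrm{id}_{X\otimes Y}\otimes\sigma_{\lambda(g_1,g_2),Z}\otimes\mathrm{id}$, where $\sigma_{\lambda(g_1,g_2),Z}:\Bbbk\lambda(g_1,g_2)\otimes Z\to Z\otimes\Bbbk\lambda(g_1,g_2)$ is the half-braiding $\lambda(g_1,g_2)\otimes z\mapsto\langle\gamma(\lambda(g_1,g_2)),z_{(-1)}\rangle z_{(0)}\otimes\lambda(g_1,g_2)$, followed by $\mathrm{id}_{X\otimes Y\otimes Z}$ tensored with the isomorphism $\Bbbk\lambda(g_1,g_2)\otimes\Bbbk\lambda(g_1g_2,g_3)\to\Bbbk\lambda(g_2,g_3)\otimes\Bbbk\lambda(g_1,g_2g_3)$ sending basis element to basis element times $\omega(g_1,g_2,g_3)$.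
   Formalization: Condition 1 of the zesting datum is taken with g^{-1} h_(2) g in place of g h_(2) g^{-1}; as printed it is incompatible with the half-braiding and the claim fails. Comodules are taken inside an arbitrary set-sized universe closed under tensor products. *)

theory Defs
  imports "HOL-Algebra.Module" "HOL-Library.FuncSet"
begin

section \<open>Vector spaces and tensor products\<close>

text \<open>The ground field is a type \<open>'k::field\<close>; \<open>base\<close> is that field as a record, both as the ring of
  scalars and as a one-dimensional vector space.  Vector spaces are modules over it in the sense
  of HOL-Algebra (the ring fields \<open>mult\<close> and \<open>one\<close> of a module record are meaningful for algebras only).\<close>

definition base :: "('k::field, 'k) module" where
  "base = \<lparr>carrier = UNIV, monoid.mult = (*), one = 1, zero = 0, add = (+), smult = (*)\<rparr>"

abbreviation vspace :: "('k::field, 'a, 'm) module_scheme \<Rightarrow> bool" where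
  "vspace M \<equiv> module base M"

definition mk_vspace ::
  "'a set \<Rightarrow> 'a \<Rightarrow> ('a \<Rightarrow> 'a \<Rightarrow> 'a) \<Rightarrow> ('k \<Rightarrow> 'a \<Rightarrow> 'a) \<Rightarrow> ('k, 'a) module" where
  "mk_vspace S z p s = \<lparr>carrier = S, monoid.mult = undefined, one = undefined, zero = z, add = p, smult = s\<rparr>"

definition lin ::
  "('k::field, 'a, 'm) module_scheme \<Rightarrow> ('k, 'b, 'n) module_scheme \<Rightarrow> ('a \<Rightarrow> 'b) \<Rightarrow> bool" where
  "lin M N f \<longleftrightarrow> f \<in> carrier M \<rightarrow> carrier N
     \<and> (\<forall>x\<in>carrier M. \<forall>y\<in>carrier M. f (x \<oplus>\<^bsub>M\<^esub> y) = f x \<oplus>\<^bsub>N\<^esub> f y)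
     \<and> (\<forall>c. \<forall>x\<in>carrier M. f (c \<odot>\<^bsub>M\<^esub> x) = c \<odot>\<^bsub>N\<^esub> f x)"

text \<open>A list of pairs \<open>[(a\<^sub>1, b\<^sub>1), \<dots>, (a\<^sub>n, b\<^sub>n)]\<close> stands for the formal sum
  \<open>a\<^sub>1 \<otimes> b\<^sub>1 + \<dots> + a\<^sub>n \<otimes> b\<^sub>n\<close>; \<open>M \<otimes> N\<close> is the set of such formal sums modulo the congruence
  generated by commutativity and bilinearity.\<close>

inductive tens_eq ::
  "('k::field, 'a, 'm) module_scheme \<Rightarrow> ('k, 'b, 'n) module_scheme
     \<Rightarrow> ('a \<times> 'b) list \<Rightarrow> ('a \<times> 'b) list \<Rightarrow> bool"
  for M :: "('k::field, 'a, 'm) module_scheme" and N :: "('k, 'b, 'n) module_scheme" where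
  tens_refl: "set l \<subseteq> carrier M \<times> carrier N \<Longrightarrow> tens_eq M N l l"
| tens_sym: "tens_eq M N l l' \<Longrightarrow> tens_eq M N l' l"
| tens_trans: "tens_eq M N l l' \<Longrightarrow> tens_eq M N l' l'' \<Longrightarrow> tens_eq M N l l''"
| tens_append: "tens_eq M N l l' \<Longrightarrow> tens_eq M N m m' \<Longrightarrow> tens_eq M N (l @ m) (l' @ m')"
| tens_commute: "set l \<subseteq> carrier M \<times> carrier N \<Longrightarrow> set m \<subseteq> carrier M \<times> carrier N
     \<Longrightarrow> tens_eq M N (l @ m) (m @ l)"
| tens_add_left: "a \<in> carrier M \<Longrightarrow> a' \<in> carrier M \<Longrightarrow> b \<in> carrier N
     \<Longrightarrow> tens_eq M N [(a \<oplus>\<^bsub>M\<^esub> a', b)] [(a, b), (a', b)]"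
| tens_add_right: "a \<in> carrier M \<Longrightarrow> b \<in> carrier N \<Longrightarrow> b' \<in> carrier N
     \<Longrightarrow> tens_eq M N [(a, b \<oplus>\<^bsub>N\<^esub> b')] [(a, b), (a, b')]"
| tens_scalar: "a \<in> carrier M \<Longrightarrow> b \<in> carrier N
     \<Longrightarrow> tens_eq M N [(c \<odot>\<^bsub>M\<^esub> a, b)] [(a, c \<odot>\<^bsub>N\<^esub> b)]"
| tens_zero_left: "b \<in> carrier N \<Longrightarrow> tens_eq M N [(\<zero>\<^bsub>M\<^esub>, b)] []"
| tens_zero_right: "a \<in> carrier M \<Longrightarrow> tens_eq M N [(a, \<zero>\<^bsub>N\<^esub>)] []"

definition tens_class ::
  "('k::field, 'a, 'm) module_scheme \<Rightarrow> ('k, 'b, 'n) module_scheme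
     \<Rightarrow> ('a \<times> 'b) list \<Rightarrow> ('a \<times> 'b) list set" where
  "tens_class M N l = {l'. tens_eq M N l l'}"

definition rep :: "'a set \<Rightarrow> 'a" where
  "rep t = (SOME l. l \<in> t)"

definition tensor ::
  "('k::field, 'a, 'm) module_scheme \<Rightarrow> ('k, 'b, 'n) module_scheme
     \<Rightarrow> ('k, ('a \<times> 'b) list set) module" where
  "tensor M N = mk_vspace
     (tens_class M N ` lists (carrier M \<times> carrier N))
     (tens_class M N [])
     (\<lambda>s t. tens_class M N (rep s @ rep t))
     (\<lambda>c t. tens_class M N (map (\<lambda>(a, b). (c \<odot>\<^bsub>M\<^esub> a, b)) (rep t)))"

definition pure ::
  "('k::field, 'a, 'm) module_scheme \<Rightarrow> ('k, 'b, 'n) module_scheme \<Rightarrow> 'a \<Rightarrow> 'b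
     \<Rightarrow> ('a \<times> 'b) list set" where
  "pure M N a b = tens_class M N [(a, b)]"

text \<open>\<open>tsum N t f\<close> is the sum in \<open>N\<close> of \<open>f a b\<close> over the pure tensors \<open>a \<otimes> b\<close> in some representation
  of \<open>t\<close>.  It is independent of the representation, and linear in \<open>t\<close>, whenever \<open>f\<close> is bilinear;
  it is only used for such \<open>f\<close>.  In particular \<open>tsum N (\<Delta> h) (\<lambda>h\<^sub>1 h\<^sub>2. \<dots>)\<close> renders Sweedler notation.\<close>

definition tsum ::
  "('k, 'c, 'p) module_scheme \<Rightarrow> ('a \<times> 'b) list set \<Rightarrow> ('a \<Rightarrow> 'b \<Rightarrow> 'c) \<Rightarrow> 'c" where
  "tsum N t f = foldr (\<lambda>(a, b) s. f a b \<oplus>\<^bsub>N\<^esub> s) (rep t) \<zero>\<^bsub>N\<^esub>"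

definition tmap ::
  "('k::field, 'c, 'm) module_scheme \<Rightarrow> ('k, 'd, 'n) module_scheme
     \<Rightarrow> ('a \<Rightarrow> 'c) \<Rightarrow> ('b \<Rightarrow> 'd) \<Rightarrow> ('a \<times> 'b) list set \<Rightarrow> ('c \<times> 'd) list set" where
  "tmap M' N' f g t = tsum (tensor M' N') t (\<lambda>a b. pure M' N' (f a) (g b))"


section \<open>Coalgebras, Hopf algebras, coquasi-bialgebras\<close>

record ('k, 'h) coalg = "('k, 'h) module" +
  comult :: "'h \<Rightarrow> ('h \<times> 'h) list set"
  counit :: "'h \<Rightarrow> 'k"

record ('k, 'h) hopf = "('k, 'h) coalg" +
  antipode :: "'h \<Rightarrow> 'h"

record ('k, 'h) coquasi = "('k, 'h) coalg" +
  reassociator :: "'h \<Rightarrow> 'h \<Rightarrow> 'h \<Rightarrow> 'k"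

definition coalgebra :: "('k::field, 'h, 'm) coalg_scheme \<Rightarrow> bool" where
  "coalgebra H \<longleftrightarrow> vspace H \<and> lin H (tensor H H) (comult H) \<and> lin H base (counit H)
     \<and> (\<forall>h\<in>carrier H.
          tsum (tensor H (tensor H H)) (comult H h) (\<lambda>a b.
            tsum (tensor H (tensor H H)) (comult H b) (\<lambda>b\<^sub>1 b\<^sub>2.
              pure H (tensor H H) a (pure H H b\<^sub>1 b\<^sub>2)))
        = tsum (tensor H (tensor H H)) (comult H h) (\<lambda>a b.
            tsum (tensor H (tensor H H)) (comult H a) (\<lambda>a\<^sub>1 a\<^sub>2.
              pure H (tensor H H) a\<^sub>1 (pure H H a\<^sub>2 b))))
     \<and> (\<forall>h\<in>carrier H. tsum H (comult H h) (\<lambda>a b. counit H a \<odot>\<^bsub>H\<^esub> b) = h)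
     \<and> (\<forall>h\<in>carrier H. tsum H (comult H h) (\<lambda>a b. counit H b \<odot>\<^bsub>H\<^esub> a) = h)"

text \<open>\<open>m : H \<otimes> H \<rightarrow> H\<close> and \<open>u : k \<rightarrow> H\<close> are coalgebra maps, given as the bilinear operation
  \<open>mult H\<close> and the element \<open>\<one> = u(1)\<close>.\<close>

definition coalgebra_mult_unit :: "('k::field, 'h, 'm) coalg_scheme \<Rightarrow> bool" where
  "coalgebra_mult_unit H \<longleftrightarrow>
     (\<forall>h\<in>carrier H. lin H H (\<lambda>k. h \<otimes>\<^bsub>H\<^esub> k) \<and> lin H H (\<lambda>k. k \<otimes>\<^bsub>H\<^esub> h))
     \<and> (\<forall>h\<in>carrier H. \<forall>k\<in>carrier H.
          comult H (h \<otimes>\<^bsub>H\<^esub> k)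
            = tsum (tensor H H) (comult H h) (\<lambda>h\<^sub>1 h\<^sub>2. tsum (tensor H H) (comult H k) (\<lambda>k\<^sub>1 k\<^sub>2.
                pure H H (h\<^sub>1 \<otimes>\<^bsub>H\<^esub> k\<^sub>1) (h\<^sub>2 \<otimes>\<^bsub>H\<^esub> k\<^sub>2)))
          \<and> counit H (h \<otimes>\<^bsub>H\<^esub> k) = counit H h * counit H k)
     \<and> \<one>\<^bsub>H\<^esub> \<in> carrier H \<and> comult H \<one>\<^bsub>H\<^esub> = pure H H \<one>\<^bsub>H\<^esub> \<one>\<^bsub>H\<^esub> \<and> counit H \<one>\<^bsub>H\<^esub> = 1"

definition bialgebra :: "('k::field, 'h, 'm) coalg_scheme \<Rightarrow> bool" where
  "bialgebra H \<longleftrightarrow> coalgebra H \<and> ring H \<and> coalgebra_mult_unit H"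

definition hopf_algebra :: "('k::field, 'h, 'm) hopf_scheme \<Rightarrow> bool" where
  "hopf_algebra H \<longleftrightarrow> bialgebra H \<and> lin H H (antipode H)
     \<and> (\<forall>h\<in>carrier H.
          tsum H (comult H h) (\<lambda>h\<^sub>1 h\<^sub>2. antipode H h\<^sub>1 \<otimes>\<^bsub>H\<^esub> h\<^sub>2) = counit H h \<odot>\<^bsub>H\<^esub> \<one>\<^bsub>H\<^esub>
        \<and> tsum H (comult H h) (\<lambda>h\<^sub>1 h\<^sub>2. h\<^sub>1 \<otimes>\<^bsub>H\<^esub> antipode H h\<^sub>2) = counit H h \<odot>\<^bsub>H\<^esub> \<one>\<^bsub>H\<^esub>)"

text \<open>Bialgebra maps; between Hopf algebras these automatically commute with the antipodes.\<close>

definition hopf_map ::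
  "('k::field, 'h, 'm) hopf_scheme \<Rightarrow> ('k, 'l, 'n) hopf_scheme \<Rightarrow> ('h \<Rightarrow> 'l) \<Rightarrow> bool" where
  "hopf_map H L f \<longleftrightarrow> lin H L f \<and> f \<in> ring_hom H L
     \<and> (\<forall>h\<in>carrier H. comult L (f h) = tmap L L f f (comult H h) \<and> counit L (f h) = counit H h)"

definition trilinear_form ::
  "('k::field, 'h, 'm) module_scheme \<Rightarrow> ('h \<Rightarrow> 'h \<Rightarrow> 'h \<Rightarrow> 'k) \<Rightarrow> bool" where
  "trilinear_form H \<Omega> \<longleftrightarrow> (\<forall>h\<in>carrier H. \<forall>k\<in>carrier H.
      lin H base (\<lambda>x. \<Omega> x h k) \<and> lin H base (\<lambda>x. \<Omega> h x k) \<and> lin H base (\<lambda>x. \<Omega> h k x))"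

definition conv3 ::
  "('k::field, 'h, 'm) coalg_scheme \<Rightarrow> ('h \<Rightarrow> 'h \<Rightarrow> 'h \<Rightarrow> 'k) \<Rightarrow> ('h \<Rightarrow> 'h \<Rightarrow> 'h \<Rightarrow> 'k)
     \<Rightarrow> 'h \<Rightarrow> 'h \<Rightarrow> 'h \<Rightarrow> 'k" where
  "conv3 H \<Omega> \<Omega>' h k l =
     tsum base (comult H h) (\<lambda>h\<^sub>1 h\<^sub>2. tsum base (comult H k) (\<lambda>k\<^sub>1 k\<^sub>2. tsum base (comult H l) (\<lambda>l\<^sub>1 l\<^sub>2.
       \<Omega> h\<^sub>1 k\<^sub>1 l\<^sub>1 * \<Omega>' h\<^sub>2 k\<^sub>2 l\<^sub>2)))"

definition conv_invertible3 ::
  "('k::field, 'h, 'm) coalg_scheme \<Rightarrow> ('h \<Rightarrow> 'h \<Rightarrow> 'h \<Rightarrow> 'k) \<Rightarrow> bool" where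
  "conv_invertible3 H \<Omega> \<longleftrightarrow> (\<exists>\<Omega>'. trilinear_form H \<Omega>' \<and>
     (\<forall>h\<in>carrier H. \<forall>k\<in>carrier H. \<forall>l\<in>carrier H.
        conv3 H \<Omega> \<Omega>' h k l = counit H h * counit H k * counit H l
      \<and> conv3 H \<Omega>' \<Omega> h k l = counit H h * counit H k * counit H l))"

text \<open>\<open>tsum3 N H h (\<lambda>h\<^sub>1 h\<^sub>2 h\<^sub>3. \<dots>)\<close> is Sweedler notation for the twofold iterated comultiplication.\<close>

definition tsum3 ::
  "('k, 'c, 'p) module_scheme \<Rightarrow> ('k, 'h, 'm) coalg_scheme \<Rightarrow> 'h \<Rightarrow> ('h \<Rightarrow> 'h \<Rightarrow> 'h \<Rightarrow> 'c) \<Rightarrow> 'c" where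
  "tsum3 N H h f = tsum N (comult H h) (\<lambda>a h\<^sub>3. tsum N (comult H a) (\<lambda>h\<^sub>1 h\<^sub>2. f h\<^sub>1 h\<^sub>2 h\<^sub>3))"

definition coquasi_bialgebra :: "('k::field, 'h, 'm) coquasi_scheme \<Rightarrow> bool" where
  "coquasi_bialgebra H \<longleftrightarrow> (let \<Omega> = reassociator H in
     coalgebra H \<and> coalgebra_mult_unit H
     \<and> trilinear_form H \<Omega> \<and> conv_invertible3 H \<Omega>
     \<and> (\<forall>h\<in>carrier H. \<forall>k\<in>carrier H. \<forall>l\<in>carrier H.
          tsum H (comult H h) (\<lambda>h\<^sub>1 h\<^sub>2. tsum H (comult H k) (\<lambda>k\<^sub>1 k\<^sub>2. tsum H (comult H l) (\<lambda>l\<^sub>1 l\<^sub>2.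
            \<Omega> h\<^sub>2 k\<^sub>2 l\<^sub>2 \<odot>\<^bsub>H\<^esub> ((h\<^sub>1 \<otimes>\<^bsub>H\<^esub> k\<^sub>1) \<otimes>\<^bsub>H\<^esub> l\<^sub>1))))
        = tsum H (comult H h) (\<lambda>h\<^sub>1 h\<^sub>2. tsum H (comult H k) (\<lambda>k\<^sub>1 k\<^sub>2. tsum H (comult H l) (\<lambda>l\<^sub>1 l\<^sub>2.
            \<Omega> h\<^sub>1 k\<^sub>1 l\<^sub>1 \<odot>\<^bsub>H\<^esub> (h\<^sub>2 \<otimes>\<^bsub>H\<^esub> (k\<^sub>2 \<otimes>\<^bsub>H\<^esub> l\<^sub>2))))))
     \<and> (\<forall>h\<in>carrier H. \<one>\<^bsub>H\<^esub> \<otimes>\<^bsub>H\<^esub> h = h \<and> h \<otimes>\<^bsub>H\<^esub> \<one>\<^bsub>H\<^esub> = h)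
     \<and> (\<forall>h\<in>carrier H. \<forall>k\<in>carrier H. \<forall>l\<in>carrier H. \<forall>t\<in>carrier H.
          tsum base (comult H h) (\<lambda>h\<^sub>1 h\<^sub>2. tsum base (comult H k) (\<lambda>k\<^sub>1 k\<^sub>2.
            tsum base (comult H l) (\<lambda>l\<^sub>1 l\<^sub>2. tsum base (comult H t) (\<lambda>t\<^sub>1 t\<^sub>2.
              \<Omega> (h\<^sub>1 \<otimes>\<^bsub>H\<^esub> k\<^sub>1) l\<^sub>1 t\<^sub>1 * \<Omega> h\<^sub>2 k\<^sub>2 (l\<^sub>2 \<otimes>\<^bsub>H\<^esub> t\<^sub>2)))))
        = tsum base (comult H h) (\<lambda>h\<^sub>1 h\<^sub>2. tsum3 base H k (\<lambda>k\<^sub>1 k\<^sub>2 k\<^sub>3.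
            tsum3 base H l (\<lambda>l\<^sub>1 l\<^sub>2 l\<^sub>3. tsum base (comult H t) (\<lambda>t\<^sub>1 t\<^sub>2.
              \<Omega> h\<^sub>1 k\<^sub>1 l\<^sub>1 * \<Omega> h\<^sub>2 (k\<^sub>2 \<otimes>\<^bsub>H\<^esub> l\<^sub>2) t\<^sub>1 * \<Omega> k\<^sub>3 l\<^sub>3 t\<^sub>2)))))
     \<and> (\<forall>h\<in>carrier H. \<forall>k\<in>carrier H. \<Omega> h \<one>\<^bsub>H\<^esub> k = counit H h * counit H k))"


section \<open>Group algebras, cocentral maps, gradings\<close>

definition delta :: "'g \<Rightarrow> 'g \<Rightarrow> 'k::field" where
  "delta g = (\<lambda>x. if x = g then 1 else 0)"

definition supp :: "('g \<Rightarrow> 'k::field) \<Rightarrow> 'g set" where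
  "supp f = {x. f x \<noteq> 0}"

definition group_alg_module :: "('g, 'm) monoid_scheme \<Rightarrow> ('k::field, 'g \<Rightarrow> 'k) module" where
  "group_alg_module G =
     \<lparr>carrier = {f. finite (supp f) \<and> supp f \<subseteq> carrier G},
      monoid.mult = (\<lambda>f f' x. \<Sum>(a, b) \<in> {(a, b) \<in> supp f \<times> supp f'. a \<otimes>\<^bsub>G\<^esub> b = x}. f a * f' b),
      one = delta \<one>\<^bsub>G\<^esub>,
      zero = (\<lambda>x. 0),
      add = (\<lambda>f f' x. f x + f' x),
      smult = (\<lambda>c f x. c * f x)\<rparr>"

text \<open>The comultiplication is the linear extension of \<open>g \<mapsto> g \<otimes> g\<close>.\<close>

definition group_alg :: "('g, 'm) monoid_scheme \<Rightarrow> ('k::field, 'g \<Rightarrow> 'k) hopf" where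
  "group_alg G = (let V = group_alg_module G in
     \<lparr>carrier = carrier V, monoid.mult = monoid.mult V, one = one V, zero = zero V, add = add V,
      smult = smult V,
      comult = (\<lambda>f. \<Oplus>\<^bsub>tensor V V\<^esub>g\<in>supp f. f g \<odot>\<^bsub>tensor V V\<^esub> pure V V (delta g) (delta g)),
      counit = (\<lambda>f. \<Sum>g\<in>supp f. f g),
      antipode = (\<lambda>f g. if g \<in> carrier G then f (inv\<^bsub>G\<^esub> g) else 0)\<rparr>)"

definition cocentral ::
  "('k::field, 'h, 'm) coalg_scheme \<Rightarrow> ('k, 'l, 'n) coalg_scheme \<Rightarrow> ('h \<Rightarrow> 'l) \<Rightarrow> bool" where
  "cocentral H L \<pi> \<longleftrightarrow> (\<forall>h\<in>carrier H.
     tsum (tensor H L) (comult H h) (\<lambda>h\<^sub>1 h\<^sub>2. pure H L h\<^sub>1 (\<pi> h\<^sub>2))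
   = tsum (tensor H L) (comult H h) (\<lambda>h\<^sub>1 h\<^sub>2. pure H L h\<^sub>2 (\<pi> h\<^sub>1)))"

definition grade ::
  "('k::field, 'h, 'm) coalg_scheme \<Rightarrow> ('g, 'n) monoid_scheme \<Rightarrow> ('h \<Rightarrow> 'g \<Rightarrow> 'k) \<Rightarrow> 'g \<Rightarrow> 'h set" where
  "grade H G \<pi> g = {h \<in> carrier H.
     tmap (group_alg G) H \<pi> (\<lambda>x. x) (comult H h) = pure (group_alg G) H (delta g) h}"

definition coinvariants ::
  "('k::field, 'h, 'm) coalg_scheme \<Rightarrow> ('k, 'l, 'n) coalg_scheme \<Rightarrow> ('h \<Rightarrow> 'l) \<Rightarrow> 'h set" where
  "coinvariants H L \<pi> = {h \<in> carrier H.
     tmap H L (\<lambda>x. x) \<pi> (comult H h) = pure H L h \<one>\<^bsub>L\<^esub>}"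


section \<open>Zesting data\<close>

text \<open>The group of group-like elements of the Hopf subalgebra of coinvariants.\<close>

definition grouplikes_coinv ::
  "('k::field, 'h, 'm) coalg_scheme \<Rightarrow> ('k, 'l, 'n) coalg_scheme \<Rightarrow> ('h \<Rightarrow> 'l) \<Rightarrow> 'h monoid" where
  "grouplikes_coinv H L \<pi> =
     \<lparr>carrier = {s \<in> coinvariants H L \<pi>. comult H s = pure H H s s \<and> counit H s = 1},
      monoid.mult = monoid.mult H, one = \<one>\<^bsub>H\<^esub>\<rparr>"

definition alg_chars :: "('k::field, 'h, 'm) coalg_scheme \<Rightarrow> ('h \<Rightarrow> 'k) monoid" where
  "alg_chars H =
     \<lparr>carrier = {f \<in> extensional (carrier H). lin H base f \<and> f \<one>\<^bsub>H\<^esub> = 1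
                  \<and> (\<forall>x\<in>carrier H. \<forall>y\<in>carrier H. f (x \<otimes>\<^bsub>H\<^esub> y) = f x * f y)},
      monoid.mult = (\<lambda>f f'. \<lambda>h\<in>carrier H. tsum base (comult H h) (\<lambda>h\<^sub>1 h\<^sub>2. f h\<^sub>1 * f' h\<^sub>2)),
      one = restrict (counit H) (carrier H)\<rparr>"

text \<open>The compatibility condition between \<open>\<gamma>\<close> and the conjugation by \<open>s \<in> \<Gamma>\<^sub>0\<close>, equivalently
  \<open>\<langle>\<gamma>(s), h\<^sub>1\<rangle> h\<^sub>2 s = s h\<^sub>1 \<langle>\<gamma>(s), h\<^sub>2\<rangle>\<close>, says exactly that the half-braiding
  \<open>s \<otimes> z \<mapsto> \<langle>\<gamma>(s), z\<^sub>(\<^sub>-\<^sub>1\<^sub>)\<rangle> z\<^sub>0 \<otimes> s\<close> is a map of left comodules.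
  With \<open>s h\<^sub>2 s\<inverse>\<close> in place of \<open>s\<inverse> h\<^sub>2 s\<close> it would instead express this for the maps
  \<open>z \<otimes> s \<mapsto> \<langle>\<gamma>(s), z\<^sub>(\<^sub>-\<^sub>1\<^sub>)\<rangle> s \<otimes> z\<^sub>0\<close> going in the opposite direction.\<close>

definition zesting_datum ::
  "('k::field, 'h, 'm) coalg_scheme \<Rightarrow> ('g, 'n) monoid_scheme \<Rightarrow> ('h \<Rightarrow> 'g \<Rightarrow> 'k) \<Rightarrow> 'h set
     \<Rightarrow> ('h \<Rightarrow> 'h \<Rightarrow> 'k) \<Rightarrow> ('g \<Rightarrow> 'g \<Rightarrow> 'h) \<Rightarrow> ('g \<Rightarrow> 'g \<Rightarrow> 'g \<Rightarrow> 'k) \<Rightarrow> bool" where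
  "zesting_datum H G \<pi> \<Gamma>\<^sub>0 \<gamma> \<Lambda> \<omega> \<longleftrightarrow>
     (let GL = grouplikes_coinv H (group_alg G) \<pi> in
       subgroup \<Gamma>\<^sub>0 GL
     \<and> \<gamma> \<in> hom (GL\<lparr>carrier := \<Gamma>\<^sub>0\<rparr>) (alg_chars H)
     \<and> (\<forall>s\<in>\<Gamma>\<^sub>0. \<forall>h\<in>carrier H.
          tsum H (comult H h) (\<lambda>h\<^sub>1 h\<^sub>2. \<gamma> s h\<^sub>1 \<odot>\<^bsub>H\<^esub> (inv\<^bsub>GL\<^esub> s \<otimes>\<^bsub>H\<^esub> h\<^sub>2 \<otimes>\<^bsub>H\<^esub> s))
        = tsum H (comult H h) (\<lambda>h\<^sub>1 h\<^sub>2. \<gamma> s h\<^sub>2 \<odot>\<^bsub>H\<^esub> h\<^sub>1))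
     \<and> (\<forall>a\<in>carrier G. \<forall>b\<in>carrier G. \<Lambda> a b \<in> \<Gamma>\<^sub>0)
     \<and> (\<forall>a\<in>carrier G. \<forall>b\<in>carrier G. \<forall>c\<in>carrier G.
          \<Lambda> a b \<otimes>\<^bsub>H\<^esub> \<Lambda> (a \<otimes>\<^bsub>G\<^esub> b) c = \<Lambda> b c \<otimes>\<^bsub>H\<^esub> \<Lambda> a (b \<otimes>\<^bsub>G\<^esub> c))
     \<and> (\<forall>a\<in>carrier G. \<Lambda> a \<one>\<^bsub>G\<^esub> = \<one>\<^bsub>H\<^esub> \<and> \<Lambda> \<one>\<^bsub>G\<^esub> a = \<one>\<^bsub>H\<^esub>)
     \<and> (\<forall>a\<in>carrier G. \<forall>b\<in>carrier G. \<forall>c\<in>carrier G. \<omega> a b c \<noteq> 0)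
     \<and> (\<forall>a\<in>carrier G. \<forall>b\<in>carrier G. \<omega> \<one>\<^bsub>G\<^esub> a b = 1 \<and> \<omega> a \<one>\<^bsub>G\<^esub> b = 1 \<and> \<omega> a b \<one>\<^bsub>G\<^esub> = 1)
     \<and> (\<forall>a\<in>carrier G. \<forall>b\<in>carrier G. \<forall>c\<in>carrier G. \<forall>d\<in>carrier G.
          \<gamma> (\<Lambda> a b) (\<Lambda> c d)
            = (\<omega> a b c * \<omega> a (b \<otimes>\<^bsub>G\<^esub> c) d * \<omega> b c d) / (\<omega> (a \<otimes>\<^bsub>G\<^esub> b) c d * \<omega> a b (c \<otimes>\<^bsub>G\<^esub> d))))"


section \<open>Linear monoidal categories and tensor equivalence\<close>

text \<open>Hom-sets are vector spaces and need not be disjoint, so composition is indexed by objects: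
  \<open>Cmp C X Y Z g f\<close> is \<open>g \<circ> f\<close> for \<open>f : X \<rightarrow> Y\<close>, \<open>g : Y \<rightarrow> Z\<close>, and
  \<open>TMor C X X' Y Y' f g\<close> is \<open>f \<otimes> g\<close> for \<open>f : X \<rightarrow> X'\<close>, \<open>g : Y \<rightarrow> Y'\<close>.\<close>

record ('k, 'o, 'm) lincat =
  Ob :: "'o set"
  Hom :: "'o \<Rightarrow> 'o \<Rightarrow> ('k, 'm) module"
  Cmp :: "'o \<Rightarrow> 'o \<Rightarrow> 'o \<Rightarrow> 'm \<Rightarrow> 'm \<Rightarrow> 'm"
  Idn :: "'o \<Rightarrow> 'm"

record ('k, 'o, 'm) moncat = "('k, 'o, 'm) lincat" +
  TOb :: "'o \<Rightarrow> 'o \<Rightarrow> 'o"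
  TMor :: "'o \<Rightarrow> 'o \<Rightarrow> 'o \<Rightarrow> 'o \<Rightarrow> 'm \<Rightarrow> 'm \<Rightarrow> 'm"
  UOb :: "'o"
  Asc :: "'o \<Rightarrow> 'o \<Rightarrow> 'o \<Rightarrow> 'm"
  LUn :: "'o \<Rightarrow> 'm"
  RUn :: "'o \<Rightarrow> 'm"

definition mor :: "('k, 'o, 'm, 'z) lincat_scheme \<Rightarrow> 'o \<Rightarrow> 'o \<Rightarrow> 'm set" where
  "mor C X Y = carrier (Hom C X Y)"

definition linear_category :: "('k::field, 'o, 'm, 'z) lincat_scheme \<Rightarrow> bool" where
  "linear_category C \<longleftrightarrow>
     (\<forall>X\<in>Ob C. \<forall>Y\<in>Ob C. vspace (Hom C X Y))
     \<and> (\<forall>X\<in>Ob C. Idn C X \<in> mor C X X)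
     \<and> (\<forall>X\<in>Ob C. \<forall>Y\<in>Ob C. \<forall>Z\<in>Ob C.
          (\<forall>g\<in>mor C Y Z. lin (Hom C X Y) (Hom C X Z) (\<lambda>f. Cmp C X Y Z g f))
        \<and> (\<forall>f\<in>mor C X Y. lin (Hom C Y Z) (Hom C X Z) (\<lambda>g. Cmp C X Y Z g f)))
     \<and> (\<forall>X\<in>Ob C. \<forall>Y\<in>Ob C. \<forall>f\<in>mor C X Y.
          Cmp C X Y Y (Idn C Y) f = f \<and> Cmp C X X Y f (Idn C X) = f)
     \<and> (\<forall>W\<in>Ob C. \<forall>X\<in>Ob C. \<forall>Y\<in>Ob C. \<forall>Z\<in>Ob C.
          \<forall>f\<in>mor C W X. \<forall>g\<in>mor C X Y. \<forall>h\<in>mor C Y Z.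
            Cmp C W Y Z h (Cmp C W X Y g f) = Cmp C W X Z (Cmp C X Y Z h g) f)"

definition iso_in :: "('k, 'o, 'm, 'z) lincat_scheme \<Rightarrow> 'o \<Rightarrow> 'o \<Rightarrow> 'm \<Rightarrow> bool" where
  "iso_in C X Y f \<longleftrightarrow> f \<in> mor C X Y
     \<and> (\<exists>g\<in>mor C Y X. Cmp C X Y X g f = Idn C X \<and> Cmp C Y X Y f g = Idn C Y)"

definition monoidal_category :: "('k::field, 'o, 'm, 'z) moncat_scheme \<Rightarrow> bool" where
  "monoidal_category C \<longleftrightarrow> (let T = TOb C; I = UOb C in
     linear_category C
     \<and> I \<in> Ob C
     \<and> (\<forall>X\<in>Ob C. \<forall>Y\<in>Ob C. T X Y \<in> Ob C)
     \<and> (\<forall>X\<in>Ob C. \<forall>X'\<in>Ob C. \<forall>Y\<in>Ob C. \<forall>Y'\<in>Ob C.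
          (\<forall>f\<in>mor C X X'. lin (Hom C Y Y') (Hom C (T X Y) (T X' Y')) (\<lambda>g. TMor C X X' Y Y' f g))
        \<and> (\<forall>g\<in>mor C Y Y'. lin (Hom C X X') (Hom C (T X Y) (T X' Y')) (\<lambda>f. TMor C X X' Y Y' f g)))
     \<and> (\<forall>X\<in>Ob C. \<forall>Y\<in>Ob C. TMor C X X Y Y (Idn C X) (Idn C Y) = Idn C (T X Y))
     \<and> (\<forall>X\<in>Ob C. \<forall>X'\<in>Ob C. \<forall>X''\<in>Ob C. \<forall>Y\<in>Ob C. \<forall>Y'\<in>Ob C. \<forall>Y''\<in>Ob C.
          \<forall>f\<in>mor C X X'. \<forall>f'\<in>mor C X' X''. \<forall>g\<in>mor C Y Y'. \<forall>g'\<in>mor C Y' Y''.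
            TMor C X X'' Y Y'' (Cmp C X X' X'' f' f) (Cmp C Y Y' Y'' g' g)
              = Cmp C (T X Y) (T X' Y') (T X'' Y'') (TMor C X' X'' Y' Y'' f' g') (TMor C X X' Y Y' f g))
     \<and> (\<forall>X\<in>Ob C. \<forall>Y\<in>Ob C. \<forall>Z\<in>Ob C. iso_in C (T (T X Y) Z) (T X (T Y Z)) (Asc C X Y Z))
     \<and> (\<forall>X\<in>Ob C. \<forall>X'\<in>Ob C. \<forall>Y\<in>Ob C. \<forall>Y'\<in>Ob C. \<forall>Z\<in>Ob C. \<forall>Z'\<in>Ob C.
          \<forall>f\<in>mor C X X'. \<forall>g\<in>mor C Y Y'. \<forall>h\<in>mor C Z Z'.
            Cmp C (T (T X Y) Z) (T (T X' Y') Z') (T X' (T Y' Z'))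
              (Asc C X' Y' Z') (TMor C (T X Y) (T X' Y') Z Z' (TMor C X X' Y Y' f g) h)
          = Cmp C (T (T X Y) Z) (T X (T Y Z)) (T X' (T Y' Z'))
              (TMor C X X' (T Y Z) (T Y' Z') f (TMor C Y Y' Z Z' g h)) (Asc C X Y Z))
     \<and> (\<forall>X\<in>Ob C. iso_in C (T I X) X (LUn C X) \<and> iso_in C (T X I) X (RUn C X))
     \<and> (\<forall>X\<in>Ob C. \<forall>X'\<in>Ob C. \<forall>f\<in>mor C X X'.
          Cmp C (T I X) (T I X') X' (LUn C X') (TMor C I I X X' (Idn C I) f)
            = Cmp C (T I X) X X' f (LUn C X)
        \<and> Cmp C (T X I) (T X' I) X' (RUn C X') (TMor C X X' I I f (Idn C I))
            = Cmp C (T X I) X X' f (RUn C X))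
     \<and> (\<forall>W\<in>Ob C. \<forall>X\<in>Ob C. \<forall>Y\<in>Ob C. \<forall>Z\<in>Ob C.
          Cmp C (T (T (T W X) Y) Z) (T (T W X) (T Y Z)) (T W (T X (T Y Z)))
            (Asc C W X (T Y Z)) (Asc C (T W X) Y Z)
        = Cmp C (T (T (T W X) Y) Z) (T W (T (T X Y) Z)) (T W (T X (T Y Z)))
            (TMor C W W (T (T X Y) Z) (T X (T Y Z)) (Idn C W) (Asc C X Y Z))
            (Cmp C (T (T (T W X) Y) Z) (T (T W (T X Y)) Z) (T W (T (T X Y) Z))
              (Asc C W (T X Y) Z)
              (TMor C (T (T W X) Y) (T W (T X Y)) Z Z (Asc C W X Y) (Idn C Z))))
     \<and> (\<forall>X\<in>Ob C. \<forall>Y\<in>Ob C.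
          Cmp C (T (T X I) Y) (T X (T I Y)) (T X Y)
            (TMor C X X (T I Y) Y (Idn C X) (LUn C Y)) (Asc C X I Y)
        = TMor C (T X I) X Y Y (RUn C X) (Idn C Y)))"

definition linear_functor ::
  "('k::field, 'o, 'm, 'z) lincat_scheme \<Rightarrow> ('k, 'p, 'n, 'y) lincat_scheme
     \<Rightarrow> ('o \<Rightarrow> 'p) \<Rightarrow> ('o \<Rightarrow> 'o \<Rightarrow> 'm \<Rightarrow> 'n) \<Rightarrow> bool" where
  "linear_functor C D F Fm \<longleftrightarrow>
     (\<forall>X\<in>Ob C. F X \<in> Ob D)
     \<and> (\<forall>X\<in>Ob C. \<forall>Y\<in>Ob C. lin (Hom C X Y) (Hom D (F X) (F Y)) (Fm X Y))
     \<and> (\<forall>X\<in>Ob C. Fm X X (Idn C X) = Idn D (F X))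
     \<and> (\<forall>X\<in>Ob C. \<forall>Y\<in>Ob C. \<forall>Z\<in>Ob C. \<forall>f\<in>mor C X Y. \<forall>g\<in>mor C Y Z.
          Fm X Z (Cmp C X Y Z g f) = Cmp D (F X) (F Y) (F Z) (Fm Y Z g) (Fm X Y f))"

definition natural_iso ::
  "('k, 'o, 'm, 'z) lincat_scheme \<Rightarrow> ('k, 'p, 'n, 'y) lincat_scheme
     \<Rightarrow> ('o \<Rightarrow> 'p) \<Rightarrow> ('o \<Rightarrow> 'o \<Rightarrow> 'm \<Rightarrow> 'n) \<Rightarrow> ('o \<Rightarrow> 'p) \<Rightarrow> ('o \<Rightarrow> 'o \<Rightarrow> 'm \<Rightarrow> 'n)
     \<Rightarrow> ('o \<Rightarrow> 'n) \<Rightarrow> bool" where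
  "natural_iso C D F Fm F' Fm' \<eta> \<longleftrightarrow>
     (\<forall>X\<in>Ob C. iso_in D (F X) (F' X) (\<eta> X))
     \<and> (\<forall>X\<in>Ob C. \<forall>Y\<in>Ob C. \<forall>f\<in>mor C X Y.
          Cmp D (F X) (F Y) (F' Y) (\<eta> Y) (Fm X Y f) = Cmp D (F X) (F' X) (F' Y) (Fm' X Y f) (\<eta> X))"

definition equivalence_functor ::
  "('k::field, 'o, 'm, 'z) lincat_scheme \<Rightarrow> ('k, 'p, 'n, 'y) lincat_scheme
     \<Rightarrow> ('o \<Rightarrow> 'p) \<Rightarrow> ('o \<Rightarrow> 'o \<Rightarrow> 'm \<Rightarrow> 'n) \<Rightarrow> bool" where
  "equivalence_functor C D F Fm \<longleftrightarrow> linear_functor C D F Fm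
     \<and> (\<exists>R Rm \<eta> \<theta>. linear_functor D C R Rm
          \<and> natural_iso C C (\<lambda>X. X) (\<lambda>X Y f. f)
              (\<lambda>X. R (F X)) (\<lambda>X Y f. Rm (F X) (F Y) (Fm X Y f)) \<eta>
          \<and> natural_iso D D (\<lambda>X. F (R X)) (\<lambda>X Y f. Fm (R X) (R Y) (Rm X Y f))
              (\<lambda>X. X) (\<lambda>X Y f. f) \<theta>)"

text \<open>Strong monoidal structure on a functor: isomorphisms \<open>J X Y : F X \<otimes> F Y \<rightarrow> F (X \<otimes> Y)\<close>,
  natural in both arguments, and \<open>\<phi> : \<one> \<rightarrow> F \<one>\<close>.\<close>

definition monoidal_structure ::
  "('k::field, 'o, 'm, 'z) moncat_scheme \<Rightarrow> ('k, 'p, 'n, 'y) moncat_scheme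
     \<Rightarrow> ('o \<Rightarrow> 'p) \<Rightarrow> ('o \<Rightarrow> 'o \<Rightarrow> 'm \<Rightarrow> 'n) \<Rightarrow> ('o \<Rightarrow> 'o \<Rightarrow> 'n) \<Rightarrow> 'n \<Rightarrow> bool" where
  "monoidal_structure C D F Fm J \<phi> \<longleftrightarrow> (let T = TOb C; S = TOb D; I = UOb C; E = UOb D in
     (\<forall>X\<in>Ob C. \<forall>Y\<in>Ob C. iso_in D (S (F X) (F Y)) (F (T X Y)) (J X Y))
     \<and> (\<forall>X\<in>Ob C. \<forall>X'\<in>Ob C. \<forall>Y\<in>Ob C. \<forall>Y'\<in>Ob C. \<forall>f\<in>mor C X X'. \<forall>g\<in>mor C Y Y'.
          Cmp D (S (F X) (F Y)) (S (F X') (F Y')) (F (T X' Y'))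
            (J X' Y') (TMor D (F X) (F X') (F Y) (F Y') (Fm X X' f) (Fm Y Y' g))
        = Cmp D (S (F X) (F Y)) (F (T X Y)) (F (T X' Y'))
            (Fm (T X Y) (T X' Y') (TMor C X X' Y Y' f g)) (J X Y))
     \<and> iso_in D E (F I) \<phi>
     \<and> (\<forall>X\<in>Ob C. \<forall>Y\<in>Ob C. \<forall>Z\<in>Ob C.
          Cmp D (S (S (F X) (F Y)) (F Z)) (F (T (T X Y) Z)) (F (T X (T Y Z)))
            (Fm (T (T X Y) Z) (T X (T Y Z)) (Asc C X Y Z))
            (Cmp D (S (S (F X) (F Y)) (F Z)) (S (F (T X Y)) (F Z)) (F (T (T X Y) Z))
              (J (T X Y) Z)
              (TMor D (S (F X) (F Y)) (F (T X Y)) (F Z) (F Z) (J X Y) (Idn D (F Z))))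
        = Cmp D (S (S (F X) (F Y)) (F Z)) (S (F X) (S (F Y) (F Z))) (F (T X (T Y Z)))
            (Cmp D (S (F X) (S (F Y) (F Z))) (S (F X) (F (T Y Z))) (F (T X (T Y Z)))
              (J X (T Y Z))
              (TMor D (F X) (F X) (S (F Y) (F Z)) (F (T Y Z)) (Idn D (F X)) (J Y Z)))
            (Asc D (F X) (F Y) (F Z)))
     \<and> (\<forall>X\<in>Ob C.
          Cmp D (S E (F X)) (F (T I X)) (F X) (Fm (T I X) X (LUn C X))
            (Cmp D (S E (F X)) (S (F I) (F X)) (F (T I X))
              (J I X) (TMor D E (F I) (F X) (F X) \<phi> (Idn D (F X))))
          = LUn D (F X)
        \<and> Cmp D (S (F X) E) (F (T X I)) (F X) (Fm (T X I) X (RUn C X))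
            (Cmp D (S (F X) E) (S (F X) (F I)) (F (T X I))
              (J X I) (TMor D (F X) (F X) E (F I) (Idn D (F X)) \<phi>))
          = RUn D (F X)))"

definition tensor_equivalent ::
  "('k::field, 'o, 'm, 'z) moncat_scheme \<Rightarrow> ('k, 'p, 'n, 'y) moncat_scheme \<Rightarrow> bool" where
  "tensor_equivalent C D \<longleftrightarrow> monoidal_category C \<and> monoidal_category D
     \<and> (\<exists>F Fm J \<phi>. equivalence_functor C D F Fm \<and> monoidal_structure C D F Fm J \<phi>)"


section \<open>Comodules\<close>

record ('k, 'h, 'x) comod = "('k, 'x) module" +
  coact :: "'x \<Rightarrow> ('h \<times> 'x) list set"

definition mk_comod ::
  "('k, 'x, 'm) module_scheme \<Rightarrow> ('x \<Rightarrow> ('h \<times> 'x) list set) \<Rightarrow> ('k, 'h, 'x) comod" where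
  "mk_comod M \<rho> = \<lparr>carrier = carrier M, monoid.mult = undefined, one = undefined,
     zero = zero M, add = add M, smult = smult M, coact = \<rho>\<rparr>"

definition comodule :: "('k::field, 'h, 'm) coalg_scheme \<Rightarrow> ('k, 'h, 'x, 'n) comod_scheme \<Rightarrow> bool" where
  "comodule H X \<longleftrightarrow> vspace X \<and> lin X (tensor H X) (coact X)
     \<and> (\<forall>x\<in>carrier X.
          tsum (tensor H (tensor H X)) (coact X x) (\<lambda>h x\<^sub>0.
            tsum (tensor H (tensor H X)) (coact X x\<^sub>0) (\<lambda>k x\<^sub>1.
              pure H (tensor H X) h (pure H X k x\<^sub>1)))
        = tsum (tensor H (tensor H X)) (coact X x) (\<lambda>h x\<^sub>0.
            tsum (tensor H (tensor H X)) (comult H h) (\<lambda>h\<^sub>1 h\<^sub>2.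
              pure H (tensor H X) h\<^sub>1 (pure H X h\<^sub>2 x\<^sub>0))))
     \<and> (\<forall>x\<in>carrier X. tsum X (coact X x) (\<lambda>h x\<^sub>0. counit H h \<odot>\<^bsub>X\<^esub> x\<^sub>0) = x)"

definition comod_hom ::
  "('k::field, 'h, 'm) coalg_scheme \<Rightarrow> ('k, 'h, 'x, 'n) comod_scheme
     \<Rightarrow> ('k, 'h, 'y, 'p) comod_scheme \<Rightarrow> ('k, 'x \<Rightarrow> 'y) module" where
  "comod_hom H X Y = mk_vspace
     {f \<in> extensional (carrier X). lin X Y f
        \<and> (\<forall>x\<in>carrier X. coact Y (f x) = tmap H Y (\<lambda>h. h) f (coact X x))}
     (\<lambda>x\<in>carrier X. \<zero>\<^bsub>Y\<^esub>)
     (\<lambda>f g. \<lambda>x\<in>carrier X. f x \<oplus>\<^bsub>Y\<^esub> g x)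
     (\<lambda>c f. \<lambda>x\<in>carrier X. c \<odot>\<^bsub>Y\<^esub> f x)"

text \<open>A universe for the underlying sets of comodules that contains the field, \<open>H\<close> and an arbitrary
  type \<open>'a\<close> and is closed under tensor products: an element of a tensor product is stored as
  (a chosen representative of) a formal sum.  The categories of comodules below have as objects all
  comodules, of arbitrary dimension, whose carrier is a subset of this universe; every comodule with
  carrier in \<open>'a\<close> is isomorphic to one of them, for whatever type \<open>'a\<close>.\<close>

datatype ('k, 'h, 'a) univ =
    Scal (unscal: 'k)
  | Elem (unelem: 'h)
  | Atom 'a
  | Tens (untens: "(('k, 'h, 'a) univ \<times> ('k, 'h, 'a) univ) list")

type_synonym ('k, 'h, 'a) ucomod = "('k, 'h, ('k, 'h, 'a) univ) comod"

text \<open>\<open>udec X Y\<close> is the identification of the internal tensor product \<open>utensor X Y\<close> with \<open>tensor X Y\<close>.\<close>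

definition uenc :: "(('k, 'h, 'a) univ \<times> ('k, 'h, 'a) univ) list set \<Rightarrow> ('k, 'h, 'a) univ" where
  "uenc t = Tens (rep t)"

definition udec ::
  "('k::field, ('k, 'h, 'a) univ, 'm) module_scheme \<Rightarrow> ('k, ('k, 'h, 'a) univ, 'n) module_scheme
     \<Rightarrow> ('k, 'h, 'a) univ \<Rightarrow> (('k, 'h, 'a) univ \<times> ('k, 'h, 'a) univ) list set" where
  "udec X Y u = tens_class X Y (untens u)"

definition utensor ::
  "('k::field, ('k, 'h, 'a) univ, 'm) module_scheme \<Rightarrow> ('k, ('k, 'h, 'a) univ, 'n) module_scheme
     \<Rightarrow> ('k, ('k, 'h, 'a) univ) module" where
  "utensor X Y = mk_vspace
     (uenc ` carrier (tensor X Y))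
     (uenc \<zero>\<^bsub>tensor X Y\<^esub>)
     (\<lambda>u v. uenc (udec X Y u \<oplus>\<^bsub>tensor X Y\<^esub> udec X Y v))
     (\<lambda>c u. uenc (c \<odot>\<^bsub>tensor X Y\<^esub> udec X Y u))"

definition upure ::
  "('k::field, ('k, 'h, 'a) univ, 'm) module_scheme \<Rightarrow> ('k, ('k, 'h, 'a) univ, 'n) module_scheme
     \<Rightarrow> ('k, 'h, 'a) univ \<Rightarrow> ('k, 'h, 'a) univ \<Rightarrow> ('k, 'h, 'a) univ" where
  "upure X Y x y = uenc (pure X Y x y)"

definition umap ::
  "('k::field, ('k, 'h, 'a) univ, 'm) module_scheme \<Rightarrow> ('k, ('k, 'h, 'a) univ, 'n) module_scheme
     \<Rightarrow> ('k, ('k, 'h, 'a) univ, 'p) module_scheme \<Rightarrow> ('k, ('k, 'h, 'a) univ, 'q) module_scheme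
     \<Rightarrow> (('k, 'h, 'a) univ \<Rightarrow> ('k, 'h, 'a) univ) \<Rightarrow> (('k, 'h, 'a) univ \<Rightarrow> ('k, 'h, 'a) univ)
     \<Rightarrow> ('k, 'h, 'a) univ \<Rightarrow> ('k, 'h, 'a) univ" where
  "umap X Y X' Y' f g u = tsum (utensor X' Y') (udec X Y u) (\<lambda>x y. upure X' Y' (f x) (g y))"

definition comod_tensor ::
  "('k::field, 'h, 'm) coalg_scheme \<Rightarrow> ('k, 'h, 'a) ucomod \<Rightarrow> ('k, 'h, 'a) ucomod
     \<Rightarrow> ('k, 'h, 'a) ucomod" where
  "comod_tensor H X Y = (let XY = utensor X Y; N = tensor H XY in
     mk_comod XY (\<lambda>u. tsum N (udec X Y u) (\<lambda>x y.
       tsum N (coact X x) (\<lambda>h x\<^sub>0. tsum N (coact Y y) (\<lambda>k y\<^sub>0.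
         pure H XY (h \<otimes>\<^bsub>H\<^esub> k) (upure X Y x\<^sub>0 y\<^sub>0))))))"

definition comod_unit :: "('k::field, 'h, 'm) coalg_scheme \<Rightarrow> ('k, 'h, 'a) ucomod" where
  "comod_unit H = (let K = mk_vspace (range Scal) (Scal 0)
       (\<lambda>u v. Scal (unscal u + unscal v)) (\<lambda>c u. Scal (c * unscal u)) in
     mk_comod K (\<lambda>u. pure H K \<one>\<^bsub>H\<^esub> u))"

definition comod_lincat ::
  "('k::field, 'h, 'm) coalg_scheme
     \<Rightarrow> ('k, ('k, 'h, 'a) ucomod, ('k, 'h, 'a) univ \<Rightarrow> ('k, 'h, 'a) univ) lincat" where
  "comod_lincat H = \<lparr>Ob = {X. comodule H X}, Hom = comod_hom H,
     Cmp = (\<lambda>X Y Z g f. compose (carrier X) g f), Idn = (\<lambda>X. \<lambda>x\<in>carrier X. x)\<rparr>"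

text \<open>The monoidal category of left comodules over a coquasi-bialgebra.\<close>

definition comod_cat ::
  "('k::field, 'h, 'm) coquasi_scheme
     \<Rightarrow> ('k, ('k, 'h, 'a) ucomod, ('k, 'h, 'a) univ \<Rightarrow> ('k, 'h, 'a) univ) moncat" where
  "comod_cat H = (let T = comod_tensor H; I = comod_unit H in
     \<lparr>Ob = Ob (comod_lincat H), Hom = Hom (comod_lincat H),
      Cmp = Cmp (comod_lincat H), Idn = Idn (comod_lincat H),
      TOb = T,
      TMor = (\<lambda>X X' Y Y' f g. restrict (umap X Y X' Y' f g) (carrier (T X Y))),
      UOb = I,
      Asc = (\<lambda>X Y Z. let N = T X (T Y Z) in (\<lambda>u\<in>carrier (T (T X Y) Z).
        tsum N (udec (T X Y) Z u) (\<lambda>v z. tsum N (udec X Y v) (\<lambda>x y.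
          tsum N (coact X x) (\<lambda>h x\<^sub>0. tsum N (coact Y y) (\<lambda>k y\<^sub>0. tsum N (coact Z z) (\<lambda>l z\<^sub>0.
            reassociator H h k l \<odot>\<^bsub>N\<^esub> upure X (T Y Z) x\<^sub>0 (upure Y Z y\<^sub>0 z\<^sub>0)))))))),
      LUn = (\<lambda>X. \<lambda>u\<in>carrier (T I X). tsum X (udec I X u) (\<lambda>c x. unscal c \<odot>\<^bsub>X\<^esub> x)),
      RUn = (\<lambda>X. \<lambda>u\<in>carrier (T X I). tsum X (udec X I u) (\<lambda>x c. unscal c \<odot>\<^bsub>X\<^esub> x))\<rparr>)"


section \<open>The zested category\<close>

definition comod_grade ::
  "('g, 'n) monoid_scheme \<Rightarrow> ('h \<Rightarrow> 'g \<Rightarrow> 'k::field) \<Rightarrow> ('k, 'h, 'x, 'm) comod_scheme \<Rightarrow> 'g \<Rightarrow> 'x set" where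
  "comod_grade G \<pi> X g = {x \<in> carrier X.
     tmap (group_alg G) X \<pi> (\<lambda>x. x) (coact X x) = pure (group_alg G) X (delta g) x}"

text \<open>\<open>H\<close> as a left comodule over itself.\<close>

definition regular_comod :: "('k::field, 'h, 'm) coalg_scheme \<Rightarrow> ('k, 'h, 'a) ucomod" where
  "regular_comod H = (let R = mk_vspace (Elem ` carrier H) (Elem \<zero>\<^bsub>H\<^esub>)
       (\<lambda>u v. Elem (unelem u \<oplus>\<^bsub>H\<^esub> unelem v)) (\<lambda>c u. Elem (c \<odot>\<^bsub>H\<^esub> unelem u)) in
     mk_comod R (\<lambda>u. tmap H R (\<lambda>h. h) Elem (comult H (unelem u))))"

text \<open>The coaction of a subcomodule with carrier \<open>S\<close> is the one of \<open>W\<close>, corestricted along the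
  (injective) map \<open>H \<otimes> S \<rightarrow> H \<otimes> W\<close>.\<close>

definition subcomod ::
  "('k::field, 'h, 'm) coalg_scheme \<Rightarrow> ('k, 'h, 'x) comod \<Rightarrow> 'x set \<Rightarrow> ('k, 'h, 'x) comod" where
  "subcomod H W S = (let V = W\<lparr>carrier := S\<rparr> in
     mk_comod V (\<lambda>u. THE t. t \<in> carrier (tensor H V) \<and> tmap H W (\<lambda>h. h) (\<lambda>x. x) t = coact W u))"

definition lspan :: "('k::field, 'x, 'm) module_scheme \<Rightarrow> 'x set \<Rightarrow> 'x set" where
  "lspan W B = \<Inter> {S. submodule S base W \<and> B \<subseteq> S}"

definition zpure ::
  "('k::field, 'h, 'm) coalg_scheme \<Rightarrow> ('k, 'h, 'a) ucomod \<Rightarrow> ('k, 'h, 'a) ucomod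
     \<Rightarrow> ('k, 'h, 'a) univ \<Rightarrow> ('k, 'h, 'a) univ \<Rightarrow> 'h \<Rightarrow> ('k, 'h, 'a) univ" where
  "zpure H X Y x y s = upure (comod_tensor H X Y) (regular_comod H) (upure X Y x y) (Elem s)"

text \<open>The one-dimensional comodule of a group-like element \<open>s\<close> is the subcomodule of the regular
  comodule spanned by \<open>s\<close>.  Accordingly the zested tensor product, that is the direct sum over all
  \<open>a, b\<close> of \<open>X\<^sub>a \<otimes> Y\<^sub>b \<otimes> k \<Lambda>(a, b)\<close>, is formed inside \<open>X \<otimes> Y \<otimes> H\<close>.\<close>

definition zested_tensor ::
  "('k::field, 'h, 'm) coalg_scheme \<Rightarrow> ('g, 'n) monoid_scheme \<Rightarrow> ('h \<Rightarrow> 'g \<Rightarrow> 'k)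
     \<Rightarrow> ('g \<Rightarrow> 'g \<Rightarrow> 'h) \<Rightarrow> ('k, 'h, 'a) ucomod \<Rightarrow> ('k, 'h, 'a) ucomod \<Rightarrow> ('k, 'h, 'a) ucomod" where
  "zested_tensor H G \<pi> \<Lambda> X Y = (let W = comod_tensor H (comod_tensor H X Y) (regular_comod H) in
     subcomod H W (lspan W {zpure H X Y x y (\<Lambda> a b) | x y a b.
       a \<in> carrier G \<and> b \<in> carrier G \<and> x \<in> comod_grade G \<pi> X a \<and> y \<in> comod_grade G \<pi> Y b}))"

text \<open>The half-braiding \<open>s \<otimes> z \<mapsto> \<langle>\<gamma>(s), z\<^sub>(\<^sub>-\<^sub>1\<^sub>)\<rangle> z\<^sub>0 \<otimes> s\<close> is \<open>s \<otimes> z \<mapsto> half_braid (\<gamma> s) Z z \<otimes> s\<close>.\<close>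

definition half_braid ::
  "('h \<Rightarrow> 'k) \<Rightarrow> ('k::field, 'h, 'x, 'm) comod_scheme \<Rightarrow> 'x \<Rightarrow> 'x" where
  "half_braid \<chi> Z z = tsum Z (coact Z z) (\<lambda>h z\<^sub>0. \<chi> h \<odot>\<^bsub>Z\<^esub> z\<^sub>0)"

text \<open>The associator is the composite
  \<open>x \<otimes> y \<otimes> \<Lambda>(a,b) \<otimes> z \<otimes> \<Lambda>(ab,c) \<mapsto> x \<otimes> y \<otimes> \<langle>\<gamma>(\<Lambda>(a,b)), z\<^sub>(\<^sub>-\<^sub>1\<^sub>)\<rangle> z\<^sub>0 \<otimes> \<Lambda>(a,b) \<otimes> \<Lambda>(ab,c)
   \<mapsto> \<omega>(a,b,c) x \<otimes> y \<otimes> \<langle>\<gamma>(\<Lambda>(a,b)), z\<^sub>(\<^sub>-\<^sub>1\<^sub>)\<rangle> z\<^sub>0 \<otimes> \<Lambda>(b,c) \<otimes> \<Lambda>(a,bc)\<close>.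
  In the left unit constraint, \<open>k \<otimes> X \<otimes> k \<Lambda>(e, g) \<rightarrow> X\<close>, the one-dimensional comodule of
  \<open>\<Lambda>(e, g) = 1\<close> is identified with the unit object by the counit; similarly on the right.\<close>

definition zested_assoc ::
  "('k::field, 'h, 'm) coalg_scheme \<Rightarrow> ('g, 'n) monoid_scheme \<Rightarrow> ('h \<Rightarrow> 'g \<Rightarrow> 'k)
     \<Rightarrow> ('h \<Rightarrow> 'h \<Rightarrow> 'k) \<Rightarrow> ('g \<Rightarrow> 'g \<Rightarrow> 'h) \<Rightarrow> ('g \<Rightarrow> 'g \<Rightarrow> 'g \<Rightarrow> 'k)
     \<Rightarrow> ('k, 'h, 'a) ucomod \<Rightarrow> ('k, 'h, 'a) ucomod \<Rightarrow> ('k, 'h, 'a) ucomod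
     \<Rightarrow> ('k, 'h, 'a) univ \<Rightarrow> ('k, 'h, 'a) univ" where
  "zested_assoc H G \<pi> \<gamma> \<Lambda> \<omega> X Y Z = (let T = zested_tensor H G \<pi> \<Lambda> in
     THE f. f \<in> extensional (carrier (T (T X Y) Z)) \<and> lin (T (T X Y) Z) (T X (T Y Z)) f
       \<and> (\<forall>a\<in>carrier G. \<forall>b\<in>carrier G. \<forall>c\<in>carrier G.
            \<forall>x\<in>comod_grade G \<pi> X a. \<forall>y\<in>comod_grade G \<pi> Y b. \<forall>z\<in>comod_grade G \<pi> Z c.
              f (zpure H (T X Y) Z (zpure H X Y x y (\<Lambda> a b)) z (\<Lambda> (a \<otimes>\<^bsub>G\<^esub> b) c))
                = \<omega> a b c \<odot>\<^bsub>T X (T Y Z)\<^esub>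
                    zpure H X (T Y Z) x (zpure H Y Z y (half_braid (\<gamma> (\<Lambda> a b)) Z z) (\<Lambda> b c))
                      (\<Lambda> a (b \<otimes>\<^bsub>G\<^esub> c))))"

definition zested_cat ::
  "('k::field, 'h, 'm) coalg_scheme \<Rightarrow> ('g, 'n) monoid_scheme \<Rightarrow> ('h \<Rightarrow> 'g \<Rightarrow> 'k)
     \<Rightarrow> ('h \<Rightarrow> 'h \<Rightarrow> 'k) \<Rightarrow> ('g \<Rightarrow> 'g \<Rightarrow> 'h) \<Rightarrow> ('g \<Rightarrow> 'g \<Rightarrow> 'g \<Rightarrow> 'k)
     \<Rightarrow> ('k, ('k, 'h, 'a) ucomod, ('k, 'h, 'a) univ \<Rightarrow> ('k, 'h, 'a) univ) moncat" where
  "zested_cat H G \<pi> \<gamma> \<Lambda> \<omega> =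
     (let T = zested_tensor H G \<pi> \<Lambda>; I = comod_unit H; R = regular_comod H; P = comod_tensor H in
     \<lparr>Ob = Ob (comod_lincat H), Hom = Hom (comod_lincat H),
      Cmp = Cmp (comod_lincat H), Idn = Idn (comod_lincat H),
      TOb = T,
      TMor = (\<lambda>X X' Y Y' f g.
        restrict (umap (P X Y) R (P X' Y') R (umap X Y X' Y' f g) (\<lambda>s. s)) (carrier (T X Y))),
      UOb = I,
      Asc = zested_assoc H G \<pi> \<gamma> \<Lambda> \<omega>,
      LUn = (\<lambda>X. \<lambda>u\<in>carrier (T I X). tsum X (udec (P I X) R u) (\<lambda>v s.
        tsum X (udec I X v) (\<lambda>c x. (counit H (unelem s) * unscal c) \<odot>\<^bsub>X\<^esub> x))),
      RUn = (\<lambda>X. \<lambda>u\<in>carrier (T X I). tsum X (udec (P X I) R u) (\<lambda>v s.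
        tsum X (udec X I v) (\<lambda>x c. (counit H (unelem s) * unscal c) \<odot>\<^bsub>X\<^esub> x)))\<rparr>)"

end

theory Submission
  imports Defs
begin

text \<open>Both categories have the same objects and morphisms.  Sending \<open>x \<otimes> y \<otimes> \<Lambda>(a, b)\<close>, for homogeneous
  \<open>x\<close> and \<open>y\<close> of degrees \<open>a\<close> and \<open>b\<close>, to \<open>x \<otimes> y\<close> identifies the underlying space of the zested tensor product
  with \<open>X \<otimes> Y\<close>, and turns the diagonal coaction into \<open>x \<otimes> y \<mapsto> m\<^sup>\<lambda>(x\<^sub>(\<^sub>-\<^sub>1\<^sub>), y\<^sub>(\<^sub>-\<^sub>1\<^sub>)) \<otimes> x\<^sub>0 \<otimes> y\<^sub>0\<close> and
  the half-braiding followed by \<open>\<omega>\<close> into the action of \<open>\<Omega>\<close>; so the identity functor is a tensor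
  equivalence.  On homogeneous elements quasi-associativity of \<open>m\<^sup>\<lambda>\<close> reduces to the cocycle condition for \<open>\<lambda>\<close>
  and the compatibility of \<open>\<gamma>\<close> with conjugation, and the pentagon to the equation for \<open>\<omega>\<close>; cocentrality
  makes all Sweedler components homogeneous, so that the homogeneous case suffices.\<close>

section \<open>Vector spaces and linear maps\<close>

text \<open>Tensor products are quotients with chosen representatives, so a Sweedler sum is well
  defined only for multilinear summands and every rewriting step carries linearity obligations; the
  rule set \<open>linr\<close> discharges them. Product and associator are prescribed in homogeneous
  degrees, while the entries of a representative of \<open>comult H h\<close> need not be
  homogeneous. Hence the projection to degree \<open>a\<close> is expressed as the action of the
  form \<open>\<pi> _ a\<close>, formulas are glued over degrees by \<open>gsum\<close>, and
  \<open>tsum_coact_homog_cong\<close> admits homogeneous formulas under Sweedler sums. The zested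
  product is a span inside X \<otimes> Y \<otimes> H whose coaction is a definite description; a
  linear retraction onto the span settles existence and uniqueness. Both categories instantiate one
  abstract model, in which x \<otimes> y is known only through a bilinear map \<open>pr\<close>, so
  that monoidal axioms and comparison are proved once. The order in which two characters act is
  settled by commutativity of \<Gamma>, itself a consequence of the compatibility with
  conjugation.\<close>

lemma base_simps [simp]:
  "carrier base = UNIV" "x \<oplus>\<^bsub>base\<^esub> y = x + y" "x \<otimes>\<^bsub>base\<^esub> y = x * y" "\<zero>\<^bsub>base\<^esub> = 0" "\<one>\<^bsub>base\<^esub> = 1"
  "x \<odot>\<^bsub>base\<^esub> y = x * y"
  by (simp_all add: base_def)

lemma cring_base: "cring (base :: ('k::field, 'k) module)"
proof (rule cringI)
  show "abelian_group (base :: ('k, 'k) module)"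
  proof (rule abelian_groupI)
    fix x :: 'k
    have "- x \<oplus>\<^bsub>base\<^esub> x = \<zero>\<^bsub>base\<^esub>" by simp
    then show "\<exists>y\<in>carrier base. y \<oplus>\<^bsub>base\<^esub> x = \<zero>\<^bsub>base\<^esub>" by (metis UNIV_I base_simps(1))
  qed simp_all
  show "Group.comm_monoid (base :: ('k, 'k) module)"
    by (rule Group.comm_monoidI) (auto simp: algebra_simps)
qed (simp add: algebra_simps)

lemma vspaceI:
  assumes "abelian_group M"
    "\<And>a x. x \<in> carrier M \<Longrightarrow> a \<odot>\<^bsub>M\<^esub> x \<in> carrier M"
    "\<And>a b x. x \<in> carrier M \<Longrightarrow> (a + b) \<odot>\<^bsub>M\<^esub> x = a \<odot>\<^bsub>M\<^esub> x \<oplus>\<^bsub>M\<^esub> b \<odot>\<^bsub>M\<^esub> x"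
    "\<And>a x y. x \<in> carrier M \<Longrightarrow> y \<in> carrier M \<Longrightarrow> a \<odot>\<^bsub>M\<^esub> (x \<oplus>\<^bsub>M\<^esub> y) = a \<odot>\<^bsub>M\<^esub> x \<oplus>\<^bsub>M\<^esub> a \<odot>\<^bsub>M\<^esub> y"
    "\<And>a b x. x \<in> carrier M \<Longrightarrow> (a * b) \<odot>\<^bsub>M\<^esub> x = a \<odot>\<^bsub>M\<^esub> (b \<odot>\<^bsub>M\<^esub> x)"
    "\<And>x. x \<in> carrier M \<Longrightarrow> 1 \<odot>\<^bsub>M\<^esub> x = x"
  shows "vspace M"
  by (rule moduleI[OF cring_base]) (use assms in auto)

lemma vspace_base [simp]: "vspace base"
proof (rule vspaceI)
  show "abelian_group (base :: ('a, 'a) module)" by (rule ring.is_abelian_group[OF cring.axioms(1)[OF cring_base]])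
qed (simp_all add: algebra_simps)

context
  fixes M :: "('k::field, 'a, 'm) module_scheme"
  assumes M: "vspace M"
begin

interpretation module base M by (rule M)

lemma vs_add [simp, intro]: "x \<in> carrier M \<Longrightarrow> y \<in> carrier M \<Longrightarrow> x \<oplus>\<^bsub>M\<^esub> y \<in> carrier M" by simp
lemma vs_zero [simp, intro]: "\<zero>\<^bsub>M\<^esub> \<in> carrier M" by simp
lemma vs_smult [simp, intro]: "x \<in> carrier M \<Longrightarrow> c \<odot>\<^bsub>M\<^esub> x \<in> carrier M" by simp
lemma vs_assoc: "x \<in> carrier M \<Longrightarrow> y \<in> carrier M \<Longrightarrow> z \<in> carrier M
  \<Longrightarrow> (x \<oplus>\<^bsub>M\<^esub> y) \<oplus>\<^bsub>M\<^esub> z = x \<oplus>\<^bsub>M\<^esub> (y \<oplus>\<^bsub>M\<^esub> z)" by (rule M.a_assoc)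
lemma vs_comm: "x \<in> carrier M \<Longrightarrow> y \<in> carrier M \<Longrightarrow> x \<oplus>\<^bsub>M\<^esub> y = y \<oplus>\<^bsub>M\<^esub> x" by (rule M.a_comm)
lemma vs_lcomm: "x \<in> carrier M \<Longrightarrow> y \<in> carrier M \<Longrightarrow> z \<in> carrier M
  \<Longrightarrow> x \<oplus>\<^bsub>M\<^esub> (y \<oplus>\<^bsub>M\<^esub> z) = y \<oplus>\<^bsub>M\<^esub> (x \<oplus>\<^bsub>M\<^esub> z)" by (rule M.a_lcomm)
lemma vs_l_zero [simp]: "x \<in> carrier M \<Longrightarrow> \<zero>\<^bsub>M\<^esub> \<oplus>\<^bsub>M\<^esub> x = x" by simp
lemma vs_r_zero [simp]: "x \<in> carrier M \<Longrightarrow> x \<oplus>\<^bsub>M\<^esub> \<zero>\<^bsub>M\<^esub> = x" by simp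
lemma vs_smult_add: "x \<in> carrier M \<Longrightarrow> y \<in> carrier M
  \<Longrightarrow> c \<odot>\<^bsub>M\<^esub> (x \<oplus>\<^bsub>M\<^esub> y) = c \<odot>\<^bsub>M\<^esub> x \<oplus>\<^bsub>M\<^esub> c \<odot>\<^bsub>M\<^esub> y" by (simp add: smult_r_distr)
lemma vs_add_smult: "x \<in> carrier M \<Longrightarrow> (c + d) \<odot>\<^bsub>M\<^esub> x = c \<odot>\<^bsub>M\<^esub> x \<oplus>\<^bsub>M\<^esub> d \<odot>\<^bsub>M\<^esub> x"
  using smult_l_distr[of c d x] by simp
lemma vs_smult_smult: "x \<in> carrier M \<Longrightarrow> c \<odot>\<^bsub>M\<^esub> (d \<odot>\<^bsub>M\<^esub> x) = (c * d) \<odot>\<^bsub>M\<^esub> x"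
  using smult_assoc1[of c d x] by simp
lemma vs_one [simp]: "x \<in> carrier M \<Longrightarrow> 1 \<odot>\<^bsub>M\<^esub> x = x" using smult_one[of x] by simp
lemma vs_zero_smult [simp]: "x \<in> carrier M \<Longrightarrow> 0 \<odot>\<^bsub>M\<^esub> x = \<zero>\<^bsub>M\<^esub>" using smult_l_null[of x] by simp
lemma vs_smult_zero [simp]: "c \<odot>\<^bsub>M\<^esub> \<zero>\<^bsub>M\<^esub> = \<zero>\<^bsub>M\<^esub>" by simp

end

section \<open>Linear maps and their finite sums\<close>

lemma linI:
  assumes "\<And>x. x \<in> carrier M \<Longrightarrow> f x \<in> carrier N"
    "\<And>x y. x \<in> carrier M \<Longrightarrow> y \<in> carrier M \<Longrightarrow> f (x \<oplus>\<^bsub>M\<^esub> y) = f x \<oplus>\<^bsub>N\<^esub> f y"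
    "\<And>c x. x \<in> carrier M \<Longrightarrow> f (c \<odot>\<^bsub>M\<^esub> x) = c \<odot>\<^bsub>N\<^esub> f x"
  shows "lin M N f"
  using assms by (auto simp: lin_def)

lemma lin_closed: "lin M N f \<Longrightarrow> x \<in> carrier M \<Longrightarrow> f x \<in> carrier N"
  and lin_add: "lin M N f \<Longrightarrow> x \<in> carrier M \<Longrightarrow> y \<in> carrier M \<Longrightarrow> f (x \<oplus>\<^bsub>M\<^esub> y) = f x \<oplus>\<^bsub>N\<^esub> f y"
  and lin_smult: "lin M N f \<Longrightarrow> x \<in> carrier M \<Longrightarrow> f (c \<odot>\<^bsub>M\<^esub> x) = c \<odot>\<^bsub>N\<^esub> f x"
  by (auto simp: lin_def)

lemma lin_zero:
  assumes "vspace M" "vspace N" "lin M N f"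
  shows "f \<zero>\<^bsub>M\<^esub> = \<zero>\<^bsub>N\<^esub>"
proof -
  have "f (0 \<odot>\<^bsub>M\<^esub> \<zero>\<^bsub>M\<^esub>) = 0 \<odot>\<^bsub>N\<^esub> f \<zero>\<^bsub>M\<^esub>" by (rule lin_smult[OF assms(3) vs_zero[OF assms(1)]])
  then show ?thesis using lin_closed[OF assms(3) vs_zero[OF assms(1)]] assms by simp
qed

text \<open>\<open>vspace M\<close> closes the carrier under the operations, so \<open>f\<close> and
  \<open>g\<close> also agree on the sums and multiples that occur in linearity. The lemma serves to
  remove \<open>restrict\<close> from the extensional functions used as morphisms.\<close>

lemma lin_cong:
  assumes "vspace M" "\<And>x. x \<in> carrier M \<Longrightarrow> f x = g x"
  shows "lin M N f \<longleftrightarrow> lin M N g"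
  using assms by (simp add: lin_def Pi_iff cong: ball_cong)

lemma lin_id: "lin M M (\<lambda>x. x)"
  by (rule linI) simp_all

lemma lin_comp:
  assumes "lin N P g" "lin M N f"
  shows "lin M P (\<lambda>x. g (f x))"
  by (rule linI) (simp_all add: lin_closed[OF assms(1)] lin_closed[OF assms(2)]
    lin_add[OF assms(1)] lin_add[OF assms(2)] lin_smult[OF assms(1)] lin_smult[OF assms(2)])

lemma lin_const_zero: "vspace N \<Longrightarrow> lin M N (\<lambda>x. \<zero>\<^bsub>N\<^esub>)"
  by (rule linI) simp_all

lemma lin_plus:
  assumes "vspace N" "lin M N f" "lin M N g"
  shows "lin M N (\<lambda>x. f x \<oplus>\<^bsub>N\<^esub> g x)"
  by (rule linI) (use assms in \<open>simp_all add: lin_closed[OF assms(2)] lin_closed[OF assms(3)]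
    lin_add[OF assms(2)] lin_add[OF assms(3)] lin_smult[OF assms(2)] lin_smult[OF assms(3)]
    vs_assoc[OF assms(1)] vs_lcomm[OF assms(1)] vs_smult_add[OF assms(1)]\<close>)

lemma lin_scale:
  assumes "vspace N" "lin M N f"
  shows "lin M N (\<lambda>x. c \<odot>\<^bsub>N\<^esub> f x)"
  by (rule linI) (use assms in \<open>simp_all add: lin_closed[OF assms(2)] lin_add[OF assms(2)] lin_smult[OF assms(2)]
    vs_smult_smult[OF assms(1)] vs_smult_add[OF assms(1)] mult.commute\<close>)

lemma lin_scalar:
  assumes "vspace N" "lin M base f" "v \<in> carrier N"
  shows "lin M N (\<lambda>x. f x \<odot>\<^bsub>N\<^esub> v)"
  by (rule linI) (use assms in \<open>simp_all add: lin_add[OF assms(2)] lin_smult[OF assms(2)]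
    vs_smult_smult[OF assms(1)] vs_add_smult[OF assms(1)]\<close>)

lemma lin_mult_left: "lin M base f \<Longrightarrow> lin M base (\<lambda>x. c * f x)"
  and lin_mult_right: "lin M base f \<Longrightarrow> lin M base (\<lambda>x. f x * c)"
  by (intro linI; simp add: lin_add[of M base f] lin_smult[of M base f] algebra_simps)+

lemma lin_image_finsum:
  assumes "vspace M" "vspace N" "lin M N f" "finite A" "v \<in> A \<rightarrow> carrier M"
  shows "f (\<Oplus>\<^bsub>M\<^esub>a\<in>A. v a) = (\<Oplus>\<^bsub>N\<^esub>a\<in>A. f (v a))"
proof -
  interpret M: module base M by (rule assms)
  interpret N: module base N by (rule assms)
  show ?thesis using \<open>finite A\<close> \<open>v \<in> A \<rightarrow> carrier M\<close>
  proof (induction A rule: finite_induct)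
    case empty then show ?case by (simp add: lin_zero[OF assms(1-3)])
  next
    case (insert x F)
    then have v: "v \<in> F \<rightarrow> carrier M" "v x \<in> carrier M" by auto
    then have "(\<lambda>a. f (v a)) \<in> F \<rightarrow> carrier N" "f (v x) \<in> carrier N" using lin_closed[OF assms(3)] by auto
    then show ?case using insert v by (simp add: lin_add[OF assms(3)])
  qed
qed

lemma lin_finsum:
  assumes "vspace N" "vspace M" "finite A" "\<And>a. a \<in> A \<Longrightarrow> lin M N (f a)"
  shows "lin M N (\<lambda>x. \<Oplus>\<^bsub>N\<^esub>a\<in>A. f a x)"
proof -
  interpret N: module base N by (rule assms)
  show ?thesis
    using assms(3) assms(4)
  proof (induction A rule: finite_induct)
    case empty show ?case using lin_const_zero[OF assms(1)] by simp
  next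
    case (insert a F)
    have "lin M N (\<lambda>x. f a x \<oplus>\<^bsub>N\<^esub> (\<Oplus>\<^bsub>N\<^esub>a\<in>F. f a x))"
      using insert by (intro lin_plus[OF assms(1)]) auto
    moreover have "(\<Oplus>\<^bsub>N\<^esub>a\<in>insert a F. f a x) = f a x \<oplus>\<^bsub>N\<^esub> (\<Oplus>\<^bsub>N\<^esub>a\<in>F. f a x)" if "x \<in> carrier M" for x
      using insert.hyps lin_closed[OF insert.prems that] by (intro N.M.finsum_insert) auto
    ultimately show ?case by (subst lin_cong[OF assms(2)])
  qed
qed

section \<open>Tensor products\<close>

definition psum :: "('k, 'c, 'p) module_scheme \<Rightarrow> ('a \<Rightarrow> 'b \<Rightarrow> 'c) \<Rightarrow> ('a \<times> 'b) list \<Rightarrow> 'c" where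
  "psum N f l = foldr (\<lambda>(a, b) s. f a b \<oplus>\<^bsub>N\<^esub> s) l \<zero>\<^bsub>N\<^esub>"

lemma psum_simps [simp]: "psum N f [] = \<zero>\<^bsub>N\<^esub>" "psum N f ((a, b) # l) = f a b \<oplus>\<^bsub>N\<^esub> psum N f l"
  by (simp_all add: psum_def)

text \<open>On lists the sum admits induction. The choice of a representative enters only through
  \<open>rep\<close>, so facts about \<open>tsum\<close> over one fixed tensor reduce to facts about
  \<open>psum\<close>.\<close>

lemma tsum_psum: "tsum N t f = psum N f (rep t)"
  by (simp add: tsum_def psum_def)

lemma psum_closed:
  "vspace N \<Longrightarrow> set l \<subseteq> A \<times> B \<Longrightarrow> (\<And>a b. a \<in> A \<Longrightarrow> b \<in> B \<Longrightarrow> f a b \<in> carrier N) \<Longrightarrow> psum N f l \<in> carrier N"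
  by (induction l) auto

lemma psum_append:
  "vspace N \<Longrightarrow> set l \<subseteq> A \<times> B \<Longrightarrow> set m \<subseteq> A \<times> B \<Longrightarrow> (\<And>a b. a \<in> A \<Longrightarrow> b \<in> B \<Longrightarrow> f a b \<in> carrier N)
    \<Longrightarrow> psum N f (l @ m) = psum N f l \<oplus>\<^bsub>N\<^esub> psum N f m"
  by (induction l) (auto simp: psum_closed[of N _ A B] vs_assoc)

lemma psum_cong:
  "set l \<subseteq> A \<times> B \<Longrightarrow> (\<And>a b. a \<in> A \<Longrightarrow> b \<in> B \<Longrightarrow> f a b = g a b) \<Longrightarrow> psum N f l = psum N g l"
  by (induction l) auto

lemma psum_image:
  "vspace N \<Longrightarrow> vspace P \<Longrightarrow> lin N P L \<Longrightarrow> set l \<subseteq> A \<times> B \<Longrightarrow> (\<And>a b. a \<in> A \<Longrightarrow> b \<in> B \<Longrightarrow> f a b \<in> carrier N)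
    \<Longrightarrow> L (psum N f l) = psum P (\<lambda>a b. L (f a b)) l"
  by (induction l) (auto simp: lin_zero lin_add psum_closed[of N _ A B])

lemma psum_add:
  "vspace N \<Longrightarrow> set l \<subseteq> A \<times> B \<Longrightarrow> (\<And>a b. a \<in> A \<Longrightarrow> b \<in> B \<Longrightarrow> f a b \<in> carrier N)
    \<Longrightarrow> (\<And>a b. a \<in> A \<Longrightarrow> b \<in> B \<Longrightarrow> g a b \<in> carrier N)
    \<Longrightarrow> psum N (\<lambda>a b. f a b \<oplus>\<^bsub>N\<^esub> g a b) l = psum N f l \<oplus>\<^bsub>N\<^esub> psum N g l"
  by (induction l) (auto simp: psum_closed[of N _ A B] vs_assoc vs_lcomm)

lemma psum_zero: "vspace N \<Longrightarrow> psum N (\<lambda>a b. \<zero>\<^bsub>N\<^esub>) l = \<zero>\<^bsub>N\<^esub>"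
  by (induction l) auto

lemma psum_smult:
  "vspace N \<Longrightarrow> set l \<subseteq> A \<times> B \<Longrightarrow> (\<And>a b. a \<in> A \<Longrightarrow> b \<in> B \<Longrightarrow> f a b \<in> carrier N)
    \<Longrightarrow> psum N (\<lambda>a b. c \<odot>\<^bsub>N\<^esub> f a b) l = c \<odot>\<^bsub>N\<^esub> psum N f l"
  by (induction l) (auto simp: psum_closed[of N _ A B] vs_smult_add)

lemma psum_swap:
  "vspace N \<Longrightarrow> set l \<subseteq> A \<times> B \<Longrightarrow> set m \<subseteq> C \<times> D
    \<Longrightarrow> (\<And>a b c d. a \<in> A \<Longrightarrow> b \<in> B \<Longrightarrow> c \<in> C \<Longrightarrow> d \<in> D \<Longrightarrow> f a b c d \<in> carrier N)
    \<Longrightarrow> psum N (\<lambda>a b. psum N (\<lambda>c d. f a b c d) m) l = psum N (\<lambda>c d. psum N (\<lambda>a b. f a b c d) l) m"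
proof (induction l)
  case Nil then show ?case by (simp add: psum_zero)
next
  case (Cons p l)
  obtain a b where p: "p = (a, b)" by fastforce
  have "psum N (\<lambda>c d. f a b c d \<oplus>\<^bsub>N\<^esub> psum N (\<lambda>a b. f a b c d) l) m
      = psum N (\<lambda>c d. f a b c d) m \<oplus>\<^bsub>N\<^esub> psum N (\<lambda>c d. psum N (\<lambda>a b. f a b c d) l) m"
    using Cons.prems p by (intro psum_add[of N _ C D]) (auto intro!: psum_closed[of N _ A B])
  then show ?case using Cons by (simp add: p)
qed

section \<open>Bilinear maps and the universal property of the tensor product\<close>

definition bilin ::
  "('k::field, 'a, 'm) module_scheme \<Rightarrow> ('k, 'b, 'n) module_scheme \<Rightarrow> ('k, 'c, 'p) module_scheme
    \<Rightarrow> ('a \<Rightarrow> 'b \<Rightarrow> 'c) \<Rightarrow> bool" where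
  "bilin M N P f \<longleftrightarrow> (\<forall>y\<in>carrier N. lin M P (\<lambda>x. f x y)) \<and> (\<forall>x\<in>carrier M. lin N P (\<lambda>y. f x y))"

lemma bilinI:
  "(\<And>y. y \<in> carrier N \<Longrightarrow> lin M P (\<lambda>x. f x y)) \<Longrightarrow> (\<And>x. x \<in> carrier M \<Longrightarrow> lin N P (\<lambda>y. f x y)) \<Longrightarrow> bilin M N P f"
  by (simp add: bilin_def)

lemma bilin_left: "bilin M N P f \<Longrightarrow> y \<in> carrier N \<Longrightarrow> lin M P (\<lambda>x. f x y)"
  and bilin_right: "bilin M N P f \<Longrightarrow> x \<in> carrier M \<Longrightarrow> lin N P (\<lambda>y. f x y)"
  by (simp_all add: bilin_def)

lemma bilin_closed: "bilin M N P f \<Longrightarrow> x \<in> carrier M \<Longrightarrow> y \<in> carrier N \<Longrightarrow> f x y \<in> carrier P"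
  by (rule lin_closed[OF bilin_left])

context
  fixes M :: "('k::field, 'a, 'm) module_scheme" and N :: "('k, 'b, 'n) module_scheme"
  assumes M: "vspace M" and N: "vspace N"
begin

lemma tens_eq_carrier:
  "tens_eq M N l l' \<Longrightarrow> set l \<subseteq> carrier M \<times> carrier N \<and> set l' \<subseteq> carrier M \<times> carrier N"
  by (induction rule: tens_eq.induct) (auto simp: M N)

text \<open>Each generating relation of the congruence is an identity satisfied by a bilinear
  \<open>f\<close>, or a permutation or concatenation of formal sums. This is the well-definedness
  behind \<open>tsum\<close>.\<close>

lemma tens_eq_psum:
  assumes P: "vspace P" and f: "bilin M N P f" and "tens_eq M N l l'"
  shows "psum P f l = psum P f l'"
  using assms(3)
proof (induction rule: tens_eq.induct)
  have c: "f a b \<in> carrier P" if "a \<in> carrier M" "b \<in> carrier N" for a b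
    using that f by (rule bilin_closed[rotated])
  note [simp] = psum_append[OF P _ _ c, where A="carrier M" and B="carrier N"]
    psum_closed[OF P _ c, where A="carrier M" and B="carrier N"]
  { case (tens_append l l' m m') then show ?case using tens_eq_carrier by fastforce }
  { case (tens_commute l m) then show ?case by (simp add: vs_comm[OF P]) }
  { case (tens_add_left a a' b) then show ?case using lin_add[OF bilin_left[OF f]] P M c by simp }
  { case (tens_add_right a b b') then show ?case using lin_add[OF bilin_right[OF f]] P N c by simp }
  { case (tens_scalar a b d) then show ?case
      using lin_smult[OF bilin_right[OF f]] lin_smult[OF bilin_left[OF f]] P M N c by simp }
  { case (tens_zero_left b) then show ?case using lin_zero[OF M P bilin_left[OF f]] P M c by simp }
  { case (tens_zero_right a) then show ?case using lin_zero[OF N P bilin_right[OF f]] P N c by simp }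
qed auto

text \<open>The congruence is reflexive only on formal sums with entries in the carriers; the
  hypothesis puts \<open>l\<close> into its own class.\<close>

lemma tens_class_eq_iff:
  assumes "set l \<subseteq> carrier M \<times> carrier N"
  shows "tens_class M N l = tens_class M N l' \<longleftrightarrow> tens_eq M N l l'"
proof
  assume "tens_class M N l = tens_class M N l'"
  moreover have "l \<in> tens_class M N l" using assms by (simp add: tens_class_def tens_refl)
  ultimately show "tens_eq M N l l'" by (simp add: tens_class_def tens_sym)
next
  assume *: "tens_eq M N l l'"
  then show "tens_class M N l = tens_class M N l'"
    unfolding tens_class_def using tens_trans[OF *] tens_trans[OF tens_sym[OF *]] by (intro Collect_cong iffI)
qed

lemma tens_class_eqI: "tens_eq M N l l' \<Longrightarrow> tens_class M N l = tens_class M N l'"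
  using tens_class_eq_iff tens_eq_carrier by blast

lemma rep_tens_class:
  assumes "set l \<subseteq> carrier M \<times> carrier N"
  shows "tens_eq M N l (rep (tens_class M N l))"
proof -
  have "l \<in> tens_class M N l" using assms by (simp add: tens_class_def tens_refl)
  then have "rep (tens_class M N l) \<in> tens_class M N l" unfolding rep_def by (rule someI)
  then show ?thesis by (simp add: tens_class_def)
qed

lemma carrier_tensor: "carrier (tensor M N) = tens_class M N ` {l. set l \<subseteq> carrier M \<times> carrier N}"
  by (simp add: tensor_def mk_vspace_def lists_eq_set)

lemma tens_class_closed [simp, intro]:
  "set l \<subseteq> carrier M \<times> carrier N \<Longrightarrow> tens_class M N l \<in> carrier (tensor M N)"
  by (auto simp: carrier_tensor)

lemma tensor_zero: "\<zero>\<^bsub>tensor M N\<^esub> = tens_class M N []"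
  by (simp add: tensor_def mk_vspace_def)

lemma rep_carrier: "t \<in> carrier (tensor M N) \<Longrightarrow> set (rep t) \<subseteq> carrier M \<times> carrier N"
  unfolding carrier_tensor using rep_tens_class tens_eq_carrier by blast

lemma tens_class_rep:
  assumes "t \<in> carrier (tensor M N)"
  shows "tens_class M N (rep t) = t"
proof -
  from assms obtain l where l: "t = tens_class M N l" "set l \<subseteq> carrier M \<times> carrier N"
    by (auto simp: carrier_tensor)
  show ?thesis using tens_class_eq_iff[OF l(2)] rep_tens_class[OF l(2)] l(1) by metis
qed

lemma tensor_add:
  assumes "set l \<subseteq> carrier M \<times> carrier N" "set m \<subseteq> carrier M \<times> carrier N"
  shows "tens_class M N l \<oplus>\<^bsub>tensor M N\<^esub> tens_class M N m = tens_class M N (l @ m)"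
proof -
  have "tens_eq M N (l @ m) (rep (tens_class M N l) @ rep (tens_class M N m))"
    by (intro tens_append rep_tens_class assms)
  from tens_class_eqI[OF this] show ?thesis by (simp add: tensor_def mk_vspace_def)
qed

text \<open>Makes scalar multiplication computable on any representative. In the case of the
  relation that moves a scalar between the factors, two scalars have to commute past each
  other.\<close>

lemma tens_eq_map_smult:
  "tens_eq M N l l' \<Longrightarrow> tens_eq M N (map (\<lambda>(a, b). (c \<odot>\<^bsub>M\<^esub> a, b)) l) (map (\<lambda>(a, b). (c \<odot>\<^bsub>M\<^esub> a, b)) l')"
proof (induction rule: tens_eq.induct)
  case (tens_refl l) then show ?case by (intro tens_eq.tens_refl) (use M in auto)
next
  case (tens_commute l m) then show ?case unfolding map_append by (intro tens_eq.tens_commute) (use M in auto)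
next
  case (tens_scalar a b d)
  have "c \<odot>\<^bsub>M\<^esub> (d \<odot>\<^bsub>M\<^esub> a) = d \<odot>\<^bsub>M\<^esub> (c \<odot>\<^bsub>M\<^esub> a)" using tens_scalar M by (simp add: vs_smult_smult mult.commute)
  then show ?case using tens_scalar M by (simp add: tens_eq.tens_scalar)
next
  case (tens_sym l l') then show ?case using tens_eq.tens_sym by blast
next
  case (tens_trans l l' l'') then show ?case using tens_eq.tens_trans by blast
qed (simp_all add: M N vs_smult_add[OF M] vs_smult_zero[OF M] tens_eq.tens_append tens_eq.tens_add_left
  tens_eq.tens_add_right tens_eq.tens_zero_left tens_eq.tens_zero_right)

lemma tensor_smult:
  assumes "set l \<subseteq> carrier M \<times> carrier N"
  shows "c \<odot>\<^bsub>tensor M N\<^esub> tens_class M N l = tens_class M N (map (\<lambda>(a, b). (c \<odot>\<^bsub>M\<^esub> a, b)) l)"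
proof -
  have "tens_eq M N (map (\<lambda>(a, b). (c \<odot>\<^bsub>M\<^esub> a, b)) l) (map (\<lambda>(a, b). (c \<odot>\<^bsub>M\<^esub> a, b)) (rep (tens_class M N l)))"
    by (intro tens_eq_map_smult rep_tens_class assms)
  from tens_class_eqI[OF this] show ?thesis by (simp add: tensor_def mk_vspace_def)
qed

lemma tens_class_Cons:
  "a \<in> carrier M \<Longrightarrow> b \<in> carrier N \<Longrightarrow> set l \<subseteq> carrier M \<times> carrier N
    \<Longrightarrow> tens_class M N ((a, b) # l) = pure M N a b \<oplus>\<^bsub>tensor M N\<^esub> tens_class M N l"
  by (simp add: pure_def tensor_add)

lemma vspace_tensor: "vspace (tensor M N)"
proof -
  let ?T = "tensor M N" and ?L = "{l. set l \<subseteq> carrier M \<times> carrier N}"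
  have assoc: "(x \<oplus>\<^bsub>?T\<^esub> y) \<oplus>\<^bsub>?T\<^esub> z = x \<oplus>\<^bsub>?T\<^esub> (y \<oplus>\<^bsub>?T\<^esub> z)"
    if "x \<in> carrier ?T" "y \<in> carrier ?T" "z \<in> carrier ?T" for x y z
    using that by (auto simp: carrier_tensor tensor_add)
  have comm: "x \<oplus>\<^bsub>?T\<^esub> y = y \<oplus>\<^bsub>?T\<^esub> x" if "x \<in> carrier ?T" "y \<in> carrier ?T" for x y
    using that tens_class_eqI[OF tens_commute] by (force simp: carrier_tensor tensor_add)
  have cl: "x \<oplus>\<^bsub>?T\<^esub> y \<in> carrier ?T" if "x \<in> carrier ?T" "y \<in> carrier ?T" for x y
    using that by (auto simp: carrier_tensor tensor_add)
  have lz: "\<zero>\<^bsub>?T\<^esub> \<oplus>\<^bsub>?T\<^esub> x = x" if "x \<in> carrier ?T" for x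
    using that by (auto simp: carrier_tensor tensor_add tensor_zero)
  have z: "\<zero>\<^bsub>?T\<^esub> \<in> carrier ?T" by (auto simp: carrier_tensor tensor_zero)
  have mp: "map (\<lambda>(a, b). (c \<odot>\<^bsub>M\<^esub> a, b)) l \<in> ?L" if "l \<in> ?L" for c l using that M by auto
  have sm: "c \<odot>\<^bsub>?T\<^esub> x \<in> carrier ?T" if "x \<in> carrier ?T" for c x
    using that mp by (auto simp: carrier_tensor tensor_smult)
  \<comment> \<open>Distributivity in the scalar splits every entry in two, so it needs an induction
    along the formal sum with a regrouping of four summands.\<close>
  have dist: "(c + d) \<odot>\<^bsub>?T\<^esub> x = c \<odot>\<^bsub>?T\<^esub> x \<oplus>\<^bsub>?T\<^esub> d \<odot>\<^bsub>?T\<^esub> x" if "x \<in> carrier ?T" for c d x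
  proof -
    have "tens_class M N (map (\<lambda>(a, b). ((c + d) \<odot>\<^bsub>M\<^esub> a, b)) l)
        = tens_class M N (map (\<lambda>(a, b). (c \<odot>\<^bsub>M\<^esub> a, b)) l) \<oplus>\<^bsub>?T\<^esub> tens_class M N (map (\<lambda>(a, b). (d \<odot>\<^bsub>M\<^esub> a, b)) l)"
      if "l \<in> ?L" for l
      using that
    proof (induction l)
      case Nil then show ?case by (simp add: tensor_add)
    next
      case (Cons p l)
      obtain a b where p: "p = (a, b)" by fastforce
      have ab: "a \<in> carrier M" "b \<in> carrier N" "l \<in> ?L" using Cons p by auto
      have q: "pure M N ((c + d) \<odot>\<^bsub>M\<^esub> a) b = pure M N (c \<odot>\<^bsub>M\<^esub> a) b \<oplus>\<^bsub>?T\<^esub> pure M N (d \<odot>\<^bsub>M\<^esub> a) b"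
        using ab M by (simp add: pure_def tensor_add tens_class_eq_iff vs_add_smult tens_add_left)
      have pc: "pure M N (c \<odot>\<^bsub>M\<^esub> a) b \<in> carrier ?T" for c using ab M by (simp add: pure_def)
      have lc: "tens_class M N (map (\<lambda>(a, b). (c \<odot>\<^bsub>M\<^esub> a, b)) l) \<in> carrier ?T" for c
        using mp[OF ab(3)] by simp
      have lm: "set (map (\<lambda>(a, b). (c \<odot>\<^bsub>M\<^esub> a, b)) l) \<subseteq> carrier M \<times> carrier N" for c
        using mp[OF ab(3)] by simp
      have four: "(u \<oplus>\<^bsub>?T\<^esub> v) \<oplus>\<^bsub>?T\<^esub> (x \<oplus>\<^bsub>?T\<^esub> y) = (u \<oplus>\<^bsub>?T\<^esub> x) \<oplus>\<^bsub>?T\<^esub> (v \<oplus>\<^bsub>?T\<^esub> y)"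
        if "u \<in> carrier ?T" "v \<in> carrier ?T" "x \<in> carrier ?T" "y \<in> carrier ?T" for u v x y
        using that assoc comm cl by metis
      have cons: "tens_class M N (map (\<lambda>(a, b). (c \<odot>\<^bsub>M\<^esub> a, b)) (p # l))
          = pure M N (c \<odot>\<^bsub>M\<^esub> a) b \<oplus>\<^bsub>?T\<^esub> tens_class M N (map (\<lambda>(a, b). (c \<odot>\<^bsub>M\<^esub> a, b)) l)" for c
        using tens_class_Cons[OF _ ab(2) lm[of c], of "c \<odot>\<^bsub>M\<^esub> a"] ab M by (simp add: p)
      show ?case unfolding cons q using Cons.IH ab(3) four[OF pc pc lc lc] by simp
    qed
    then show ?thesis using \<open>x \<in> carrier ?T\<close> by (auto simp: carrier_tensor tensor_smult)
  qed
  have zz: "0 \<odot>\<^bsub>?T\<^esub> x = \<zero>\<^bsub>?T\<^esub>" if "x \<in> carrier ?T" for x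
  proof -
    have "tens_eq M N (map (\<lambda>(a, b). (0 \<odot>\<^bsub>M\<^esub> a, b)) l) []" if "l \<in> ?L" for l
      using that
    proof (induction l)
      case Nil then show ?case by (simp add: tens_refl)
    next
      case (Cons p l)
      obtain a b where p: "p = (a, b)" by fastforce
      have "tens_eq M N [(0 \<odot>\<^bsub>M\<^esub> a, b)] []" using Cons p M by (simp add: tens_zero_left)
      from tens_append[OF this Cons.IH] show ?case using Cons p by simp
    qed
    then have "tens_class M N (map (\<lambda>(a, b). (0 \<odot>\<^bsub>M\<^esub> a, b)) l) = tens_class M N []" if "l \<in> ?L" for l
      using that by (intro tens_class_eqI)
    then show ?thesis using that by (auto simp only: carrier_tensor tensor_smult tensor_zero mem_Collect_eq)
  qed
  have one: "1 \<odot>\<^bsub>?T\<^esub> x = x" if "x \<in> carrier ?T" for x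
  proof -
    from that obtain l where l: "x = tens_class M N l" "l \<in> ?L" by (auto simp: carrier_tensor)
    have "map (\<lambda>(a, b). (1 \<odot>\<^bsub>M\<^esub> a, b)) l = l" using l(2) M by (induction l) auto
    then show ?thesis using l by (simp only: tensor_smult mem_Collect_eq)
  qed
  have ss: "(c * d) \<odot>\<^bsub>?T\<^esub> x = c \<odot>\<^bsub>?T\<^esub> (d \<odot>\<^bsub>?T\<^esub> x)" if "x \<in> carrier ?T" for c d x
  proof -
    from that obtain l where l: "x = tens_class M N l" "l \<in> ?L" by (auto simp: carrier_tensor)
    have "map (\<lambda>(a, b). ((c * d) \<odot>\<^bsub>M\<^esub> a, b)) l = map (\<lambda>(a, b). (c \<odot>\<^bsub>M\<^esub> a, b)) (map (\<lambda>(a, b). (d \<odot>\<^bsub>M\<^esub> a, b)) l)"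
      using l(2) M by (induction l) (auto simp: vs_smult_smult)
    then show ?thesis using l mp[OF l(2)] by (simp only: tensor_smult mem_Collect_eq)
  qed
  have sa: "c \<odot>\<^bsub>?T\<^esub> (x \<oplus>\<^bsub>?T\<^esub> y) = c \<odot>\<^bsub>?T\<^esub> x \<oplus>\<^bsub>?T\<^esub> c \<odot>\<^bsub>?T\<^esub> y" if "x \<in> carrier ?T" "y \<in> carrier ?T" for c x y
  proof -
    from that obtain l m where "x = tens_class M N l" "l \<in> ?L" "y = tens_class M N m" "m \<in> ?L"
      by (auto simp: carrier_tensor)
    then show ?thesis using mp[of l c] mp[of m c] by (simp add: tensor_add tensor_smult)
  qed
  have "abelian_group ?T"
  proof (rule abelian_groupI)
    fix x assume x: "x \<in> carrier ?T"
    \<comment> \<open>The congruence has no rule for negatives; the inverse of \<open>x\<close> is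
      its multiple by -1, because multiples by 0 vanish.\<close>
    have "(-1) \<odot>\<^bsub>?T\<^esub> x \<oplus>\<^bsub>?T\<^esub> 1 \<odot>\<^bsub>?T\<^esub> x = \<zero>\<^bsub>?T\<^esub>" using dist[OF x, of "-1" 1] zz[OF x] by simp
    then show "\<exists>y\<in>carrier ?T. y \<oplus>\<^bsub>?T\<^esub> x = \<zero>\<^bsub>?T\<^esub>" using one sm x by metis
  qed (use assoc comm cl z lz in auto)
  then show ?thesis by (rule vspaceI) (use sm dist sa ss one in auto)
qed

lemma pure_closed: "a \<in> carrier M \<Longrightarrow> b \<in> carrier N \<Longrightarrow> pure M N a b \<in> carrier (tensor M N)"
  by (simp add: pure_def)

lemma bilin_pure: "bilin M N (tensor M N) (pure M N)"
proof (intro bilinI linI)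
  fix a a' b c assume *: "a \<in> carrier M" "a' \<in> carrier M" "b \<in> carrier N"
  show "pure M N (a \<oplus>\<^bsub>M\<^esub> a') b = pure M N a b \<oplus>\<^bsub>tensor M N\<^esub> pure M N a' b"
    using * M by (simp add: pure_def tensor_add tens_class_eq_iff tens_add_left)
next
  fix a b b' assume *: "a \<in> carrier M" "b \<in> carrier N" "b' \<in> carrier N"
  show "pure M N a (b \<oplus>\<^bsub>N\<^esub> b') = pure M N a b \<oplus>\<^bsub>tensor M N\<^esub> pure M N a b'"
    using * N by (simp add: pure_def tensor_add tens_class_eq_iff tens_add_right)
next
  fix c a b assume *: "a \<in> carrier M" "b \<in> carrier N"
  show "pure M N (c \<odot>\<^bsub>M\<^esub> a) b = c \<odot>\<^bsub>tensor M N\<^esub> pure M N a b"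
    using * by (simp add: pure_def tensor_smult)
  show "pure M N a (c \<odot>\<^bsub>N\<^esub> b) = c \<odot>\<^bsub>tensor M N\<^esub> pure M N a b"
    using * M N tens_sym[OF tens_scalar[of a M b N c]] by (simp add: pure_def tensor_smult tens_class_eq_iff)
qed (simp_all add: pure_closed)

lemma tsum_closed:
  "vspace P \<Longrightarrow> t \<in> carrier (tensor M N) \<Longrightarrow> (\<And>a b. a \<in> carrier M \<Longrightarrow> b \<in> carrier N \<Longrightarrow> f a b \<in> carrier P)
    \<Longrightarrow> tsum P t f \<in> carrier P"
  unfolding tsum_psum by (rule psum_closed[OF _ rep_carrier])

lemma tsum_cong:
  "t \<in> carrier (tensor M N) \<Longrightarrow> (\<And>a b. a \<in> carrier M \<Longrightarrow> b \<in> carrier N \<Longrightarrow> f a b = g a b)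
    \<Longrightarrow> tsum P t f = tsum P t g"
  unfolding tsum_psum by (rule psum_cong[OF rep_carrier])

lemma tsum_image:
  "vspace P \<Longrightarrow> vspace Q \<Longrightarrow> lin P Q L \<Longrightarrow> t \<in> carrier (tensor M N)
    \<Longrightarrow> (\<And>a b. a \<in> carrier M \<Longrightarrow> b \<in> carrier N \<Longrightarrow> f a b \<in> carrier P)
    \<Longrightarrow> L (tsum P t f) = tsum Q t (\<lambda>a b. L (f a b))"
  unfolding tsum_psum by (rule psum_image[OF _ _ _ rep_carrier])

lemma tsum_plus:
  "vspace P \<Longrightarrow> t \<in> carrier (tensor M N) \<Longrightarrow> (\<And>a b. a \<in> carrier M \<Longrightarrow> b \<in> carrier N \<Longrightarrow> f a b \<in> carrier P)
    \<Longrightarrow> (\<And>a b. a \<in> carrier M \<Longrightarrow> b \<in> carrier N \<Longrightarrow> g a b \<in> carrier P)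
    \<Longrightarrow> tsum P t (\<lambda>a b. f a b \<oplus>\<^bsub>P\<^esub> g a b) = tsum P t f \<oplus>\<^bsub>P\<^esub> tsum P t g"
  unfolding tsum_psum by (rule psum_add[OF _ rep_carrier])

lemma tsum_scale:
  "vspace P \<Longrightarrow> t \<in> carrier (tensor M N) \<Longrightarrow> (\<And>a b. a \<in> carrier M \<Longrightarrow> b \<in> carrier N \<Longrightarrow> f a b \<in> carrier P)
    \<Longrightarrow> tsum P t (\<lambda>a b. c \<odot>\<^bsub>P\<^esub> f a b) = c \<odot>\<^bsub>P\<^esub> tsum P t f"
  unfolding tsum_psum by (rule psum_smult[OF _ rep_carrier])

text \<open>For a bilinear summand the chosen representative may be replaced by any formal sum of
  the same class. Evaluations of \<open>tsum\<close> on explicit tensors go through this.\<close>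

lemma tsum_class:
  assumes "vspace P" "bilin M N P f" "set l \<subseteq> carrier M \<times> carrier N"
  shows "tsum P (tens_class M N l) f = psum P f l"
  unfolding tsum_psum using tens_eq_psum[OF assms(1,2) rep_tens_class[OF assms(3)]] by simp

lemma tsum_pure:
  assumes "vspace P" "bilin M N P f" "a \<in> carrier M" "b \<in> carrier N"
  shows "tsum P (pure M N a b) f = f a b"
  using assms bilin_closed[OF assms(2-4)] by (simp add: pure_def tsum_class)

lemma lin_tsum:
  assumes P: "vspace P" and f: "bilin M N P f"
  shows "lin (tensor M N) P (\<lambda>t. tsum P t f)"
proof (rule linI)
  fix x y assume "x \<in> carrier (tensor M N)" "y \<in> carrier (tensor M N)"
  then obtain l m where lm: "x = tens_class M N l" "y = tens_class M N m"
    "set l \<subseteq> carrier M \<times> carrier N" "set m \<subseteq> carrier M \<times> carrier N" by (auto simp: carrier_tensor)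
  show "tsum P (x \<oplus>\<^bsub>tensor M N\<^esub> y) f = tsum P x f \<oplus>\<^bsub>P\<^esub> tsum P y f"
    using lm psum_append[OF P lm(3,4) bilin_closed[OF f]] by (simp add: tensor_add tsum_class[OF P f])
next
  fix c x assume "x \<in> carrier (tensor M N)"
  then obtain l where l: "x = tens_class M N l" "set l \<subseteq> carrier M \<times> carrier N" by (auto simp: carrier_tensor)
  have "psum P f (map (\<lambda>(a, b). (c \<odot>\<^bsub>M\<^esub> a, b)) l) = psum P (\<lambda>a b. c \<odot>\<^bsub>P\<^esub> f a b) l"
    using l(2) by (induction l) (auto simp: lin_smult[OF bilin_left[OF f]])
  moreover have "set (map (\<lambda>(a, b). (c \<odot>\<^bsub>M\<^esub> a, b)) l) \<subseteq> carrier M \<times> carrier N" using l M by auto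
  ultimately show "tsum P (c \<odot>\<^bsub>tensor M N\<^esub> x) f = c \<odot>\<^bsub>P\<^esub> tsum P x f"
    using l psum_smult[OF P l(2) bilin_closed[OF f]] by (simp add: tensor_smult tsum_class[OF P f])
qed (auto intro: tsum_closed P bilin_closed[OF f])

text \<open>A representative, read as a sum in the tensor product, gives back its class. This opens
  up an arbitrary tensor for linear maps, as in \<open>tensor_ext\<close>.\<close>

lemma tsum_pure_id: "t \<in> carrier (tensor M N) \<Longrightarrow> tsum (tensor M N) t (pure M N) = t"
proof -
  assume t: "t \<in> carrier (tensor M N)"
  have "psum (tensor M N) (pure M N) l = tens_class M N l" if "set l \<subseteq> carrier M \<times> carrier N" for l
    using that by (induction l) (auto simp: tensor_zero tens_class_Cons)
  then show ?thesis using rep_carrier[OF t] tens_class_rep[OF t] by (simp add: tsum_psum)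
qed

lemma tensor_ext:
  assumes P: "vspace P" and f: "lin (tensor M N) P f" and g: "lin (tensor M N) P g"
    and "\<And>a b. a \<in> carrier M \<Longrightarrow> b \<in> carrier N \<Longrightarrow> f (pure M N a b) = g (pure M N a b)"
    and t: "t \<in> carrier (tensor M N)"
  shows "f t = g t"
proof -
  have "f (tsum (tensor M N) t (pure M N)) = g (tsum (tensor M N) t (pure M N))"
    using assms by (simp add: tsum_image[OF vspace_tensor P _ t] pure_closed cong: tsum_cong)
  then show ?thesis by (simp add: tsum_pure_id[OF t])
qed

end

text \<open>Both iterated sums run over the same two fixed representatives, so this is the exchange
  of two finite sums.\<close>

lemma tsum_swap:
  assumes "vspace A" "vspace B" "vspace C" "vspace D" "vspace P"
    "t \<in> carrier (tensor A B)" "s \<in> carrier (tensor C D)"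
    "\<And>a b c d. a \<in> carrier A \<Longrightarrow> b \<in> carrier B \<Longrightarrow> c \<in> carrier C \<Longrightarrow> d \<in> carrier D \<Longrightarrow> f a b c d \<in> carrier P"
  shows "tsum P t (\<lambda>a b. tsum P s (\<lambda>c d. f a b c d)) = tsum P s (\<lambda>c d. tsum P t (\<lambda>a b. f a b c d))"
  unfolding tsum_psum
  by (rule psum_swap[OF assms(5) rep_carrier[OF assms(1,2,6)] rep_carrier[OF assms(3,4,7)] assms(8)])

section \<open>Independence of the tensor product from further record fields\<close>

lemma tens_eq_transfer:
  assumes "tens_eq M N l l'"
    "carrier M = carrier M'" "add M = add M'" "smult M = smult M'" "zero M = zero M'"
    "carrier N = carrier N'" "add N = add N'" "smult N = smult N'" "zero N = zero N'"
  shows "tens_eq M' N' l l'"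
  using assms(1)
proof (induction rule: tens_eq.induct)
  case (tens_sym l l') then show ?case using tens_eq.tens_sym by blast
next
  case (tens_trans l l' l'') then show ?case using tens_eq.tens_trans by blast
next
  case (tens_append l l' m m') then show ?case by (simp add: tens_eq.tens_append)
qed (use assms(2-) in \<open>simp_all add: tens_eq.tens_refl tens_eq.tens_commute tens_eq.tens_add_left
  tens_eq.tens_add_right tens_eq.tens_scalar tens_eq.tens_zero_left tens_eq.tens_zero_right\<close>)

text \<open>Modules, coalgebras and comodules with the same linear structure are different records;
  their tensor products nevertheless consist of the same classes. Used whenever one record stands in
  for another.\<close>

lemma tens_class_transfer:
  assumes "carrier M = carrier M'" "add M = add M'" "smult M = smult M'" "zero M = zero M'"
    "carrier N = carrier N'" "add N = add N'" "smult N = smult N'" "zero N = zero N'"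
  shows "tens_class M N = tens_class M' N'"
  by (intro ext, unfold tens_class_def) (metis assms tens_eq_transfer)

lemma tensor_transfer:
  assumes "carrier M = carrier M'" "add M = add M'" "smult M = smult M'" "zero M = zero M'"
    "carrier N = carrier N'" "add N = add N'" "smult N = smult N'" "zero N = zero N'"
  shows "tensor M N = tensor M' N'" "pure M N = pure M' N'"
  using assms by (simp_all add: tensor_def tens_class_transfer[OF assms] pure_def fun_eq_iff)

text \<open>Syntax-directed rules for linearity, membership and the vector space property. The
  linearity rules are stated for composites with a linear \<open>F\<close>, so that repeated
  resolution descends through nested Sweedler sums.\<close>

named_theorems linr

lemma base_closed: "c \<in> carrier base" by simp

lemma lin_pure_left:
  "lin M P F \<Longrightarrow> vspace P \<Longrightarrow> vspace Q \<Longrightarrow> b \<in> carrier Q \<Longrightarrow> lin M (tensor P Q) (\<lambda>x. pure P Q (F x) b)"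
  by (rule lin_comp[OF bilin_left[OF bilin_pure]])

lemma lin_pure_right:
  "lin M Q F \<Longrightarrow> vspace P \<Longrightarrow> vspace Q \<Longrightarrow> a \<in> carrier P \<Longrightarrow> lin M (tensor P Q) (\<lambda>x. pure P Q a (F x))"
  by (rule lin_comp[OF bilin_right[OF bilin_pure]])

text \<open>A Sweedler sum can depend linearly on a parameter in two ways: through the tensor, as
  here, where the summand must be bilinear; or through the summand over a fixed tensor, as in
  \<open>lin_tsum_ker\<close>.\<close>

lemma lin_tsum_arg:
  "lin M (tensor A B) F \<Longrightarrow> vspace A \<Longrightarrow> vspace B \<Longrightarrow> vspace N
    \<Longrightarrow> (\<And>b. b \<in> carrier B \<Longrightarrow> lin A N (\<lambda>a. f a b)) \<Longrightarrow> (\<And>a. a \<in> carrier A \<Longrightarrow> lin B N (\<lambda>b. f a b))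
    \<Longrightarrow> lin M N (\<lambda>x. tsum N (F x) f)"
  by (rule lin_comp[OF lin_tsum[OF _ _ _ bilinI]])

lemma lin_tsum_ker:
  assumes t: "t \<in> carrier (tensor A B)" and A: "vspace A" and B: "vspace B" and N: "vspace N"
    and f: "\<And>a b. a \<in> carrier A \<Longrightarrow> b \<in> carrier B \<Longrightarrow> lin M N (\<lambda>x. f x a b)"
  shows "lin M N (\<lambda>x. tsum N t (f x))"
proof (rule linI)
  fix x y assume xy: "x \<in> carrier M" "y \<in> carrier M"
  have "tsum N t (f (x \<oplus>\<^bsub>M\<^esub> y)) = tsum N t (\<lambda>a b. f x a b \<oplus>\<^bsub>N\<^esub> f y a b)"
    by (rule tsum_cong[OF A B t]) (simp add: lin_add[OF f] xy)
  also have "\<dots> = tsum N t (f x) \<oplus>\<^bsub>N\<^esub> tsum N t (f y)"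
    by (rule tsum_plus[OF A B N t]) (simp_all add: lin_closed[OF f] xy)
  finally show "tsum N t (f (x \<oplus>\<^bsub>M\<^esub> y)) = tsum N t (f x) \<oplus>\<^bsub>N\<^esub> tsum N t (f y)" .
next
  fix c x assume x: "x \<in> carrier M"
  have "tsum N t (f (c \<odot>\<^bsub>M\<^esub> x)) = tsum N t (\<lambda>a b. c \<odot>\<^bsub>N\<^esub> f x a b)"
    by (rule tsum_cong[OF A B t]) (simp add: lin_smult[OF f] x)
  also have "\<dots> = c \<odot>\<^bsub>N\<^esub> tsum N t (f x)"
    by (rule tsum_scale[OF A B N t]) (simp_all add: lin_closed[OF f] x)
  finally show "tsum N t (f (c \<odot>\<^bsub>M\<^esub> x)) = c \<odot>\<^bsub>N\<^esub> tsum N t (f x)" .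
qed (rule tsum_closed[OF A B N t lin_closed[OF f]])

lemma lin_bilin_left: "bilin A B N f \<Longrightarrow> lin M A F \<Longrightarrow> b \<in> carrier B \<Longrightarrow> lin M N (\<lambda>x. f (F x) b)"
  by (rule lin_comp[OF bilin_left])

lemma lin_bilin_right: "bilin A B N f \<Longrightarrow> lin M B F \<Longrightarrow> a \<in> carrier A \<Longrightarrow> lin M N (\<lambda>x. f a (F x))"
  by (rule lin_comp[OF bilin_right])

text \<open>A reordering for resolution: solving the membership premise first fixes \<open>M\<close>
  and \<open>N\<close> in the remaining ones.\<close>

lemma tsum_closed':
  "t \<in> carrier (tensor M N) \<Longrightarrow> vspace M \<Longrightarrow> vspace N \<Longrightarrow> vspace P
    \<Longrightarrow> (\<And>a b. a \<in> carrier M \<Longrightarrow> b \<in> carrier N \<Longrightarrow> f a b \<in> carrier P) \<Longrightarrow> tsum P t f \<in> carrier P"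
  by (rule tsum_closed)

lemma pure_closed':
  "a \<in> carrier M \<Longrightarrow> b \<in> carrier N \<Longrightarrow> vspace M \<Longrightarrow> vspace N \<Longrightarrow> pure M N a b \<in> carrier (tensor M N)"
  by (rule pure_closed)

lemma vs_smult': "x \<in> carrier M \<Longrightarrow> vspace M \<Longrightarrow> c \<odot>\<^bsub>M\<^esub> x \<in> carrier M"
  by (rule vs_smult)

lemma lin_tmap:
  "lin M M' f \<Longrightarrow> lin N N' g \<Longrightarrow> vspace M \<Longrightarrow> vspace N \<Longrightarrow> vspace M' \<Longrightarrow> vspace N'
    \<Longrightarrow> lin (tensor M N) (tensor M' N') (tmap M' N' f g)"
  unfolding tmap_def
  by (rule lin_tsum_arg lin_id lin_pure_left lin_pure_right vspace_tensor | assumption | erule lin_closed | rule lin_closed)+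

lemma tmap_pure:
  assumes "lin M M' f" "lin N N' g" "vspace M" "vspace N" "vspace M'" "vspace N'" "a \<in> carrier M" "b \<in> carrier N"
  shows "tmap M' N' f g (pure M N a b) = pure M' N' (f a) (g b)"
  unfolding tmap_def
  by (rule tsum_pure[OF assms(3,4) vspace_tensor[OF assms(5,6)] bilinI assms(7,8)])
    (rule lin_pure_left lin_pure_right assms lin_closed[OF assms(1)] lin_closed[OF assms(2)] | assumption)+

lemma tsum_tmap:
  assumes f: "lin M M' f" and g: "lin N N' g" and vs: "vspace M" "vspace N" "vspace M'" "vspace N'" "vspace P"
    and k: "bilin M' N' P k" and t: "t \<in> carrier (tensor M N)"
  shows "tsum P (tmap M' N' f g t) k = tsum P t (\<lambda>a b. k (f a) (g b))"
proof -
  have "tsum P (tmap M' N' f g t) k = tsum P t (\<lambda>a b. tsum P (pure M' N' (f a) (g b)) k)"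
    unfolding tmap_def
    by (rule tsum_image[OF vs(1,2) vspace_tensor _ lin_tsum t])
      (use assms in \<open>auto intro!: pure_closed intro: lin_closed\<close>)
  also have "\<dots> = tsum P t (\<lambda>a b. k (f a) (g b))"
    by (rule tsum_cong[OF vs(1,2) t]) (simp add: tsum_pure[OF vs(3-5) k] lin_closed[OF f] lin_closed[OF g])
  finally show ?thesis .
qed

lemmas [linr] = vspace_base vspace_tensor base_closed lin_id lin_pure_left lin_pure_right
  lin_tsum_ker lin_tsum_arg lin_scale lin_scalar lin_mult_left lin_mult_right
  tsum_closed' pure_closed' vs_smult'

section \<open>Coalgebras and comodules\<close>

locale coalg_struct =
  fixes H :: "('k::field, 'h, 'm) coalg_scheme"
  assumes coalgebra: "coalgebra H"
begin

lemma vsH [linr, simp]: "vspace H"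
  and lin_comult: "lin H (tensor H H) (comult H)"
  and lin_counit: "lin H base (counit H)"
  using coalgebra by (auto simp: coalgebra_def)

lemma lin_comult' [linr]: "lin M H F \<Longrightarrow> lin M (tensor H H) (\<lambda>x. comult H (F x))"
  by (rule lin_comp[OF lin_comult])

lemma lin_counit' [linr]: "lin M H F \<Longrightarrow> lin M base (\<lambda>x. counit H (F x))"
  by (rule lin_comp[OF lin_counit])

lemma comult_closed [linr]: "h \<in> carrier H \<Longrightarrow> comult H h \<in> carrier (tensor H H)"
  by (rule lin_closed[OF lin_comult])

lemma comodule_vspace: "comodule H X \<Longrightarrow> vspace X"
  and lin_coact: "comodule H X \<Longrightarrow> lin X (tensor H X) (coact X)"
  by (auto simp: comodule_def)

lemma coact_closed: "x \<in> carrier X \<Longrightarrow> comodule H X \<Longrightarrow> coact X x \<in> carrier (tensor H X)"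
  by (rule lin_closed[OF lin_coact])

lemma lin_coact': "lin M X F \<Longrightarrow> comodule H X \<Longrightarrow> lin M (tensor H X) (\<lambda>x. coact X (F x))"
  by (rule lin_comp[OF lin_coact])

lemmas [linr] = lin_coact' coact_closed comodule_vspace

text \<open>Coassociativity is an identity in the triple tensor product. The trilinear
  \<open>f\<close> induces a linear map \<open>L\<close> from there to \<open>N\<close>, and
  applying \<open>L\<close> to both sides gives the law for arbitrary Sweedler summands.\<close>

lemma coact_coassoc:
  assumes X: "comodule H X" and N: "vspace N" and x: "x \<in> carrier X"
    and f1: "\<And>k y. k \<in> carrier H \<Longrightarrow> y \<in> carrier X \<Longrightarrow> lin H N (\<lambda>h. f h k y)"
    and f2: "\<And>h y. h \<in> carrier H \<Longrightarrow> y \<in> carrier X \<Longrightarrow> lin H N (\<lambda>k. f h k y)"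
    and f3: "\<And>h k. h \<in> carrier H \<Longrightarrow> k \<in> carrier H \<Longrightarrow> lin X N (\<lambda>y. f h k y)"
  shows "tsum N (coact X x) (\<lambda>h x\<^sub>0. tsum N (coact X x\<^sub>0) (\<lambda>k x\<^sub>1. f h k x\<^sub>1))
       = tsum N (coact X x) (\<lambda>h x\<^sub>0. tsum N (comult H h) (\<lambda>h\<^sub>1 h\<^sub>2. f h\<^sub>1 h\<^sub>2 x\<^sub>0))"
proof -
  note vX = comodule_vspace[OF X]
  have g: "bilin H X N (f h)" if "h \<in> carrier H" for h
    by (rule bilinI) (use f2 f3 that in auto)
  define L where "L t = tsum N t (\<lambda>h s. tsum N s (f h))" for t
  have bL: "bilin H (tensor H X) N (\<lambda>h s. tsum N s (f h))"
    by (rule bilinI) (rule linr vX N g lin_tsum f1 | assumption)+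
  have L: "lin (tensor H (tensor H X)) N L"
    unfolding L_def by (rule lin_tsum[OF _ _ N bL]) (rule linr vX)+
  have Lp: "L (pure H (tensor H X) h (pure H X k y)) = f h k y"
    if "h \<in> carrier H" "k \<in> carrier H" "y \<in> carrier X" for h k y
    unfolding L_def using that
    by (subst tsum_pure[OF _ _ N bL]) (simp_all add: vspace_tensor vX pure_closed tsum_pure[OF vsH vX N g])
  let ?T = "tensor H (tensor H X)"
  have vT: "vspace ?T" by (rule linr vX)+
  have eq: "tsum ?T (coact X x) (\<lambda>h x\<^sub>0. tsum ?T (coact X x\<^sub>0) (\<lambda>k x\<^sub>1. pure H (tensor H X) h (pure H X k x\<^sub>1)))
        = tsum ?T (coact X x) (\<lambda>h x\<^sub>0. tsum ?T (comult H h) (\<lambda>h\<^sub>1 h\<^sub>2. pure H (tensor H X) h\<^sub>1 (pure H X h\<^sub>2 x\<^sub>0)))"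
    using X x unfolding comodule_def by blast
  have cX: "coact X y \<in> carrier (tensor H X)" if "y \<in> carrier X" for y using that X by (rule coact_closed)
  have "L (tsum ?T (coact X x) (\<lambda>h x\<^sub>0. tsum ?T (coact X x\<^sub>0) (\<lambda>k x\<^sub>1. pure H (tensor H X) h (pure H X k x\<^sub>1))))
      = tsum N (coact X x) (\<lambda>h x\<^sub>0. L (tsum ?T (coact X x\<^sub>0) (\<lambda>k x\<^sub>1. pure H (tensor H X) h (pure H X k x\<^sub>1))))"
    by (rule tsum_image[OF vsH vX vT N L cX[OF x]]) (rule linr X | assumption)+
  also have "\<dots> = tsum N (coact X x) (\<lambda>h x\<^sub>0. tsum N (coact X x\<^sub>0) (\<lambda>k x\<^sub>1. L (pure H (tensor H X) h (pure H X k x\<^sub>1))))"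
    by (rule tsum_cong[OF vsH vX cX[OF x]], rule tsum_image[OF vsH vX vT N L cX]) (rule linr X | assumption)+
  also have "\<dots> = tsum N (coact X x) (\<lambda>h x\<^sub>0. tsum N (coact X x\<^sub>0) (\<lambda>k x\<^sub>1. f h k x\<^sub>1))"
    by (intro tsum_cong[OF vsH vX] cX x Lp)
  finally have 1: "L (tsum ?T (coact X x) (\<lambda>h x\<^sub>0. tsum ?T (coact X x\<^sub>0) (\<lambda>k x\<^sub>1. pure H (tensor H X) h (pure H X k x\<^sub>1))))
      = tsum N (coact X x) (\<lambda>h x\<^sub>0. tsum N (coact X x\<^sub>0) (\<lambda>k x\<^sub>1. f h k x\<^sub>1))" .
  have "L (tsum ?T (coact X x) (\<lambda>h x\<^sub>0. tsum ?T (comult H h) (\<lambda>h\<^sub>1 h\<^sub>2. pure H (tensor H X) h\<^sub>1 (pure H X h\<^sub>2 x\<^sub>0))))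
      = tsum N (coact X x) (\<lambda>h x\<^sub>0. L (tsum ?T (comult H h) (\<lambda>h\<^sub>1 h\<^sub>2. pure H (tensor H X) h\<^sub>1 (pure H X h\<^sub>2 x\<^sub>0))))"
    by (rule tsum_image[OF vsH vX vT N L cX[OF x]]) (rule linr X | assumption)+
  also have "\<dots> = tsum N (coact X x) (\<lambda>h x\<^sub>0. tsum N (comult H h) (\<lambda>h\<^sub>1 h\<^sub>2. L (pure H (tensor H X) h\<^sub>1 (pure H X h\<^sub>2 x\<^sub>0))))"
    by (rule tsum_cong[OF vsH vX cX[OF x]], rule tsum_image[OF vsH vsH vT N L comult_closed]) (rule linr X | assumption)+
  also have "\<dots> = tsum N (coact X x) (\<lambda>h x\<^sub>0. tsum N (comult H h) (\<lambda>h\<^sub>1 h\<^sub>2. f h\<^sub>1 h\<^sub>2 x\<^sub>0))"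
    by (rule tsum_cong[OF vsH vX cX[OF x]], rule tsum_cong[OF vsH vsH comult_closed]) (assumption | rule Lp)+
  finally show ?thesis using 1 eq by simp
qed

lemma coact_counit:
  assumes X: "comodule H X" and N: "vspace N" and x: "x \<in> carrier X" and g: "lin X N g"
  shows "tsum N (coact X x) (\<lambda>h x\<^sub>0. counit H h \<odot>\<^bsub>N\<^esub> g x\<^sub>0) = g x"
proof -
  note vX = comodule_vspace[OF X]
  have cX: "coact X x \<in> carrier (tensor H X)" using x X by (rule coact_closed)
  have "g (tsum X (coact X x) (\<lambda>h x\<^sub>0. counit H h \<odot>\<^bsub>X\<^esub> x\<^sub>0)) = tsum N (coact X x) (\<lambda>h x\<^sub>0. g (counit H h \<odot>\<^bsub>X\<^esub> x\<^sub>0))"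
    by (rule tsum_image[OF vsH vX vX N g cX]) (rule linr vX | assumption)+
  also have "\<dots> = tsum N (coact X x) (\<lambda>h x\<^sub>0. counit H h \<odot>\<^bsub>N\<^esub> g x\<^sub>0)"
    by (rule tsum_cong[OF vsH vX cX]) (simp add: lin_smult[OF g])
  finally show ?thesis using X x unfolding comodule_def by simp
qed

section \<open>The coalgebra as a comodule over itself\<close>

definition self_comod :: "('k, 'h, 'h) comod" where
  "self_comod = mk_comod H (comult H)"

lemma self_comod_simps [simp]:
  "carrier self_comod = carrier H" "zero self_comod = zero H" "add self_comod = add H"
  "smult self_comod = smult H" "coact self_comod = comult H"
  by (simp_all add: self_comod_def mk_comod_def)

lemma tensor_self_comod [simp]:
  "tensor H self_comod = tensor H H" "pure H self_comod = pure H H"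
  by (rule tensor_transfer; simp)+

lemma lin_self_comod [simp]: "lin self_comod N f = lin H N f" "lin M self_comod g = lin M H g"
  by (simp_all add: lin_def)

lemma tsum_self_comod [simp]: "tsum self_comod t f = tsum H t f"
  by (simp add: tsum_def)

lemma vs_self_comod: "vspace self_comod"
proof (rule vspaceI)
  interpret H: module base H by (rule vsH)
  show "abelian_group self_comod"
    by (rule abelian_groupI) (auto simp: H.M.add.m_ac intro: H.M.l_neg)
qed (simp_all add: vs_add_smult vs_smult_add vs_smult_smult)

lemma comodule_self [linr]: "comodule H self_comod"
  using coalgebra lin_comult vs_self_comod unfolding comodule_def coalgebra_def by simp

lemma comult_coassoc:
  assumes N: "vspace N" and x: "x \<in> carrier H"
    and f1: "\<And>k y. k \<in> carrier H \<Longrightarrow> y \<in> carrier H \<Longrightarrow> lin H N (\<lambda>h. f h k y)"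
    and f2: "\<And>h y. h \<in> carrier H \<Longrightarrow> y \<in> carrier H \<Longrightarrow> lin H N (\<lambda>k. f h k y)"
    and f3: "\<And>h k. h \<in> carrier H \<Longrightarrow> k \<in> carrier H \<Longrightarrow> lin H N (\<lambda>y. f h k y)"
  shows "tsum N (comult H x) (\<lambda>h x\<^sub>0. tsum N (comult H x\<^sub>0) (\<lambda>k x\<^sub>1. f h k x\<^sub>1))
       = tsum N (comult H x) (\<lambda>h x\<^sub>0. tsum N (comult H h) (\<lambda>h\<^sub>1 h\<^sub>2. f h\<^sub>1 h\<^sub>2 x\<^sub>0))"
  using coact_coassoc[OF comodule_self N, of x f] assms by simp

lemma comult_counit_left:
  assumes "vspace N" "x \<in> carrier H" "lin H N g"
  shows "tsum N (comult H x) (\<lambda>h k. counit H h \<odot>\<^bsub>N\<^esub> g k) = g x"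
  using coact_counit[OF comodule_self, of N x g] assms by simp

text \<open>The comodule axioms contain the counit law on the \<open>H\<close> leg only, so this one
  cannot be read off from \<open>self_comod\<close> and comes from the coalgebra axioms.\<close>

lemma comult_counit_right:
  assumes N: "vspace N" and x: "x \<in> carrier H" and g: "lin H N g"
  shows "tsum N (comult H x) (\<lambda>h k. counit H k \<odot>\<^bsub>N\<^esub> g h) = g x"
proof -
  have "g (tsum H (comult H x) (\<lambda>h k. counit H k \<odot>\<^bsub>H\<^esub> h)) = tsum N (comult H x) (\<lambda>h k. g (counit H k \<odot>\<^bsub>H\<^esub> h))"
    by (rule tsum_image[OF vsH vsH vsH N g comult_closed[OF x]]) (rule linr | assumption)+
  also have "\<dots> = tsum N (comult H x) (\<lambda>h k. counit H k \<odot>\<^bsub>N\<^esub> g h)"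
    by (rule tsum_cong[OF vsH vsH comult_closed[OF x]]) (simp add: lin_smult[OF g])
  finally show ?thesis using coalgebra x unfolding coalgebra_def by simp
qed

lemma tsum_coact_cong:
  "comodule H X \<Longrightarrow> x \<in> carrier X \<Longrightarrow> (\<And>h y. h \<in> carrier H \<Longrightarrow> y \<in> carrier X \<Longrightarrow> f h y = g h y)
    \<Longrightarrow> tsum N (coact X x) f = tsum N (coact X x) g"
  by (rule tsum_cong[OF vsH comodule_vspace coact_closed])

lemma tsum_comult_cong:
  "x \<in> carrier H \<Longrightarrow> (\<And>h k. h \<in> carrier H \<Longrightarrow> k \<in> carrier H \<Longrightarrow> f h k = g h k)
    \<Longrightarrow> tsum N (comult H x) f = tsum N (comult H x) g"
  by (rule tsum_cong[OF vsH vsH comult_closed])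

section \<open>The action of linear forms on comodules\<close>

text \<open>\<open>half_braid\<close> is used with arbitrary linear forms: it is the action of the
  convolution algebra of forms on a comodule. The half-braidings are the instances
  \<open>\<gamma> s\<close>; the projections to homogeneous components will be the instances given
  by the coordinates of \<pi>.\<close>

lemma half_braid_lin:
  assumes X: "comodule H X" and \<chi>: "lin H base \<chi>"
  shows "lin X X (half_braid \<chi> X)"
  unfolding half_braid_def[abs_def]
  by (rule linr X \<chi> | assumption)+

lemma half_braid_closed:
  "comodule H X \<Longrightarrow> lin H base \<chi> \<Longrightarrow> x \<in> carrier X \<Longrightarrow> half_braid \<chi> X x \<in> carrier X"
  by (rule lin_closed[OF half_braid_lin])

lemma tsum_half_braid:
  assumes X: "comodule H X" and N: "vspace N" and x: "x \<in> carrier X" and \<chi>: "lin H base \<chi>" and f: "lin X N f"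
  shows "tsum N (coact X x) (\<lambda>h x\<^sub>0. \<chi> h \<odot>\<^bsub>N\<^esub> f x\<^sub>0) = f (half_braid \<chi> X x)"
proof -
  note vX = comodule_vspace[OF X]
  have "f (half_braid \<chi> X x) = tsum N (coact X x) (\<lambda>h x\<^sub>0. f (\<chi> h \<odot>\<^bsub>X\<^esub> x\<^sub>0))"
    unfolding half_braid_def
    by (rule tsum_image[OF vsH vX vX N f coact_closed[OF x X]]) (rule linr vX | assumption)+
  also have "\<dots> = tsum N (coact X x) (\<lambda>h x\<^sub>0. \<chi> h \<odot>\<^bsub>N\<^esub> f x\<^sub>0)"
    by (rule tsum_coact_cong[OF X x]) (simp add: lin_smult[OF f])
  finally show ?thesis by simp
qed

text \<open>Coassociativity moves the form \<open>\<chi>\<close> onto the first leg of the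
  comultiplication, while the coaction that remains to be summed uses the second leg.\<close>

lemma tsum_coact_half_braid:
  assumes X: "comodule H X" and N: "vspace N" and x: "x \<in> carrier X" and \<chi>: "lin H base \<chi>"
    and f: "bilin H X N f"
  shows "tsum N (coact X (half_braid \<chi> X x)) f
       = tsum N (coact X x) (\<lambda>h x\<^sub>0. tsum N (comult H h) (\<lambda>h\<^sub>1 h\<^sub>2. \<chi> h\<^sub>1 \<odot>\<^bsub>N\<^esub> f h\<^sub>2 x\<^sub>0))"
proof -
  note vX = comodule_vspace[OF X]
  have "tsum N (coact X (half_braid \<chi> X x)) f = tsum N (coact X x) (\<lambda>h x\<^sub>0. \<chi> h \<odot>\<^bsub>N\<^esub> tsum N (coact X x\<^sub>0) f)"
    by (rule tsum_half_braid[OF X N x \<chi>, symmetric])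
      (rule linr X N vX bilin_left[OF f] bilin_right[OF f] | assumption)+
  also have "\<dots> = tsum N (coact X x) (\<lambda>h x\<^sub>0. tsum N (coact X x\<^sub>0) (\<lambda>k x\<^sub>1. \<chi> h \<odot>\<^bsub>N\<^esub> f k x\<^sub>1))"
    by (rule tsum_coact_cong[OF X x], rule tsum_scale[OF vsH vX N coact_closed[OF _ X], symmetric])
      (auto intro: bilin_closed[OF f])
  also have "\<dots> = tsum N (coact X x) (\<lambda>h x\<^sub>0. tsum N (comult H h) (\<lambda>h\<^sub>1 h\<^sub>2. \<chi> h\<^sub>1 \<odot>\<^bsub>N\<^esub> f h\<^sub>2 x\<^sub>0))"
    by (rule coact_coassoc[OF X N x])
      (rule linr X N vX \<chi> bilin_left[OF f] bilin_right[OF f] bilin_closed[OF f] | assumption)+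
  finally show ?thesis .
qed

text \<open>Forms act from the right: by coassociativity, acting by \<open>\<chi>\<close> and then
  by \<open>\<psi>\<close> is acting by their convolution product in this order.\<close>

lemma half_braid_half_braid:
  assumes X: "comodule H X" and x: "x \<in> carrier X" and \<chi>: "lin H base \<chi>" and \<psi>: "lin H base \<psi>"
    and \<theta>: "\<And>h. h \<in> carrier H \<Longrightarrow> \<theta> h = tsum base (comult H h) (\<lambda>h\<^sub>1 h\<^sub>2. \<chi> h\<^sub>1 * \<psi> h\<^sub>2)"
  shows "half_braid \<psi> X (half_braid \<chi> X x) = half_braid \<theta> X x"
proof -
  note vX = comodule_vspace[OF X]
  have "half_braid \<psi> X (half_braid \<chi> X x) = tsum X (coact X (half_braid \<chi> X x)) (\<lambda>h x\<^sub>0. \<psi> h \<odot>\<^bsub>X\<^esub> x\<^sub>0)"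
    by (simp add: half_braid_def)
  also have "\<dots> = tsum X (coact X x) (\<lambda>h x\<^sub>0. tsum X (comult H h) (\<lambda>h\<^sub>1 h\<^sub>2. \<chi> h\<^sub>1 \<odot>\<^bsub>X\<^esub> (\<psi> h\<^sub>2 \<odot>\<^bsub>X\<^esub> x\<^sub>0)))"
    by (rule tsum_coact_half_braid[OF X vX x \<chi> bilinI]) (rule linr X vX \<psi> | assumption)+
  also have "\<dots> = tsum X (coact X x) (\<lambda>h x\<^sub>0. \<theta> h \<odot>\<^bsub>X\<^esub> x\<^sub>0)"
  proof (rule tsum_coact_cong[OF X x])
    fix h y assume h: "h \<in> carrier H" and y: "y \<in> carrier X"
    have "\<theta> h \<odot>\<^bsub>X\<^esub> y = tsum X (comult H h) (\<lambda>h\<^sub>1 h\<^sub>2. (\<chi> h\<^sub>1 * \<psi> h\<^sub>2) \<odot>\<^bsub>X\<^esub> y)"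
      unfolding \<theta>[OF h]
      by (rule tsum_image[OF vsH vsH vspace_base vX _ comult_closed[OF h], of "\<lambda>c. c \<odot>\<^bsub>X\<^esub> y"])
        (rule linr vX y | simp)+
    also have "\<dots> = tsum X (comult H h) (\<lambda>h\<^sub>1 h\<^sub>2. \<chi> h\<^sub>1 \<odot>\<^bsub>X\<^esub> (\<psi> h\<^sub>2 \<odot>\<^bsub>X\<^esub> y))"
      by (simp add: vs_smult_smult[OF vX y])
    finally show "tsum X (comult H h) (\<lambda>h\<^sub>1 h\<^sub>2. \<chi> h\<^sub>1 \<odot>\<^bsub>X\<^esub> (\<psi> h\<^sub>2 \<odot>\<^bsub>X\<^esub> y)) = \<theta> h \<odot>\<^bsub>X\<^esub> y" by simp
  qed
  finally show ?thesis by (simp add: half_braid_def)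
qed

section \<open>The linear category of comodules\<close>

lemma mor_comod:
  "f \<in> carrier (comod_hom H X Y) \<longleftrightarrow> f \<in> extensional (carrier X) \<and> lin X Y f
    \<and> (\<forall>x\<in>carrier X. coact Y (f x) = tmap H Y (\<lambda>h. h) f (coact X x))"
  by (simp add: comod_hom_def mk_vspace_def)

lemma mor_lin: "f \<in> carrier (comod_hom H X Y) \<Longrightarrow> lin X Y f"
  by (simp add: mor_comod)

lemma tsum_coact_mor:
  assumes X: "comodule H X" and Y: "comodule H Y" and N: "vspace N" and f: "f \<in> carrier (comod_hom H X Y)"
    and g: "bilin H Y N g" and x: "x \<in> carrier X"
  shows "tsum N (coact Y (f x)) g = tsum N (coact X x) (\<lambda>h x\<^sub>0. g h (f x\<^sub>0))"
proof -
  have "coact Y (f x) = tmap H Y (\<lambda>h. h) f (coact X x)" using f x by (simp add: mor_comod)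
  then show ?thesis
    using tsum_tmap[OF lin_id mor_lin[OF f] vsH comodule_vspace[OF X] vsH comodule_vspace[OF Y] N g coact_closed[OF x X]]
    by simp
qed

lemma morI:
  "f \<in> extensional (carrier X) \<Longrightarrow> lin X Y f
    \<Longrightarrow> (\<And>x. x \<in> carrier X \<Longrightarrow> coact Y (f x) = tsum (tensor H Y) (coact X x) (\<lambda>h x\<^sub>0. pure H Y h (f x\<^sub>0)))
    \<Longrightarrow> f \<in> carrier (comod_hom H X Y)"
  by (simp add: mor_comod tmap_def)

text \<open>Colinear maps commute with the action of every form. For \<open>\<gamma> s\<close> this
  is the naturality of the half-braiding; for the coordinates of \<pi> it says that morphisms
  preserve degrees.\<close>

lemma half_braid_mor:
  assumes X: "comodule H X" and Y: "comodule H Y" and f: "f \<in> carrier (comod_hom H X Y)"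
    and \<chi>: "lin H base \<chi>" and x: "x \<in> carrier X"
  shows "half_braid \<chi> Y (f x) = f (half_braid \<chi> X x)"
proof -
  have "half_braid \<chi> Y (f x) = tsum Y (coact X x) (\<lambda>h x\<^sub>0. \<chi> h \<odot>\<^bsub>Y\<^esub> f x\<^sub>0)"
    unfolding half_braid_def
    by (rule tsum_coact_mor[OF X Y comodule_vspace[OF Y] f bilinI x])
      (rule linr Y \<chi> | assumption)+
  also have "\<dots> = f (half_braid \<chi> X x)"
    by (rule tsum_half_braid[OF X comodule_vspace[OF Y] x \<chi> mor_lin[OF f]])
  finally show ?thesis .
qed

lemma coact_tsum_pure: "comodule H X \<Longrightarrow> x \<in> carrier X \<Longrightarrow> tsum (tensor H X) (coact X x) (pure H X) = coact X x"
  by (rule tsum_pure_id[OF vsH comodule_vspace coact_closed])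

lemma idn_mor: "comodule H X \<Longrightarrow> (\<lambda>x\<in>carrier X. x) \<in> carrier (comod_hom H X X)"
proof (rule morI)
  assume X: "comodule H X"
  show "lin X X (\<lambda>x\<in>carrier X. x)" by (subst lin_cong[OF comodule_vspace[OF X], where g="\<lambda>x. x"]) (simp_all add: lin_id)
  fix x assume x: "x \<in> carrier X"
  have "tsum (tensor H X) (coact X x) (\<lambda>h x\<^sub>0. pure H X h ((\<lambda>x\<in>carrier X. x) x\<^sub>0)) = tsum (tensor H X) (coact X x) (pure H X)"
    by (rule tsum_coact_cong[OF X x]) simp
  then show "coact X ((\<lambda>x\<in>carrier X. x) x) = tsum (tensor H X) (coact X x) (\<lambda>h x\<^sub>0. pure H X h ((\<lambda>x\<in>carrier X. x) x\<^sub>0))"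
    using x by (simp add: coact_tsum_pure[OF X x])
qed simp

lemma compose_lin: "vspace X \<Longrightarrow> lin X Y f \<Longrightarrow> lin Y Z g \<Longrightarrow> lin X Z (compose (carrier X) g f)"
  using lin_cong[of X "compose (carrier X) g f" "\<lambda>x. g (f x)" Z] lin_comp[of Y Z g X f] by (simp add: compose_def)

lemma compose_mor:
  assumes X: "comodule H X" and Y: "comodule H Y" and Z: "comodule H Z"
    and f: "f \<in> carrier (comod_hom H X Y)" and g: "g \<in> carrier (comod_hom H Y Z)"
  shows "compose (carrier X) g f \<in> carrier (comod_hom H X Z)"
proof (rule morI)
  show "lin X Z (compose (carrier X) g f)" by (rule compose_lin[OF comodule_vspace[OF X] mor_lin[OF f] mor_lin[OF g]])
  fix x assume x: "x \<in> carrier X"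
  have fx: "f x \<in> carrier Y" using x by (rule lin_closed[OF mor_lin[OF f]])
  have vZ: "vspace (tensor H Z)" by (rule linr Z)+
  have "coact Z (g (f x)) = tsum (tensor H Z) (coact Z (g (f x))) (pure H Z)"
    using coact_tsum_pure[OF Z lin_closed[OF mor_lin[OF g] fx]] by simp
  also have "\<dots> = tsum (tensor H Z) (coact Y (f x)) (\<lambda>h y. pure H Z h (g y))"
    by (rule tsum_coact_mor[OF Y Z vZ g bilin_pure fx]) (rule linr Z)+
  also have "\<dots> = tsum (tensor H Z) (coact X x) (\<lambda>h y. pure H Z h (g (f y)))"
    by (rule tsum_coact_mor[OF X Y vZ f bilinI x]) (rule linr Z mor_lin[OF g] lin_closed[OF mor_lin[OF g]] | assumption)+
  also have "\<dots> = tsum (tensor H Z) (coact X x) (\<lambda>h y. pure H Z h (compose (carrier X) g f y))"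
    by (rule tsum_coact_cong[OF X x]) (simp add: compose_def)
  finally show "coact Z (compose (carrier X) g f x) = tsum (tensor H Z) (coact X x) (\<lambda>h y. pure H Z h (compose (carrier X) g f y))"
    using x by (simp add: compose_def)
qed (simp add: compose_def)

lemma mor_plus:
  assumes X: "comodule H X" and Y: "comodule H Y"
    and f: "f \<in> carrier (comod_hom H X Y)" and g: "g \<in> carrier (comod_hom H X Y)"
  shows "(\<lambda>x\<in>carrier X. f x \<oplus>\<^bsub>Y\<^esub> g x) \<in> carrier (comod_hom H X Y)"
proof (rule morI)
  note vX = comodule_vspace[OF X] and vY = comodule_vspace[OF Y] and lf = mor_lin[OF f] and lg = mor_lin[OF g]
  show "lin X Y (\<lambda>x\<in>carrier X. f x \<oplus>\<^bsub>Y\<^esub> g x)"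
    using lin_plus[OF vY lf lg] lin_cong[OF vX, of "\<lambda>x\<in>carrier X. f x \<oplus>\<^bsub>Y\<^esub> g x" "\<lambda>x. f x \<oplus>\<^bsub>Y\<^esub> g x" Y] by simp
  fix x assume x: "x \<in> carrier X"
  have vT: "vspace (tensor H Y)" by (rule linr Y)+
  have "tsum (tensor H Y) (coact X x) (\<lambda>h x\<^sub>0. pure H Y h ((\<lambda>x\<in>carrier X. f x \<oplus>\<^bsub>Y\<^esub> g x) x\<^sub>0))
      = tsum (tensor H Y) (coact X x) (\<lambda>h x\<^sub>0. pure H Y h (f x\<^sub>0) \<oplus>\<^bsub>tensor H Y\<^esub> pure H Y h (g x\<^sub>0))"
    by (rule tsum_coact_cong[OF X x])
      (simp add: lin_add[OF bilin_right[OF bilin_pure[OF vsH vY]]] lin_closed[OF lf] lin_closed[OF lg])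
  also have "\<dots> = tsum (tensor H Y) (coact X x) (\<lambda>h x\<^sub>0. pure H Y h (f x\<^sub>0)) \<oplus>\<^bsub>tensor H Y\<^esub> tsum (tensor H Y) (coact X x) (\<lambda>h x\<^sub>0. pure H Y h (g x\<^sub>0))"
    by (rule tsum_plus[OF vsH vX vT coact_closed[OF x X]]) (rule linr vY lin_closed[OF lf] lin_closed[OF lg] | assumption)+
  also have "\<dots> = coact Y (f x) \<oplus>\<^bsub>tensor H Y\<^esub> coact Y (g x)"
    using f g x by (simp add: mor_comod tmap_def)
  finally show "coact Y ((\<lambda>x\<in>carrier X. f x \<oplus>\<^bsub>Y\<^esub> g x) x) = tsum (tensor H Y) (coact X x) (\<lambda>h x\<^sub>0. pure H Y h ((\<lambda>x\<in>carrier X. f x \<oplus>\<^bsub>Y\<^esub> g x) x\<^sub>0))"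
    using x by (simp add: lin_add[OF lin_coact[OF Y]] lin_closed[OF lf] lin_closed[OF lg])
qed simp

lemma mor_scale:
  assumes X: "comodule H X" and Y: "comodule H Y" and f: "f \<in> carrier (comod_hom H X Y)"
  shows "(\<lambda>x\<in>carrier X. c \<odot>\<^bsub>Y\<^esub> f x) \<in> carrier (comod_hom H X Y)"
proof (rule morI)
  note vX = comodule_vspace[OF X] and vY = comodule_vspace[OF Y] and lf = mor_lin[OF f]
  show "lin X Y (\<lambda>x\<in>carrier X. c \<odot>\<^bsub>Y\<^esub> f x)"
    using lin_scale[OF vY lf] lin_cong[OF vX, of "\<lambda>x\<in>carrier X. c \<odot>\<^bsub>Y\<^esub> f x" "\<lambda>x. c \<odot>\<^bsub>Y\<^esub> f x" Y] by simp
  fix x assume x: "x \<in> carrier X"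
  have vT: "vspace (tensor H Y)" by (rule linr Y)+
  have "tsum (tensor H Y) (coact X x) (\<lambda>h x\<^sub>0. pure H Y h ((\<lambda>x\<in>carrier X. c \<odot>\<^bsub>Y\<^esub> f x) x\<^sub>0))
      = tsum (tensor H Y) (coact X x) (\<lambda>h x\<^sub>0. c \<odot>\<^bsub>tensor H Y\<^esub> pure H Y h (f x\<^sub>0))"
    by (rule tsum_coact_cong[OF X x])
      (simp add: lin_smult[OF bilin_right[OF bilin_pure[OF vsH vY]]] lin_closed[OF lf])
  also have "\<dots> = c \<odot>\<^bsub>tensor H Y\<^esub> tsum (tensor H Y) (coact X x) (\<lambda>h x\<^sub>0. pure H Y h (f x\<^sub>0))"
    by (rule tsum_scale[OF vsH vX vT coact_closed[OF x X]]) (rule linr vY lin_closed[OF lf] | assumption)+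
  also have "\<dots> = c \<odot>\<^bsub>tensor H Y\<^esub> coact Y (f x)"
    using f x by (simp add: mor_comod tmap_def)
  finally show "coact Y ((\<lambda>x\<in>carrier X. c \<odot>\<^bsub>Y\<^esub> f x) x) = tsum (tensor H Y) (coact X x) (\<lambda>h x\<^sub>0. pure H Y h ((\<lambda>x\<in>carrier X. c \<odot>\<^bsub>Y\<^esub> f x) x\<^sub>0))"
    using x by (simp add: lin_smult[OF lin_coact[OF Y]] lin_closed[OF lf])
qed simp

lemma mor_ext:
  assumes "f \<in> carrier (comod_hom H X Y)" "g \<in> carrier (comod_hom H X Y)" "\<And>x. x \<in> carrier X \<Longrightarrow> f x = g x"
  shows "f = g"
  using assms by (intro extensionalityI[of f "carrier X" g]) (auto simp: mor_comod)

end

text \<open>What the two monoidal categories share: objects, hom-spaces, composition and identities.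
  Linearity of the category and the isomorphism criterion are derived from this alone.\<close>

definition comod_like ::
  "('k::field, 'h, 'm) coalg_scheme \<Rightarrow> ('k, ('k, 'h, 'x) comod, 'x \<Rightarrow> 'x, 'z) lincat_scheme \<Rightarrow> bool" where
  "comod_like H C \<longleftrightarrow> Ob C = {X. comodule H X} \<and> Hom C = comod_hom H
     \<and> Cmp C = (\<lambda>X Y Z g f. compose (carrier X) g f) \<and> Idn C = (\<lambda>X. \<lambda>x\<in>carrier X. x)"

context coalg_struct
begin

lemma vspace_comod_hom:
  assumes X: "comodule H X" and Y: "comodule H Y"
  shows "vspace (comod_hom H X Y)"
proof -
  note vX = comodule_vspace[OF X] and vY = comodule_vspace[OF Y]
  let ?M = "comod_hom H X Y"
  have ops: "f \<oplus>\<^bsub>?M\<^esub> g = (\<lambda>x\<in>carrier X. f x \<oplus>\<^bsub>Y\<^esub> g x)" "c \<odot>\<^bsub>?M\<^esub> f = (\<lambda>x\<in>carrier X. c \<odot>\<^bsub>Y\<^esub> f x)"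
    "\<zero>\<^bsub>?M\<^esub> = (\<lambda>x\<in>carrier X. \<zero>\<^bsub>Y\<^esub>)" for f g c
    by (simp_all add: comod_hom_def mk_vspace_def)
  have add: "f \<oplus>\<^bsub>?M\<^esub> g \<in> carrier ?M" if "f \<in> carrier ?M" "g \<in> carrier ?M" for f g
    unfolding ops using that by (rule mor_plus[OF X Y])
  have scale: "c \<odot>\<^bsub>?M\<^esub> f \<in> carrier ?M" if "f \<in> carrier ?M" for f c
    unfolding ops using that by (rule mor_scale[OF X Y])
  have cl: "f x \<in> carrier Y" if "f \<in> carrier ?M" "x \<in> carrier X" for f x
    by (rule lin_closed[OF mor_lin[OF that(1)] that(2)])
  have "(\<lambda>x\<in>carrier X. \<zero>\<^bsub>Y\<^esub>) \<in> carrier ?M"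
  proof (rule morI)
    show "lin X Y (\<lambda>x\<in>carrier X. \<zero>\<^bsub>Y\<^esub>)"
      by (subst lin_cong[OF vX, where g="\<lambda>x. \<zero>\<^bsub>Y\<^esub>"]) (simp_all add: lin_const_zero vY)
    fix x assume x: "x \<in> carrier X"
    have vT: "vspace (tensor H Y)" by (rule linr Y)+
    have "tsum (tensor H Y) (coact X x) (\<lambda>h x\<^sub>0. pure H Y h ((\<lambda>x\<in>carrier X. \<zero>\<^bsub>Y\<^esub>) x\<^sub>0))
        = tsum (tensor H Y) (coact X x) (\<lambda>h x\<^sub>0. \<zero>\<^bsub>tensor H Y\<^esub>)"
      by (rule tsum_coact_cong[OF X x]) (simp add: lin_zero[OF vY vT bilin_right[OF bilin_pure[OF vsH vY]]])
    also have "\<dots> = \<zero>\<^bsub>tensor H Y\<^esub>" by (simp add: tsum_psum psum_zero vT)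
    finally show "coact Y ((\<lambda>x\<in>carrier X. \<zero>\<^bsub>Y\<^esub>) x) = tsum (tensor H Y) (coact X x) (\<lambda>h x\<^sub>0. pure H Y h ((\<lambda>x\<in>carrier X. \<zero>\<^bsub>Y\<^esub>) x\<^sub>0))"
      using x by (simp add: lin_zero[OF vY vT lin_coact[OF Y]])
  qed simp
  then have zero: "\<zero>\<^bsub>?M\<^esub> \<in> carrier ?M" unfolding ops .
  have eqI: "f = g" if "f \<in> carrier ?M" "g \<in> carrier ?M" "\<And>x. x \<in> carrier X \<Longrightarrow> f x = g x" for f g
    using that by (rule mor_ext)
  show ?thesis
  proof (rule vspaceI)
    show "abelian_group ?M"
    proof (rule abelian_groupI)
      fix f assume f: "f \<in> carrier ?M"
      have "(-1) \<odot>\<^bsub>?M\<^esub> f \<oplus>\<^bsub>?M\<^esub> f = \<zero>\<^bsub>?M\<^esub>"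
      proof (rule eqI[OF add[OF scale[OF f] f] zero])
        fix x assume x: "x \<in> carrier X"
        have "(-1) \<odot>\<^bsub>Y\<^esub> f x \<oplus>\<^bsub>Y\<^esub> 1 \<odot>\<^bsub>Y\<^esub> f x = \<zero>\<^bsub>Y\<^esub>"
          using vs_add_smult[OF vY cl[OF f x], of "-1" 1] vs_zero_smult[OF vY cl[OF f x]] by simp
        then show "((-1) \<odot>\<^bsub>?M\<^esub> f \<oplus>\<^bsub>?M\<^esub> f) x = \<zero>\<^bsub>?M\<^esub> x" using x vs_one[OF vY cl[OF f x]] by (simp add: ops)
      qed
      then show "\<exists>g\<in>carrier ?M. g \<oplus>\<^bsub>?M\<^esub> f = \<zero>\<^bsub>?M\<^esub>" using scale[OF f] by blast
    next
      fix f g h assume "f \<in> carrier ?M" "g \<in> carrier ?M" "h \<in> carrier ?M"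
      then show "f \<oplus>\<^bsub>?M\<^esub> g \<oplus>\<^bsub>?M\<^esub> h = f \<oplus>\<^bsub>?M\<^esub> (g \<oplus>\<^bsub>?M\<^esub> h)"
        by (intro eqI add) (simp_all add: ops vs_assoc[OF vY] cl)
    next
      fix f g assume "f \<in> carrier ?M" "g \<in> carrier ?M"
      then show "f \<oplus>\<^bsub>?M\<^esub> g = g \<oplus>\<^bsub>?M\<^esub> f" by (intro eqI add) (simp_all add: ops vs_comm[OF vY] cl)
    next
      fix f assume f: "f \<in> carrier ?M"
      then show "\<zero>\<^bsub>?M\<^esub> \<oplus>\<^bsub>?M\<^esub> f = f" by (intro eqI add zero) (simp_all add: ops vs_l_zero[OF vY] cl)
    qed (auto intro: add zero)
  next
    fix a b f assume "f \<in> carrier ?M"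
    then show "(a + b) \<odot>\<^bsub>?M\<^esub> f = a \<odot>\<^bsub>?M\<^esub> f \<oplus>\<^bsub>?M\<^esub> b \<odot>\<^bsub>?M\<^esub> f"
      by (intro eqI add scale) (simp_all add: ops vs_add_smult[OF vY] cl)
  next
    fix a f g assume "f \<in> carrier ?M" "g \<in> carrier ?M"
    then show "a \<odot>\<^bsub>?M\<^esub> (f \<oplus>\<^bsub>?M\<^esub> g) = a \<odot>\<^bsub>?M\<^esub> f \<oplus>\<^bsub>?M\<^esub> a \<odot>\<^bsub>?M\<^esub> g"
      by (intro eqI add scale) (simp_all add: ops vs_smult_add[OF vY] cl)
  next
    fix a b f assume "f \<in> carrier ?M"
    then show "(a * b) \<odot>\<^bsub>?M\<^esub> f = a \<odot>\<^bsub>?M\<^esub> (b \<odot>\<^bsub>?M\<^esub> f)"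
      by (intro eqI scale) (simp_all add: ops vs_smult_smult[OF vY] cl)
  next
    fix f assume "f \<in> carrier ?M"
    then show "1 \<odot>\<^bsub>?M\<^esub> f = f" by (intro eqI scale) (simp_all add: ops vs_one[OF vY] cl)
  qed (rule scale)
qed

lemma linear_category_comod:
  fixes C :: "('k, ('k, 'h, 'x) comod, 'x \<Rightarrow> 'x, 'z) lincat_scheme"
  assumes C: "comod_like H C"
  shows "linear_category C"
proof -
  have [simp]: "Ob C = {X. comodule H X}" "Hom C = comod_hom H"
    "Cmp C = (\<lambda>X Y Z g f. compose (carrier X) g f)" "Idn C = (\<lambda>X. \<lambda>x\<in>carrier X. x)"
    using C by (auto simp: comod_like_def)
  have ops: "f \<oplus>\<^bsub>comod_hom H X Y\<^esub> g = (\<lambda>x\<in>carrier X. f x \<oplus>\<^bsub>Y\<^esub> g x)" "c \<odot>\<^bsub>comod_hom H X Y\<^esub> f = (\<lambda>x\<in>carrier X. c \<odot>\<^bsub>Y\<^esub> f x)"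
    for X Y :: "('k, 'h, 'x) comod" and f g c
    by (simp_all add: comod_hom_def mk_vspace_def)
  have l1: "lin (comod_hom H X Y) (comod_hom H X Z) (compose (carrier X) g)"
    if X: "comodule H X" and Y: "comodule H Y" and Z: "comodule H Z" and g: "g \<in> carrier (comod_hom H Y Z)"
    for X Y Z :: "('k, 'h, 'x) comod" and g
    by (rule linI)
      (auto simp: compose_mor[OF X Y Z _ g, unfolded compose_def] ops compose_def lin_add[OF mor_lin[OF g]] lin_smult[OF mor_lin[OF g]]
        lin_closed[OF mor_lin])
  have l2: "lin (comod_hom H Y Z) (comod_hom H X Z) (\<lambda>g. compose (carrier X) g f)"
    if X: "comodule H X" and Y: "comodule H Y" and Z: "comodule H Z" and f: "f \<in> carrier (comod_hom H X Y)"
    for X Y Z :: "('k, 'h, 'x) comod" and f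
    by (rule linI)
      (auto simp: compose_mor[OF X Y Z f, unfolded compose_def] ops compose_def lin_closed[OF mor_lin[OF f]])
  have l3: "compose (carrier X) (\<lambda>x\<in>carrier Y. x) f = f \<and> compose (carrier X) f (\<lambda>x\<in>carrier X. x) = f"
    if f: "f \<in> carrier (comod_hom H X Y)" for X Y :: "('k, 'h, 'x) comod" and f
    using f lin_closed[OF mor_lin[OF f]] by (auto simp: mor_comod compose_def fun_eq_iff extensional_def)
  have l4: "compose (carrier W) h (compose (carrier W) g f) = compose (carrier W) (compose (carrier X) h g) f"
    if f: "f \<in> carrier (comod_hom H W X)" for W X :: "('k, 'h, 'x) comod" and f g h
    using lin_closed[OF mor_lin[OF f]] by (auto simp: compose_def fun_eq_iff)
  show ?thesis
    unfolding linear_category_def mor_def by (simp add: vspace_comod_hom idn_mor l1 l2 l3) (intro allI impI ballI l4)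
qed

text \<open>The inverse of a bijective colinear map is automatically colinear, so a linear inverse
  is enough. It is replaced by its restriction \<open>g'\<close> because morphisms are
  extensional.\<close>

lemma comod_iso:
  assumes C: "comod_like H C" and X: "comodule H X" and Y: "comodule H Y"
    and f: "f \<in> carrier (comod_hom H X Y)" and g: "lin Y X g"
    and gf: "\<And>x. x \<in> carrier X \<Longrightarrow> g (f x) = x" and fg: "\<And>y. y \<in> carrier Y \<Longrightarrow> f (g y) = y"
  shows "iso_in C X Y f"
proof -
  have [simp]: "Ob C = {X. comodule H X}" "Hom C = comod_hom H"
    "Cmp C = (\<lambda>X Y Z g f. compose (carrier X) g f)" "Idn C = (\<lambda>X. \<lambda>x\<in>carrier X. x)"
    using C by (auto simp: comod_like_def)
  note vX = comodule_vspace[OF X] and vY = comodule_vspace[OF Y]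
  define g' where "g' = restrict g (carrier Y)"
  have "g' \<in> carrier (comod_hom H Y X)"
  proof (rule morI)
    show lg: "lin Y X g'" using g lin_cong[OF vY, of g g' X] by (simp add: g'_def)
    fix y assume y: "y \<in> carrier Y"
    have gy: "g y \<in> carrier X" using lin_closed[OF g y] .
    have vT: "vspace (tensor H X)" by (rule linr X)+
    \<comment> \<open>Writing \<open>y\<close> as \<open>f (g y)\<close> brings in the colinearity
      of \<open>f\<close>, after which \<open>g'\<close> cancels \<open>f\<close>.\<close>
    have "tsum (tensor H X) (coact Y y) (\<lambda>h x\<^sub>0. pure H X h (g' x\<^sub>0))
        = tsum (tensor H X) (coact Y (f (g y))) (\<lambda>h x\<^sub>0. pure H X h (g' x\<^sub>0))" by (simp add: fg y)
    also have "\<dots> = tsum (tensor H X) (coact X (g y)) (\<lambda>h x\<^sub>0. pure H X h (g' (f x\<^sub>0)))"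
      by (rule tsum_coact_mor[OF X Y vT f bilinI gy]) (rule linr vX lg lin_closed[OF lg] | assumption)+
    also have "\<dots> = tsum (tensor H X) (coact X (g y)) (pure H X)"
      by (rule tsum_coact_cong[OF X gy]) (simp add: g'_def gf lin_closed[OF mor_lin[OF f]])
    also have "\<dots> = coact X (g y)" by (rule coact_tsum_pure[OF X gy])
    finally show "coact X (g' y) = tsum (tensor H X) (coact Y y) (\<lambda>h x\<^sub>0. pure H X h (g' x\<^sub>0))"
      by (simp add: g'_def y)
  qed (simp add: g'_def)
  moreover have "compose (carrier X) g' f = (\<lambda>x\<in>carrier X. x)"
    using lin_closed[OF mor_lin[OF f]] by (auto simp: compose_def g'_def gf)
  moreover have "compose (carrier Y) f g' = (\<lambda>x\<in>carrier Y. x)"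
    by (auto simp: compose_def g'_def fg)
  ultimately show ?thesis using f by (auto simp: iso_in_def mor_def)
qed

end

section \<open>Linear forms on the group algebra\<close>

lemma finsum_base: "finite A \<Longrightarrow> (\<Oplus>\<^bsub>base\<^esub>a\<in>A. f a) = (\<Sum>a\<in>A. f a :: 'k::field)"
proof (induction A rule: finite_induct)
  interpret module base "base :: ('k, 'k) module" by (rule vspace_base)
  case empty show ?case by simp
next
  interpret module base "base :: ('k, 'k) module" by (rule vspace_base)
  case (insert x F) then show ?case by (simp add: Pi_iff)
qed

lemma group_alg_simps:
  "carrier (group_alg G :: ('k::field, 'g \<Rightarrow> 'k) hopf) = {f. finite (supp f) \<and> supp f \<subseteq> carrier G}"
  "f \<oplus>\<^bsub>group_alg G\<^esub> f' = (\<lambda>x. f x + f' x)" "c \<odot>\<^bsub>group_alg G\<^esub> f = (\<lambda>x. c * f x)"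
  "\<zero>\<^bsub>group_alg G\<^esub> = (\<lambda>x. 0)" "\<one>\<^bsub>group_alg G\<^esub> = delta \<one>\<^bsub>G\<^esub>"
  "f \<otimes>\<^bsub>group_alg G\<^esub> f' = (\<lambda>x. \<Sum>(a, b) \<in> {(a, b) \<in> supp f \<times> supp f'. a \<otimes>\<^bsub>G\<^esub> b = x}. f a * f' b)"
  "counit (group_alg G) f = (\<Sum>g\<in>supp f. f g)"
  by (simp_all add: group_alg_def group_alg_module_def Let_def)

lemma vspace_group_alg: "vspace (group_alg G :: ('k::field, 'g \<Rightarrow> 'k) hopf)"
proof (rule vspaceI)
  have s: "supp (\<lambda>x. f x + f' x) \<subseteq> supp f \<union> supp f'" for f f' :: "'g \<Rightarrow> 'k" by (auto simp: supp_def)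
  have t: "supp (\<lambda>x. c * f x) \<subseteq> supp f" for c and f :: "'g \<Rightarrow> 'k" by (auto simp: supp_def)
  have z: "supp (\<lambda>x. 0 :: 'k) = ({} :: 'g set)" by (simp add: supp_def)
  show "abelian_group (group_alg G :: ('k, 'g \<Rightarrow> 'k) hopf)"
  proof (rule abelian_groupI)
    fix f f' :: "'g \<Rightarrow> 'k" assume "f \<in> carrier (group_alg G)" "f' \<in> carrier (group_alg G)"
    then show "f \<oplus>\<^bsub>group_alg G\<^esub> f' \<in> carrier (group_alg G)"
      using s[of f f'] finite_subset[OF s[of f f']] by (auto simp: group_alg_simps)
  next
    fix f :: "'g \<Rightarrow> 'k" assume f: "f \<in> carrier (group_alg G)"
    have "(\<lambda>x. (-1) * f x) \<in> carrier (group_alg G)"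
      using f t[of "-1" f] finite_subset[OF t[of "-1" f]] by (auto simp: group_alg_simps)
    then show "\<exists>g\<in>carrier (group_alg G). g \<oplus>\<^bsub>group_alg G\<^esub> f = \<zero>\<^bsub>group_alg G\<^esub>"
      by (intro bexI[of _ "\<lambda>x. (-1) * f x"]) (simp_all add: group_alg_simps)
  qed (simp_all add: group_alg_simps z algebra_simps)
  fix c and f :: "'g \<Rightarrow> 'k" assume "f \<in> carrier (group_alg G)"
  then show "c \<odot>\<^bsub>group_alg G\<^esub> f \<in> carrier (group_alg G)"
    using t[of c f] finite_subset[OF t[of c f]] by (auto simp: group_alg_simps)
qed (simp_all add: group_alg_simps algebra_simps)

lemma lin_eval: "lin (group_alg G) base (\<lambda>f. f a)"
  by (rule linI) (simp_all add: group_alg_simps)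

lemma lin_eval': "lin M (group_alg G) F \<Longrightarrow> lin M base (\<lambda>x. F x a)"
  by (rule lin_comp[OF lin_eval])

lemma supp_delta: "supp (delta g :: 'g \<Rightarrow> 'k::field) = {g}"
  by (auto simp: supp_def delta_def)

lemma delta_closed: "g \<in> carrier G \<Longrightarrow> delta g \<in> carrier (group_alg G)"
  by (simp add: group_alg_simps supp_delta)

text \<open>The comultiplication is diagonal on the basis, so the coordinate functions are
  orthogonal idempotents for convolution. They are the source of the projections to homogeneous
  components.\<close>

lemma comult_group_alg_eval:
  assumes f: "f \<in> carrier (group_alg G :: ('k::field, 'g \<Rightarrow> 'k) hopf)"
  shows "tsum base (comult (group_alg G) f) (\<lambda>u v. u a * v b) = (if a = b then f a else 0)"
proof -
  let ?A = "group_alg G :: ('k, 'g \<Rightarrow> 'k) hopf" and ?V = "group_alg_module G :: ('k, 'g \<Rightarrow> 'k) module"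
  note vA = vspace_group_alg[of G]
  \<comment> \<open>The comultiplication of \<open>group_alg\<close> is built over the tensor square
    of the bare module; the extra Hopf fields do not change that square.\<close>
  have tr: "tensor ?V ?V = tensor ?A ?A" "pure ?V ?V = pure ?A ?A"
    by (rule tensor_transfer; simp add: group_alg_def Let_def)+
  have cm: "comult ?A f = (\<Oplus>\<^bsub>tensor ?A ?A\<^esub>g\<in>supp f. f g \<odot>\<^bsub>tensor ?A ?A\<^esub> pure ?A ?A (delta g) (delta g))"
    unfolding tr[symmetric] by (simp add: group_alg_def Let_def)
  have vT: "vspace (tensor ?A ?A)" by (rule vspace_tensor[OF vA vA])
  have bl: "bilin ?A ?A base (\<lambda>u v. u a * v b)"
    by (rule bilinI) (rule linr lin_eval)+
  have fin: "finite (supp f)" and sub: "supp f \<subseteq> carrier G" using f by (auto simp: group_alg_simps)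
  have p: "pure ?A ?A (delta g) (delta g) \<in> carrier (tensor ?A ?A)" if "g \<in> supp f" for g
    using that sub by (intro pure_closed vA delta_closed) auto
  have "tsum base (comult ?A f) (\<lambda>u v. u a * v b)
      = (\<Oplus>\<^bsub>base\<^esub>g\<in>supp f. tsum base (f g \<odot>\<^bsub>tensor ?A ?A\<^esub> pure ?A ?A (delta g) (delta g)) (\<lambda>u v. u a * v b))"
    unfolding cm
    by (rule lin_image_finsum[OF vT vspace_base lin_tsum[OF vA vA vspace_base bl] fin]) (use p vT in auto)
  also have "\<dots> = (\<Sum>g\<in>supp f. f g * (delta g a * delta g b))"
    unfolding finsum_base[OF fin]
  proof (rule sum.cong)
    fix g assume g: "g \<in> supp f"
    then have "delta g \<in> carrier ?A" using sub by (intro delta_closed) auto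
    then show "tsum base (f g \<odot>\<^bsub>tensor ?A ?A\<^esub> pure ?A ?A (delta g) (delta g)) (\<lambda>u v. u a * v b) = f g * (delta g a * delta g b)"
      using lin_smult[OF lin_tsum[OF vA vA vspace_base bl] p[OF g]]
      by (simp add: tsum_pure[OF vA vA vspace_base bl])
  qed simp
  also have "\<dots> = (\<Sum>g\<in>supp f. if g = a then (if a = b then f a else 0) else 0)"
    by (intro sum.cong) (auto simp: delta_def)
  also have "\<dots> = (if a = b then f a else 0)" by (subst sum.delta[OF fin]) (auto simp: supp_def)
  finally show ?thesis .
qed

text \<open>The linear extension of \<open>v\<close> from the basis \<open>G\<close> to the group
  algebra.\<close>

definition glift :: "('k::field, 'a, 'm) module_scheme \<Rightarrow> ('g \<Rightarrow> 'a) \<Rightarrow> ('g \<Rightarrow> 'k) \<Rightarrow> 'a" where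
  "glift N v f = (\<Oplus>\<^bsub>N\<^esub>a\<in>supp f. f a \<odot>\<^bsub>N\<^esub> v a)"

text \<open>The range of summation in \<open>glift\<close> varies with \<open>f\<close>. A fixed
  finite superset makes sums for different arguments comparable, which additivity needs.\<close>

lemma glift_superset:
  assumes N: "vspace N" and v: "\<And>a. a \<in> carrier G \<Longrightarrow> v a \<in> carrier N"
    and B: "finite B" "supp f \<subseteq> B" "B \<subseteq> carrier G"
  shows "glift N v f = (\<Oplus>\<^bsub>N\<^esub>a\<in>B. f a \<odot>\<^bsub>N\<^esub> v a)"
proof -
  interpret module base N by (rule N)
  have "v a \<in> carrier N" if "a \<in> B" for a using that v B by auto
  then show ?thesis unfolding glift_def
    by (intro M.add.finprod_mono_neutral_cong_left B) (auto simp: supp_def vs_zero_smult[OF N] vs_smult[OF N])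
qed

lemma lin_glift:
  fixes N :: "('k::field, 'a, 'm) module_scheme" and G :: "('g, 'n) monoid_scheme"
  assumes N: "vspace N" and v: "\<And>a. a \<in> carrier G \<Longrightarrow> v a \<in> carrier N"
  shows "lin (group_alg G) N (glift N v)"
proof (rule linI)
  interpret module base N by (rule N)
  note sup = glift_superset[OF N, of G v, OF v]
  { fix f :: "'g \<Rightarrow> 'k" assume f: "f \<in> carrier (group_alg G)"
    show "glift N v f \<in> carrier N"
      unfolding glift_def using f v by (intro M.add.finprod_closed) (auto simp: group_alg_simps intro!: vs_smult[OF N])
    fix c
    have fin: "finite (supp f)" "supp f \<subseteq> carrier G" using f by (auto simp: group_alg_simps)
    have vc: "v a \<in> carrier N" if "a \<in> supp f" for a using that fin v by auto
    have "glift N v (c \<odot>\<^bsub>group_alg G\<^esub> f) = (\<Oplus>\<^bsub>N\<^esub>a\<in>supp f. c \<odot>\<^bsub>N\<^esub> (f a \<odot>\<^bsub>N\<^esub> v a))"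
    proof (subst sup[OF _ fin(1) _ fin(2)])
      show "supp (c \<odot>\<^bsub>group_alg G\<^esub> f) \<subseteq> supp f" by (auto simp: group_alg_simps supp_def)
      show "(\<Oplus>\<^bsub>N\<^esub>a\<in>supp f. (c \<odot>\<^bsub>group_alg G\<^esub> f) a \<odot>\<^bsub>N\<^esub> v a) = (\<Oplus>\<^bsub>N\<^esub>a\<in>supp f. c \<odot>\<^bsub>N\<^esub> (f a \<odot>\<^bsub>N\<^esub> v a))"
        by (rule M.finsum_cong') (use vc in \<open>auto simp: group_alg_simps vs_smult_smult[OF N] intro!: vs_smult[OF N]\<close>)
    qed
    also have "\<dots> = c \<odot>\<^bsub>N\<^esub> glift N v f"
      unfolding glift_def
      by (rule lin_image_finsum[OF N N lin_scale[OF N lin_id] fin(1), symmetric]) (use vc vs_smult[OF N] in auto)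
    finally show "glift N v (c \<odot>\<^bsub>group_alg G\<^esub> f) = c \<odot>\<^bsub>N\<^esub> glift N v f" . }
  fix f g :: "'g \<Rightarrow> 'k" assume f: "f \<in> carrier (group_alg G)" and g: "g \<in> carrier (group_alg G)"
  let ?B = "supp f \<union> supp g"
  have B: "finite ?B" "?B \<subseteq> carrier G" using f g by (auto simp: group_alg_simps)
  have vc: "v a \<in> carrier N" if "a \<in> ?B" for a using that B v by auto
  have "glift N v (f \<oplus>\<^bsub>group_alg G\<^esub> g) = (\<Oplus>\<^bsub>N\<^esub>a\<in>?B. f a \<odot>\<^bsub>N\<^esub> v a \<oplus>\<^bsub>N\<^esub> g a \<odot>\<^bsub>N\<^esub> v a)"
  proof (subst sup[OF _ B(1) _ B(2)])
    show "supp (f \<oplus>\<^bsub>group_alg G\<^esub> g) \<subseteq> ?B" by (auto simp: group_alg_simps supp_def)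
    show "(\<Oplus>\<^bsub>N\<^esub>a\<in>?B. (f \<oplus>\<^bsub>group_alg G\<^esub> g) a \<odot>\<^bsub>N\<^esub> v a) = (\<Oplus>\<^bsub>N\<^esub>a\<in>?B. f a \<odot>\<^bsub>N\<^esub> v a \<oplus>\<^bsub>N\<^esub> g a \<odot>\<^bsub>N\<^esub> v a)"
      by (rule M.finsum_cong') (use vc in \<open>auto simp: group_alg_simps vs_add_smult[OF N] intro!: vs_smult[OF N] vs_add[OF N]\<close>)
  qed
  also have "\<dots> = (\<Oplus>\<^bsub>N\<^esub>a\<in>?B. f a \<odot>\<^bsub>N\<^esub> v a) \<oplus>\<^bsub>N\<^esub> (\<Oplus>\<^bsub>N\<^esub>a\<in>?B. g a \<odot>\<^bsub>N\<^esub> v a)"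
    by (rule M.finsum_addf) (use vc vs_smult[OF N] in auto)
  also have "\<dots> = glift N v f \<oplus>\<^bsub>N\<^esub> glift N v g"
    using sup[OF _ B(1) _ B(2), of f] sup[OF _ B(1) _ B(2), of g] by simp
  finally show "glift N v (f \<oplus>\<^bsub>group_alg G\<^esub> g) = glift N v f \<oplus>\<^bsub>N\<^esub> glift N v g" .
qed

lemma glift_delta:
  assumes N: "vspace N" and "v g \<in> carrier N"
  shows "glift N v (delta g) = v g"
proof -
  interpret module base N by (rule N)
  show ?thesis unfolding glift_def supp_delta using assms by (simp add: delta_def)
qed

lemma lin_glift_param:
  assumes N: "vspace N" and M: "vspace M" and f: "f \<in> carrier (group_alg G)"
    and v: "\<And>a. a \<in> carrier G \<Longrightarrow> lin M N (\<lambda>x. v x a)"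
  shows "lin M N (\<lambda>x. glift N (v x) f)"
  unfolding glift_def using f
  by (intro lin_finsum[OF N M] lin_scale[OF N v]) (auto simp: group_alg_simps)

lemma glift_const:
  assumes N: "vspace N" and v: "v \<in> carrier N" and f: "f \<in> carrier (group_alg G)"
  shows "glift N (\<lambda>a. v) f = counit (group_alg G) f \<odot>\<^bsub>N\<^esub> v"
proof -
  have fin: "finite (supp f)" using f by (simp add: group_alg_simps)
  have "(\<Oplus>\<^bsub>base\<^esub>a\<in>supp f. f a) \<odot>\<^bsub>N\<^esub> v = (\<Oplus>\<^bsub>N\<^esub>a\<in>supp f. f a \<odot>\<^bsub>N\<^esub> v)"
    by (rule lin_image_finsum[OF vspace_base N lin_scalar[OF N lin_id v] fin]) auto
  then show ?thesis by (simp add: glift_def group_alg_simps finsum_base[OF fin])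
qed

lemma vspace_transfer:
  assumes M: "vspace M"
    and eq: "carrier M = carrier M'" "add M = add M'" "smult M = smult M'" "zero M = zero M'"
  shows "vspace M'"
proof (rule vspaceI)
  interpret module base M by (rule M)
  have "\<exists>y\<in>carrier M. y \<oplus>\<^bsub>M\<^esub> x = \<zero>\<^bsub>M\<^esub>" if "x \<in> carrier M" for x
    using that M.l_neg M.a_inv_closed by blast
  then show "abelian_group M'"
    unfolding eq by (intro abelian_groupI) (auto simp: M.add.m_ac simp flip: eq)
qed (simp_all add: vs_add_smult[OF M] vs_smult_add[OF M] vs_smult_smult[OF M] vs_smult[OF M] vs_one[OF M] flip: eq)

text \<open>Associativity is left out so that both \<open>H\<close> and the merely quasi-associative
  \<open>zested\<close> are instances.\<close>

locale bialg_struct = coalg_struct H for H :: "('k::field, 'h, 'm) coalg_scheme" +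
  assumes mult_unit: "coalgebra_mult_unit H"
begin

lemma lin_mult_fst: "k \<in> carrier H \<Longrightarrow> lin H H (\<lambda>h. h \<otimes>\<^bsub>H\<^esub> k)"
  and lin_mult_snd: "h \<in> carrier H \<Longrightarrow> lin H H (\<lambda>k. h \<otimes>\<^bsub>H\<^esub> k)"
  and one_closed [linr]: "\<one>\<^bsub>H\<^esub> \<in> carrier H"
  and comult_one: "comult H \<one>\<^bsub>H\<^esub> = pure H H \<one>\<^bsub>H\<^esub> \<one>\<^bsub>H\<^esub>"
  and counit_one: "counit H \<one>\<^bsub>H\<^esub> = 1"
  and counit_mult: "h \<in> carrier H \<Longrightarrow> k \<in> carrier H \<Longrightarrow> counit H (h \<otimes>\<^bsub>H\<^esub> k) = counit H h * counit H k"
  using mult_unit by (auto simp: coalgebra_mult_unit_def)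

lemma lin_mult_fst' [linr]: "lin M H F \<Longrightarrow> k \<in> carrier H \<Longrightarrow> lin M H (\<lambda>x. F x \<otimes>\<^bsub>H\<^esub> k)"
  by (rule lin_comp[OF lin_mult_fst])

lemma lin_mult_snd' [linr]: "lin M H F \<Longrightarrow> h \<in> carrier H \<Longrightarrow> lin M H (\<lambda>x. h \<otimes>\<^bsub>H\<^esub> F x)"
  by (rule lin_comp[OF lin_mult_snd])

lemma mult_closed [linr]: "h \<in> carrier H \<Longrightarrow> k \<in> carrier H \<Longrightarrow> h \<otimes>\<^bsub>H\<^esub> k \<in> carrier H"
  by (rule lin_closed[OF lin_mult_snd])

lemma tsum_comult_mult:
  assumes h: "h \<in> carrier H" and k: "k \<in> carrier H" and N: "vspace N" and f: "bilin H H N f"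
  shows "tsum N (comult H (h \<otimes>\<^bsub>H\<^esub> k)) f
       = tsum N (comult H h) (\<lambda>h\<^sub>1 h\<^sub>2. tsum N (comult H k) (\<lambda>k\<^sub>1 k\<^sub>2. f (h\<^sub>1 \<otimes>\<^bsub>H\<^esub> k\<^sub>1) (h\<^sub>2 \<otimes>\<^bsub>H\<^esub> k\<^sub>2)))"
proof -
  let ?T = "tensor H H" and ?p = "\<lambda>h\<^sub>1 h\<^sub>2 k\<^sub>1 k\<^sub>2. pure H H (h\<^sub>1 \<otimes>\<^bsub>H\<^esub> k\<^sub>1) (h\<^sub>2 \<otimes>\<^bsub>H\<^esub> k\<^sub>2)"
  note L = lin_tsum[OF vsH vsH N f]
  have vT: "vspace ?T" by (rule linr)+
  have "comult H (h \<otimes>\<^bsub>H\<^esub> k) = tsum ?T (comult H h) (\<lambda>h\<^sub>1 h\<^sub>2. tsum ?T (comult H k) (\<lambda>k\<^sub>1 k\<^sub>2. ?p h\<^sub>1 h\<^sub>2 k\<^sub>1 k\<^sub>2))"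
    using mult_unit h k by (simp add: coalgebra_mult_unit_def)
  then have "tsum N (comult H (h \<otimes>\<^bsub>H\<^esub> k)) f
      = tsum N (tsum ?T (comult H h) (\<lambda>h\<^sub>1 h\<^sub>2. tsum ?T (comult H k) (\<lambda>k\<^sub>1 k\<^sub>2. ?p h\<^sub>1 h\<^sub>2 k\<^sub>1 k\<^sub>2))) f" by simp
  also have "\<dots> = tsum N (comult H h) (\<lambda>h\<^sub>1 h\<^sub>2. tsum N (tsum ?T (comult H k) (\<lambda>k\<^sub>1 k\<^sub>2. ?p h\<^sub>1 h\<^sub>2 k\<^sub>1 k\<^sub>2)) f)"
    by (rule tsum_image[OF vsH vsH vT N L comult_closed[OF h]]) (rule linr k | assumption)+
  also have "\<dots> = tsum N (comult H h) (\<lambda>h\<^sub>1 h\<^sub>2. tsum N (comult H k) (\<lambda>k\<^sub>1 k\<^sub>2. tsum N (?p h\<^sub>1 h\<^sub>2 k\<^sub>1 k\<^sub>2) f))"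
    by (rule tsum_comult_cong[OF h], rule tsum_image[OF vsH vsH vT N L comult_closed[OF k]]) (rule linr k | assumption)+
  also have "\<dots> = tsum N (comult H h) (\<lambda>h\<^sub>1 h\<^sub>2. tsum N (comult H k) (\<lambda>k\<^sub>1 k\<^sub>2. f (h\<^sub>1 \<otimes>\<^bsub>H\<^esub> k\<^sub>1) (h\<^sub>2 \<otimes>\<^bsub>H\<^esub> k\<^sub>2)))"
    by (rule tsum_comult_cong[OF h], rule tsum_comult_cong[OF k]) (simp add: tsum_pure[OF vsH vsH N f] mult_closed)
  finally show ?thesis .
qed

lemma tsum_comult_grouplike:
  assumes "comult H s = pure H H s s" "s \<in> carrier H" "vspace N" "bilin H H N f"
  shows "tsum N (comult H s) f = f s s"
  using tsum_pure[OF vsH vsH assms(3,4,2,2)] assms(1) by simp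

end

section \<open>The grading\<close>

locale graded = bialg_struct H for H :: "('k::field, 'h, 'm) hopf_scheme" +
  fixes G :: "'g monoid" and \<pi> :: "'h \<Rightarrow> 'g \<Rightarrow> 'k"
  assumes ringH: "ring H" and grp: "group G" and pi: "hopf_map H (group_alg G) \<pi>"
    and cocentral: "cocentral H (group_alg G) \<pi>"
begin

abbreviation A :: "('k, 'g \<Rightarrow> 'k) hopf" where "A \<equiv> group_alg G"

lemma vsA [linr]: "vspace A" by (rule vspace_group_alg)

lemma lin_pi: "lin H A \<pi>" using pi by (simp add: hopf_map_def)
lemma pi_closed: "h \<in> carrier H \<Longrightarrow> \<pi> h \<in> carrier A" by (rule lin_closed[OF lin_pi])
lemma lin_pi' [linr]: "lin M H F \<Longrightarrow> lin M A (\<lambda>x. \<pi> (F x))" by (rule lin_comp[OF lin_pi])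
lemma lin_pi_eval [linr]: "lin M H F \<Longrightarrow> lin M base (\<lambda>x. \<pi> (F x) a)" by (rule lin_eval'[OF lin_pi'])
lemmas [linr] = pi_closed

lemma lin_pg: "lin H base (\<lambda>h. \<pi> h a)" by (rule lin_pi_eval[OF lin_id])

lemma pi_mult: "h \<in> carrier H \<Longrightarrow> k \<in> carrier H \<Longrightarrow> \<pi> (h \<otimes>\<^bsub>H\<^esub> k) = \<pi> h \<otimes>\<^bsub>A\<^esub> \<pi> k"
  and pi_one: "\<pi> \<one>\<^bsub>H\<^esub> = delta \<one>\<^bsub>G\<^esub>"
  and pi_counit: "h \<in> carrier H \<Longrightarrow> counit A (\<pi> h) = counit H h"
  and pi_comult: "h \<in> carrier H \<Longrightarrow> comult A (\<pi> h) = tmap A A \<pi> \<pi> (comult H h)"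
  using pi by (auto simp: hopf_map_def ring_hom_def group_alg_simps(5)[symmetric])

text \<open>Since \<pi> is a coalgebra map, the orthogonality of the coordinates pulls back to
  \<open>H\<close>: the forms \<open>\<pi> _ a\<close> are orthogonal idempotents for convolution,
  and they will act on comodules as projections.\<close>

lemma pi_conv:
  assumes h: "h \<in> carrier H"
  shows "tsum base (comult H h) (\<lambda>h\<^sub>1 h\<^sub>2. \<pi> h\<^sub>1 a * \<pi> h\<^sub>2 b) = (if a = b then \<pi> h a else 0)"
proof -
  have bl: "bilin A A base (\<lambda>u v. u a * v b)"
    by (rule bilinI) (rule linr lin_eval)+
  have "tsum base (tmap A A \<pi> \<pi> (comult H h)) (\<lambda>u v. u a * v b) = tsum base (comult H h) (\<lambda>h\<^sub>1 h\<^sub>2. \<pi> h\<^sub>1 a * \<pi> h\<^sub>2 b)"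
    by (rule tsum_tmap[OF lin_pi lin_pi vsH vsH vsA vsA vspace_base bl comult_closed[OF h]])
  then show ?thesis using comult_group_alg_eval[OF pi_closed[OF h], of a b] pi_comult[OF h] by simp
qed

text \<open>Evaluating the group algebra factor of the cocentrality identity at \<open>a\<close>
  shows that the idempotent \<open>\<pi> _ a\<close> can be moved between the two legs, that is, it
  is central for convolution.\<close>

lemma pi_cocentral:
  assumes h: "h \<in> carrier H" and N: "vspace N" and g: "lin H N g"
  shows "tsum N (comult H h) (\<lambda>h\<^sub>1 h\<^sub>2. \<pi> h\<^sub>2 a \<odot>\<^bsub>N\<^esub> g h\<^sub>1) = tsum N (comult H h) (\<lambda>h\<^sub>1 h\<^sub>2. \<pi> h\<^sub>1 a \<odot>\<^bsub>N\<^esub> g h\<^sub>2)"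
proof -
  let ?T = "tensor H A" and ?k = "\<lambda>x u. u a \<odot>\<^bsub>N\<^esub> g x"
  have bl: "bilin H A N ?k"
    by (rule bilinI) (rule linr N g lin_eval lin_closed[OF g] | assumption)+
  have vT: "vspace ?T" by (rule linr)+
  note L = lin_tsum[OF vsH vsA N bl]
  have "tsum N (tsum ?T (comult H h) (\<lambda>h\<^sub>1 h\<^sub>2. pure H A h\<^sub>1 (\<pi> h\<^sub>2))) ?k = tsum N (comult H h) (\<lambda>h\<^sub>1 h\<^sub>2. tsum N (pure H A h\<^sub>1 (\<pi> h\<^sub>2)) ?k)"
    by (rule tsum_image[OF vsH vsH vT N L comult_closed[OF h]]) (rule linr | assumption)+
  also have "\<dots> = tsum N (comult H h) (\<lambda>h\<^sub>1 h\<^sub>2. \<pi> h\<^sub>2 a \<odot>\<^bsub>N\<^esub> g h\<^sub>1)"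
    by (rule tsum_comult_cong[OF h]) (simp add: tsum_pure[OF vsH vsA N bl] pi_closed)
  finally have 1: "tsum N (tsum ?T (comult H h) (\<lambda>h\<^sub>1 h\<^sub>2. pure H A h\<^sub>1 (\<pi> h\<^sub>2))) ?k = tsum N (comult H h) (\<lambda>h\<^sub>1 h\<^sub>2. \<pi> h\<^sub>2 a \<odot>\<^bsub>N\<^esub> g h\<^sub>1)" .
  have "tsum N (tsum ?T (comult H h) (\<lambda>h\<^sub>1 h\<^sub>2. pure H A h\<^sub>2 (\<pi> h\<^sub>1))) ?k = tsum N (comult H h) (\<lambda>h\<^sub>1 h\<^sub>2. tsum N (pure H A h\<^sub>2 (\<pi> h\<^sub>1)) ?k)"
    by (rule tsum_image[OF vsH vsH vT N L comult_closed[OF h]]) (rule linr | assumption)+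
  also have "\<dots> = tsum N (comult H h) (\<lambda>h\<^sub>1 h\<^sub>2. \<pi> h\<^sub>1 a \<odot>\<^bsub>N\<^esub> g h\<^sub>2)"
    by (rule tsum_comult_cong[OF h]) (simp add: tsum_pure[OF vsH vsA N bl] pi_closed)
  finally show ?thesis using 1 cocentral h by (simp add: cocentral_def)
qed

section \<open>Homogeneous components and projections\<close>

abbreviation gr :: "('k, 'h, 'x, 'n) comod_scheme \<Rightarrow> 'g \<Rightarrow> 'x set" where
  "gr X a \<equiv> comod_grade G \<pi> X a"

abbreviation hom_part :: "'g \<Rightarrow> ('k, 'h, 'x, 'n) comod_scheme \<Rightarrow> 'x \<Rightarrow> 'x" where
  "hom_part a X \<equiv> half_braid (\<lambda>h. \<pi> h a) X"

text \<open>Homogeneity is defined by an equation of tensors over the group algebra. Evaluating at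
  \<open>a\<close> turns it into a fixed point equation for a projection of X, which is far easier
  to verify; conversely, applying the projection first leaves only the basis vector
  \<open>delta a\<close> in the group algebra factor.\<close>

lemma gr_iff:
  assumes X: "comodule H X" and a: "a \<in> carrier G"
  shows "x \<in> gr X a \<longleftrightarrow> x \<in> carrier X \<and> hom_part a X x = x"
proof -
  note vX = comodule_vspace[OF X]
  have 1: "hom_part a X x = x" if x: "x \<in> gr X a"
  proof -
    have xX: "x \<in> carrier X" and eq: "tmap A X \<pi> (\<lambda>x. x) (coact X x) = pure A X (delta a) x"
      using x by (auto simp: comod_grade_def)
    have bl: "bilin A X X (\<lambda>u y. u a \<odot>\<^bsub>X\<^esub> y)" by (rule bilinI) (rule linr vX lin_eval | assumption)+
    have "hom_part a X x = tsum X (tmap A X \<pi> (\<lambda>x. x) (coact X x)) (\<lambda>u y. u a \<odot>\<^bsub>X\<^esub> y)"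
      unfolding half_braid_def
      by (rule tsum_tmap[OF lin_pi lin_id vsH vX vsA vX vX bl coact_closed[OF xX X], symmetric])
    then show ?thesis
      using tsum_pure[OF vsA vX vX bl delta_closed[OF a] xX] vs_one[OF vX xX] by (simp add: eq delta_def)
  qed
  have 2: "x \<in> gr X a" if xX: "x \<in> carrier X" and x: "hom_part a X x = x"
  proof -
    let ?T = "tensor A X"
    have vT: "vspace ?T" by (rule linr vX)+
    \<comment> \<open>Next to the coordinate \<open>a\<close> of the first leg, \<pi> of the second
      leg collapses to a multiple of \<open>delta a\<close>; this is checked coordinatewise by
      \<open>pi_conv\<close>.\<close>
    have inner: "tsum ?T (comult H h) (\<lambda>h\<^sub>1 h\<^sub>2. \<pi> h\<^sub>1 a \<odot>\<^bsub>?T\<^esub> pure A X (\<pi> h\<^sub>2) y) = \<pi> h a \<odot>\<^bsub>?T\<^esub> pure A X (delta a) y"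
      if h: "h \<in> carrier H" and y: "y \<in> carrier X" for h y
    proof -
      note lp = bilin_left[OF bilin_pure[OF vsA vX] y]
      have "tsum A (comult H h) (\<lambda>h\<^sub>1 h\<^sub>2. \<pi> h\<^sub>1 a \<odot>\<^bsub>A\<^esub> \<pi> h\<^sub>2) = \<pi> h a \<odot>\<^bsub>A\<^esub> delta a"
      proof
        fix b
        have "tsum A (comult H h) (\<lambda>h\<^sub>1 h\<^sub>2. \<pi> h\<^sub>1 a \<odot>\<^bsub>A\<^esub> \<pi> h\<^sub>2) b = tsum base (comult H h) (\<lambda>h\<^sub>1 h\<^sub>2. (\<pi> h\<^sub>1 a \<odot>\<^bsub>A\<^esub> \<pi> h\<^sub>2) b)"
          by (rule tsum_image[OF vsH vsH vsA vspace_base lin_eval comult_closed[OF h]]) (rule linr | assumption)+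
        also have "\<dots> = (if a = b then \<pi> h a else 0)" using pi_conv[OF h, of a b] by (simp add: group_alg_simps)
        finally show "tsum A (comult H h) (\<lambda>h\<^sub>1 h\<^sub>2. \<pi> h\<^sub>1 a \<odot>\<^bsub>A\<^esub> \<pi> h\<^sub>2) b = (\<pi> h a \<odot>\<^bsub>A\<^esub> delta a) b"
          by (simp add: group_alg_simps delta_def)
      qed
      then have "\<pi> h a \<odot>\<^bsub>?T\<^esub> pure A X (delta a) y = pure A X (tsum A (comult H h) (\<lambda>h\<^sub>1 h\<^sub>2. \<pi> h\<^sub>1 a \<odot>\<^bsub>A\<^esub> \<pi> h\<^sub>2)) y"
        using lin_smult[OF lp delta_closed[OF a]] by simp
      also have "\<dots> = tsum ?T (comult H h) (\<lambda>h\<^sub>1 h\<^sub>2. pure A X (\<pi> h\<^sub>1 a \<odot>\<^bsub>A\<^esub> \<pi> h\<^sub>2) y)"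
        by (rule tsum_image[OF vsH vsH vsA vT lp comult_closed[OF h]]) (rule linr | assumption)+
      also have "\<dots> = tsum ?T (comult H h) (\<lambda>h\<^sub>1 h\<^sub>2. \<pi> h\<^sub>1 a \<odot>\<^bsub>?T\<^esub> pure A X (\<pi> h\<^sub>2) y)"
        by (rule tsum_comult_cong[OF h]) (simp add: lin_smult[OF lp] pi_closed)
      finally show ?thesis by simp
    qed
    have bl: "bilin H X ?T (\<lambda>h y. pure A X (\<pi> h) y)" by (rule bilinI) (rule linr vX | assumption)+
    \<comment> \<open>Replacing \<open>x\<close> by its projection creates the first leg that
      \<open>inner\<close> requires.\<close>
    have "tmap A X \<pi> (\<lambda>x. x) (coact X x) = tsum ?T (coact X (hom_part a X x)) (\<lambda>h y. pure A X (\<pi> h) y)"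
      by (simp add: tmap_def x)
    also have "\<dots> = tsum ?T (coact X x) (\<lambda>h x\<^sub>0. tsum ?T (comult H h) (\<lambda>h\<^sub>1 h\<^sub>2. \<pi> h\<^sub>1 a \<odot>\<^bsub>?T\<^esub> pure A X (\<pi> h\<^sub>2) x\<^sub>0))"
      by (rule tsum_coact_half_braid[OF X vT xX lin_pg bl])
    also have "\<dots> = tsum ?T (coact X x) (\<lambda>h x\<^sub>0. \<pi> h a \<odot>\<^bsub>?T\<^esub> pure A X (delta a) x\<^sub>0)"
      by (rule tsum_coact_cong[OF X xX inner])
    also have "\<dots> = pure A X (delta a) (hom_part a X x)"
      by (rule tsum_half_braid[OF X vT xX lin_pg bilin_right[OF bilin_pure[OF vsA vX] delta_closed[OF a]]])
    finally show ?thesis using xX by (simp add: comod_grade_def x)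
  qed
  show ?thesis using 1 2 by (auto simp: comod_grade_def)
qed

lemma gr_carrier: "x \<in> gr X a \<Longrightarrow> x \<in> carrier X" by (simp add: comod_grade_def)

lemma hom_part_gr:
  assumes X: "comodule H X" and a: "a \<in> carrier G" and x: "x \<in> carrier X"
  shows "hom_part a X x \<in> gr X a"
  unfolding gr_iff[OF X a]
  using half_braid_half_braid[OF X x lin_pg lin_pg, of "\<lambda>h. \<pi> h a" a a] pi_conv
    half_braid_closed[OF X lin_pg x] by simp

lemma gr_self: "grade H G \<pi> a = gr self_comod a"
proof -
  have "tensor A H = tensor A self_comod" "pure A H = pure A self_comod" by (rule tensor_transfer; simp)+
  then show ?thesis by (simp add: grade_def comod_grade_def tmap_def)
qed

text \<open>Because \<pi> preserves the counit, the idempotents \<open>\<pi> _ a\<close> sum to the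
  counit. This is the completeness needed to decompose an element into homogeneous parts.\<close>

lemma counit_finsum:
  assumes N: "vspace N" and h: "h \<in> carrier H" and v: "v \<in> carrier N"
  shows "glift N (\<lambda>a. v) (\<pi> h) = counit H h \<odot>\<^bsub>N\<^esub> v"
  using glift_const[OF N v pi_closed[OF h]] pi_counit[OF h] by simp

lemma psum_cong_set: "(\<And>a b. (a, b) \<in> set l \<Longrightarrow> f a b = g a b) \<Longrightarrow> psum N f l = psum N g l"
proof (induction l)
  case (Cons p l)
  then show ?case by (cases p) simp
qed simp

lemma psum_finsum:
  assumes N: "vspace N" and B: "finite B" and l: "set l \<subseteq> S \<times> T"
    and F: "\<And>a x y. a \<in> B \<Longrightarrow> x \<in> S \<Longrightarrow> y \<in> T \<Longrightarrow> F a x y \<in> carrier N"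
  shows "psum N (\<lambda>x y. \<Oplus>\<^bsub>N\<^esub>a\<in>B. F a x y) l = (\<Oplus>\<^bsub>N\<^esub>a\<in>B. psum N (F a) l)"
proof -
  interpret N: module base N by (rule N)
  show ?thesis using l
  proof (induction l)
    case Nil then show ?case by (simp add: N.M.finsum_zero)
  next
    case (Cons p l)
    obtain x y where p: "p = (x, y)" by fastforce
    have "(\<Oplus>\<^bsub>N\<^esub>a\<in>B. F a x y \<oplus>\<^bsub>N\<^esub> psum N (F a) l) = (\<Oplus>\<^bsub>N\<^esub>a\<in>B. F a x y) \<oplus>\<^bsub>N\<^esub> (\<Oplus>\<^bsub>N\<^esub>a\<in>B. psum N (F a) l)"
      by (rule N.M.finsum_addf) (use Cons p F psum_closed[OF N, of l S T] in auto)
    then show ?case using Cons p by simp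
  qed
qed

text \<open>Every element is the finite sum of its homogeneous parts.\<close>

lemma homog_ext:
  assumes X: "comodule H X" and N: "vspace N" and f: "lin X N f" and g: "lin X N g" and x: "x \<in> carrier X"
    and eq: "\<And>a y. a \<in> carrier G \<Longrightarrow> y \<in> gr X a \<Longrightarrow> f y = g y"
  shows "f x = g x"
proof -
  note vX = comodule_vspace[OF X]
  define l where "l = rep (coact X x)"
  have l: "set l \<subseteq> carrier H \<times> carrier X" unfolding l_def by (rule rep_carrier[OF vsH vX coact_closed[OF x X]])
  \<comment> \<open>The degrees occurring in the first factors of one representative of the
    coaction: a finite set outside of which no degree contributes.\<close>
  define B where "B = (\<Union>(h, y)\<in>set l. supp (\<pi> h))"
  have piA: "finite (supp (\<pi> h))" "supp (\<pi> h) \<subseteq> carrier G" if "h \<in> carrier H" for h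
    using pi_closed[OF that] by (auto simp: group_alg_simps)
  have B: "finite B" unfolding B_def by (rule finite_UN_I) (use piA l in auto)
  have BG: "B \<subseteq> carrier G" unfolding B_def using piA(2) l by blast
  have "f x = (\<Oplus>\<^bsub>N\<^esub>a\<in>B. f (hom_part a X x))" if f: "lin X N f" for f
  proof -
    have "f x = psum N (\<lambda>h y. counit H h \<odot>\<^bsub>N\<^esub> f y) l"
      using coact_counit[OF X N x f] by (simp add: tsum_psum l_def)
    also have "\<dots> = psum N (\<lambda>h y. \<Oplus>\<^bsub>N\<^esub>a\<in>B. \<pi> h a \<odot>\<^bsub>N\<^esub> f y) l"
    proof -
      have "counit H h \<odot>\<^bsub>N\<^esub> f y = (\<Oplus>\<^bsub>N\<^esub>a\<in>B. \<pi> h a \<odot>\<^bsub>N\<^esub> f y)" if "(h, y) \<in> set l" for h y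
      proof -
        have hy: "h \<in> carrier H" "f y \<in> carrier N" using l that lin_closed[OF f] by auto
        have "supp (\<pi> h) \<subseteq> B" using that by (auto simp: B_def)
        then show ?thesis
          using counit_finsum[OF N hy] glift_superset[OF N, of G "\<lambda>a. f y" B "\<pi> h"] B BG hy by simp
      qed
      then show ?thesis by (rule psum_cong_set)
    qed
    also have "\<dots> = (\<Oplus>\<^bsub>N\<^esub>a\<in>B. psum N (\<lambda>h y. \<pi> h a \<odot>\<^bsub>N\<^esub> f y) l)"
      by (rule psum_finsum[OF N B l]) (simp add: vs_smult[OF N] lin_closed[OF f])
    also have "\<dots> = (\<Oplus>\<^bsub>N\<^esub>a\<in>B. f (hom_part a X x))"
      using tsum_half_braid[OF X N x lin_pg f] by (simp add: tsum_psum l_def)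
    finally show ?thesis .
  qed
  note sum = this
  interpret N: module base N by (rule N)
  have "(\<Oplus>\<^bsub>N\<^esub>a\<in>B. f (hom_part a X x)) = (\<Oplus>\<^bsub>N\<^esub>a\<in>B. g (hom_part a X x))"
    using BG eq hom_part_gr[OF X _ x] lin_closed[OF g half_braid_closed[OF X lin_pg x]]
    by (intro N.M.finsum_cong') auto
  then show ?thesis using sum[OF f] sum[OF g] by simp
qed

lemma bilin_homog_ext:
  assumes X: "comodule H X" and Y: "comodule H Y" and N: "vspace N" and f: "bilin X Y N f" and g: "bilin X Y N g"
    and x: "x \<in> carrier X" and y: "y \<in> carrier Y"
    and eq: "\<And>a b x y. a \<in> carrier G \<Longrightarrow> b \<in> carrier G \<Longrightarrow> x \<in> gr X a \<Longrightarrow> y \<in> gr Y b \<Longrightarrow> f x y = g x y"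
  shows "f x y = g x y"
proof (rule homog_ext[OF X N bilin_left[OF f y] bilin_left[OF g y] x])
  fix a x assume a: "a \<in> carrier G" "x \<in> gr X a"
  have xX: "x \<in> carrier X" by (rule gr_carrier[OF a(2)])
  show "f x y = g x y"
    by (rule homog_ext[OF Y N bilin_right[OF f xX] bilin_right[OF g xX] y]) (rule eq[OF a(1) _ a(2)])
qed

text \<open>Orthogonality kills all coordinates but \<open>a\<close>, and preservation of the counit
  identifies the remaining one.\<close>

lemma pi_homog:
  assumes a: "a \<in> carrier G" and h: "h \<in> gr self_comod a"
  shows "\<pi> h = (\<lambda>b. counit H h * delta a b)"
proof -
  have hH: "h \<in> carrier H" using gr_carrier[OF h] by simp
  have e: "hom_part a self_comod h = h" using h unfolding gr_iff[OF comodule_self a] by simp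
  have pb: "\<pi> h b = (if a = b then \<pi> h a else 0)" for b
  proof -
    have "\<pi> h b = tsum base (comult H h) (\<lambda>h\<^sub>1 h\<^sub>2. \<pi> h\<^sub>1 a * \<pi> h\<^sub>2 b)"
      using tsum_half_braid[OF comodule_self vspace_base, of h "\<lambda>h. \<pi> h a" "\<lambda>h. \<pi> h b"] hH lin_pg e by simp
    then show ?thesis using pi_conv[OF hH, of a b] by simp
  qed
  have pb0: "\<pi> h b = 0" if "a \<noteq> b" for b using pb[of b] that by simp
  have "counit H h = \<pi> h a"
  \<comment> \<open>The counit of the group algebra sums over the support, which is empty or
    \<open>{a}\<close> according to this coordinate.\<close>
  proof (cases "\<pi> h a = 0")
    case True
    then have "\<pi> h b = 0" for b using pb0[of b] by (cases "a = b") auto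
    then have "supp (\<pi> h) = {}" by (simp add: supp_def)
    then show ?thesis using True pi_counit[OF hH] by (simp add: group_alg_simps)
  next
    case False
    then have "a \<in> supp (\<pi> h)" by (simp add: supp_def)
    moreover have "supp (\<pi> h) \<subseteq> {a}"
    proof
      fix b assume "b \<in> supp (\<pi> h)"
      then show "b \<in> {a}" using pb0[of b] by (cases "a = b") (simp_all add: supp_def)
    qed
    ultimately have "supp (\<pi> h) = {a}" by blast
    then show ?thesis using pi_counit[OF hH] by (simp add: group_alg_simps)
  qed
  then show ?thesis using pb0 by (auto simp: delta_def)
qed

text \<open>The coaction of a homogeneous element has homogeneous components; on the left tensor
  factor this uses cocentrality.\<close>

lemma tsum_coact_homog:
  assumes X: "comodule H X" and N: "vspace N" and a: "a \<in> carrier G" and x: "x \<in> gr X a" and f: "bilin H X N f"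
  shows "tsum N (coact X x) f = tsum N (coact X x) (\<lambda>h y. f (hom_part a self_comod h) (hom_part a X y))"
proof -
  note vX = comodule_vspace[OF X]
  have xX: "x \<in> carrier X" and e: "hom_part a X x = x" using x unfolding gr_iff[OF X a] by simp_all
  have left: "tsum N (coact X x) k = tsum N (coact X x) (\<lambda>h y. k (hom_part a self_comod h) y)"
    and right: "tsum N (coact X x) k = tsum N (coact X x) (\<lambda>h y. k h (hom_part a X y))" if k: "bilin H X N k" for k
  proof -
    have "tsum N (coact X x) k = tsum N (coact X (hom_part a X x)) k" by (simp add: e)
    also have "\<dots> = tsum N (coact X x) (\<lambda>h y. tsum N (comult H h) (\<lambda>h\<^sub>1 h\<^sub>2. \<pi> h\<^sub>1 a \<odot>\<^bsub>N\<^esub> k h\<^sub>2 y))"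
      by (rule tsum_coact_half_braid[OF X N xX lin_pg k])
    finally have 1: "tsum N (coact X x) k = tsum N (coact X x) (\<lambda>h y. tsum N (comult H h) (\<lambda>h\<^sub>1 h\<^sub>2. \<pi> h\<^sub>1 a \<odot>\<^bsub>N\<^esub> k h\<^sub>2 y))" .
    also have "\<dots> = tsum N (coact X x) (\<lambda>h y. k (hom_part a self_comod h) y)"
      by (rule tsum_coact_cong[OF X xX]) (use tsum_half_braid[OF comodule_self N _ lin_pg, of _ "\<lambda>h. k h _"] bilin_left[OF k] in simp)
    finally show "tsum N (coact X x) k = tsum N (coact X x) (\<lambda>h y. k (hom_part a self_comod h) y)" .
    \<comment> \<open>Cocentrality moves the idempotent from the first leg of
      \<open>comult H h\<close> to the second; coassociativity then lets it act on the comodule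
      element.\<close>
    have "tsum N (coact X x) k = tsum N (coact X x) (\<lambda>h y. tsum N (comult H h) (\<lambda>h\<^sub>1 h\<^sub>2. \<pi> h\<^sub>2 a \<odot>\<^bsub>N\<^esub> k h\<^sub>1 y))"
      unfolding 1 by (rule tsum_coact_cong[OF X xX], rule pi_cocentral[OF _ N bilin_left[OF k], symmetric])
    also have "\<dots> = tsum N (coact X x) (\<lambda>h y. tsum N (coact X y) (\<lambda>h' y. \<pi> h' a \<odot>\<^bsub>N\<^esub> k h y))"
      by (rule coact_coassoc[OF X N xX, symmetric])
        (rule linr N vX bilin_left[OF k] bilin_right[OF k] bilin_closed[OF k] | assumption)+
    also have "\<dots> = tsum N (coact X x) (\<lambda>h y. k h (hom_part a X y))"
      by (rule tsum_coact_cong[OF X xX], rule tsum_half_braid[OF X N _ lin_pg bilin_right[OF k]])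
    finally show "tsum N (coact X x) k = tsum N (coact X x) (\<lambda>h y. k h (hom_part a X y))" .
  qed
  have "bilin H X N (\<lambda>h y. f h (hom_part a X y))"
    by (rule bilinI)
      (rule bilin_left[OF f] half_braid_closed[OF X lin_pg] lin_comp[OF bilin_right[OF f]] half_braid_lin[OF X lin_pg] | assumption)+
  from left[OF this] right[OF f] show ?thesis by simp
qed

text \<open>The central device for Sweedler sums: formulas known only in homogeneous degrees may be
  applied to the summand, although the entries of the chosen representative need not be homogeneous.
  Both summands must be bilinear, so that the projections can be inserted.\<close>

lemma tsum_coact_homog_cong:
  assumes X: "comodule H X" and N: "vspace N" and a: "a \<in> carrier G" and x: "x \<in> gr X a"
    and f: "bilin H X N f" and g: "bilin H X N g"
    and eq: "\<And>h y. h \<in> gr self_comod a \<Longrightarrow> y \<in> gr X a \<Longrightarrow> f h y = g h y"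
  shows "tsum N (coact X x) f = tsum N (coact X x) g"
  unfolding tsum_coact_homog[OF X N a x f] tsum_coact_homog[OF X N a x g]
  by (rule tsum_coact_cong[OF X gr_carrier[OF x]], rule eq) (simp_all add: hom_part_gr[OF comodule_self a] hom_part_gr[OF X a])

lemma tsum_comult_homog_cong:
  assumes "vspace N" "a \<in> carrier G" "x \<in> gr self_comod a" "bilin H H N f" "bilin H H N g"
    "\<And>h y. h \<in> gr self_comod a \<Longrightarrow> y \<in> gr self_comod a \<Longrightarrow> f h y = g h y"
  shows "tsum N (comult H x) f = tsum N (comult H x) g"
  using tsum_coact_homog_cong[OF comodule_self assms(1-3), of f g] assms(4-6) by (simp add: bilin_def)

text \<open>\<open>gsum N X \<phi>\<close> glues the linear maps \<open>\<phi> a\<close> on the homogeneous components of \<open>X\<close>.\<close>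

definition gsum :: "('k, 'c, 'p) module_scheme \<Rightarrow> ('k, 'h, 'x, 'n) comod_scheme \<Rightarrow> ('g \<Rightarrow> 'x \<Rightarrow> 'c) \<Rightarrow> 'x \<Rightarrow> 'c" where
  "gsum N X \<phi> x = tsum N (coact X x) (\<lambda>h x\<^sub>0. glift N (\<lambda>a. \<phi> a x\<^sub>0) (\<pi> h))"

lemma bilin_gsum:
  assumes X: "comodule H X" and N: "vspace N" and \<phi>: "\<And>a. a \<in> carrier G \<Longrightarrow> lin X N (\<phi> a)"
  shows "bilin H X N (\<lambda>h x\<^sub>0. glift N (\<lambda>a. \<phi> a x\<^sub>0) (\<pi> h))"
proof (rule bilinI)
  fix y assume "y \<in> carrier X"
  then show "lin H N (\<lambda>h. glift N (\<lambda>a. \<phi> a y) (\<pi> h))"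
    using lin_comp[OF lin_glift[OF N, of G "\<lambda>a. \<phi> a y"] lin_pi] lin_closed[OF \<phi>] by blast
next
  fix h assume "h \<in> carrier H"
  then show "lin X N (\<lambda>y. glift N (\<lambda>a. \<phi> a y) (\<pi> h))"
    by (intro lin_glift_param[OF N comodule_vspace[OF X] pi_closed \<phi>])
qed

lemma lin_gsum:
  assumes F: "lin M X F" and X: "comodule H X" and N: "vspace N" and \<phi>: "\<And>a. a \<in> carrier G \<Longrightarrow> lin X N (\<phi> a)"
  shows "lin M N (\<lambda>x. gsum N X \<phi> (F x))"
proof -
  note vX = comodule_vspace[OF X] and b = bilin_gsum[OF X N \<phi>]
  have "lin X N (gsum N X \<phi>)"
    unfolding gsum_def[abs_def]
    by (rule linr vX X N bilin_left[OF b] bilin_right[OF b] | assumption)+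
  then show ?thesis by (rule lin_comp[OF _ F])
qed

lemma lin_gsum_param:
  assumes y: "y \<in> carrier X" and X: "comodule H X" and M: "vspace M" and N: "vspace N"
    and \<phi>: "\<And>a y. a \<in> carrier G \<Longrightarrow> y \<in> carrier X \<Longrightarrow> lin M N (\<lambda>x. \<phi> x a y)"
  shows "lin M N (\<lambda>x. gsum N X (\<phi> x) y)"
  unfolding gsum_def
  by (rule lin_tsum_ker[OF coact_closed[OF y X] vsH comodule_vspace[OF X] N])
    (rule lin_glift_param[OF N M pi_closed \<phi>])

text \<open>In degree \<open>a\<close> all components have degree \<open>a\<close>, where \<pi> is
  the counit times \<open>delta a\<close>; the family is thereby evaluated at \<open>a\<close>, and
  the counit law removes the counit.\<close>

lemma gsum_homog:
  assumes X: "comodule H X" and N: "vspace N" and a: "a \<in> carrier G" and x: "x \<in> gr X a"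
    and \<phi>: "\<And>a. a \<in> carrier G \<Longrightarrow> lin X N (\<phi> a)"
  shows "gsum N X \<phi> x = \<phi> a x"
proof -
  note vX = comodule_vspace[OF X] and b = bilin_gsum[OF X N \<phi>]
  have "gsum N X \<phi> x = tsum N (coact X x) (\<lambda>h y. counit H h \<odot>\<^bsub>N\<^esub> \<phi> a y)"
    unfolding gsum_def
  proof (rule tsum_coact_homog_cong[OF X N a x b bilinI])
    fix h y assume h: "h \<in> gr self_comod a" and y: "y \<in> gr X a"
    have hH: "h \<in> carrier H" using gr_carrier[OF h] by simp
    have c: "\<phi> b y \<in> carrier N" if "b \<in> carrier G" for b using lin_closed[OF \<phi>[OF that] gr_carrier[OF y]] .
    have "\<pi> h = counit H h \<odot>\<^bsub>A\<^esub> delta a" using pi_homog[OF a h] by (simp add: group_alg_simps)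
    then show "glift N (\<lambda>a. \<phi> a y) (\<pi> h) = counit H h \<odot>\<^bsub>N\<^esub> \<phi> a y"
      using lin_smult[OF lin_glift[OF N, of G "\<lambda>a. \<phi> a y"] delta_closed[OF a]] c glift_delta[OF N, of "\<lambda>a. \<phi> a y" a] a by simp
  qed (rule linr N vX \<phi>[OF a] lin_closed[OF \<phi>[OF a]] | assumption)+
  also have "\<dots> = \<phi> a x" by (rule coact_counit[OF X N gr_carrier[OF x] \<phi>[OF a]])
  finally show ?thesis .
qed

lemmas [linr] = lin_gsum lin_gsum_param

end

section \<open>Zesting data\<close>

locale zesting = graded H G \<pi> for H :: "('k::field, 'h, 'm) hopf_scheme" and G :: "'g monoid" and \<pi> +
  fixes \<Gamma> :: "'h set" and \<gamma> :: "'h \<Rightarrow> 'h \<Rightarrow> 'k" and \<Lambda> :: "'g \<Rightarrow> 'g \<Rightarrow> 'h" and \<omega> :: "'g \<Rightarrow> 'g \<Rightarrow> 'g \<Rightarrow> 'k"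
  assumes hopf: "hopf_algebra H" and datum: "zesting_datum H G \<pi> \<Gamma> \<gamma> \<Lambda> \<omega>"
begin

interpretation R: ring H by (rule ringH)
interpretation Gr: group G by (rule grp)

abbreviation GL :: "'h monoid" where "GL \<equiv> grouplikes_coinv H A \<pi>"
abbreviation gH :: "'g \<Rightarrow> 'h set" where "gH a \<equiv> gr self_comod a"

lemma gH_carrier: "h \<in> gH a \<Longrightarrow> h \<in> carrier H"
  using gr_carrier[of h self_comod a] by simp

lemma homog_ext_H:
  assumes "vspace N" "h \<in> carrier H" "lin H N f" "lin H N g" "\<And>a y. a \<in> carrier G \<Longrightarrow> y \<in> gH a \<Longrightarrow> f y = g y"
  shows "f h = g h"
  using homog_ext[OF comodule_self assms(1), of f g h] assms(2-) by simp

section \<open>Group-like coinvariants\<close>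

lemma GL_simps: "carrier GL = {s \<in> coinvariants H A \<pi>. comult H s = pure H H s s \<and> counit H s = 1}"
  "s \<otimes>\<^bsub>GL\<^esub> t = s \<otimes>\<^bsub>H\<^esub> t" "\<one>\<^bsub>GL\<^esub> = \<one>\<^bsub>H\<^esub>"
  by (simp_all add: grouplikes_coinv_def)

text \<open>For a group-like \<open>s\<close> coinvariance reads s \<otimes> \<pi>(s) = s \<otimes>
  1; applying the counit, which is 1 at \<open>s\<close>, to the first factor leaves a condition on
  \<pi>(s) alone.\<close>

lemma GL_iff:
  "s \<in> carrier GL \<longleftrightarrow> s \<in> carrier H \<and> comult H s = pure H H s s \<and> counit H s = 1 \<and> \<pi> s = delta \<one>\<^bsub>G\<^esub>"
proof -
  have dA: "delta \<one>\<^bsub>G\<^esub> \<in> carrier A" by (simp add: delta_closed)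
  have *: "tmap H A (\<lambda>x. x) \<pi> (comult H s) = pure H A s (\<pi> s)" if "s \<in> carrier H" "comult H s = pure H H s s"
    using that tmap_pure[OF lin_id lin_pi vsH vsH vsH vsA that(1) that(1)] by simp
  have "\<pi> s = delta \<one>\<^bsub>G\<^esub>"
    if s: "s \<in> carrier H" "comult H s = pure H H s s" "counit H s = 1"
      and t: "tmap H A (\<lambda>x. x) \<pi> (comult H s) = pure H A s (delta \<one>\<^bsub>G\<^esub>)"
  proof -
    have bl: "bilin H A A (\<lambda>h u. counit H h \<odot>\<^bsub>A\<^esub> u)" by (rule bilinI) (rule linr | assumption)+
    have "tsum A (pure H A s (\<pi> s)) (\<lambda>h u. counit H h \<odot>\<^bsub>A\<^esub> u) = tsum A (pure H A s (delta \<one>\<^bsub>G\<^esub>)) (\<lambda>h u. counit H h \<odot>\<^bsub>A\<^esub> u)"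
      using t *[OF s(1,2)] by simp
    then show ?thesis
      using vs_one[OF vsA] pi_closed[OF s(1)] dA by (simp add: tsum_pure[OF vsH vsA vsA bl s(1)] s(3))
  qed
  then show ?thesis using * by (auto simp: GL_simps coinvariants_def group_alg_simps)
qed

lemma delta_one_mult: "f \<in> carrier A \<Longrightarrow> delta \<one>\<^bsub>G\<^esub> \<otimes>\<^bsub>A\<^esub> f = f"
proof
  fix x assume f: "f \<in> carrier A"
  have "{(a, b). a \<in> {\<one>\<^bsub>G\<^esub>} \<and> b \<in> supp f \<and> a \<otimes>\<^bsub>G\<^esub> b = x} = (if x \<in> supp f then {(\<one>\<^bsub>G\<^esub>, x)} else {})"
    using f by (auto simp: group_alg_simps)
  then show "(delta \<one>\<^bsub>G\<^esub> \<otimes>\<^bsub>A\<^esub> f) x = f x"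
    by (simp add: group_alg_simps supp_delta) (simp add: delta_def supp_def)
qed

text \<open>The group-likes are given as a bare monoid record; the antipode supplies the inverses,
  and it has to be checked that these are again group-like and coinvariant.\<close>

lemma GL_inverse:
  assumes s: "s \<in> carrier GL"
  obtains y where "y \<in> carrier GL" "y \<otimes>\<^bsub>H\<^esub> s = \<one>\<^bsub>H\<^esub>" "s \<otimes>\<^bsub>H\<^esub> y = \<one>\<^bsub>H\<^esub>"
proof -
  have sH: "s \<in> carrier H" and cs: "comult H s = pure H H s s" and es: "counit H s = 1" and ps: "\<pi> s = delta \<one>\<^bsub>G\<^esub>"
    using s by (auto simp: GL_iff)
  define y where "y = antipode H s"
  have lS: "lin H H (antipode H)" using hopf by (simp add: hopf_algebra_def)
  have yH: "y \<in> carrier H" unfolding y_def by (rule lin_closed[OF lS sH])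
  have bl1: "bilin H H H (\<lambda>a b. antipode H a \<otimes>\<^bsub>H\<^esub> b)" and bl2: "bilin H H H (\<lambda>a b. a \<otimes>\<^bsub>H\<^esub> antipode H b)"
    by (rule bilinI; (rule linr lS lin_closed[OF lS] | assumption)+)+
  have ys: "y \<otimes>\<^bsub>H\<^esub> s = \<one>\<^bsub>H\<^esub>" and sy: "s \<otimes>\<^bsub>H\<^esub> y = \<one>\<^bsub>H\<^esub>"
    using hopf sH tsum_comult_grouplike[OF cs sH vsH bl1] tsum_comult_grouplike[OF cs sH vsH bl2] es
      vs_one[OF vsH one_closed] by (simp_all add: hopf_algebra_def y_def)
  have ey: "counit H y = 1" using counit_mult[OF yH sH] ys es counit_one by simp
  have "\<pi> y = delta \<one>\<^bsub>G\<^esub>"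
    using pi_mult[OF sH yH] sy pi_one delta_one_mult[OF pi_closed[OF yH]] by (simp add: ps)
  moreover have "comult H y = pure H H y y"
  proof -
    let ?T = "tensor H H"
    have vT: "vspace ?T" by (rule linr)+
    let ?g = "\<lambda>h k. pure H H (y \<otimes>\<^bsub>H\<^esub> h) (y \<otimes>\<^bsub>H\<^esub> k)"
    have bg: "bilin H H ?T ?g" by (rule bilinI) (rule linr yH | assumption)+
    have bp: "bilin H H ?T (\<lambda>h k. ?g (s \<otimes>\<^bsub>H\<^esub> h) (s \<otimes>\<^bsub>H\<^esub> k))" by (rule bilinI) (rule linr yH sH | assumption)+
    have bq: "bilin H H ?T (\<lambda>h\<^sub>1 h\<^sub>2. tsum ?T (comult H y) (\<lambda>k\<^sub>1 k\<^sub>2. ?g (h\<^sub>1 \<otimes>\<^bsub>H\<^esub> k\<^sub>1) (h\<^sub>2 \<otimes>\<^bsub>H\<^esub> k\<^sub>2)))"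
      by (rule bilinI) (rule linr yH sH | assumption)+
    \<comment> \<open>Inserting y s = 1 in both legs produces y \<otimes> y times the coproduct of s
      y = 1, hence y \<otimes> y.\<close>
    have "comult H y = tsum ?T (comult H y) (pure H H)" by (rule tsum_pure_id[OF vsH vsH comult_closed[OF yH], symmetric])
    also have "\<dots> = tsum ?T (comult H y) (\<lambda>h k. ?g (s \<otimes>\<^bsub>H\<^esub> h) (s \<otimes>\<^bsub>H\<^esub> k))"
      by (rule tsum_comult_cong[OF yH]) (simp add: ys yH sH flip: R.m_assoc)
    also have "\<dots> = tsum ?T (comult H (s \<otimes>\<^bsub>H\<^esub> y)) ?g"
      unfolding tsum_comult_mult[OF sH yH vT bg] by (rule tsum_comult_grouplike[OF cs sH vT bq, symmetric])
    also have "\<dots> = pure H H y y"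
      using tsum_comult_grouplike[OF comult_one one_closed vT bg] yH by (simp add: sy)
    finally show ?thesis .
  qed
  ultimately have "y \<in> carrier GL" using yH ey by (simp add: GL_iff)
  then show thesis using that ys sy by blast
qed

text \<open>\<open>m_inv\<close> is a definite description; its uniqueness comes from associativity
  in \<open>H\<close>.\<close>

lemma inv_GL:
  assumes s: "s \<in> carrier GL"
  shows "inv\<^bsub>GL\<^esub> s \<in> carrier GL" "inv\<^bsub>GL\<^esub> s \<otimes>\<^bsub>H\<^esub> s = \<one>\<^bsub>H\<^esub>" "s \<otimes>\<^bsub>H\<^esub> inv\<^bsub>GL\<^esub> s = \<one>\<^bsub>H\<^esub>"
proof -
  obtain y where y: "y \<in> carrier GL" "y \<otimes>\<^bsub>H\<^esub> s = \<one>\<^bsub>H\<^esub>" "s \<otimes>\<^bsub>H\<^esub> y = \<one>\<^bsub>H\<^esub>" using GL_inverse[OF s] .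
  have "inv\<^bsub>GL\<^esub> s = y"
    unfolding m_inv_def
  proof (rule the_equality)
    fix z assume z: "z \<in> carrier GL \<and> s \<otimes>\<^bsub>GL\<^esub> z = \<one>\<^bsub>GL\<^esub> \<and> z \<otimes>\<^bsub>GL\<^esub> s = \<one>\<^bsub>GL\<^esub>"
    have "z = (y \<otimes>\<^bsub>H\<^esub> s) \<otimes>\<^bsub>H\<^esub> z" using z y by (simp add: GL_iff)
    also have "\<dots> = y \<otimes>\<^bsub>H\<^esub> (s \<otimes>\<^bsub>H\<^esub> z)" using y(1) z s R.m_assoc by (simp add: GL_iff)
    also have "\<dots> = y" using y(1) z by (simp add: GL_iff GL_simps(2,3))
    finally show "z = y" .
  qed (use y in \<open>simp add: GL_simps(2,3)\<close>)
  then show "inv\<^bsub>GL\<^esub> s \<in> carrier GL" "inv\<^bsub>GL\<^esub> s \<otimes>\<^bsub>H\<^esub> s = \<one>\<^bsub>H\<^esub>" "s \<otimes>\<^bsub>H\<^esub> inv\<^bsub>GL\<^esub> s = \<one>\<^bsub>H\<^esub>" using y by auto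
qed

lemma
  shows sub: "subgroup \<Gamma> GL"
    and gamma_hom: "\<gamma> \<in> hom (GL\<lparr>carrier := \<Gamma>\<rparr>) (alg_chars H)"
    and compat0: "\<And>s h. s \<in> \<Gamma> \<Longrightarrow> h \<in> carrier H \<Longrightarrow>
          tsum H (comult H h) (\<lambda>h\<^sub>1 h\<^sub>2. \<gamma> s h\<^sub>1 \<odot>\<^bsub>H\<^esub> (inv\<^bsub>GL\<^esub> s \<otimes>\<^bsub>H\<^esub> h\<^sub>2 \<otimes>\<^bsub>H\<^esub> s))
        = tsum H (comult H h) (\<lambda>h\<^sub>1 h\<^sub>2. \<gamma> s h\<^sub>2 \<odot>\<^bsub>H\<^esub> h\<^sub>1)"
    and Lambda_closed: "\<And>a b. a \<in> carrier G \<Longrightarrow> b \<in> carrier G \<Longrightarrow> \<Lambda> a b \<in> \<Gamma>"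
    and cocycle: "\<And>a b c. a \<in> carrier G \<Longrightarrow> b \<in> carrier G \<Longrightarrow> c \<in> carrier G \<Longrightarrow>
          \<Lambda> a b \<otimes>\<^bsub>H\<^esub> \<Lambda> (a \<otimes>\<^bsub>G\<^esub> b) c = \<Lambda> b c \<otimes>\<^bsub>H\<^esub> \<Lambda> a (b \<otimes>\<^bsub>G\<^esub> c)"
    and Lambda_one: "\<And>a. a \<in> carrier G \<Longrightarrow> \<Lambda> a \<one>\<^bsub>G\<^esub> = \<one>\<^bsub>H\<^esub>" "\<And>a. a \<in> carrier G \<Longrightarrow> \<Lambda> \<one>\<^bsub>G\<^esub> a = \<one>\<^bsub>H\<^esub>"
    and omega_nonzero: "\<And>a b c. a \<in> carrier G \<Longrightarrow> b \<in> carrier G \<Longrightarrow> c \<in> carrier G \<Longrightarrow> \<omega> a b c \<noteq> 0"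
    and omega_one: "\<And>a b. a \<in> carrier G \<Longrightarrow> b \<in> carrier G \<Longrightarrow> \<omega> a \<one>\<^bsub>G\<^esub> b = 1"
    and omega_eq0: "\<And>a b c d. a \<in> carrier G \<Longrightarrow> b \<in> carrier G \<Longrightarrow> c \<in> carrier G \<Longrightarrow> d \<in> carrier G \<Longrightarrow>
          \<gamma> (\<Lambda> a b) (\<Lambda> c d)
            = (\<omega> a b c * \<omega> a (b \<otimes>\<^bsub>G\<^esub> c) d * \<omega> b c d) / (\<omega> (a \<otimes>\<^bsub>G\<^esub> b) c d * \<omega> a b (c \<otimes>\<^bsub>G\<^esub> d))"
  using datum by (auto simp: zesting_datum_def Let_def)

lemma Gamma_GL: "s \<in> \<Gamma> \<Longrightarrow> s \<in> carrier GL" using subgroup.subset[OF sub] by blast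
lemma Gamma_closed: "s \<in> \<Gamma> \<Longrightarrow> s \<in> carrier H" using Gamma_GL by (simp add: GL_iff)
lemma Gamma_comult: "s \<in> \<Gamma> \<Longrightarrow> comult H s = pure H H s s" using Gamma_GL by (simp add: GL_iff)
lemma Gamma_counit: "s \<in> \<Gamma> \<Longrightarrow> counit H s = 1" using Gamma_GL by (simp add: GL_iff)
lemma Gamma_one: "\<one>\<^bsub>H\<^esub> \<in> \<Gamma>" using subgroup.one_closed[OF sub] by (simp add: GL_simps)
lemma Gamma_inv: "s \<in> \<Gamma> \<Longrightarrow> inv\<^bsub>GL\<^esub> s \<in> \<Gamma>" by (rule subgroup.m_inv_closed[OF sub])

lemma omega_eq:
  assumes "a \<in> carrier G" "b \<in> carrier G" "c \<in> carrier G" "d \<in> carrier G"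
  shows "\<omega> (a \<otimes>\<^bsub>G\<^esub> b) c d * \<omega> a b (c \<otimes>\<^bsub>G\<^esub> d) * \<gamma> (\<Lambda> a b) (\<Lambda> c d) = \<omega> a b c * \<omega> a (b \<otimes>\<^bsub>G\<^esub> c) d * \<omega> b c d"
  using omega_eq0[OF assms] omega_nonzero assms by simp

lemma lin_gamma: "s \<in> \<Gamma> \<Longrightarrow> lin H base (\<gamma> s)"
  and gamma_one: "s \<in> \<Gamma> \<Longrightarrow> \<gamma> s \<one>\<^bsub>H\<^esub> = 1"
  and gamma_mult: "s \<in> \<Gamma> \<Longrightarrow> h \<in> carrier H \<Longrightarrow> k \<in> carrier H \<Longrightarrow> \<gamma> s (h \<otimes>\<^bsub>H\<^esub> k) = \<gamma> s h * \<gamma> s k"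
  using gamma_hom by (auto simp: hom_def alg_chars_def Pi_iff)

lemma lin_gamma' [linr]: "lin M H F \<Longrightarrow> s \<in> \<Gamma> \<Longrightarrow> lin M base (\<lambda>x. \<gamma> s (F x))"
  by (rule lin_comp[OF lin_gamma])

lemma gamma_conv:
  assumes "s \<in> \<Gamma>" "t \<in> \<Gamma>" "h \<in> carrier H"
  shows "\<gamma> (s \<otimes>\<^bsub>H\<^esub> t) h = tsum base (comult H h) (\<lambda>h\<^sub>1 h\<^sub>2. \<gamma> s h\<^sub>1 * \<gamma> t h\<^sub>2)"
proof -
  have "\<gamma> (s \<otimes>\<^bsub>H\<^esub> t) = \<gamma> s \<otimes>\<^bsub>alg_chars H\<^esub> \<gamma> t"
    using hom_mult[OF gamma_hom, of s t] assms by (simp add: GL_simps)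
  then show ?thesis using assms by (simp add: alg_chars_def)
qed

text \<open>Multiplying the compatibility condition by \<open>s\<close> on the left removes the
  inverse; composing with a linear \<open>g\<close> gives a form that applies under further Sweedler
  sums.\<close>

lemma compat:
  assumes s: "s \<in> \<Gamma>" and h: "h \<in> carrier H" and N: "vspace N" and g: "lin H N g"
  shows "tsum N (comult H h) (\<lambda>h\<^sub>1 h\<^sub>2. \<gamma> s h\<^sub>1 \<odot>\<^bsub>N\<^esub> g (h\<^sub>2 \<otimes>\<^bsub>H\<^esub> s)) = tsum N (comult H h) (\<lambda>h\<^sub>1 h\<^sub>2. \<gamma> s h\<^sub>2 \<odot>\<^bsub>N\<^esub> g (s \<otimes>\<^bsub>H\<^esub> h\<^sub>1))"
proof -
  define L where "L x = g (s \<otimes>\<^bsub>H\<^esub> x)" for x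
  have L: "lin H N L" unfolding L_def by (rule lin_comp[OF g]) (rule linr Gamma_closed[OF s])+
  have iH: "inv\<^bsub>GL\<^esub> s \<in> carrier H" using Gamma_inv[OF s] by (rule Gamma_closed)
  have "L (tsum H (comult H h) (\<lambda>h\<^sub>1 h\<^sub>2. \<gamma> s h\<^sub>1 \<odot>\<^bsub>H\<^esub> (inv\<^bsub>GL\<^esub> s \<otimes>\<^bsub>H\<^esub> h\<^sub>2 \<otimes>\<^bsub>H\<^esub> s)))
      = tsum N (comult H h) (\<lambda>h\<^sub>1 h\<^sub>2. L (\<gamma> s h\<^sub>1 \<odot>\<^bsub>H\<^esub> (inv\<^bsub>GL\<^esub> s \<otimes>\<^bsub>H\<^esub> h\<^sub>2 \<otimes>\<^bsub>H\<^esub> s)))"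
    by (rule tsum_image[OF vsH vsH vsH N L comult_closed[OF h]]) (rule linr s Gamma_closed[OF s] iH | assumption)+
  also have "\<dots> = tsum N (comult H h) (\<lambda>h\<^sub>1 h\<^sub>2. \<gamma> s h\<^sub>1 \<odot>\<^bsub>N\<^esub> g (h\<^sub>2 \<otimes>\<^bsub>H\<^esub> s))"
  proof (rule tsum_comult_cong[OF h])
    fix h\<^sub>1 h\<^sub>2 assume *: "h\<^sub>1 \<in> carrier H" "h\<^sub>2 \<in> carrier H"
    have "s \<otimes>\<^bsub>H\<^esub> (inv\<^bsub>GL\<^esub> s \<otimes>\<^bsub>H\<^esub> h\<^sub>2 \<otimes>\<^bsub>H\<^esub> s) = (s \<otimes>\<^bsub>H\<^esub> inv\<^bsub>GL\<^esub> s) \<otimes>\<^bsub>H\<^esub> (h\<^sub>2 \<otimes>\<^bsub>H\<^esub> s)"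
      using * iH Gamma_closed[OF s] by (simp add: R.m_assoc)
    then show "L (\<gamma> s h\<^sub>1 \<odot>\<^bsub>H\<^esub> (inv\<^bsub>GL\<^esub> s \<otimes>\<^bsub>H\<^esub> h\<^sub>2 \<otimes>\<^bsub>H\<^esub> s)) = \<gamma> s h\<^sub>1 \<odot>\<^bsub>N\<^esub> g (h\<^sub>2 \<otimes>\<^bsub>H\<^esub> s)"
      using * iH Gamma_closed[OF s] inv_GL(3)[OF Gamma_GL[OF s]] by (simp add: lin_smult[OF L]) (simp add: L_def)
  qed
  finally have 1: "L (tsum H (comult H h) (\<lambda>h\<^sub>1 h\<^sub>2. \<gamma> s h\<^sub>1 \<odot>\<^bsub>H\<^esub> (inv\<^bsub>GL\<^esub> s \<otimes>\<^bsub>H\<^esub> h\<^sub>2 \<otimes>\<^bsub>H\<^esub> s)))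
      = tsum N (comult H h) (\<lambda>h\<^sub>1 h\<^sub>2. \<gamma> s h\<^sub>1 \<odot>\<^bsub>N\<^esub> g (h\<^sub>2 \<otimes>\<^bsub>H\<^esub> s))" .
  have "L (tsum H (comult H h) (\<lambda>h\<^sub>1 h\<^sub>2. \<gamma> s h\<^sub>2 \<odot>\<^bsub>H\<^esub> h\<^sub>1)) = tsum N (comult H h) (\<lambda>h\<^sub>1 h\<^sub>2. L (\<gamma> s h\<^sub>2 \<odot>\<^bsub>H\<^esub> h\<^sub>1))"
    by (rule tsum_image[OF vsH vsH vsH N L comult_closed[OF h]]) (rule linr | assumption)+
  also have "\<dots> = tsum N (comult H h) (\<lambda>h\<^sub>1 h\<^sub>2. \<gamma> s h\<^sub>2 \<odot>\<^bsub>N\<^esub> g (s \<otimes>\<^bsub>H\<^esub> h\<^sub>1))"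
    by (rule tsum_comult_cong[OF h]) (simp add: lin_smult[OF L] L_def[symmetric])
  finally show ?thesis using 1 compat0[OF s h] by simp
qed

text \<open>At a group-like \<open>t\<close> the compatibility condition reads \<gamma>(s)(t) t s =
  \<gamma>(s)(t) s t, and the scalar is invertible because \<gamma>(s) is multiplicative and
  \<open>t\<close> is invertible. Both pentagon identities need this to compare the orders of two
  characters.\<close>

lemma Gamma_commute:
  assumes s: "s \<in> \<Gamma>" and t: "t \<in> \<Gamma>"
  shows "s \<otimes>\<^bsub>H\<^esub> t = t \<otimes>\<^bsub>H\<^esub> s"
proof -
  note sH = Gamma_closed[OF s] and tH = Gamma_closed[OF t]
  have b1: "bilin H H H (\<lambda>h\<^sub>1 h\<^sub>2. \<gamma> s h\<^sub>1 \<odot>\<^bsub>H\<^esub> (h\<^sub>2 \<otimes>\<^bsub>H\<^esub> s))" and b2: "bilin H H H (\<lambda>h\<^sub>1 h\<^sub>2. \<gamma> s h\<^sub>2 \<odot>\<^bsub>H\<^esub> (s \<otimes>\<^bsub>H\<^esub> h\<^sub>1))"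
    by (rule bilinI; (rule linr s sH | assumption)+)+
  have "\<gamma> s t \<odot>\<^bsub>H\<^esub> (t \<otimes>\<^bsub>H\<^esub> s) = \<gamma> s t \<odot>\<^bsub>H\<^esub> (s \<otimes>\<^bsub>H\<^esub> t)"
    using compat[OF s tH vsH lin_id] tsum_comult_grouplike[OF Gamma_comult[OF t] tH vsH b1]
      tsum_comult_grouplike[OF Gamma_comult[OF t] tH vsH b2] by simp
  then have "\<gamma> s (inv\<^bsub>GL\<^esub> t) \<odot>\<^bsub>H\<^esub> (\<gamma> s t \<odot>\<^bsub>H\<^esub> (t \<otimes>\<^bsub>H\<^esub> s)) = \<gamma> s (inv\<^bsub>GL\<^esub> t) \<odot>\<^bsub>H\<^esub> (\<gamma> s t \<odot>\<^bsub>H\<^esub> (s \<otimes>\<^bsub>H\<^esub> t))" by simp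
  moreover have "\<gamma> s (inv\<^bsub>GL\<^esub> t) * \<gamma> s t = 1"
    using gamma_mult[OF s tH Gamma_closed[OF Gamma_inv[OF t]]] inv_GL(3)[OF Gamma_GL[OF t]] gamma_one[OF s]
    by (simp add: mult.commute)
  ultimately show ?thesis using sH tH by (simp add: vs_smult_smult)
qed

text \<open>Multiplicativity of \<gamma> makes \<gamma>(1) idempotent for convolution, and
  composition with the antipode gives it a left convolution inverse; hence it is the counit.
  Membership in \<open>hom\<close> by itself speaks only about products.\<close>

lemma gamma_unit:
  assumes h: "h \<in> carrier H"
  shows "\<gamma> \<one>\<^bsub>H\<^esub> h = counit H h"
proof -
  let ?c = "\<gamma> \<one>\<^bsub>H\<^esub>" and ?S = "antipode H"
  have lS: "lin H H ?S" using hopf by (simp add: hopf_algebra_def)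
  note lS' = lin_comp[OF lS] and cS = lin_closed[OF lS]
  note c = lin_gamma[OF Gamma_one] Gamma_one
  \<comment> \<open>Multiplicativity of the character turns the antipode identity into the statement
    that its composite with the antipode is a left convolution inverse.\<close>
  have conv: "tsum base (comult H k) (\<lambda>h\<^sub>1 h\<^sub>2. ?c (?S h\<^sub>1) * ?c h\<^sub>2) = counit H k" if k: "k \<in> carrier H" for k
  proof -
    have "?c (tsum H (comult H k) (\<lambda>h\<^sub>1 h\<^sub>2. ?S h\<^sub>1 \<otimes>\<^bsub>H\<^esub> h\<^sub>2)) = tsum base (comult H k) (\<lambda>h\<^sub>1 h\<^sub>2. ?c (?S h\<^sub>1 \<otimes>\<^bsub>H\<^esub> h\<^sub>2))"
      by (rule tsum_image[OF vsH vsH vsH vspace_base c(1) comult_closed[OF k]]) (rule linr cS | assumption)+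
    also have "\<dots> = tsum base (comult H k) (\<lambda>h\<^sub>1 h\<^sub>2. ?c (?S h\<^sub>1) * ?c h\<^sub>2)"
      by (rule tsum_comult_cong[OF k]) (simp add: gamma_mult[OF Gamma_one] cS)
    finally show ?thesis
      using hopf k lin_smult[OF c(1) one_closed] gamma_one[OF Gamma_one] by (simp add: hopf_algebra_def)
  qed
  have "?c h = tsum base (comult H h) (\<lambda>h\<^sub>1 h\<^sub>2. counit H h\<^sub>1 * ?c h\<^sub>2)"
    using comult_counit_left[OF vspace_base h c(1)] by simp
  also have "\<dots> = tsum base (comult H h) (\<lambda>h\<^sub>1 h\<^sub>2. tsum base (comult H h\<^sub>1) (\<lambda>k\<^sub>1 k\<^sub>2. ?c (?S k\<^sub>1) * (?c k\<^sub>2 * ?c h\<^sub>2)))"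
  proof (rule tsum_comult_cong[OF h])
    fix h\<^sub>1 h\<^sub>2 assume *: "h\<^sub>1 \<in> carrier H" "h\<^sub>2 \<in> carrier H"
    have "tsum base (comult H h\<^sub>1) (\<lambda>h\<^sub>1 k. ?c (?S h\<^sub>1) * ?c k) * ?c h\<^sub>2 = tsum base (comult H h\<^sub>1) (\<lambda>k\<^sub>1 k\<^sub>2. ?c (?S k\<^sub>1) * ?c k\<^sub>2 * ?c h\<^sub>2)"
      by (rule tsum_image[OF vsH vsH vspace_base vspace_base lin_mult_right[OF lin_id] comult_closed[OF *(1)]]) simp
    then show "counit H h\<^sub>1 * ?c h\<^sub>2 = tsum base (comult H h\<^sub>1) (\<lambda>k\<^sub>1 k\<^sub>2. ?c (?S k\<^sub>1) * (?c k\<^sub>2 * ?c h\<^sub>2))"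
      using conv[OF *(1)] by (simp add: mult.assoc)
  qed
  also have "\<dots> = tsum base (comult H h) (\<lambda>h\<^sub>1 h\<^sub>2. tsum base (comult H h\<^sub>2) (\<lambda>k\<^sub>1 k\<^sub>2. ?c (?S h\<^sub>1) * (?c k\<^sub>1 * ?c k\<^sub>2)))"
    by (rule comult_coassoc[OF vspace_base h, symmetric]) (rule linr lS' c cS | assumption)+
  also have "\<dots> = tsum base (comult H h) (\<lambda>h\<^sub>1 h\<^sub>2. ?c (?S h\<^sub>1) * ?c h\<^sub>2)"
  proof (rule tsum_comult_cong[OF h])
    fix h\<^sub>1 h\<^sub>2 assume *: "h\<^sub>1 \<in> carrier H" "h\<^sub>2 \<in> carrier H"
    have "?c (?S h\<^sub>1) * tsum base (comult H h\<^sub>2) (\<lambda>h\<^sub>1 k. ?c h\<^sub>1 * ?c k) = tsum base (comult H h\<^sub>2) (\<lambda>k\<^sub>1 k\<^sub>2. ?c (?S h\<^sub>1) * (?c k\<^sub>1 * ?c k\<^sub>2))"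
      by (rule tsum_image[OF vsH vsH vspace_base vspace_base lin_mult_left[OF lin_id] comult_closed[OF *(2)]]) simp
    then show "tsum base (comult H h\<^sub>2) (\<lambda>k\<^sub>1 k\<^sub>2. ?c (?S h\<^sub>1) * (?c k\<^sub>1 * ?c k\<^sub>2)) = ?c (?S h\<^sub>1) * ?c h\<^sub>2"
      using gamma_conv[OF Gamma_one Gamma_one *(2)] one_closed by simp
  qed
  also have "\<dots> = counit H h" by (rule conv[OF h])
  finally show ?thesis .
qed

lemma gamma_inv_conv:
  assumes s: "s \<in> \<Gamma>" and h: "h \<in> carrier H"
  shows "tsum base (comult H h) (\<lambda>h\<^sub>1 h\<^sub>2. \<gamma> s h\<^sub>1 * \<gamma> (inv\<^bsub>GL\<^esub> s) h\<^sub>2) = counit H h"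
    "tsum base (comult H h) (\<lambda>h\<^sub>1 h\<^sub>2. \<gamma> (inv\<^bsub>GL\<^esub> s) h\<^sub>1 * \<gamma> s h\<^sub>2) = counit H h"
  using gamma_conv[OF s Gamma_inv[OF s] h] gamma_conv[OF Gamma_inv[OF s] s h] inv_GL(2,3)[OF Gamma_GL[OF s]] gamma_unit[OF h] by simp_all

lemma gr_one:
  assumes "\<pi> s = delta a" "comult H s = pure H H s s" "s \<in> carrier H" "a \<in> carrier G"
  shows "s \<in> gH a"
proof -
  have "hom_part a self_comod s = tsum H (comult H s) (\<lambda>h k. \<pi> h a \<odot>\<^bsub>H\<^esub> k)" by (simp add: half_braid_def)
  also have "\<dots> = \<pi> s a \<odot>\<^bsub>H\<^esub> s"
    by (rule tsum_comult_grouplike[OF assms(2,3) vsH bilinI]) (rule linr | assumption)+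
  finally show ?thesis using assms by (simp add: gr_iff[OF comodule_self] delta_def)
qed

lemma Gamma_gr: "s \<in> \<Gamma> \<Longrightarrow> s \<in> gH \<one>\<^bsub>G\<^esub>"
  using Gamma_GL[of s] by (intro gr_one) (auto simp: GL_iff)

section \<open>Products in homogeneous degrees\<close>

lemma pi_mult_homog:
  assumes a: "a \<in> carrier G" and b: "b \<in> carrier G" and h: "h \<in> gH a" and k: "k \<in> gH b"
  shows "\<pi> (h \<otimes>\<^bsub>H\<^esub> k) (a \<otimes>\<^bsub>G\<^esub> b) = counit H h * counit H k"
proof -
  \<comment> \<open>If one of the counits vanishes, \<pi> vanishes on that factor and there is no
    contributing pair.\<close>
  have *: "{(x, y). x \<in> supp (\<pi> h) \<and> y \<in> supp (\<pi> k) \<and> x \<otimes>\<^bsub>G\<^esub> y = a \<otimes>\<^bsub>G\<^esub> b}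
      = (if counit H h = 0 \<or> counit H k = 0 then {} else {(a, b)})"
    unfolding pi_homog[OF a h] pi_homog[OF b k] by (auto simp: supp_def delta_def)
  have "\<pi> (h \<otimes>\<^bsub>H\<^esub> k) = \<pi> h \<otimes>\<^bsub>A\<^esub> \<pi> k" by (rule pi_mult[OF gH_carrier[OF h] gH_carrier[OF k]])
  then show ?thesis
    using * by (simp add: group_alg_simps) (simp add: pi_homog[OF a h] pi_homog[OF b k] delta_def)
qed

text \<open>Collapses one Sweedler sum: when on homogeneous legs the summand is the counit of one
  leg times a linear function of the other, the counit law applies. Nested sums are removed by using
  this once for each variable.\<close>

lemma reduce_left:
  assumes h: "h \<in> gH a" and a: "a \<in> carrier G" and N: "vspace N"
    and eq: "\<And>h\<^sub>1 h\<^sub>2. h\<^sub>1 \<in> gH a \<Longrightarrow> h\<^sub>2 \<in> gH a \<Longrightarrow> f h\<^sub>1 h\<^sub>2 = counit H h\<^sub>1 \<odot>\<^bsub>N\<^esub> g h\<^sub>2"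
    and g: "lin H N g" and f1: "\<And>k. k \<in> carrier H \<Longrightarrow> lin H N (\<lambda>h. f h k)" and f2: "\<And>k. k \<in> carrier H \<Longrightarrow> lin H N (\<lambda>h. f k h)"
  shows "tsum N (comult H h) f = g h"
proof -
  have "tsum N (comult H h) f = tsum N (comult H h) (\<lambda>h\<^sub>1 h\<^sub>2. counit H h\<^sub>1 \<odot>\<^bsub>N\<^esub> g h\<^sub>2)"
    by (rule tsum_comult_homog_cong[OF N a h bilinI bilinI eq]) (rule f1 f2 linr N g lin_closed[OF g] | assumption)+
  then show ?thesis using comult_counit_left[OF N gH_carrier[OF h] g] by simp
qed

lemma reduce_right:
  assumes h: "h \<in> gH a" and a: "a \<in> carrier G" and N: "vspace N"
    and eq: "\<And>h\<^sub>1 h\<^sub>2. h\<^sub>1 \<in> gH a \<Longrightarrow> h\<^sub>2 \<in> gH a \<Longrightarrow> f h\<^sub>1 h\<^sub>2 = counit H h\<^sub>2 \<odot>\<^bsub>N\<^esub> g h\<^sub>1"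
    and g: "lin H N g" and f1: "\<And>k. k \<in> carrier H \<Longrightarrow> lin H N (\<lambda>h. f h k)" and f2: "\<And>k. k \<in> carrier H \<Longrightarrow> lin H N (\<lambda>h. f k h)"
  shows "tsum N (comult H h) f = g h"
proof -
  have "tsum N (comult H h) f = tsum N (comult H h) (\<lambda>h\<^sub>1 h\<^sub>2. counit H h\<^sub>2 \<odot>\<^bsub>N\<^esub> g h\<^sub>1)"
    by (rule tsum_comult_homog_cong[OF N a h bilinI bilinI eq]) (rule f1 f2 linr N g lin_closed[OF g] | assumption)+
  then show ?thesis using comult_counit_right[OF N gH_carrier[OF h] g] by simp
qed

text \<open>On homogeneous legs the coordinate of \<pi> at the product degree is a product of
  counits, so both Sweedler sums in the projection of the product collapse.\<close>

lemma mult_gr: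
  assumes a: "a \<in> carrier G" and b: "b \<in> carrier G" and h: "h \<in> gH a" and k: "k \<in> gH b"
  shows "h \<otimes>\<^bsub>H\<^esub> k \<in> gH (a \<otimes>\<^bsub>G\<^esub> b)"
proof -
  let ?c = "a \<otimes>\<^bsub>G\<^esub> b"
  note hH = gH_carrier[OF h] and kH = gH_carrier[OF k]
  have "hom_part ?c self_comod (h \<otimes>\<^bsub>H\<^esub> k) = tsum H (comult H (h \<otimes>\<^bsub>H\<^esub> k)) (\<lambda>x y. \<pi> x ?c \<odot>\<^bsub>H\<^esub> y)"
    by (simp add: half_braid_def)
  also have "\<dots> = tsum H (comult H h) (\<lambda>h\<^sub>1 h\<^sub>2. tsum H (comult H k) (\<lambda>k\<^sub>1 k\<^sub>2. \<pi> (h\<^sub>1 \<otimes>\<^bsub>H\<^esub> k\<^sub>1) ?c \<odot>\<^bsub>H\<^esub> (h\<^sub>2 \<otimes>\<^bsub>H\<^esub> k\<^sub>2)))"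
    by (rule tsum_comult_mult[OF hH kH vsH bilinI]) (rule linr | assumption)+
  also have "\<dots> = h \<otimes>\<^bsub>H\<^esub> k"
  proof (rule reduce_left[OF h a vsH])
    fix h\<^sub>1 h\<^sub>2 assume h12: "h\<^sub>1 \<in> gH a" "h\<^sub>2 \<in> gH a"
    show "tsum H (comult H k) (\<lambda>k\<^sub>1 k\<^sub>2. \<pi> (h\<^sub>1 \<otimes>\<^bsub>H\<^esub> k\<^sub>1) ?c \<odot>\<^bsub>H\<^esub> (h\<^sub>2 \<otimes>\<^bsub>H\<^esub> k\<^sub>2)) = counit H h\<^sub>1 \<odot>\<^bsub>H\<^esub> (h\<^sub>2 \<otimes>\<^bsub>H\<^esub> k)"
    proof (rule reduce_left[OF k b vsH])
      fix k\<^sub>1 k\<^sub>2 assume k12: "k\<^sub>1 \<in> gH b" "k\<^sub>2 \<in> gH b"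
      show "\<pi> (h\<^sub>1 \<otimes>\<^bsub>H\<^esub> k\<^sub>1) ?c \<odot>\<^bsub>H\<^esub> (h\<^sub>2 \<otimes>\<^bsub>H\<^esub> k\<^sub>2) = counit H k\<^sub>1 \<odot>\<^bsub>H\<^esub> (counit H h\<^sub>1 \<odot>\<^bsub>H\<^esub> (h\<^sub>2 \<otimes>\<^bsub>H\<^esub> k\<^sub>2))"
        using h12 k12 gH_carrier by (simp add: pi_mult_homog[OF a b] vs_smult_smult mult.commute)
    qed (rule linr gH_carrier[OF h12(1)] gH_carrier[OF h12(2)] | assumption)+
  qed (rule linr kH | assumption)+
  finally show ?thesis using hH kH a b by (simp add: gr_iff[OF comodule_self])
qed

end

section \<open>The zested coquasi-bialgebra\<close>

context zesting
begin

interpretation R: ring H by (rule ringH)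
interpretation Gr: group G by (rule grp)

lemma lin_gsum_self [linr]:
  "lin M H F \<Longrightarrow> vspace N \<Longrightarrow> (\<And>a. a \<in> carrier G \<Longrightarrow> lin H N (\<phi> a)) \<Longrightarrow> lin M N (\<lambda>x. gsum N self_comod \<phi> (F x))"
  using lin_gsum[OF _ comodule_self, of M F N \<phi>] by simp

lemma lin_gsum_self_param [linr]:
  "y \<in> carrier H \<Longrightarrow> vspace M \<Longrightarrow> vspace N
    \<Longrightarrow> (\<And>a y. a \<in> carrier G \<Longrightarrow> y \<in> carrier H \<Longrightarrow> lin M N (\<lambda>x. \<phi> x a y))
    \<Longrightarrow> lin M N (\<lambda>x. gsum N self_comod (\<phi> x) y)"
  using lin_gsum_param[OF _ comodule_self, of y M N \<phi>] by simp

lemma gsum_homog_self: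
  "a \<in> carrier G \<Longrightarrow> x \<in> gH a \<Longrightarrow> vspace N \<Longrightarrow> (\<And>a. a \<in> carrier G \<Longrightarrow> lin H N (\<phi> a)) \<Longrightarrow> gsum N self_comod \<phi> x = \<phi> a x"
  using gsum_homog[OF comodule_self, of N a x \<phi>] by simp

section \<open>Product and associator extended from homogeneous elements\<close>

definition zmult :: "'h \<Rightarrow> 'h \<Rightarrow> 'h" where
  "zmult h k = gsum H self_comod (\<lambda>a h'. gsum H self_comod (\<lambda>b k'. h' \<otimes>\<^bsub>H\<^esub> k' \<otimes>\<^bsub>H\<^esub> \<Lambda> a b) k) h"

text \<open>The parameters \<open>w\<close> and \<open>\<sigma>\<close> allow one construction for
  the associator and for its convolution inverse, which uses inverse scalars and inverse
  group-likes. The counit of a product is written as the product of counits, which makes the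
  dependence on each argument visibly linear.\<close>

definition zform :: "('g \<Rightarrow> 'g \<Rightarrow> 'g \<Rightarrow> 'k) \<Rightarrow> ('g \<Rightarrow> 'g \<Rightarrow> 'h) \<Rightarrow> 'h \<Rightarrow> 'h \<Rightarrow> 'h \<Rightarrow> 'k" where
  "zform w \<sigma> h k l = gsum base self_comod (\<lambda>a h'. gsum base self_comod (\<lambda>b k'.
     gsum base self_comod (\<lambda>c l'. counit H h' * (counit H k' * (w a b c * \<gamma> (\<sigma> a b) l'))) l) k) h"

abbreviation "\<Omega> \<equiv> zform \<omega> \<Lambda>"
abbreviation "\<Omega>' \<equiv> zform (\<lambda>a b c. inverse (\<omega> a b c)) (\<lambda>a b. inv\<^bsub>GL\<^esub> (\<Lambda> a b))"

lemma Lambda_H: "a \<in> carrier G \<Longrightarrow> b \<in> carrier G \<Longrightarrow> \<Lambda> a b \<in> carrier H"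
  by (rule Gamma_closed[OF Lambda_closed])

lemma zmult_homog:
  assumes a: "a \<in> carrier G" and b: "b \<in> carrier G" and h: "h \<in> gH a" and k: "k \<in> gH b"
  shows "zmult h k = h \<otimes>\<^bsub>H\<^esub> k \<otimes>\<^bsub>H\<^esub> \<Lambda> a b"
proof -
  note hH = gH_carrier[OF h] and kH = gH_carrier[OF k]
  have "zmult h k = gsum H self_comod (\<lambda>b k'. h \<otimes>\<^bsub>H\<^esub> k' \<otimes>\<^bsub>H\<^esub> \<Lambda> a b) k"
    unfolding zmult_def
    by (rule gsum_homog_self[OF a h vsH]) (rule linr kH Lambda_H | assumption)+
  also have "\<dots> = h \<otimes>\<^bsub>H\<^esub> k \<otimes>\<^bsub>H\<^esub> \<Lambda> a b"
    by (rule gsum_homog_self[OF b k vsH]) (rule linr hH a Lambda_H | assumption)+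
  finally show ?thesis .
qed

lemma lin_zmult_left [linr]: "lin M H F \<Longrightarrow> k \<in> carrier H \<Longrightarrow> lin M H (\<lambda>x. zmult (F x) k)"
  unfolding zmult_def by (rule linr Lambda_H | assumption)+

lemma lin_zmult_right [linr]:
  assumes "lin M H F" "h \<in> carrier H"
  shows "lin M H (\<lambda>x. zmult h (F x))"
proof -
  have "lin H H (zmult h)" unfolding zmult_def[abs_def] by (rule linr Lambda_H assms | assumption)+
  then show ?thesis by (rule lin_comp[OF _ assms(1)])
qed

lemma zmult_closed [linr]: "h \<in> carrier H \<Longrightarrow> k \<in> carrier H \<Longrightarrow> zmult h k \<in> carrier H"
  by (rule lin_closed[OF lin_zmult_left[OF lin_id]])

lemma zform_homog:
  assumes a: "a \<in> carrier G" and b: "b \<in> carrier G" and c: "c \<in> carrier G"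
    and h: "h \<in> gH a" and k: "k \<in> gH b" and l: "l \<in> gH c"
    and \<sigma>: "\<And>a b. a \<in> carrier G \<Longrightarrow> b \<in> carrier G \<Longrightarrow> \<sigma> a b \<in> \<Gamma>"
  shows "zform w \<sigma> h k l = counit H h * (counit H k * (w a b c * \<gamma> (\<sigma> a b) l))"
proof -
  note hH = gH_carrier[OF h] and kH = gH_carrier[OF k] and lH = gH_carrier[OF l]
  have "zform w \<sigma> h k l = gsum base self_comod (\<lambda>b k'.
     gsum base self_comod (\<lambda>c l'. counit H h * (counit H k' * (w a b c * \<gamma> (\<sigma> a b) l'))) l) k"
    unfolding zform_def
    by (rule gsum_homog_self[OF a h vspace_base]) (rule linr kH lH \<sigma> | assumption)+
  also have "\<dots> = gsum base self_comod (\<lambda>c l'. counit H h * (counit H k * (w a b c * \<gamma> (\<sigma> a b) l'))) l"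
    by (rule gsum_homog_self[OF b k vspace_base]) (rule linr lH a \<sigma> | assumption)+
  also have "\<dots> = counit H h * (counit H k * (w a b c * \<gamma> (\<sigma> a b) l))"
    by (rule gsum_homog_self[OF c l vspace_base]) (rule linr a b \<sigma> | assumption)+
  finally show ?thesis .
qed

lemma lin_zform:
  assumes \<sigma>: "\<And>a b. a \<in> carrier G \<Longrightarrow> b \<in> carrier G \<Longrightarrow> \<sigma> a b \<in> \<Gamma>"
    and h: "h \<in> carrier H" and k: "k \<in> carrier H" and F: "lin M H F"
  shows "lin M base (\<lambda>x. zform w \<sigma> (F x) h k)" "lin M base (\<lambda>x. zform w \<sigma> h (F x) k)" "lin M base (\<lambda>x. zform w \<sigma> h k (F x))"
proof -
  have "lin H base (\<lambda>x. zform w \<sigma> x h k)" "lin H base (\<lambda>x. zform w \<sigma> h x k)" "lin H base (\<lambda>x. zform w \<sigma> h k x)"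
    unfolding zform_def[abs_def] by (rule linr h k \<sigma> | assumption)+
  then show "lin M base (\<lambda>x. zform w \<sigma> (F x) h k)" "lin M base (\<lambda>x. zform w \<sigma> h (F x) k)" "lin M base (\<lambda>x. zform w \<sigma> h k (F x))"
    using lin_comp[OF _ F] by blast+
qed

lemma Lambda_inv_closed: "a \<in> carrier G \<Longrightarrow> b \<in> carrier G \<Longrightarrow> inv\<^bsub>GL\<^esub> (\<Lambda> a b) \<in> \<Gamma>"
  by (rule Gamma_inv[OF Lambda_closed])

lemma lin_Omega [linr]:
  assumes "lin M H F" "h \<in> carrier H" "k \<in> carrier H"
  shows "lin M base (\<lambda>x. \<Omega> (F x) h k)" "lin M base (\<lambda>x. \<Omega> h (F x) k)" "lin M base (\<lambda>x. \<Omega> h k (F x))"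
    "lin M base (\<lambda>x. \<Omega>' (F x) h k)" "lin M base (\<lambda>x. \<Omega>' h (F x) k)" "lin M base (\<lambda>x. \<Omega>' h k (F x))"
  by (intro lin_zform Lambda_closed Lambda_inv_closed assms; assumption)+

lemma Omega_homog:
  assumes "a \<in> carrier G" "b \<in> carrier G" "c \<in> carrier G" "h \<in> gH a" "k \<in> gH b" "l \<in> gH c"
  shows "\<Omega> h k l = counit H h * (counit H k * (\<omega> a b c * \<gamma> (\<Lambda> a b) l))"
    "\<Omega>' h k l = counit H h * (counit H k * (inverse (\<omega> a b c) * \<gamma> (inv\<^bsub>GL\<^esub> (\<Lambda> a b)) l))"
  by (rule zform_homog[OF assms]; intro Lambda_closed Lambda_inv_closed; assumption)+

text \<open>The extra factor \<open>\<Lambda> a b\<close> is homogeneous of trivial degree and does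
  not change the degree of the product in \<open>H\<close>.\<close>

lemma zmult_gr:
  assumes a: "a \<in> carrier G" and b: "b \<in> carrier G" and h: "h \<in> gH a" and k: "k \<in> gH b"
  shows "zmult h k \<in> gH (a \<otimes>\<^bsub>G\<^esub> b)"
  using mult_gr[OF _ _ mult_gr[OF a b h k] Gamma_gr[OF Lambda_closed[OF a b]]] a b zmult_homog[OF a b h k] by simp

lemma counit_zmult_homog:
  assumes a: "a \<in> carrier G" and b: "b \<in> carrier G" and h: "h \<in> gH a" and k: "k \<in> gH b"
  shows "counit H (zmult h k) = counit H h * counit H k"
  using assms Gamma_counit[OF Lambda_closed[OF a b]]
  by (simp add: zmult_homog counit_mult gH_carrier Lambda_H mult_closed)

lemma counit_zmult:
  assumes "h \<in> carrier H" "k \<in> carrier H"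
  shows "counit H (zmult h k) = counit H h * counit H k"
proof (rule homog_ext_H[OF vspace_base assms(1), where f="\<lambda>h. counit H (zmult h k)" and g="\<lambda>h. counit H h * counit H k"])
  fix a h assume a: "a \<in> carrier G" and h: "h \<in> gH a"
  show "counit H (zmult h k) = counit H h * counit H k"
    by (rule homog_ext_H[OF vspace_base assms(2), where f="\<lambda>k. counit H (zmult h k)" and g="\<lambda>k. counit H h * counit H k"])
      (rule linr gH_carrier[OF h] counit_zmult_homog[OF a _ h] | assumption)+
qed (rule linr assms)+

text \<open>The factor \<open>\<Lambda> a b\<close> is group-like, so it appears on both legs of the
  coproduct. The legs of \<open>h\<close> and \<open>k\<close> keep the degrees \<open>a\<close> and
  \<open>b\<close>, so on each leg it is the factor that \<open>zmult\<close> prescribes.\<close>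

lemma comult_zmult:
  assumes hH: "h \<in> carrier H" and kH: "k \<in> carrier H"
  shows "comult H (zmult h k) = tsum (tensor H H) (comult H h) (\<lambda>h\<^sub>1 h\<^sub>2. tsum (tensor H H) (comult H k) (\<lambda>k\<^sub>1 k\<^sub>2.
    pure H H (zmult h\<^sub>1 k\<^sub>1) (zmult h\<^sub>2 k\<^sub>2)))" (is "_ = ?R h k")
proof (rule homog_ext_H[OF _ hH, where f="\<lambda>h. comult H (zmult h k)" and g="\<lambda>h. ?R h k" and N="tensor H H"])
  let ?T = "tensor H H"
  show vT: "vspace ?T" by (rule linr)+
  fix a h assume a: "a \<in> carrier G" and h: "h \<in> gH a"
  note hH = gH_carrier[OF h]
  show "comult H (zmult h k) = ?R h k"
  proof (rule homog_ext_H[OF vT kH, where f="\<lambda>k. comult H (zmult h k)" and g="\<lambda>k. ?R h k"])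
    fix b k assume b: "b \<in> carrier G" and k: "k \<in> gH b"
    let ?s = "\<Lambda> a b"
    note kH = gH_carrier[OF k] and sG = Lambda_closed[OF a b] and sH = Lambda_H[OF a b]
    have bp: "bilin H H ?T (\<lambda>x y. pure H H (x \<otimes>\<^bsub>H\<^esub> ?s) (y \<otimes>\<^bsub>H\<^esub> ?s))" by (rule bilinI) (rule linr sH | assumption)+
    have "comult H (zmult h k) = tsum ?T (comult H (h \<otimes>\<^bsub>H\<^esub> k \<otimes>\<^bsub>H\<^esub> ?s)) (pure H H)"
      unfolding zmult_homog[OF a b h k]
      by (rule tsum_pure_id[OF vsH vsH, symmetric]) (rule linr hH kH sH)+
    also have "\<dots> = tsum ?T (comult H (h \<otimes>\<^bsub>H\<^esub> k)) (\<lambda>x\<^sub>1 x\<^sub>2. tsum ?T (comult H ?s) (\<lambda>s\<^sub>1 s\<^sub>2. pure H H (x\<^sub>1 \<otimes>\<^bsub>H\<^esub> s\<^sub>1) (x\<^sub>2 \<otimes>\<^bsub>H\<^esub> s\<^sub>2)))"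
      by (rule tsum_comult_mult[OF mult_closed[OF hH kH] sH vT bilin_pure[OF vsH vsH]])
    also have "\<dots> = tsum ?T (comult H (h \<otimes>\<^bsub>H\<^esub> k)) (\<lambda>x\<^sub>1 x\<^sub>2. pure H H (x\<^sub>1 \<otimes>\<^bsub>H\<^esub> ?s) (x\<^sub>2 \<otimes>\<^bsub>H\<^esub> ?s))"
      by (rule tsum_comult_cong[OF mult_closed[OF hH kH]], rule tsum_comult_grouplike[OF Gamma_comult[OF sG] sH vT bilinI])
        (rule linr sH | assumption)+
    also have "\<dots> = tsum ?T (comult H h) (\<lambda>h\<^sub>1 h\<^sub>2. tsum ?T (comult H k) (\<lambda>k\<^sub>1 k\<^sub>2. pure H H (h\<^sub>1 \<otimes>\<^bsub>H\<^esub> k\<^sub>1 \<otimes>\<^bsub>H\<^esub> ?s) (h\<^sub>2 \<otimes>\<^bsub>H\<^esub> k\<^sub>2 \<otimes>\<^bsub>H\<^esub> ?s)))"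
      by (rule tsum_comult_mult[OF hH kH vT bp])
    also have "\<dots> = ?R h k"
    proof (rule tsum_comult_homog_cong[OF vT a h bilinI bilinI])
      fix h\<^sub>1 h\<^sub>2 assume h12: "h\<^sub>1 \<in> gH a" "h\<^sub>2 \<in> gH a"
      show "tsum ?T (comult H k) (\<lambda>k\<^sub>1 k\<^sub>2. pure H H (h\<^sub>1 \<otimes>\<^bsub>H\<^esub> k\<^sub>1 \<otimes>\<^bsub>H\<^esub> ?s) (h\<^sub>2 \<otimes>\<^bsub>H\<^esub> k\<^sub>2 \<otimes>\<^bsub>H\<^esub> ?s))
          = tsum ?T (comult H k) (\<lambda>k\<^sub>1 k\<^sub>2. pure H H (zmult h\<^sub>1 k\<^sub>1) (zmult h\<^sub>2 k\<^sub>2))"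
      proof (rule tsum_comult_homog_cong[OF vT b k bilinI bilinI])
        fix k\<^sub>1 k\<^sub>2 assume k12: "k\<^sub>1 \<in> gH b" "k\<^sub>2 \<in> gH b"
        show "pure H H (h\<^sub>1 \<otimes>\<^bsub>H\<^esub> k\<^sub>1 \<otimes>\<^bsub>H\<^esub> ?s) (h\<^sub>2 \<otimes>\<^bsub>H\<^esub> k\<^sub>2 \<otimes>\<^bsub>H\<^esub> ?s) = pure H H (zmult h\<^sub>1 k\<^sub>1) (zmult h\<^sub>2 k\<^sub>2)"
          using h12 k12 by (simp add: zmult_homog[OF a b])
      qed (rule linr gH_carrier[OF h12(1)] gH_carrier[OF h12(2)] sH | assumption)+
    qed (rule linr kH sH | assumption)+
    finally show "comult H (zmult h k) = ?R h k" .
  qed (rule linr hH | assumption)+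
qed (rule linr kH | assumption)+

lemma zmult_one:
  assumes hH: "h \<in> carrier H"
  shows "zmult \<one>\<^bsub>H\<^esub> h = h" "zmult h \<one>\<^bsub>H\<^esub> = h"
proof -
  have e: "\<one>\<^bsub>H\<^esub> \<in> gH \<one>\<^bsub>G\<^esub>" by (rule Gamma_gr[OF Gamma_one])
  show "zmult \<one>\<^bsub>H\<^esub> h = h"
    by (rule homog_ext_H[OF vsH hH, where f="\<lambda>h. zmult \<one>\<^bsub>H\<^esub> h" and g="\<lambda>h. h"])
      (rule linr | simp add: zmult_homog[OF _ _ e] Lambda_one gH_carrier)+
  show "zmult h \<one>\<^bsub>H\<^esub> = h"
    by (rule homog_ext_H[OF vsH hH, where f="\<lambda>h. zmult h \<one>\<^bsub>H\<^esub>" and g="\<lambda>h. h"])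
      (rule linr | simp add: zmult_homog[OF _ _ _ e] Lambda_one gH_carrier)+
qed

lemma Omega_one:
  assumes hH: "h \<in> carrier H" and kH: "k \<in> carrier H"
  shows "\<Omega> h \<one>\<^bsub>H\<^esub> k = counit H h * counit H k"
proof -
  have e: "\<one>\<^bsub>H\<^esub> \<in> gH \<one>\<^bsub>G\<^esub>" by (rule Gamma_gr[OF Gamma_one])
  show ?thesis
  proof (rule homog_ext_H[OF vspace_base hH, where f="\<lambda>h. \<Omega> h \<one>\<^bsub>H\<^esub> k" and g="\<lambda>h. counit H h * counit H k"])
    fix a h assume a: "a \<in> carrier G" and h: "h \<in> gH a"
    show "\<Omega> h \<one>\<^bsub>H\<^esub> k = counit H h * counit H k"
    proof (rule homog_ext_H[OF vspace_base kH, where f="\<lambda>k. \<Omega> h \<one>\<^bsub>H\<^esub> k" and g="\<lambda>k. counit H h * counit H k"])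
      fix b k assume "b \<in> carrier G" "k \<in> gH b"
      then show "\<Omega> h \<one>\<^bsub>H\<^esub> k = counit H h * counit H k"
        using a h by (simp add: Omega_homog(1)[OF _ _ _ _ e] Lambda_one counit_one omega_one gamma_unit gH_carrier)
    qed (rule linr gH_carrier[OF h])+
  qed (rule linr kH)+
qed

text \<open>In degrees a, b, c the associator contributes only \<omega>(a,b,c) and a value of
  \<gamma>(\<Lambda>(a,b)) on one leg of \<open>l\<close>. One side has \<Lambda>(a,b) to the left
  of the other leg of \<open>l\<close>, the other side can be brought to have it on the right, and
  \<open>compat\<close> exchanges the two.\<close>

lemma quasi_assoc:
  assumes hH: "h \<in> carrier H" and kH: "k \<in> carrier H" and lH: "l \<in> carrier H"
  shows "tsum H (comult H h) (\<lambda>h\<^sub>1 h\<^sub>2. tsum H (comult H k) (\<lambda>k\<^sub>1 k\<^sub>2. tsum H (comult H l) (\<lambda>l\<^sub>1 l\<^sub>2.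
            \<Omega> h\<^sub>2 k\<^sub>2 l\<^sub>2 \<odot>\<^bsub>H\<^esub> zmult (zmult h\<^sub>1 k\<^sub>1) l\<^sub>1)))
       = tsum H (comult H h) (\<lambda>h\<^sub>1 h\<^sub>2. tsum H (comult H k) (\<lambda>k\<^sub>1 k\<^sub>2. tsum H (comult H l) (\<lambda>l\<^sub>1 l\<^sub>2.
            \<Omega> h\<^sub>1 k\<^sub>1 l\<^sub>1 \<odot>\<^bsub>H\<^esub> zmult h\<^sub>2 (zmult k\<^sub>2 l\<^sub>2))))" (is "?L h k l = ?R h k l")
proof (rule homog_ext_H[OF vsH hH, where f="\<lambda>h. ?L h k l" and g="\<lambda>h. ?R h k l"])
  fix a h assume a: "a \<in> carrier G" and h: "h \<in> gH a"
  note hH = gH_carrier[OF h]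
  show "?L h k l = ?R h k l"
  proof (rule homog_ext_H[OF vsH kH, where f="\<lambda>k. ?L h k l" and g="\<lambda>k. ?R h k l"])
    fix b k assume b: "b \<in> carrier G" and k: "k \<in> gH b"
    note kH = gH_carrier[OF k]
    show "?L h k l = ?R h k l"
    proof (rule homog_ext_H[OF vsH lH, where f="\<lambda>l. ?L h k l" and g="\<lambda>l. ?R h k l"])
      fix c l assume c: "c \<in> carrier G" and l: "l \<in> gH c"
      note lH = gH_carrier[OF l]
      let ?s = "\<Lambda> a b" and ?t = "\<Lambda> (a \<otimes>\<^bsub>G\<^esub> b) c" and ?u = "\<Lambda> b c" and ?v = "\<Lambda> a (b \<otimes>\<^bsub>G\<^esub> c)" and ?w = "\<omega> a b c"
      note sG = Lambda_closed[OF a b] and sH = Lambda_H[OF a b] and uH = Lambda_H[OF b c]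
      have ab: "a \<otimes>\<^bsub>G\<^esub> b \<in> carrier G" and bc: "b \<otimes>\<^bsub>G\<^esub> c \<in> carrier G" using a b c by auto
      note tH = Lambda_H[OF ab c] and vH = Lambda_H[OF a bc]
      note cl = sH uH tH vH sG hH kH lH
      \<comment> \<open>\<open>X\<close> and \<open>Y\<close> are what remains of the two sides once
        the sums over \<open>h\<close> and \<open>k\<close> have collapsed; they differ in the
        position of \<open>?s\<close> and in the leg of \<open>l\<close> that carries the
        character.\<close>
      define X where "X x y = tsum H (comult H l) (\<lambda>l\<^sub>1 l\<^sub>2. \<gamma> ?s l\<^sub>2 \<odot>\<^bsub>H\<^esub> (?w \<odot>\<^bsub>H\<^esub> (x \<otimes>\<^bsub>H\<^esub> y \<otimes>\<^bsub>H\<^esub> (?s \<otimes>\<^bsub>H\<^esub> l\<^sub>1) \<otimes>\<^bsub>H\<^esub> ?t)))" for x y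
      define Y where "Y x y = tsum H (comult H l) (\<lambda>l\<^sub>1 l\<^sub>2. \<gamma> ?s l\<^sub>1 \<odot>\<^bsub>H\<^esub> (?w \<odot>\<^bsub>H\<^esub> (x \<otimes>\<^bsub>H\<^esub> y \<otimes>\<^bsub>H\<^esub> (l\<^sub>2 \<otimes>\<^bsub>H\<^esub> ?s) \<otimes>\<^bsub>H\<^esub> ?t)))" for x y
      have lX: "lin H H (\<lambda>x. X x y)" "lin H H (\<lambda>x. X y x)" "lin H H (\<lambda>x. Y x y)" "lin H H (\<lambda>x. Y y x)" if "y \<in> carrier H" for y
        unfolding X_def Y_def by (rule linr that cl | assumption)+
      have Xc: "X x y \<in> carrier H" "Y x y \<in> carrier H" if "x \<in> carrier H" "y \<in> carrier H" for x y
        using lin_closed[OF lX(1)] lin_closed[OF lX(3)] that by auto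
      have "?L h k l = X h k"
      proof (rule reduce_right[OF h a vsH])
        fix h\<^sub>1 h\<^sub>2 assume h12: "h\<^sub>1 \<in> gH a" "h\<^sub>2 \<in> gH a"
        note hc = h12[THEN gH_carrier]
        show "tsum H (comult H k) (\<lambda>k\<^sub>1 k\<^sub>2. tsum H (comult H l) (\<lambda>l\<^sub>1 l\<^sub>2. \<Omega> h\<^sub>2 k\<^sub>2 l\<^sub>2 \<odot>\<^bsub>H\<^esub> zmult (zmult h\<^sub>1 k\<^sub>1) l\<^sub>1))
            = counit H h\<^sub>2 \<odot>\<^bsub>H\<^esub> X h\<^sub>1 k"
        proof (rule reduce_right[OF k b vsH])
          fix k\<^sub>1 k\<^sub>2 assume k12: "k\<^sub>1 \<in> gH b" "k\<^sub>2 \<in> gH b"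
          note kc = k12[THEN gH_carrier]
          have "tsum H (comult H l) (\<lambda>l\<^sub>1 l\<^sub>2. \<Omega> h\<^sub>2 k\<^sub>2 l\<^sub>2 \<odot>\<^bsub>H\<^esub> zmult (zmult h\<^sub>1 k\<^sub>1) l\<^sub>1)
              = tsum H (comult H l) (\<lambda>l\<^sub>1 l\<^sub>2. (counit H k\<^sub>2 * counit H h\<^sub>2) \<odot>\<^bsub>H\<^esub> (\<gamma> ?s l\<^sub>2 \<odot>\<^bsub>H\<^esub> (?w \<odot>\<^bsub>H\<^esub> (h\<^sub>1 \<otimes>\<^bsub>H\<^esub> k\<^sub>1 \<otimes>\<^bsub>H\<^esub> (?s \<otimes>\<^bsub>H\<^esub> l\<^sub>1) \<otimes>\<^bsub>H\<^esub> ?t))))"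
          proof (rule tsum_comult_homog_cong[OF vsH c l bilinI bilinI])
            fix l\<^sub>1 l\<^sub>2 assume l12: "l\<^sub>1 \<in> gH c" "l\<^sub>2 \<in> gH c"
            show "\<Omega> h\<^sub>2 k\<^sub>2 l\<^sub>2 \<odot>\<^bsub>H\<^esub> zmult (zmult h\<^sub>1 k\<^sub>1) l\<^sub>1
                = (counit H k\<^sub>2 * counit H h\<^sub>2) \<odot>\<^bsub>H\<^esub> (\<gamma> ?s l\<^sub>2 \<odot>\<^bsub>H\<^esub> (?w \<odot>\<^bsub>H\<^esub> (h\<^sub>1 \<otimes>\<^bsub>H\<^esub> k\<^sub>1 \<otimes>\<^bsub>H\<^esub> (?s \<otimes>\<^bsub>H\<^esub> l\<^sub>1) \<otimes>\<^bsub>H\<^esub> ?t)))"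
              using h12 k12 l12 hc kc l12[THEN gH_carrier] cl ab zmult_gr[OF a b h12(1) k12(1)]
              by (simp add: Omega_homog(1)[OF a b c] zmult_homog[OF ab c] zmult_homog[OF a b] vs_smult_smult R.m_assoc mult_ac)
          qed (rule linr hc kc cl | assumption)+
          also have "\<dots> = (counit H k\<^sub>2 * counit H h\<^sub>2) \<odot>\<^bsub>H\<^esub> X h\<^sub>1 k\<^sub>1"
            unfolding X_def by (rule tsum_scale[OF vsH vsH vsH comult_closed[OF lH]]) (rule linr hc kc cl | assumption)+
          finally show "tsum H (comult H l) (\<lambda>l\<^sub>1 l\<^sub>2. \<Omega> h\<^sub>2 k\<^sub>2 l\<^sub>2 \<odot>\<^bsub>H\<^esub> zmult (zmult h\<^sub>1 k\<^sub>1) l\<^sub>1) = counit H k\<^sub>2 \<odot>\<^bsub>H\<^esub> (counit H h\<^sub>2 \<odot>\<^bsub>H\<^esub> X h\<^sub>1 k\<^sub>1)"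
            using Xc hc kc by (simp add: vs_smult_smult)
        qed (rule linr lX hc cl | assumption)+
      qed (rule linr lX cl | assumption)+
      \<comment> \<open>\<open>compat\<close> is applied with all factors around the leg of
        \<open>l\<close> gathered in the linear map.\<close>
      also have "X h k = Y h k"
        unfolding X_def Y_def
        by (rule compat[OF sG lH vsH, of "\<lambda>x. ?w \<odot>\<^bsub>H\<^esub> (h \<otimes>\<^bsub>H\<^esub> k \<otimes>\<^bsub>H\<^esub> x \<otimes>\<^bsub>H\<^esub> ?t)", symmetric]) (rule linr cl)+
      also have "Y h k = ?R h k l"
      proof (rule reduce_left[OF h a vsH, symmetric])
        fix h\<^sub>1 h\<^sub>2 assume h12: "h\<^sub>1 \<in> gH a" "h\<^sub>2 \<in> gH a"
        note hc = h12[THEN gH_carrier]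
        show "tsum H (comult H k) (\<lambda>k\<^sub>1 k\<^sub>2. tsum H (comult H l) (\<lambda>l\<^sub>1 l\<^sub>2. \<Omega> h\<^sub>1 k\<^sub>1 l\<^sub>1 \<odot>\<^bsub>H\<^esub> zmult h\<^sub>2 (zmult k\<^sub>2 l\<^sub>2)))
            = counit H h\<^sub>1 \<odot>\<^bsub>H\<^esub> Y h\<^sub>2 k"
        proof (rule reduce_left[OF k b vsH])
          fix k\<^sub>1 k\<^sub>2 assume k12: "k\<^sub>1 \<in> gH b" "k\<^sub>2 \<in> gH b"
          note kc = k12[THEN gH_carrier]
          have "tsum H (comult H l) (\<lambda>l\<^sub>1 l\<^sub>2. \<Omega> h\<^sub>1 k\<^sub>1 l\<^sub>1 \<odot>\<^bsub>H\<^esub> zmult h\<^sub>2 (zmult k\<^sub>2 l\<^sub>2))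
              = tsum H (comult H l) (\<lambda>l\<^sub>1 l\<^sub>2. (counit H k\<^sub>1 * counit H h\<^sub>1) \<odot>\<^bsub>H\<^esub> (\<gamma> ?s l\<^sub>1 \<odot>\<^bsub>H\<^esub> (?w \<odot>\<^bsub>H\<^esub> (h\<^sub>2 \<otimes>\<^bsub>H\<^esub> k\<^sub>2 \<otimes>\<^bsub>H\<^esub> (l\<^sub>2 \<otimes>\<^bsub>H\<^esub> ?s) \<otimes>\<^bsub>H\<^esub> ?t))))"
          proof (rule tsum_comult_homog_cong[OF vsH c l bilinI bilinI])
            fix l\<^sub>1 l\<^sub>2 assume l12: "l\<^sub>1 \<in> gH c" "l\<^sub>2 \<in> gH c"
            note lc = l12[THEN gH_carrier]
            have "zmult h\<^sub>2 (zmult k\<^sub>2 l\<^sub>2) = h\<^sub>2 \<otimes>\<^bsub>H\<^esub> k\<^sub>2 \<otimes>\<^bsub>H\<^esub> l\<^sub>2 \<otimes>\<^bsub>H\<^esub> (?u \<otimes>\<^bsub>H\<^esub> ?v)"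
              using h12 k12 l12 hc kc lc cl zmult_gr[OF b c k12(2) l12(2)]
              by (simp add: zmult_homog[OF a bc] zmult_homog[OF b c] R.m_assoc)
            \<comment> \<open>The cocycle condition replaces \<Lambda>(b,c)\<Lambda>(a,bc) by
              \<Lambda>(a,b)\<Lambda>(ab,c).\<close>
            also have "\<dots> = h\<^sub>2 \<otimes>\<^bsub>H\<^esub> k\<^sub>2 \<otimes>\<^bsub>H\<^esub> (l\<^sub>2 \<otimes>\<^bsub>H\<^esub> ?s) \<otimes>\<^bsub>H\<^esub> ?t"
              using hc kc lc cl by (simp add: cocycle[OF a b c, symmetric] R.m_assoc)
            finally show "\<Omega> h\<^sub>1 k\<^sub>1 l\<^sub>1 \<odot>\<^bsub>H\<^esub> zmult h\<^sub>2 (zmult k\<^sub>2 l\<^sub>2)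
                = (counit H k\<^sub>1 * counit H h\<^sub>1) \<odot>\<^bsub>H\<^esub> (\<gamma> ?s l\<^sub>1 \<odot>\<^bsub>H\<^esub> (?w \<odot>\<^bsub>H\<^esub> (h\<^sub>2 \<otimes>\<^bsub>H\<^esub> k\<^sub>2 \<otimes>\<^bsub>H\<^esub> (l\<^sub>2 \<otimes>\<^bsub>H\<^esub> ?s) \<otimes>\<^bsub>H\<^esub> ?t)))"
              using h12 k12 l12 hc kc lc cl
              by (simp add: Omega_homog(1)[OF a b c] vs_smult_smult mult_ac)
          qed (rule linr hc kc cl | assumption)+
          also have "\<dots> = (counit H k\<^sub>1 * counit H h\<^sub>1) \<odot>\<^bsub>H\<^esub> Y h\<^sub>2 k\<^sub>2"
            unfolding Y_def by (rule tsum_scale[OF vsH vsH vsH comult_closed[OF lH]]) (rule linr hc kc cl | assumption)+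
          finally show "tsum H (comult H l) (\<lambda>l\<^sub>1 l\<^sub>2. \<Omega> h\<^sub>1 k\<^sub>1 l\<^sub>1 \<odot>\<^bsub>H\<^esub> zmult h\<^sub>2 (zmult k\<^sub>2 l\<^sub>2)) = counit H k\<^sub>1 \<odot>\<^bsub>H\<^esub> (counit H h\<^sub>1 \<odot>\<^bsub>H\<^esub> Y h\<^sub>2 k\<^sub>2)"
            using Xc hc kc by (simp add: vs_smult_smult)
        qed (rule linr lX hc cl | assumption)+
      qed (rule linr lX cl | assumption)+
      finally show "?L h k l = ?R h k l" .
    qed (rule linr hH kH | assumption)+
  qed (rule linr hH lH | assumption)+
qed (rule linr kH lH | assumption)+

text \<open>In homogeneous degrees both sides equal the same product of counits, a scalar, the value
  of \<gamma>(\<Lambda>(a,b)) at \<open>l\<close>, and the value at \<open>t\<close> of the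
  character of a product of two group-likes. Agreement of the scalars is exactly the equation for
  \<omega>.\<close>

lemma Omega_pentagon:
  assumes hH: "h \<in> carrier H" and kH: "k \<in> carrier H" and lH: "l \<in> carrier H" and tH: "t \<in> carrier H"
  shows "tsum base (comult H h) (\<lambda>h\<^sub>1 h\<^sub>2. tsum base (comult H k) (\<lambda>k\<^sub>1 k\<^sub>2.
            tsum base (comult H l) (\<lambda>l\<^sub>1 l\<^sub>2. tsum base (comult H t) (\<lambda>t\<^sub>1 t\<^sub>2.
              \<Omega> (zmult h\<^sub>1 k\<^sub>1) l\<^sub>1 t\<^sub>1 * \<Omega> h\<^sub>2 k\<^sub>2 (zmult l\<^sub>2 t\<^sub>2)))))
        = tsum base (comult H h) (\<lambda>h\<^sub>1 h\<^sub>2. tsum3 base H k (\<lambda>k\<^sub>1 k\<^sub>2 k\<^sub>3.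
            tsum3 base H l (\<lambda>l\<^sub>1 l\<^sub>2 l\<^sub>3. tsum base (comult H t) (\<lambda>t\<^sub>1 t\<^sub>2.
              \<Omega> h\<^sub>1 k\<^sub>1 l\<^sub>1 * \<Omega> h\<^sub>2 (zmult k\<^sub>2 l\<^sub>2) t\<^sub>1 * \<Omega> k\<^sub>3 l\<^sub>3 t\<^sub>2))))" (is "?L h k l t = ?R h k l t")
  unfolding tsum3_def
proof (rule homog_ext_H[OF vspace_base hH, where f="\<lambda>h. ?L h k l t"])
  \<comment> \<open>The right-hand side after unfolding \<open>tsum3\<close>, with the intermediate
    legs \<open>k'\<close> and \<open>l'\<close> visible for the reductions below.\<close>
  let ?R = "\<lambda>h k l t. tsum base (comult H h) (\<lambda>h\<^sub>1 h\<^sub>2. tsum base (comult H k) (\<lambda>k' k\<^sub>3. tsum base (comult H k') (\<lambda>k\<^sub>1 k\<^sub>2.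
            tsum base (comult H l) (\<lambda>l' l\<^sub>3. tsum base (comult H l') (\<lambda>l\<^sub>1 l\<^sub>2. tsum base (comult H t) (\<lambda>t\<^sub>1 t\<^sub>2.
              \<Omega> h\<^sub>1 k\<^sub>1 l\<^sub>1 * \<Omega> h\<^sub>2 (zmult k\<^sub>2 l\<^sub>2) t\<^sub>1 * \<Omega> k\<^sub>3 l\<^sub>3 t\<^sub>2))))))"
  fix a h assume a: "a \<in> carrier G" and h: "h \<in> gH a"
  note hH = gH_carrier[OF h]
  show "?L h k l t = ?R h k l t"
  proof (rule homog_ext_H[OF vspace_base kH, where f="\<lambda>k. ?L h k l t" and g="\<lambda>k. ?R h k l t"])
    fix b k assume b: "b \<in> carrier G" and k: "k \<in> gH b"
    note kH = gH_carrier[OF k]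
    show "?L h k l t = ?R h k l t"
    proof (rule homog_ext_H[OF vspace_base lH, where f="\<lambda>l. ?L h k l t" and g="\<lambda>l. ?R h k l t"])
      fix c l assume c: "c \<in> carrier G" and l: "l \<in> gH c"
      note lH = gH_carrier[OF l]
      show "?L h k l t = ?R h k l t"
      proof (rule homog_ext_H[OF vspace_base tH, where f="\<lambda>t. ?L h k l t" and g="\<lambda>t. ?R h k l t"])
        fix d t assume d: "d \<in> carrier G" and t: "t \<in> gH d"
        note tH = gH_carrier[OF t]
        let ?s = "\<Lambda> a b" and ?s' = "\<Lambda> (a \<otimes>\<^bsub>G\<^esub> b) c" and ?u = "\<Lambda> b c" and ?v = "\<Lambda> a (b \<otimes>\<^bsub>G\<^esub> c)" and ?e = "counit H"
        have ab: "a \<otimes>\<^bsub>G\<^esub> b \<in> carrier G" and bc: "b \<otimes>\<^bsub>G\<^esub> c \<in> carrier G" and cd: "c \<otimes>\<^bsub>G\<^esub> d \<in> carrier G" using a b c d by auto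
        note sG = Lambda_closed[OF a b] and s'G = Lambda_closed[OF ab c] and uG = Lambda_closed[OF b c] and vG = Lambda_closed[OF a bc]
        let ?p = "?s' \<otimes>\<^bsub>H\<^esub> ?s"
        \<comment> \<open>The two sides produce characters on \<open>t\<close> in the orders
          \<open>?s', ?s\<close> and \<open>?v, ?u\<close>; commutativity of \<Gamma> and the
          cocycle condition identify the products.\<close>
        have p: "?v \<otimes>\<^bsub>H\<^esub> ?u = ?p"
          using Gamma_commute[OF sG s'G] Gamma_commute[OF uG vG] cocycle[OF a b c] by simp
        \<comment> \<open>The last factor arises because the character of \<open>?s\<close> is
          evaluated on a zested product of legs of \<open>l\<close> and \<open>t\<close>, which
          contains \<open>\<Lambda> c d\<close>.\<close>
        define W where "W = \<omega> (a \<otimes>\<^bsub>G\<^esub> b) c d * \<omega> a b (c \<otimes>\<^bsub>G\<^esub> d) * \<gamma> ?s (\<Lambda> c d)"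
        have W: "W = \<omega> a b c * \<omega> a (b \<otimes>\<^bsub>G\<^esub> c) d * \<omega> b c d" unfolding W_def by (rule omega_eq[OF a b c d])
        define Z where "Z x y z = ?e x * (?e y * (W * (\<gamma> ?s z * \<gamma> ?p t)))" for x y z
        have lZ: "lin H base (\<lambda>x. Z x y z)" "lin H base (\<lambda>x. Z y x z)" "lin H base (\<lambda>x. Z y z x)" for y z
          unfolding Z_def by (rule linr sG)+
        have "?L h k l t = Z h k l"
        proof (rule reduce_left[OF h a vspace_base])
          fix h\<^sub>1 h\<^sub>2 assume h12: "h\<^sub>1 \<in> gH a" "h\<^sub>2 \<in> gH a"
          note hc = h12[THEN gH_carrier]
          show "tsum base (comult H k) (\<lambda>k\<^sub>1 k\<^sub>2. tsum base (comult H l) (\<lambda>l\<^sub>1 l\<^sub>2. tsum base (comult H t) (\<lambda>t\<^sub>1 t\<^sub>2.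
              \<Omega> (zmult h\<^sub>1 k\<^sub>1) l\<^sub>1 t\<^sub>1 * \<Omega> h\<^sub>2 k\<^sub>2 (zmult l\<^sub>2 t\<^sub>2)))) = ?e h\<^sub>1 \<odot>\<^bsub>base\<^esub> Z h\<^sub>2 k l"
          proof (rule reduce_left[OF k b vspace_base])
            fix k\<^sub>1 k\<^sub>2 assume k12: "k\<^sub>1 \<in> gH b" "k\<^sub>2 \<in> gH b"
            note kc = k12[THEN gH_carrier]
            show "tsum base (comult H l) (\<lambda>l\<^sub>1 l\<^sub>2. tsum base (comult H t) (\<lambda>t\<^sub>1 t\<^sub>2.
              \<Omega> (zmult h\<^sub>1 k\<^sub>1) l\<^sub>1 t\<^sub>1 * \<Omega> h\<^sub>2 k\<^sub>2 (zmult l\<^sub>2 t\<^sub>2))) = ?e k\<^sub>1 \<odot>\<^bsub>base\<^esub> (?e h\<^sub>1 \<odot>\<^bsub>base\<^esub> Z h\<^sub>2 k\<^sub>2 l)"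
            proof (rule reduce_left[OF l c vspace_base, where g="\<lambda>l. ?e k\<^sub>1 \<odot>\<^bsub>base\<^esub> (?e h\<^sub>1 \<odot>\<^bsub>base\<^esub> Z h\<^sub>2 k\<^sub>2 l)"])
              fix l\<^sub>1 l\<^sub>2 assume l12: "l\<^sub>1 \<in> gH c" "l\<^sub>2 \<in> gH c"
              note lc = l12[THEN gH_carrier]
              let ?C = "?e l\<^sub>1 * (?e k\<^sub>1 * (?e h\<^sub>1 * (?e h\<^sub>2 * (?e k\<^sub>2 * (W * \<gamma> ?s l\<^sub>2)))))"
              have "tsum base (comult H t) (\<lambda>t\<^sub>1 t\<^sub>2. \<Omega> (zmult h\<^sub>1 k\<^sub>1) l\<^sub>1 t\<^sub>1 * \<Omega> h\<^sub>2 k\<^sub>2 (zmult l\<^sub>2 t\<^sub>2))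
                  = tsum base (comult H t) (\<lambda>t\<^sub>1 t\<^sub>2. ?C * (\<gamma> ?s' t\<^sub>1 * \<gamma> ?s t\<^sub>2))"
              proof (rule tsum_comult_homog_cong[OF vspace_base d t bilinI bilinI])
                fix t\<^sub>1 t\<^sub>2 assume t12: "t\<^sub>1 \<in> gH d" "t\<^sub>2 \<in> gH d"
                note tc = t12[THEN gH_carrier]
                have "\<Omega> (zmult h\<^sub>1 k\<^sub>1) l\<^sub>1 t\<^sub>1 = ?e h\<^sub>1 * ?e k\<^sub>1 * ?e l\<^sub>1 * \<omega> (a \<otimes>\<^bsub>G\<^esub> b) c d * \<gamma> ?s' t\<^sub>1"
                  using Omega_homog(1)[OF ab c d zmult_gr[OF a b h12(1) k12(1)] l12(1) t12(1)] counit_zmult[OF hc(1) kc(1)] by simp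
                moreover have "\<Omega> h\<^sub>2 k\<^sub>2 (zmult l\<^sub>2 t\<^sub>2) = ?e h\<^sub>2 * ?e k\<^sub>2 * \<omega> a b (c \<otimes>\<^bsub>G\<^esub> d) * \<gamma> ?s l\<^sub>2 * \<gamma> ?s t\<^sub>2 * \<gamma> ?s (\<Lambda> c d)"
                  using Omega_homog(1)[OF a b cd h12(2) k12(2) zmult_gr[OF c d l12(2) t12(2)]] lc tc Lambda_H[OF c d]
                  by (simp add: zmult_homog[OF c d l12(2) t12(2)] gamma_mult[OF sG] mult_closed)
                ultimately show "\<Omega> (zmult h\<^sub>1 k\<^sub>1) l\<^sub>1 t\<^sub>1 * \<Omega> h\<^sub>2 k\<^sub>2 (zmult l\<^sub>2 t\<^sub>2) = ?C * (\<gamma> ?s' t\<^sub>1 * \<gamma> ?s t\<^sub>2)"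
                  by (simp add: W_def mult_ac)
              qed (rule linr hc kc lc sG s'G | assumption)+
              also have "\<dots> = ?C * \<gamma> ?p t"
                unfolding gamma_conv[OF s'G sG tH]
                by (rule tsum_image[OF vsH vsH vspace_base vspace_base lin_mult_left[OF lin_id] comult_closed[OF tH], symmetric]) simp
              finally show "tsum base (comult H t) (\<lambda>t\<^sub>1 t\<^sub>2. \<Omega> (zmult h\<^sub>1 k\<^sub>1) l\<^sub>1 t\<^sub>1 * \<Omega> h\<^sub>2 k\<^sub>2 (zmult l\<^sub>2 t\<^sub>2))
                  = ?e l\<^sub>1 \<odot>\<^bsub>base\<^esub> (?e k\<^sub>1 \<odot>\<^bsub>base\<^esub> (?e h\<^sub>1 \<odot>\<^bsub>base\<^esub> Z h\<^sub>2 k\<^sub>2 l\<^sub>2))"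
                by (simp add: Z_def mult_ac)
            qed (rule linr lZ hc kc tH | assumption)+
          qed (rule linr lZ hc lH tH | assumption)+
        qed (rule linr lZ kH lH tH | assumption)+
        also have "Z h k l = ?R h k l t"
        proof (rule reduce_left[OF h a vspace_base, symmetric])
          fix h\<^sub>1 h\<^sub>2 assume h12: "h\<^sub>1 \<in> gH a" "h\<^sub>2 \<in> gH a"
          note hc = h12[THEN gH_carrier]
          show "tsum base (comult H k) (\<lambda>k' k\<^sub>3. tsum base (comult H k') (\<lambda>k\<^sub>1 k\<^sub>2.
            tsum base (comult H l) (\<lambda>l' l\<^sub>3. tsum base (comult H l') (\<lambda>l\<^sub>1 l\<^sub>2. tsum base (comult H t) (\<lambda>t\<^sub>1 t\<^sub>2.
              \<Omega> h\<^sub>1 k\<^sub>1 l\<^sub>1 * \<Omega> h\<^sub>2 (zmult k\<^sub>2 l\<^sub>2) t\<^sub>1 * \<Omega> k\<^sub>3 l\<^sub>3 t\<^sub>2))))) = ?e h\<^sub>1 \<odot>\<^bsub>base\<^esub> Z h\<^sub>2 k l"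
          proof (rule reduce_right[OF k b vspace_base])
            fix k' k\<^sub>3 assume k3: "k' \<in> gH b" "k\<^sub>3 \<in> gH b"
            note k3c = k3[THEN gH_carrier]
            show "tsum base (comult H k') (\<lambda>k\<^sub>1 k\<^sub>2.
              tsum base (comult H l) (\<lambda>l' l\<^sub>3. tsum base (comult H l') (\<lambda>l\<^sub>1 l\<^sub>2. tsum base (comult H t) (\<lambda>t\<^sub>1 t\<^sub>2.
              \<Omega> h\<^sub>1 k\<^sub>1 l\<^sub>1 * \<Omega> h\<^sub>2 (zmult k\<^sub>2 l\<^sub>2) t\<^sub>1 * \<Omega> k\<^sub>3 l\<^sub>3 t\<^sub>2)))) = ?e k\<^sub>3 \<odot>\<^bsub>base\<^esub> (?e h\<^sub>1 \<odot>\<^bsub>base\<^esub> Z h\<^sub>2 k' l)"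
            proof (rule reduce_left[OF k3(1) b vspace_base, where g="\<lambda>k'. ?e k\<^sub>3 \<odot>\<^bsub>base\<^esub> (?e h\<^sub>1 \<odot>\<^bsub>base\<^esub> Z h\<^sub>2 k' l)"])
              fix k\<^sub>1 k\<^sub>2 assume k12: "k\<^sub>1 \<in> gH b" "k\<^sub>2 \<in> gH b"
              note kc = k12[THEN gH_carrier]
              show "tsum base (comult H l) (\<lambda>l' l\<^sub>3. tsum base (comult H l') (\<lambda>l\<^sub>1 l\<^sub>2. tsum base (comult H t) (\<lambda>t\<^sub>1 t\<^sub>2.
                \<Omega> h\<^sub>1 k\<^sub>1 l\<^sub>1 * \<Omega> h\<^sub>2 (zmult k\<^sub>2 l\<^sub>2) t\<^sub>1 * \<Omega> k\<^sub>3 l\<^sub>3 t\<^sub>2)))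
                = ?e k\<^sub>1 \<odot>\<^bsub>base\<^esub> (?e k\<^sub>3 \<odot>\<^bsub>base\<^esub> (?e h\<^sub>1 \<odot>\<^bsub>base\<^esub> Z h\<^sub>2 k\<^sub>2 l))"
              proof (rule reduce_right[OF l c vspace_base, where g="\<lambda>l. ?e k\<^sub>1 \<odot>\<^bsub>base\<^esub> (?e k\<^sub>3 \<odot>\<^bsub>base\<^esub> (?e h\<^sub>1 \<odot>\<^bsub>base\<^esub> Z h\<^sub>2 k\<^sub>2 l))"])
                fix l' l\<^sub>3 assume l3: "l' \<in> gH c" "l\<^sub>3 \<in> gH c"
                note l3c = l3[THEN gH_carrier]
                show "tsum base (comult H l') (\<lambda>l\<^sub>1 l\<^sub>2. tsum base (comult H t) (\<lambda>t\<^sub>1 t\<^sub>2.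
                  \<Omega> h\<^sub>1 k\<^sub>1 l\<^sub>1 * \<Omega> h\<^sub>2 (zmult k\<^sub>2 l\<^sub>2) t\<^sub>1 * \<Omega> k\<^sub>3 l\<^sub>3 t\<^sub>2))
                  = ?e l\<^sub>3 \<odot>\<^bsub>base\<^esub> (?e k\<^sub>1 \<odot>\<^bsub>base\<^esub> (?e k\<^sub>3 \<odot>\<^bsub>base\<^esub> (?e h\<^sub>1 \<odot>\<^bsub>base\<^esub> Z h\<^sub>2 k\<^sub>2 l')))"
                \<comment> \<open>Of the three legs of \<open>l\<close> only the first carries a
                  character, so both counits are removed from the right.\<close>
                proof (rule reduce_right[OF l3(1) c vspace_base,
                    where g="\<lambda>l'. ?e l\<^sub>3 \<odot>\<^bsub>base\<^esub> (?e k\<^sub>1 \<odot>\<^bsub>base\<^esub> (?e k\<^sub>3 \<odot>\<^bsub>base\<^esub> (?e h\<^sub>1 \<odot>\<^bsub>base\<^esub> Z h\<^sub>2 k\<^sub>2 l')))"])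
                  fix l\<^sub>1 l\<^sub>2 assume l12: "l\<^sub>1 \<in> gH c" "l\<^sub>2 \<in> gH c"
                  note lc = l12[THEN gH_carrier]
                  let ?C = "?e l\<^sub>2 * (?e l\<^sub>3 * (?e k\<^sub>1 * (?e k\<^sub>3 * (?e h\<^sub>1 * (?e h\<^sub>2 * (?e k\<^sub>2 * (W * \<gamma> ?s l\<^sub>1)))))))"
                  have "tsum base (comult H t) (\<lambda>t\<^sub>1 t\<^sub>2. \<Omega> h\<^sub>1 k\<^sub>1 l\<^sub>1 * \<Omega> h\<^sub>2 (zmult k\<^sub>2 l\<^sub>2) t\<^sub>1 * \<Omega> k\<^sub>3 l\<^sub>3 t\<^sub>2)
                      = tsum base (comult H t) (\<lambda>t\<^sub>1 t\<^sub>2. ?C * (\<gamma> ?v t\<^sub>1 * \<gamma> ?u t\<^sub>2))"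
                  proof (rule tsum_comult_homog_cong[OF vspace_base d t bilinI bilinI])
                    fix t\<^sub>1 t\<^sub>2 assume t12: "t\<^sub>1 \<in> gH d" "t\<^sub>2 \<in> gH d"
                    show "\<Omega> h\<^sub>1 k\<^sub>1 l\<^sub>1 * \<Omega> h\<^sub>2 (zmult k\<^sub>2 l\<^sub>2) t\<^sub>1 * \<Omega> k\<^sub>3 l\<^sub>3 t\<^sub>2 = ?C * (\<gamma> ?v t\<^sub>1 * \<gamma> ?u t\<^sub>2)"
                      using Omega_homog(1)[OF a b c h12(1) k12(1) l12(1)] Omega_homog(1)[OF b c d k3(2) l3(2) t12(2)]
                        Omega_homog(1)[OF a bc d h12(2) zmult_gr[OF b c k12(2) l12(2)] t12(1)] counit_zmult[OF kc(2) lc(2)]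
                      by (simp add: W mult_ac)
                  qed (rule linr hc kc lc k3c l3c uG vG | assumption)+
                  also have "\<dots> = ?C * \<gamma> ?p t"
                    unfolding p[symmetric] gamma_conv[OF vG uG tH]
                    by (rule tsum_image[OF vsH vsH vspace_base vspace_base lin_mult_left[OF lin_id] comult_closed[OF tH], symmetric]) simp
                  finally show "tsum base (comult H t) (\<lambda>t\<^sub>1 t\<^sub>2. \<Omega> h\<^sub>1 k\<^sub>1 l\<^sub>1 * \<Omega> h\<^sub>2 (zmult k\<^sub>2 l\<^sub>2) t\<^sub>1 * \<Omega> k\<^sub>3 l\<^sub>3 t\<^sub>2)
                      = ?e l\<^sub>2 \<odot>\<^bsub>base\<^esub> (?e l\<^sub>3 \<odot>\<^bsub>base\<^esub> (?e k\<^sub>1 \<odot>\<^bsub>base\<^esub> (?e k\<^sub>3 \<odot>\<^bsub>base\<^esub> (?e h\<^sub>1 \<odot>\<^bsub>base\<^esub> Z h\<^sub>2 k\<^sub>2 l\<^sub>1))))"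
                    by (simp add: Z_def mult_ac)
                qed (rule linr lZ hc kc k3c l3c tH | assumption)+
              qed (rule linr lZ hc kc k3c tH | assumption)+
            qed (rule linr lZ hc k3c lH tH | assumption)+
          qed (rule linr lZ hc lH tH | assumption)+
        qed (rule linr lZ kH lH tH | assumption)+
        finally show "?L h k l t = ?R h k l t" .
      qed (rule linr hH kH lH | assumption)+
    qed (rule linr hH kH tH | assumption)+
  qed (rule linr hH lH tH | assumption)+
qed (rule linr kH lH tH | assumption)+

text \<open>In fixed degrees the associator is two counits times a form in the third argument, so
  the inverse can be computed in the third argument alone, where the character of
  \<open>\<Lambda> a b\<close> is inverted by that of the inverse group-like.\<close>

lemma Omega_inverse:
  assumes hH: "h \<in> carrier H" and kH: "k \<in> carrier H" and lH: "l \<in> carrier H"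
  shows "conv3 H \<Omega> \<Omega>' h k l = counit H h * counit H k * counit H l"
    and "conv3 H \<Omega>' \<Omega> h k l = counit H h * counit H k * counit H l"
proof -
  \<comment> \<open>Stated for an abstract pair \<open>P\<close>, \<open>Q\<close>, so that it
    serves both orders of the convolution product.\<close>
  have main: "conv3 H P Q h k l = counit H h * counit H k * counit H l"
    if P: "\<And>h k M F. h \<in> carrier H \<Longrightarrow> k \<in> carrier H \<Longrightarrow> lin H H F \<Longrightarrow> lin H base (\<lambda>x. P (F x) h k)"
        "\<And>h k M F. h \<in> carrier H \<Longrightarrow> k \<in> carrier H \<Longrightarrow> lin H H F \<Longrightarrow> lin H base (\<lambda>x. P h (F x) k)"
        "\<And>h k M F. h \<in> carrier H \<Longrightarrow> k \<in> carrier H \<Longrightarrow> lin H H F \<Longrightarrow> lin H base (\<lambda>x. P h k (F x))"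
      and Q: "\<And>h k M F. h \<in> carrier H \<Longrightarrow> k \<in> carrier H \<Longrightarrow> lin H H F \<Longrightarrow> lin H base (\<lambda>x. Q (F x) h k)"
        "\<And>h k M F. h \<in> carrier H \<Longrightarrow> k \<in> carrier H \<Longrightarrow> lin H H F \<Longrightarrow> lin H base (\<lambda>x. Q h (F x) k)"
        "\<And>h k M F. h \<in> carrier H \<Longrightarrow> k \<in> carrier H \<Longrightarrow> lin H H F \<Longrightarrow> lin H base (\<lambda>x. Q h k (F x))"
      and hom: "\<And>a b c. a \<in> carrier G \<Longrightarrow> b \<in> carrier G \<Longrightarrow> c \<in> carrier G \<Longrightarrow>
        \<exists>\<chi> \<psi>. lin H base \<chi> \<and> lin H base \<psi> \<and> (\<forall>l\<in>carrier H. tsum base (comult H l) (\<lambda>l\<^sub>1 l\<^sub>2. \<chi> l\<^sub>1 * \<psi> l\<^sub>2) = counit H l)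
          \<and> (\<forall>h\<in>gH a. \<forall>k\<in>gH b. \<forall>l\<in>gH c. P h k l = counit H h * (counit H k * \<chi> l) \<and> Q h k l = counit H h * (counit H k * \<psi> l))"
    for P Q
    unfolding conv3_def
  proof (rule homog_ext_H[OF vspace_base hH, where g="\<lambda>h. counit H h * counit H k * counit H l"])
    let ?L = "\<lambda>h k l. tsum base (comult H h) (\<lambda>h\<^sub>1 h\<^sub>2. tsum base (comult H k) (\<lambda>k\<^sub>1 k\<^sub>2. tsum base (comult H l) (\<lambda>l\<^sub>1 l\<^sub>2.
       P h\<^sub>1 k\<^sub>1 l\<^sub>1 * Q h\<^sub>2 k\<^sub>2 l\<^sub>2)))"
    fix a h assume a: "a \<in> carrier G" and h: "h \<in> gH a"
    note hH = gH_carrier[OF h]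
    show "?L h k l = counit H h * counit H k * counit H l"
    proof (rule homog_ext_H[OF vspace_base kH, where f="\<lambda>k. ?L h k l" and g="\<lambda>k. counit H h * counit H k * counit H l"])
      fix b k assume b: "b \<in> carrier G" and k: "k \<in> gH b"
      note kH = gH_carrier[OF k]
      show "?L h k l = counit H h * counit H k * counit H l"
      proof (rule homog_ext_H[OF vspace_base lH, where f="\<lambda>l. ?L h k l" and g="\<lambda>l. counit H h * counit H k * counit H l"])
        fix c l assume c: "c \<in> carrier G" and l: "l \<in> gH c"
        note lH = gH_carrier[OF l]
        obtain \<chi> \<psi> where \<chi>: "lin H base \<chi>" and \<psi>: "lin H base \<psi>"
          and inv: "tsum base (comult H l) (\<lambda>l\<^sub>1 l\<^sub>2. \<chi> l\<^sub>1 * \<psi> l\<^sub>2) = counit H l"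
          and PQ: "\<And>h k l. h\<in>gH a \<Longrightarrow> k\<in>gH b \<Longrightarrow> l\<in>gH c \<Longrightarrow> P h k l = counit H h * (counit H k * \<chi> l)"
            "\<And>h k l. h\<in>gH a \<Longrightarrow> k\<in>gH b \<Longrightarrow> l\<in>gH c \<Longrightarrow> Q h k l = counit H h * (counit H k * \<psi> l)"
          using hom[OF a b c] lH by blast
        show "?L h k l = counit H h * counit H k * counit H l"
        proof (rule reduce_left[OF h a vspace_base])
          fix h\<^sub>1 h\<^sub>2 assume h12: "h\<^sub>1 \<in> gH a" "h\<^sub>2 \<in> gH a"
          note hc = h12[THEN gH_carrier]
          show "tsum base (comult H k) (\<lambda>k\<^sub>1 k\<^sub>2. tsum base (comult H l) (\<lambda>l\<^sub>1 l\<^sub>2. P h\<^sub>1 k\<^sub>1 l\<^sub>1 * Q h\<^sub>2 k\<^sub>2 l\<^sub>2))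
              = counit H h\<^sub>1 \<odot>\<^bsub>base\<^esub> (counit H h\<^sub>2 * counit H k * counit H l)"
          proof (rule reduce_left[OF k b vspace_base])
            fix k\<^sub>1 k\<^sub>2 assume k12: "k\<^sub>1 \<in> gH b" "k\<^sub>2 \<in> gH b"
            note kc = k12[THEN gH_carrier]
            let ?C = "counit H h\<^sub>1 * counit H h\<^sub>2 * counit H k\<^sub>1 * counit H k\<^sub>2"
            have "tsum base (comult H l) (\<lambda>l\<^sub>1 l\<^sub>2. P h\<^sub>1 k\<^sub>1 l\<^sub>1 * Q h\<^sub>2 k\<^sub>2 l\<^sub>2) = tsum base (comult H l) (\<lambda>l\<^sub>1 l\<^sub>2. ?C * (\<chi> l\<^sub>1 * \<psi> l\<^sub>2))"
              by (rule tsum_comult_homog_cong[OF vspace_base c l bilinI bilinI])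
                (rule linr P Q hc kc lin_comp[OF \<chi>] lin_comp[OF \<psi>] \<chi> \<psi> | assumption | simp add: PQ h12 k12)+
            also have "\<dots> = ?C * counit H l"
              unfolding inv[symmetric]
              by (rule tsum_image[OF vsH vsH vspace_base vspace_base lin_mult_left[OF lin_id] comult_closed[OF lH], symmetric]) simp
            finally show "tsum base (comult H l) (\<lambda>l\<^sub>1 l\<^sub>2. P h\<^sub>1 k\<^sub>1 l\<^sub>1 * Q h\<^sub>2 k\<^sub>2 l\<^sub>2)
                = counit H k\<^sub>1 \<odot>\<^bsub>base\<^esub> (counit H h\<^sub>1 \<odot>\<^bsub>base\<^esub> (counit H h\<^sub>2 * counit H k\<^sub>2 * counit H l))" by (simp add: mult_ac)
          qed (rule linr P Q hc lH | assumption | simp)+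
        qed (rule linr P Q kH lH | assumption)+
      qed (rule linr P Q hH kH | assumption)+
    qed (rule linr P Q hH lH | assumption)+
  qed (rule linr P Q kH lH | assumption)+
  have ex: "\<exists>\<chi> \<psi>. lin H base \<chi> \<and> lin H base \<psi> \<and> (\<forall>l\<in>carrier H. tsum base (comult H l) (\<lambda>l\<^sub>1 l\<^sub>2. \<chi> l\<^sub>1 * \<psi> l\<^sub>2) = counit H l)
      \<and> (\<forall>h\<in>gH a. \<forall>k\<in>gH b. \<forall>l\<in>gH c. P h k l = counit H h * (counit H k * \<chi> l) \<and> Q h k l = counit H h * (counit H k * \<psi> l))"
    if g: "a \<in> carrier G" "b \<in> carrier G" "c \<in> carrier G" and s: "s \<in> \<Gamma>" "t \<in> \<Gamma>" and w: "w * v = 1"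
      and st: "\<And>h. h \<in> carrier H \<Longrightarrow> tsum base (comult H h) (\<lambda>h\<^sub>1 h\<^sub>2. \<gamma> s h\<^sub>1 * \<gamma> t h\<^sub>2) = counit H h"
      and PQ: "\<And>h k l. h\<in>gH a \<Longrightarrow> k\<in>gH b \<Longrightarrow> l\<in>gH c \<Longrightarrow> P h k l = counit H h * (counit H k * (w * \<gamma> s l))"
            "\<And>h k l. h\<in>gH a \<Longrightarrow> k\<in>gH b \<Longrightarrow> l\<in>gH c \<Longrightarrow> Q h k l = counit H h * (counit H k * (v * \<gamma> t l))"
    for a b c s t w v P Q
  proof (intro exI conjI ballI)
    show "lin H base (\<lambda>l. w * \<gamma> s l)" "lin H base (\<lambda>l. v * \<gamma> t l)" by (rule linr s)+
    fix l assume l: "l \<in> carrier H"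
    have "(w * \<gamma> s l\<^sub>1) * (v * \<gamma> t l\<^sub>2) = (w * v) * (\<gamma> s l\<^sub>1 * \<gamma> t l\<^sub>2)" for l\<^sub>1 l\<^sub>2 by (simp add: mult_ac)
    then have "(w * \<gamma> s l\<^sub>1) * (v * \<gamma> t l\<^sub>2) = \<gamma> s l\<^sub>1 * \<gamma> t l\<^sub>2" for l\<^sub>1 l\<^sub>2 by (simp add: w)
    then show "tsum base (comult H l) (\<lambda>l\<^sub>1 l\<^sub>2. (w * \<gamma> s l\<^sub>1) * (v * \<gamma> t l\<^sub>2)) = counit H l"
      using st[OF l] by (simp only:)
  qed (simp_all add: PQ)
  show "conv3 H \<Omega> \<Omega>' h k l = counit H h * counit H k * counit H l"
  proof (rule main)
    fix a b c assume g: "a \<in> carrier G" "b \<in> carrier G" "c \<in> carrier G"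
    show "\<exists>\<chi> \<psi>. lin H base \<chi> \<and> lin H base \<psi> \<and> (\<forall>l\<in>carrier H. tsum base (comult H l) (\<lambda>l\<^sub>1 l\<^sub>2. \<chi> l\<^sub>1 * \<psi> l\<^sub>2) = counit H l)
      \<and> (\<forall>h\<in>gH a. \<forall>k\<in>gH b. \<forall>l\<in>gH c. \<Omega> h k l = counit H h * (counit H k * \<chi> l) \<and> \<Omega>' h k l = counit H h * (counit H k * \<psi> l))"
      by (rule ex[OF g Lambda_closed[OF g(1,2)] Lambda_inv_closed[OF g(1,2)] _ gamma_inv_conv(1)[OF Lambda_closed[OF g(1,2)]] Omega_homog(1)[OF g] Omega_homog(2)[OF g]])
        (simp_all add: omega_nonzero g)
  qed (rule linr | assumption)+
  show "conv3 H \<Omega>' \<Omega> h k l = counit H h * counit H k * counit H l"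
  proof (rule main)
    fix a b c assume g: "a \<in> carrier G" "b \<in> carrier G" "c \<in> carrier G"
    show "\<exists>\<chi> \<psi>. lin H base \<chi> \<and> lin H base \<psi> \<and> (\<forall>l\<in>carrier H. tsum base (comult H l) (\<lambda>l\<^sub>1 l\<^sub>2. \<chi> l\<^sub>1 * \<psi> l\<^sub>2) = counit H l)
      \<and> (\<forall>h\<in>gH a. \<forall>k\<in>gH b. \<forall>l\<in>gH c. \<Omega>' h k l = counit H h * (counit H k * \<chi> l) \<and> \<Omega> h k l = counit H h * (counit H k * \<psi> l))"
      by (rule ex[OF g Lambda_inv_closed[OF g(1,2)] Lambda_closed[OF g(1,2)] _ gamma_inv_conv(2)[OF Lambda_closed[OF g(1,2)]] Omega_homog(2)[OF g] Omega_homog(1)[OF g]])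
        (simp_all add: omega_nonzero g)
  qed (rule linr | assumption)+
qed

section \<open>The coquasi-bialgebra structure\<close>

definition zested :: "('k, 'h) coquasi" where
  "zested = \<lparr>carrier = carrier H, monoid.mult = zmult, one = \<one>\<^bsub>H\<^esub>, zero = \<zero>\<^bsub>H\<^esub>, add = add H, smult = smult H,
     comult = comult H, counit = counit H, reassociator = \<Omega>\<rparr>"

lemma zested_simps [simp]:
  "carrier zested = carrier H" "x \<otimes>\<^bsub>zested\<^esub> y = zmult x y" "\<one>\<^bsub>zested\<^esub> = \<one>\<^bsub>H\<^esub>" "\<zero>\<^bsub>zested\<^esub> = \<zero>\<^bsub>H\<^esub>"
  "add zested = add H" "smult zested = smult H" "comult zested = comult H" "counit zested = counit H"
  "reassociator zested = \<Omega>"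
  by (simp_all add: zested_def)

lemma tensor_zested [simp]:
  "tensor zested zested = tensor H H" "pure zested zested = pure H H" "tensor zested X = tensor H X" "pure zested X = pure H X"
  "tensor X zested = tensor X H" "pure X zested = pure X H"
  by (rule tensor_transfer; simp)+

lemma lin_zested [simp]: "lin zested N f = lin H N f" "lin M zested g = lin M H g"
  by (simp_all add: lin_def)

lemma tsum_zested [simp]: "tsum zested t f = tsum H t f"
  by (simp add: tsum_def)

lemma tensor_zested_tensor [simp]: "conv3 zested = conv3 H" "tsum3 N zested = tsum3 N H"
  by (simp_all add: conv3_def[abs_def] tsum3_def[abs_def])

lemma coalgebra_zested: "coalgebra zested"
  using coalgebra vspace_transfer[OF vsH, of zested] by (simp add: coalgebra_def)

theorem coquasi_bialgebra_zested: "coquasi_bialgebra zested"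
proof -
  have mu: "coalgebra_mult_unit zested"
    unfolding coalgebra_mult_unit_def zested_simps lin_zested tensor_zested
    by (intro conjI ballI comult_zmult counit_zmult lin_zmult_left[OF lin_id] lin_zmult_right[OF lin_id]
      one_closed comult_one counit_one; assumption)
  have tri: "trilinear_form zested \<Omega>" "trilinear_form zested \<Omega>'"
    unfolding trilinear_form_def zested_simps lin_zested by (intro conjI ballI lin_Omega[OF lin_id]; assumption)+
  have ci: "conv_invertible3 zested \<Omega>"
    unfolding conv_invertible3_def tensor_zested_tensor zested_simps by (intro exI[of _ \<Omega>'] conjI ballI Omega_inverse tri(2); assumption)
  show ?thesis
    unfolding coquasi_bialgebra_def Let_def zested_simps tsum_zested tensor_zested_tensor
    by (intro conjI ballI coalgebra_zested mu tri(1) ci quasi_assoc zmult_one Omega_pentagon Omega_one; assumption)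
qed

end

section \<open>Models of the zested tensor product\<close>

context zesting
begin

lemma lin_half_braid [linr]:
  "lin M X F \<Longrightarrow> comodule H X \<Longrightarrow> lin H base \<chi> \<Longrightarrow> lin M X (\<lambda>x. half_braid \<chi> X (F x))"
  by (rule lin_comp[OF half_braid_lin])

lemma half_braid_closed' [linr]: "x \<in> carrier X \<Longrightarrow> comodule H X \<Longrightarrow> lin H base \<chi> \<Longrightarrow> half_braid \<chi> X x \<in> carrier X"
  by (rule half_braid_closed)

text \<open>Cocentrality makes the idempotents \<open>\<pi> _ a\<close> central for convolution, so
  the projection to degree \<open>a\<close> commutes with the action of every form.\<close>

lemma half_braid_gr:
  assumes X: "comodule H X" and a: "a \<in> carrier G" and x: "x \<in> gr X a" and \<chi>: "lin H base \<chi>"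
  shows "half_braid \<chi> X x \<in> gr X a"
proof -
  have xX: "x \<in> carrier X" and e: "hom_part a X x = x" using x unfolding gr_iff[OF X a] by simp_all
  define \<theta> where "\<theta> h = tsum base (comult H h) (\<lambda>h\<^sub>1 h\<^sub>2. \<chi> h\<^sub>1 * \<pi> h\<^sub>2 a)" for h
  have "hom_part a X (half_braid \<chi> X x) = half_braid \<theta> X x"
    by (rule half_braid_half_braid[OF X xX \<chi> lin_pg]) (simp add: \<theta>_def)
  also have "\<dots> = half_braid \<chi> X (hom_part a X x)"
  proof (rule half_braid_half_braid[OF X xX lin_pg \<chi>, symmetric])
    fix h assume "h \<in> carrier H"
    then show "\<theta> h = tsum base (comult H h) (\<lambda>h\<^sub>1 h\<^sub>2. \<pi> h\<^sub>1 a * \<chi> h\<^sub>2)"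
      using pi_cocentral[of h base \<chi> a] \<chi> by (simp add: \<theta>_def mult.commute)
  qed
  finally show ?thesis unfolding gr_iff[OF X a] e using half_braid_closed[OF X \<chi> xX] by simp
qed

lemma half_braid_gamma:
  assumes X: "comodule H X" and x: "x \<in> carrier X" and s: "s \<in> \<Gamma>" and t: "t \<in> \<Gamma>"
  shows "half_braid (\<gamma> s) X (half_braid (\<gamma> t) X x) = half_braid (\<gamma> (t \<otimes>\<^bsub>H\<^esub> s)) X x"
  by (rule half_braid_half_braid[OF X x lin_gamma[OF t] lin_gamma[OF s] gamma_conv[OF t s]])

lemma half_braid_one:
  assumes X: "comodule H X" and x: "x \<in> carrier X"
  shows "half_braid (\<gamma> \<one>\<^bsub>H\<^esub>) X x = x"
proof -
  have "half_braid (\<gamma> \<one>\<^bsub>H\<^esub>) X x = tsum X (coact X x) (\<lambda>h y. counit H h \<odot>\<^bsub>X\<^esub> y)"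
    unfolding half_braid_def by (rule tsum_coact_cong[OF X x]) (simp add: gamma_unit)
  then show ?thesis using coact_counit[OF X comodule_vspace[OF X] x lin_id] by simp
qed

lemma half_braid_inverse:
  assumes X: "comodule H X" and x: "x \<in> carrier X" and s: "s \<in> \<Gamma>"
  shows "half_braid (\<gamma> s) X (half_braid (\<gamma> (inv\<^bsub>GL\<^esub> s)) X x) = x"
    "half_braid (\<gamma> (inv\<^bsub>GL\<^esub> s)) X (half_braid (\<gamma> s) X x) = x"
  using half_braid_gamma[OF X x s Gamma_inv[OF s]] half_braid_gamma[OF X x Gamma_inv[OF s] s]
    inv_GL(2,3)[OF Gamma_GL[OF s]] half_braid_one[OF X x] by simp_all

lemma mor_gr:
  assumes X: "comodule H X" and Y: "comodule H Y" and f: "f \<in> carrier (comod_hom H X Y)" and a: "a \<in> carrier G" and x: "x \<in> gr X a"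
  shows "f x \<in> gr Y a"
  using x lin_closed[OF mor_lin[OF f]] half_braid_mor[OF X Y f lin_pg, of x a] unfolding gr_iff[OF X a] gr_iff[OF Y a] by simp

end

text \<open>\<open>dc X Y\<close> identifies \<open>T X Y\<close> with \<open>X \<otimes> Y\<close> in such a way that \<open>pr X Y x y\<close> corresponds to \<open>x \<otimes> y\<close>;
  the coaction is the one of the tensor product over the zested coquasi-bialgebra.  The unit object \<open>U\<close>
  is spanned by \<open>e\<close>, and \<open>sc\<close> is the coordinate.\<close>

locale tensor_model = zesting H G \<pi> \<Gamma> \<gamma> \<Lambda> \<omega>
  for H :: "('k::field, 'h, 'm) hopf_scheme" and G :: "'g monoid" and \<pi> and \<Gamma> and \<gamma> and \<Lambda> and \<omega> +
  fixes T :: "('k, 'h, 'x) comod \<Rightarrow> ('k, 'h, 'x) comod \<Rightarrow> ('k, 'h, 'x) comod"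
    and pr :: "('k, 'h, 'x) comod \<Rightarrow> ('k, 'h, 'x) comod \<Rightarrow> 'x \<Rightarrow> 'x \<Rightarrow> 'x"
    and dc :: "('k, 'h, 'x) comod \<Rightarrow> ('k, 'h, 'x) comod \<Rightarrow> 'x \<Rightarrow> ('x \<times> 'x) list set"
    and U :: "('k, 'h, 'x) comod" and e :: 'x and sc :: "'x \<Rightarrow> 'k"
  assumes T_vspace: "\<And>X Y. comodule H X \<Longrightarrow> comodule H Y \<Longrightarrow> vspace (T X Y)"
    and T_lin: "\<And>X Y. comodule H X \<Longrightarrow> comodule H Y \<Longrightarrow> lin (T X Y) (tensor H (T X Y)) (coact (T X Y))"
    and pr_bilin: "\<And>X Y. comodule H X \<Longrightarrow> comodule H Y \<Longrightarrow> bilin X Y (T X Y) (pr X Y)"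
    and dc_lin: "\<And>X Y. comodule H X \<Longrightarrow> comodule H Y \<Longrightarrow> lin (T X Y) (tensor X Y) (dc X Y)"
    and dc_pr: "\<And>X Y x y. comodule H X \<Longrightarrow> comodule H Y \<Longrightarrow> x \<in> carrier X \<Longrightarrow> y \<in> carrier Y
      \<Longrightarrow> dc X Y (pr X Y x y) = pure X Y x y"
    and pr_dc: "\<And>X Y u. comodule H X \<Longrightarrow> comodule H Y \<Longrightarrow> u \<in> carrier (T X Y) \<Longrightarrow> tsum (T X Y) (dc X Y u) (pr X Y) = u"
    and coact_pr: "\<And>X Y x y. comodule H X \<Longrightarrow> comodule H Y \<Longrightarrow> x \<in> carrier X \<Longrightarrow> y \<in> carrier Y
      \<Longrightarrow> coact (T X Y) (pr X Y x y) = tsum (tensor H (T X Y)) (coact X x) (\<lambda>h x\<^sub>0.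
            tsum (tensor H (T X Y)) (coact Y y) (\<lambda>k y\<^sub>0. pure H (T X Y) (zmult h k) (pr X Y x\<^sub>0 y\<^sub>0)))"
    and U: "comodule H U" and e: "e \<in> carrier U" and sc_lin: "lin U base sc" and sc_e: "sc e = 1"
    and e_sc: "\<And>u. u \<in> carrier U \<Longrightarrow> u = sc u \<odot>\<^bsub>U\<^esub> e"
    and coact_U: "\<And>u. u \<in> carrier U \<Longrightarrow> coact U u = pure H U \<one>\<^bsub>H\<^esub> u"
begin

interpretation R: ring H by (rule ringH)
interpretation Gr: group G by (rule grp)

lemma lin_pr_left [linr]: "lin M X F \<Longrightarrow> comodule H X \<Longrightarrow> comodule H Y \<Longrightarrow> y \<in> carrier Y \<Longrightarrow> lin M (T X Y) (\<lambda>x. pr X Y (F x) y)"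
  by (rule lin_bilin_left[OF pr_bilin])

lemma lin_pr_right [linr]: "lin M Y F \<Longrightarrow> comodule H X \<Longrightarrow> comodule H Y \<Longrightarrow> x \<in> carrier X \<Longrightarrow> lin M (T X Y) (\<lambda>y. pr X Y x (F y))"
  by (rule lin_bilin_right[OF pr_bilin])

lemma pr_closed [linr]: "x \<in> carrier X \<Longrightarrow> y \<in> carrier Y \<Longrightarrow> comodule H X \<Longrightarrow> comodule H Y \<Longrightarrow> pr X Y x y \<in> carrier (T X Y)"
  by (rule bilin_closed[OF pr_bilin])

lemma pr_smult:
  assumes "comodule H X" "comodule H Y" "x \<in> carrier X" "y \<in> carrier Y"
  shows "pr X Y (c \<odot>\<^bsub>X\<^esub> x) y = c \<odot>\<^bsub>T X Y\<^esub> pr X Y x y" "pr X Y x (c \<odot>\<^bsub>Y\<^esub> y) = c \<odot>\<^bsub>T X Y\<^esub> pr X Y x y"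
  using lin_smult[OF bilin_left[OF pr_bilin]] lin_smult[OF bilin_right[OF pr_bilin]] assms by auto

text \<open>The universal property of X \<otimes> Y carried over to the model: a bilinear map
  extends along \<open>pr\<close>, and the extension is computed through \<open>dc\<close>.\<close>

lemma tlift:
  assumes X: "comodule H X" and Y: "comodule H Y" and N: "vspace N" and f: "bilin X Y N f"
  shows "lin (T X Y) N (\<lambda>u. tsum N (dc X Y u) f)"
    and "\<And>x y. x \<in> carrier X \<Longrightarrow> y \<in> carrier Y \<Longrightarrow> tsum N (dc X Y (pr X Y x y)) f = f x y"
proof -
  note vX = comodule_vspace[OF X] and vY = comodule_vspace[OF Y]
  show "lin (T X Y) N (\<lambda>u. tsum N (dc X Y u) f)"
    by (rule lin_comp[OF lin_tsum[OF vX vY N f] dc_lin[OF X Y]])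
  show "tsum N (dc X Y (pr X Y x y)) f = f x y" if "x \<in> carrier X" "y \<in> carrier Y" for x y
    using that by (simp add: dc_pr[OF X Y] tsum_pure[OF vX vY N f])
qed

lemma lin_dc [linr]: "lin M (T X Y) F \<Longrightarrow> comodule H X \<Longrightarrow> comodule H Y \<Longrightarrow> lin M (tensor X Y) (\<lambda>x. dc X Y (F x))"
  by (rule lin_comp[OF dc_lin])

lemma dc_closed [linr]: "u \<in> carrier (T X Y) \<Longrightarrow> comodule H X \<Longrightarrow> comodule H Y \<Longrightarrow> dc X Y u \<in> carrier (tensor X Y)"
  by (rule lin_closed[OF dc_lin])

text \<open>By \<open>pr_dc\<close> every element of the model is a finite sum of values of
  \<open>pr\<close>, so a linear map is determined on these.\<close>

lemma T_ext_all:
  assumes X: "comodule H X" and Y: "comodule H Y" and N: "vspace N" and f: "lin (T X Y) N f" and g: "lin (T X Y) N g"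
    and u: "u \<in> carrier (T X Y)"
    and eq: "\<And>x y. x \<in> carrier X \<Longrightarrow> y \<in> carrier Y \<Longrightarrow> f (pr X Y x y) = g (pr X Y x y)"
  shows "f u = g u"
proof -
  note vX = comodule_vspace[OF X] and vY = comodule_vspace[OF Y] and vT = T_vspace[OF X Y]
  note d = dc_closed[OF u X Y]
  have *: "L u = tsum N (dc X Y u) (\<lambda>x y. L (pr X Y x y))" if L: "lin (T X Y) N L" for L
    using tsum_image[OF vX vY vT N L d, of "pr X Y"] pr_dc[OF X Y u] pr_closed X Y by simp
  show ?thesis unfolding *[OF f] *[OF g] by (rule tsum_cong[OF vX vY d eq])
qed

lemma T_ext:
  assumes X: "comodule H X" and Y: "comodule H Y" and N: "vspace N" and f: "lin (T X Y) N f" and g: "lin (T X Y) N g"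
    and u: "u \<in> carrier (T X Y)"
    and eq: "\<And>a b x y. a \<in> carrier G \<Longrightarrow> b \<in> carrier G \<Longrightarrow> x \<in> gr X a \<Longrightarrow> y \<in> gr Y b \<Longrightarrow> f (pr X Y x y) = g (pr X Y x y)"
  shows "f u = g u"
proof (rule T_ext_all[OF X Y N f g u])
  fix x y assume x: "x \<in> carrier X" and y: "y \<in> carrier Y"
  have b: "bilin X Y N (\<lambda>x y. L (pr X Y x y))" if L: "lin (T X Y) N L" for L
    by (rule bilinI) (rule lin_comp[OF L] linr X Y | assumption)+
  show "f (pr X Y x y) = g (pr X Y x y)" by (rule bilin_homog_ext[OF X Y N b[OF f] b[OF g] x y eq])
qed

lemma tsum_coact_pr:
  assumes X: "comodule H X" and Y: "comodule H Y" and N: "vspace N" and f: "bilin H (T X Y) N f"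
    and x: "x \<in> carrier X" and y: "y \<in> carrier Y"
  shows "tsum N (coact (T X Y) (pr X Y x y)) f = tsum N (coact X x) (\<lambda>h x\<^sub>0. tsum N (coact Y y) (\<lambda>k y\<^sub>0. f (zmult h k) (pr X Y x\<^sub>0 y\<^sub>0)))"
proof -
  let ?T = "T X Y"
  let ?N = "tensor H ?T"
  note vX = comodule_vspace[OF X] and vY = comodule_vspace[OF Y] and vT = T_vspace[OF X Y]
  have vN: "vspace ?N" by (rule linr vT)+
  note L = lin_tsum[OF vsH vT N f] and cx = coact_closed[OF x X] and cy = coact_closed[OF y Y]
  have "tsum N (coact ?T (pr X Y x y)) f
      = tsum N (coact X x) (\<lambda>h x\<^sub>0. tsum N (tsum ?N (coact Y y) (\<lambda>k y\<^sub>0. pure H ?T (zmult h k) (pr X Y x\<^sub>0 y\<^sub>0))) f)"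
    unfolding coact_pr[OF X Y x y]
    by (rule tsum_image[OF vsH vX vN N L cx]) (rule tsum_closed[OF vsH vY vN cy] linr X Y vT | assumption)+
  also have "\<dots> = tsum N (coact X x) (\<lambda>h x\<^sub>0. tsum N (coact Y y) (\<lambda>k y\<^sub>0. tsum N (pure H ?T (zmult h k) (pr X Y x\<^sub>0 y\<^sub>0)) f))"
    by (rule tsum_coact_cong[OF X x], rule tsum_image[OF vsH vY vN N L cy]) (rule linr X Y vT | assumption)+
  also have "\<dots> = tsum N (coact X x) (\<lambda>h x\<^sub>0. tsum N (coact Y y) (\<lambda>k y\<^sub>0. f (zmult h k) (pr X Y x\<^sub>0 y\<^sub>0)))"
    by (rule tsum_coact_cong[OF X x], rule tsum_coact_cong[OF Y y], rule tsum_pure[OF vsH vT N f]) (rule linr X Y | assumption)+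
  finally show ?thesis .
qed

lemma T_comodule [linr]:
  assumes X: "comodule H X" and Y: "comodule H Y"
  shows "comodule H (T X Y)"
proof -
  let ?T = "T X Y"
  let ?M = "tensor H ?T"
  let ?N = "tensor H ?M"
  note vX = comodule_vspace[OF X] and vY = comodule_vspace[OF Y] and vT = T_vspace[OF X Y]
  note lT = T_lin[OF X Y] and lT' = lin_comp[OF T_lin[OF X Y]] and cT = lin_closed[OF T_lin[OF X Y]]
  have vM: "vspace ?M" and vN: "vspace ?N" by (rule linr vT)+
  let ?p = "\<lambda>h k v. pure H ?M h (pure H ?T k v)"
  have coassoc: "tsum ?N (coact ?T u) (\<lambda>h v. tsum ?N (coact ?T v) (\<lambda>k w. ?p h k w))
      = tsum ?N (coact ?T u) (\<lambda>h v. tsum ?N (comult H h) (\<lambda>h\<^sub>1 h\<^sub>2. ?p h\<^sub>1 h\<^sub>2 v))" (is "?L u = ?R u")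
    if u: "u \<in> carrier ?T" for u
  proof (rule T_ext_all[OF X Y vN _ _ u, where f="?L" and g="?R"])
    show "lin ?T ?N ?L" "lin ?T ?N ?R"
      by (rule lT lT' cT linr vT vX vY X Y | assumption)+
    fix x y assume x: "x \<in> carrier X" and y: "y \<in> carrier Y"
    have "?L (pr X Y x y) = tsum ?N (coact X x) (\<lambda>h x\<^sub>0. tsum ?N (coact Y y) (\<lambda>k y\<^sub>0.
        tsum ?N (coact ?T (pr X Y x\<^sub>0 y\<^sub>0)) (\<lambda>k' w. ?p (zmult h k) k' w)))"
      by (rule tsum_coact_pr[OF X Y vN bilinI x y]) (rule lT lT' cT linr vT X Y | assumption)+
    also have "\<dots> = tsum ?N (coact X x) (\<lambda>h x\<^sub>0. tsum ?N (coact Y y) (\<lambda>k y\<^sub>0.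
        tsum ?N (coact X x\<^sub>0) (\<lambda>h' x\<^sub>1. tsum ?N (coact Y y\<^sub>0) (\<lambda>k' y\<^sub>1. ?p (zmult h k) (zmult h' k') (pr X Y x\<^sub>1 y\<^sub>1)))))"
      by (rule tsum_coact_cong[OF X x], rule tsum_coact_cong[OF Y y], rule tsum_coact_pr[OF X Y vN bilinI]) (rule linr vT X Y | assumption)+
    also have "\<dots> = tsum ?N (coact X x) (\<lambda>h x\<^sub>0. tsum ?N (coact X x\<^sub>0) (\<lambda>h' x\<^sub>1. tsum ?N (coact Y y) (\<lambda>k y\<^sub>0.
        tsum ?N (coact Y y\<^sub>0) (\<lambda>k' y\<^sub>1. ?p (zmult h k) (zmult h' k') (pr X Y x\<^sub>1 y\<^sub>1)))))"
      by (rule tsum_coact_cong[OF X x], rule tsum_swap[OF vsH vY vsH vX vN]) (rule linr vT X Y y | assumption)+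
    also have "\<dots> = tsum ?N (coact X x) (\<lambda>h x\<^sub>0. tsum ?N (coact X x\<^sub>0) (\<lambda>h' x\<^sub>1. tsum ?N (coact Y y) (\<lambda>k y\<^sub>0.
        tsum ?N (comult H k) (\<lambda>k\<^sub>1 k\<^sub>2. ?p (zmult h k\<^sub>1) (zmult h' k\<^sub>2) (pr X Y x\<^sub>1 y\<^sub>0)))))"
      by (rule tsum_coact_cong[OF X x], rule tsum_coact_cong[OF X], assumption, rule coact_coassoc[OF Y vN y]) (rule linr vT X Y | assumption)+
    also have "\<dots> = tsum ?N (coact X x) (\<lambda>h x\<^sub>0. tsum ?N (comult H h) (\<lambda>h\<^sub>1 h\<^sub>2. tsum ?N (coact Y y) (\<lambda>k y\<^sub>0.
        tsum ?N (comult H k) (\<lambda>k\<^sub>1 k\<^sub>2. ?p (zmult h\<^sub>1 k\<^sub>1) (zmult h\<^sub>2 k\<^sub>2) (pr X Y x\<^sub>0 y\<^sub>0)))))"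
      by (rule coact_coassoc[OF X vN x]) (rule linr vT X Y y | assumption)+
    also have "\<dots> = tsum ?N (coact X x) (\<lambda>h x\<^sub>0. tsum ?N (coact Y y) (\<lambda>k y\<^sub>0. tsum ?N (comult H h) (\<lambda>h\<^sub>1 h\<^sub>2.
        tsum ?N (comult H k) (\<lambda>k\<^sub>1 k\<^sub>2. ?p (zmult h\<^sub>1 k\<^sub>1) (zmult h\<^sub>2 k\<^sub>2) (pr X Y x\<^sub>0 y\<^sub>0)))))"
      by (rule tsum_coact_cong[OF X x], rule tsum_swap[OF vsH vsH vsH vY vN]) (rule linr vT X Y y | assumption)+
    also have "\<dots> = tsum ?N (coact X x) (\<lambda>h x\<^sub>0. tsum ?N (coact Y y) (\<lambda>k y\<^sub>0.
        tsum ?N (comult H (zmult h k)) (\<lambda>h\<^sub>1 h\<^sub>2. ?p h\<^sub>1 h\<^sub>2 (pr X Y x\<^sub>0 y\<^sub>0))))"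
    proof (rule tsum_coact_cong[OF X x], rule tsum_coact_cong[OF Y y])
      \<comment> \<open>Provides comultiplicativity of \<open>zmult\<close> in Sweedler
        form.\<close>
      interpret Q: bialg_struct zested
        using coquasi_bialgebra_zested unfolding coquasi_bialgebra_def Let_def by unfold_locales simp_all
      fix h k x\<^sub>0 y\<^sub>0 assume *: "h \<in> carrier H" "x\<^sub>0 \<in> carrier X" "k \<in> carrier H" "y\<^sub>0 \<in> carrier Y"
      have "bilin H H ?N (\<lambda>h\<^sub>1 h\<^sub>2. ?p h\<^sub>1 h\<^sub>2 (pr X Y x\<^sub>0 y\<^sub>0))" by (rule bilinI) (rule linr vT X Y * | assumption)+
      then show "tsum ?N (comult H h) (\<lambda>h\<^sub>1 h\<^sub>2. tsum ?N (comult H k) (\<lambda>k\<^sub>1 k\<^sub>2. ?p (zmult h\<^sub>1 k\<^sub>1) (zmult h\<^sub>2 k\<^sub>2) (pr X Y x\<^sub>0 y\<^sub>0)))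
          = tsum ?N (comult H (zmult h k)) (\<lambda>h\<^sub>1 h\<^sub>2. ?p h\<^sub>1 h\<^sub>2 (pr X Y x\<^sub>0 y\<^sub>0))"
        using Q.tsum_comult_mult[of h k ?N] vN * by (simp add: bilin_def)
    qed
    also have "\<dots> = ?R (pr X Y x y)"
      by (rule tsum_coact_pr[OF X Y vN bilinI x y, symmetric]) (rule linr vT X Y | assumption)+
    finally show "?L (pr X Y x y) = ?R (pr X Y x y)" .
  qed
  have counit: "tsum ?T (coact ?T u) (\<lambda>h v. counit H h \<odot>\<^bsub>?T\<^esub> v) = u" (is "?L u = u") if u: "u \<in> carrier ?T" for u
  proof (rule T_ext_all[OF X Y vT _ lin_id u, where f="?L"])
    show "lin ?T ?T ?L" by (rule lT lT' cT linr vT vX vY X Y | assumption)+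
    fix x y assume x: "x \<in> carrier X" and y: "y \<in> carrier Y"
    have "?L (pr X Y x y) = tsum ?T (coact X x) (\<lambda>h x\<^sub>0. tsum ?T (coact Y y) (\<lambda>k y\<^sub>0. counit H (zmult h k) \<odot>\<^bsub>?T\<^esub> pr X Y x\<^sub>0 y\<^sub>0))"
      by (rule tsum_coact_pr[OF X Y vT bilinI x y]) (rule linr vT X Y | assumption)+
    also have "\<dots> = tsum ?T (coact X x) (\<lambda>h x\<^sub>0. tsum ?T (coact Y y) (\<lambda>k y\<^sub>0. counit H k \<odot>\<^bsub>?T\<^esub> (counit H h \<odot>\<^bsub>?T\<^esub> pr X Y x\<^sub>0 y\<^sub>0)))"
      by (rule tsum_coact_cong[OF X x], rule tsum_coact_cong[OF Y y])
        (simp add: counit_zmult vs_smult_smult[OF vT] pr_closed X Y mult.commute)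
    also have "\<dots> = tsum ?T (coact X x) (\<lambda>h x\<^sub>0. counit H h \<odot>\<^bsub>?T\<^esub> pr X Y x\<^sub>0 y)"
      by (rule tsum_coact_cong[OF X x], rule coact_counit[OF Y vT y]) (rule linr vT X Y | assumption)+
    also have "\<dots> = pr X Y x y"
      by (rule coact_counit[OF X vT x]) (rule linr vT X Y y | assumption)+
    finally show "?L (pr X Y x y) = pr X Y x y" .
  qed
  show ?thesis unfolding comodule_def using vT lT coassoc counit by blast
qed

text \<open>\<open>zmult\<close> multiplies degrees, and on homogeneous components the coordinate of
  \<pi> at the product degree is a product of counits; the projection therefore fixes the
  generator.\<close>

lemma pr_gr:
  assumes X: "comodule H X" and Y: "comodule H Y" and a: "a \<in> carrier G" and b: "b \<in> carrier G"
    and x: "x \<in> gr X a" and y: "y \<in> gr Y b"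
  shows "pr X Y x y \<in> gr (T X Y) (a \<otimes>\<^bsub>G\<^esub> b)"
proof -
  let ?T = "T X Y" and ?c = "a \<otimes>\<^bsub>G\<^esub> b"
  note xX = gr_carrier[OF x] and yY = gr_carrier[OF y] and vT = T_vspace[OF X Y]
  have "hom_part ?c ?T (pr X Y x y) = tsum ?T (coact X x) (\<lambda>h x\<^sub>0. tsum ?T (coact Y y) (\<lambda>k y\<^sub>0. \<pi> (zmult h k) ?c \<odot>\<^bsub>?T\<^esub> pr X Y x\<^sub>0 y\<^sub>0))"
    unfolding half_braid_def by (rule tsum_coact_pr[OF X Y vT bilinI xX yY]) (rule linr vT X Y | assumption)+
  also have "\<dots> = tsum ?T (coact X x) (\<lambda>h x\<^sub>0. counit H h \<odot>\<^bsub>?T\<^esub> pr X Y x\<^sub>0 y)"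
  proof (rule tsum_coact_homog_cong[OF X vT a x bilinI bilinI])
    fix h x\<^sub>0 assume h: "h \<in> gH a" and x0: "x\<^sub>0 \<in> gr X a"
    note hH = gH_carrier[OF h] and x0X = gr_carrier[OF x0]
    have "tsum ?T (coact Y y) (\<lambda>k y\<^sub>0. \<pi> (zmult h k) ?c \<odot>\<^bsub>?T\<^esub> pr X Y x\<^sub>0 y\<^sub>0)
        = tsum ?T (coact Y y) (\<lambda>k y\<^sub>0. counit H k \<odot>\<^bsub>?T\<^esub> (counit H h \<odot>\<^bsub>?T\<^esub> pr X Y x\<^sub>0 y\<^sub>0))"
    proof (rule tsum_coact_homog_cong[OF Y vT b y bilinI bilinI])
      fix k y\<^sub>0 assume k: "k \<in> gH b" and y0: "y\<^sub>0 \<in> gr Y b"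
      have "\<pi> (zmult h k) ?c = counit H h * counit H k"
        using pi_homog[OF _ zmult_gr[OF a b h k]] a b counit_zmult[OF hH gH_carrier[OF k]] by (simp add: delta_def)
      then show "\<pi> (zmult h k) ?c \<odot>\<^bsub>?T\<^esub> pr X Y x\<^sub>0 y\<^sub>0 = counit H k \<odot>\<^bsub>?T\<^esub> (counit H h \<odot>\<^bsub>?T\<^esub> pr X Y x\<^sub>0 y\<^sub>0)"
        using pr_closed[OF x0X gr_carrier[OF y0] X Y] by (simp add: vs_smult_smult[OF vT] mult.commute)
    qed (rule linr vT X Y hH x0X | assumption)+
    also have "\<dots> = counit H h \<odot>\<^bsub>?T\<^esub> pr X Y x\<^sub>0 y"
      by (rule coact_counit[OF Y vT yY]) (rule linr vT X Y x0X | assumption)+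
    finally show "tsum ?T (coact Y y) (\<lambda>k y\<^sub>0. \<pi> (zmult h k) ?c \<odot>\<^bsub>?T\<^esub> pr X Y x\<^sub>0 y\<^sub>0) = counit H h \<odot>\<^bsub>?T\<^esub> pr X Y x\<^sub>0 y" .
  qed (rule linr vT X Y yY | assumption)+
  also have "\<dots> = pr X Y x y"
    by (rule coact_counit[OF X vT xX]) (rule linr vT X Y yY | assumption)+
  finally show ?thesis using pr_closed[OF xX yY X Y] a b by (simp add: gr_iff[OF T_comodule[OF X Y]])
qed

text \<open>The character is multiplicative for the product of \<open>H\<close>, whereas the
  coaction uses \<open>zmult\<close>, whose extra factor \<open>\<Lambda> a b\<close> contributes a
  scalar. In the pentagon this scalar becomes the left-hand side of the equation for
  \<omega>.\<close>

lemma half_braid_pr: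
  assumes X: "comodule H X" and Y: "comodule H Y" and a: "a \<in> carrier G" and b: "b \<in> carrier G"
    and x: "x \<in> gr X a" and y: "y \<in> gr Y b" and s: "s \<in> \<Gamma>"
  shows "half_braid (\<gamma> s) (T X Y) (pr X Y x y)
    = \<gamma> s (\<Lambda> a b) \<odot>\<^bsub>T X Y\<^esub> pr X Y (half_braid (\<gamma> s) X x) (half_braid (\<gamma> s) Y y)"
proof -
  let ?T = "T X Y" and ?q = "\<gamma> s (\<Lambda> a b)"
  note xX = gr_carrier[OF x] and yY = gr_carrier[OF y] and vT = T_vspace[OF X Y] and ls = lin_gamma[OF s]
  have hy: "half_braid (\<gamma> s) Y y \<in> carrier Y" by (rule half_braid_closed[OF Y ls yY])
  have "half_braid (\<gamma> s) ?T (pr X Y x y) = tsum ?T (coact X x) (\<lambda>h x\<^sub>0. tsum ?T (coact Y y) (\<lambda>k y\<^sub>0. \<gamma> s (zmult h k) \<odot>\<^bsub>?T\<^esub> pr X Y x\<^sub>0 y\<^sub>0))"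
    unfolding half_braid_def by (rule tsum_coact_pr[OF X Y vT bilinI xX yY]) (rule linr vT X Y s | assumption)+
  also have "\<dots> = tsum ?T (coact X x) (\<lambda>h x\<^sub>0. \<gamma> s h \<odot>\<^bsub>?T\<^esub> (?q \<odot>\<^bsub>?T\<^esub> pr X Y x\<^sub>0 (half_braid (\<gamma> s) Y y)))"
  proof (rule tsum_coact_homog_cong[OF X vT a x bilinI bilinI])
    fix h x\<^sub>0 assume h: "h \<in> gH a" and x0: "x\<^sub>0 \<in> gr X a"
    note hH = gH_carrier[OF h] and x0X = gr_carrier[OF x0]
    have "tsum ?T (coact Y y) (\<lambda>k y\<^sub>0. \<gamma> s (zmult h k) \<odot>\<^bsub>?T\<^esub> pr X Y x\<^sub>0 y\<^sub>0)
        = tsum ?T (coact Y y) (\<lambda>k y\<^sub>0. \<gamma> s k \<odot>\<^bsub>?T\<^esub> (\<gamma> s h \<odot>\<^bsub>?T\<^esub> (?q \<odot>\<^bsub>?T\<^esub> pr X Y x\<^sub>0 y\<^sub>0)))"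
    proof (rule tsum_coact_homog_cong[OF Y vT b y bilinI bilinI])
      fix k y\<^sub>0 assume k: "k \<in> gH b" and y0: "y\<^sub>0 \<in> gr Y b"
      show "\<gamma> s (zmult h k) \<odot>\<^bsub>?T\<^esub> pr X Y x\<^sub>0 y\<^sub>0 = \<gamma> s k \<odot>\<^bsub>?T\<^esub> (\<gamma> s h \<odot>\<^bsub>?T\<^esub> (?q \<odot>\<^bsub>?T\<^esub> pr X Y x\<^sub>0 y\<^sub>0))"
        using pr_closed[OF x0X gr_carrier[OF y0] X Y] hH gH_carrier[OF k] Lambda_H[OF a b]
        by (simp add: zmult_homog[OF a b h k] gamma_mult[OF s] mult_closed vs_smult_smult[OF vT] mult_ac)
    qed (rule linr vT X Y hH x0X s | assumption)+
    also have "\<dots> = \<gamma> s h \<odot>\<^bsub>?T\<^esub> (?q \<odot>\<^bsub>?T\<^esub> pr X Y x\<^sub>0 (half_braid (\<gamma> s) Y y))"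
      by (rule tsum_half_braid[OF Y vT yY ls]) (rule linr vT X Y x0X | assumption)+
    finally show "tsum ?T (coact Y y) (\<lambda>k y\<^sub>0. \<gamma> s (zmult h k) \<odot>\<^bsub>?T\<^esub> pr X Y x\<^sub>0 y\<^sub>0)
        = \<gamma> s h \<odot>\<^bsub>?T\<^esub> (?q \<odot>\<^bsub>?T\<^esub> pr X Y x\<^sub>0 (half_braid (\<gamma> s) Y y))" .
  qed (rule linr vT X Y yY hy s | assumption)+
  also have "\<dots> = ?q \<odot>\<^bsub>?T\<^esub> pr X Y (half_braid (\<gamma> s) X x) (half_braid (\<gamma> s) Y y)"
    by (rule tsum_half_braid[OF X vT xX ls]) (rule linr vT X Y hy | assumption)+
  finally show ?thesis .
qed

text \<open>The homogeneous \<open>v\<close> supplied by the outer extensionality need not be a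
  value of \<open>pr\<close>; a second extensionality for fixed \<open>z\<close> reduces to that
  case.\<close>

lemma T_ext3:
  assumes X: "comodule H X" and Y: "comodule H Y" and Z: "comodule H Z" and N: "vspace N"
    and f: "lin (T (T X Y) Z) N f" and g: "lin (T (T X Y) Z) N g" and u: "u \<in> carrier (T (T X Y) Z)"
    and eq: "\<And>a b c x y z. a \<in> carrier G \<Longrightarrow> b \<in> carrier G \<Longrightarrow> c \<in> carrier G \<Longrightarrow> x \<in> gr X a \<Longrightarrow> y \<in> gr Y b \<Longrightarrow> z \<in> gr Z c
      \<Longrightarrow> f (pr (T X Y) Z (pr X Y x y) z) = g (pr (T X Y) Z (pr X Y x y) z)"
  shows "f u = g u"
proof (rule T_ext[OF T_comodule[OF X Y] Z N f g u])
  fix a c v z assume *: "a \<in> carrier G" "c \<in> carrier G" "v \<in> gr (T X Y) a" "z \<in> gr Z c"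
  note zZ = gr_carrier[OF *(4)]
  show "f (pr (T X Y) Z v z) = g (pr (T X Y) Z v z)"
    by (rule T_ext[OF X Y N _ _ gr_carrier[OF *(3)], where f="\<lambda>v. f (pr (T X Y) Z v z)" and g="\<lambda>v. g (pr (T X Y) Z v z)"])
      (assumption | rule lin_comp[OF f] lin_comp[OF g] linr X Y Z zZ eq[rotated 3] *)+
qed

lemma T_ext3':
  assumes X: "comodule H X" and Y: "comodule H Y" and Z: "comodule H Z" and N: "vspace N"
    and f: "lin (T X (T Y Z)) N f" and g: "lin (T X (T Y Z)) N g" and u: "u \<in> carrier (T X (T Y Z))"
    and eq: "\<And>a b c x y z. a \<in> carrier G \<Longrightarrow> b \<in> carrier G \<Longrightarrow> c \<in> carrier G \<Longrightarrow> x \<in> gr X a \<Longrightarrow> y \<in> gr Y b \<Longrightarrow> z \<in> gr Z c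
      \<Longrightarrow> f (pr X (T Y Z) x (pr Y Z y z)) = g (pr X (T Y Z) x (pr Y Z y z))"
  shows "f u = g u"
proof (rule T_ext[OF X T_comodule[OF Y Z] N f g u])
  fix a c v x assume *: "a \<in> carrier G" "c \<in> carrier G" "x \<in> gr X a" "v \<in> gr (T Y Z) c"
  note xX = gr_carrier[OF *(3)]
  show "f (pr X (T Y Z) x v) = g (pr X (T Y Z) x v)"
    by (rule T_ext[OF Y Z N _ _ gr_carrier[OF *(4)], where f="\<lambda>v. f (pr X (T Y Z) x v)" and g="\<lambda>v. g (pr X (T Y Z) x v)"])
      (assumption | rule lin_comp[OF f] lin_comp[OF g] linr X Y Z xX eq[rotated 3] *)+
qed

lemma T_ext4:
  assumes W: "comodule H W" and X: "comodule H X" and Y: "comodule H Y" and Z: "comodule H Z" and N: "vspace N"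
    and f: "lin (T (T (T W X) Y) Z) N f" and g: "lin (T (T (T W X) Y) Z) N g" and u: "u \<in> carrier (T (T (T W X) Y) Z)"
    and eq: "\<And>a b c d w x y z. a \<in> carrier G \<Longrightarrow> b \<in> carrier G \<Longrightarrow> c \<in> carrier G \<Longrightarrow> d \<in> carrier G
      \<Longrightarrow> w \<in> gr W a \<Longrightarrow> x \<in> gr X b \<Longrightarrow> y \<in> gr Y c \<Longrightarrow> z \<in> gr Z d
      \<Longrightarrow> f (pr (T (T W X) Y) Z (pr (T W X) Y (pr W X w x) y) z) = g (pr (T (T W X) Y) Z (pr (T W X) Y (pr W X w x) y) z)"
  shows "f u = g u"
proof (rule T_ext[OF T_comodule[OF T_comodule[OF W X] Y] Z N f g u])
  fix a c v z assume *: "a \<in> carrier G" "c \<in> carrier G" "v \<in> gr (T (T W X) Y) a" "z \<in> gr Z c"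
  note zZ = gr_carrier[OF *(4)]
  show "f (pr (T (T W X) Y) Z v z) = g (pr (T (T W X) Y) Z v z)"
    by (rule T_ext3[OF W X Y N _ _ gr_carrier[OF *(3)], where f="\<lambda>v. f (pr (T (T W X) Y) Z v z)" and g="\<lambda>v. g (pr (T (T W X) Y) Z v z)"])
      (assumption | rule lin_comp[OF f] lin_comp[OF g] linr W X Y Z zZ eq[rotated 4] *)+
qed

lemma U_gr: "u \<in> carrier U \<Longrightarrow> u \<in> gr U \<one>\<^bsub>G\<^esub>"
proof -
  assume u: "u \<in> carrier U"
  note vU = comodule_vspace[OF U]
  have "hom_part \<one>\<^bsub>G\<^esub> U u = \<pi> \<one>\<^bsub>H\<^esub> \<one>\<^bsub>G\<^esub> \<odot>\<^bsub>U\<^esub> u"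
    unfolding half_braid_def coact_U[OF u]
    by (rule tsum_pure[OF vsH vU vU bilinI one_closed u]) (rule linr vU | assumption)+
  then show ?thesis using u vU by (simp add: gr_iff[OF U] pi_one delta_def)
qed

text \<open>An associator for the model, glued over the three degrees. It will witness the existence
  part of the definite description in \<open>zested_assoc\<close>.\<close>

definition asc_map :: "('k, 'h, 'x) comod \<Rightarrow> ('k, 'h, 'x) comod \<Rightarrow> ('k, 'h, 'x) comod \<Rightarrow> 'x \<Rightarrow> 'x" where
  "asc_map X Y Z u = tsum (T X (T Y Z)) (dc (T X Y) Z u) (\<lambda>v z. tsum (T X (T Y Z)) (dc X Y v) (\<lambda>x y.
     gsum (T X (T Y Z)) X (\<lambda>a x. gsum (T X (T Y Z)) Y (\<lambda>b y. gsum (T X (T Y Z)) Z (\<lambda>c z.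
       \<omega> a b c \<odot>\<^bsub>T X (T Y Z)\<^esub> pr X (T Y Z) x (pr Y Z y (half_braid (\<gamma> (\<Lambda> a b)) Z z))) z) y) x))"

text \<open>Acts on \<open>z\<close> by the character of the inverse group-like and divides by
  \<omega>; it inverts the associator of any category built on the model.\<close>

definition asc_inv :: "('k, 'h, 'x) comod \<Rightarrow> ('k, 'h, 'x) comod \<Rightarrow> ('k, 'h, 'x) comod \<Rightarrow> 'x \<Rightarrow> 'x" where
  "asc_inv X Y Z u = tsum (T (T X Y) Z) (dc X (T Y Z) u) (\<lambda>x v. tsum (T (T X Y) Z) (dc Y Z v) (\<lambda>y z.
     gsum (T (T X Y) Z) X (\<lambda>a x. gsum (T (T X Y) Z) Y (\<lambda>b y. gsum (T (T X Y) Z) Z (\<lambda>c z.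
       inverse (\<omega> a b c) \<odot>\<^bsub>T (T X Y) Z\<^esub> pr (T X Y) Z (pr X Y x y) (half_braid (\<gamma> (inv\<^bsub>GL\<^esub> (\<Lambda> a b))) Z z)) z) y) x))"

lemma gsum3_homog:
  assumes X: "comodule H X" and Y: "comodule H Y" and Z: "comodule H Z" and N: "vspace N"
    and a: "a \<in> carrier G" and b: "b \<in> carrier G" and c: "c \<in> carrier G"
    and x: "x \<in> gr X a" and y: "y \<in> gr Y b" and z: "z \<in> gr Z c"
    and F1: "\<And>a b c y z. a \<in> carrier G \<Longrightarrow> b \<in> carrier G \<Longrightarrow> c \<in> carrier G \<Longrightarrow> y \<in> carrier Y \<Longrightarrow> z \<in> carrier Z \<Longrightarrow> lin X N (\<lambda>x. F a b c x y z)"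
    and F2: "\<And>a b c x z. a \<in> carrier G \<Longrightarrow> b \<in> carrier G \<Longrightarrow> c \<in> carrier G \<Longrightarrow> x \<in> carrier X \<Longrightarrow> z \<in> carrier Z \<Longrightarrow> lin Y N (\<lambda>y. F a b c x y z)"
    and F3: "\<And>a b c x y. a \<in> carrier G \<Longrightarrow> b \<in> carrier G \<Longrightarrow> c \<in> carrier G \<Longrightarrow> x \<in> carrier X \<Longrightarrow> y \<in> carrier Y \<Longrightarrow> lin Z N (\<lambda>z. F a b c x y z)"
  shows "gsum N X (\<lambda>a x. gsum N Y (\<lambda>b y. gsum N Z (\<lambda>c z. F a b c x y z) z) y) x = F a b c x y z"
proof -
  note xX = gr_carrier[OF x] and yY = gr_carrier[OF y] and zZ = gr_carrier[OF z] and vX = comodule_vspace[OF X] and vY = comodule_vspace[OF Y]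
  have "gsum N X (\<lambda>a x. gsum N Y (\<lambda>b y. gsum N Z (\<lambda>c z. F a b c x y z) z) y) x = gsum N Y (\<lambda>b y. gsum N Z (\<lambda>c z. F a b c x y z) z) y"
    by (rule gsum_homog[OF X N a x]) (rule linr X Y Z N F1 yY zZ | assumption)+
  also have "\<dots> = gsum N Z (\<lambda>c z. F a b c x y z) z"
    by (rule gsum_homog[OF Y N b y]) (rule linr X Y Z N F2 a xX zZ | assumption)+
  also have "\<dots> = F a b c x y z"
    by (rule gsum_homog[OF Z N c z]) (rule F3 a b xX yY | assumption)+
  finally show ?thesis .
qed

lemma asc_map:
  assumes X: "comodule H X" and Y: "comodule H Y" and Z: "comodule H Z"
  shows "lin (T (T X Y) Z) (T X (T Y Z)) (asc_map X Y Z)"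
    and "\<And>a b c x y z. a \<in> carrier G \<Longrightarrow> b \<in> carrier G \<Longrightarrow> c \<in> carrier G \<Longrightarrow> x \<in> gr X a \<Longrightarrow> y \<in> gr Y b \<Longrightarrow> z \<in> gr Z c
      \<Longrightarrow> asc_map X Y Z (pr (T X Y) Z (pr X Y x y) z) = \<omega> a b c \<odot>\<^bsub>T X (T Y Z)\<^esub> pr X (T Y Z) x (pr Y Z y (half_braid (\<gamma> (\<Lambda> a b)) Z z))"
proof -
  let ?N = "T X (T Y Z)"
  let ?F = "\<lambda>a b c x y z. \<omega> a b c \<odot>\<^bsub>?N\<^esub> pr X (T Y Z) x (pr Y Z y (half_braid (\<gamma> (\<Lambda> a b)) Z z))"
  let ?K = "\<lambda>x y z. gsum ?N X (\<lambda>a x. gsum ?N Y (\<lambda>b y. gsum ?N Z (\<lambda>c z. ?F a b c x y z) z) y) x"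
  note lg = lin_gamma[OF Lambda_closed]
  have XY: "comodule H (T X Y)" and N: "comodule H ?N" by (rule T_comodule X Y Z)+
  note vN = comodule_vspace[OF N] and vX = comodule_vspace[OF X] and vY = comodule_vspace[OF Y]
  have K: "lin X ?N (\<lambda>x. ?K x y z)" "lin Y ?N (\<lambda>y. ?K x y z)" "lin Z ?N (\<lambda>z. ?K x y z)"
    if "x \<in> carrier X" "y \<in> carrier Y" "z \<in> carrier Z" for x y z
    by (rule lg linr X Y Z that | assumption)+
  have bK: "bilin X Y ?N (\<lambda>x y. ?K x y z)" if "z \<in> carrier Z" for z
    by (rule bilinI) (rule lg linr X Y Z that | assumption)+
  have bL: "bilin (T X Y) Z ?N (\<lambda>v z. tsum ?N (dc X Y v) (\<lambda>x y. ?K x y z))"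
    by (rule bilinI) (rule lg linr X Y Z | assumption)+
  show "lin (T (T X Y) Z) ?N (asc_map X Y Z)"
    unfolding asc_map_def[abs_def] by (rule tlift(1)[OF XY Z vN bL])
  fix a b c x y z assume *: "a \<in> carrier G" "b \<in> carrier G" "c \<in> carrier G" "x \<in> gr X a" "y \<in> gr Y b" "z \<in> gr Z c"
  note xX = gr_carrier[OF *(4)] and yY = gr_carrier[OF *(5)] and zZ = gr_carrier[OF *(6)]
  have "asc_map X Y Z (pr (T X Y) Z (pr X Y x y) z) = tsum ?N (dc X Y (pr X Y x y)) (\<lambda>x y. ?K x y z)"
    unfolding asc_map_def by (rule tlift(2)[OF XY Z vN bL pr_closed[OF xX yY X Y] zZ])
  also have "\<dots> = ?K x y z" by (rule tlift(2)[OF X Y vN bK[OF zZ] xX yY])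
  also have "\<dots> = ?F a b c x y z"
    by (rule gsum3_homog[OF X Y Z vN *]) (rule lg linr X Y Z | assumption)+
  finally show "asc_map X Y Z (pr (T X Y) Z (pr X Y x y) z) = ?F a b c x y z" .
qed

lemma asc_inv:
  assumes X: "comodule H X" and Y: "comodule H Y" and Z: "comodule H Z"
  shows "lin (T X (T Y Z)) (T (T X Y) Z) (asc_inv X Y Z)"
    and "\<And>a b c x y z. a \<in> carrier G \<Longrightarrow> b \<in> carrier G \<Longrightarrow> c \<in> carrier G \<Longrightarrow> x \<in> gr X a \<Longrightarrow> y \<in> gr Y b \<Longrightarrow> z \<in> gr Z c
      \<Longrightarrow> asc_inv X Y Z (pr X (T Y Z) x (pr Y Z y z))
        = inverse (\<omega> a b c) \<odot>\<^bsub>T (T X Y) Z\<^esub> pr (T X Y) Z (pr X Y x y) (half_braid (\<gamma> (inv\<^bsub>GL\<^esub> (\<Lambda> a b))) Z z)"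
proof -
  let ?N = "T (T X Y) Z"
  let ?F = "\<lambda>a b c x y z. inverse (\<omega> a b c) \<odot>\<^bsub>?N\<^esub> pr (T X Y) Z (pr X Y x y) (half_braid (\<gamma> (inv\<^bsub>GL\<^esub> (\<Lambda> a b))) Z z)"
  let ?K = "\<lambda>x y z. gsum ?N X (\<lambda>a x. gsum ?N Y (\<lambda>b y. gsum ?N Z (\<lambda>c z. ?F a b c x y z) z) y) x"
  note lg = lin_gamma[OF Lambda_inv_closed]
  have YZ: "comodule H (T Y Z)" and N: "comodule H ?N" by (rule T_comodule X Y Z)+
  note vN = comodule_vspace[OF N]
  have bK: "bilin Y Z ?N (\<lambda>y z. ?K x y z)" if "x \<in> carrier X" for x
    by (rule bilinI) (rule lg linr X Y Z that | assumption)+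
  have bL: "bilin X (T Y Z) ?N (\<lambda>x v. tsum ?N (dc Y Z v) (\<lambda>y z. ?K x y z))"
    by (rule bilinI) (rule lg linr X Y Z | assumption)+
  show "lin (T X (T Y Z)) ?N (asc_inv X Y Z)"
    unfolding asc_inv_def[abs_def] by (rule tlift(1)[OF X YZ vN bL])
  fix a b c x y z assume *: "a \<in> carrier G" "b \<in> carrier G" "c \<in> carrier G" "x \<in> gr X a" "y \<in> gr Y b" "z \<in> gr Z c"
  note xX = gr_carrier[OF *(4)] and yY = gr_carrier[OF *(5)] and zZ = gr_carrier[OF *(6)]
  have "asc_inv X Y Z (pr X (T Y Z) x (pr Y Z y z)) = tsum ?N (dc Y Z (pr Y Z y z)) (\<lambda>y z. ?K x y z)"
    unfolding asc_inv_def by (rule tlift(2)[OF X YZ vN bL xX pr_closed[OF yY zZ Y Z]])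
  also have "\<dots> = ?K x y z" by (rule tlift(2)[OF Y Z vN bK[OF xX] yY zZ])
  also have "\<dots> = ?F a b c x y z"
    by (rule gsum3_homog[OF X Y Z vN *]) (rule lg linr X Y Z | assumption)+
  finally show "asc_inv X Y Z (pr X (T Y Z) x (pr Y Z y z)) = ?F a b c x y z" .
qed

end

section \<open>The monoidal category of a model\<close>

text \<open>The structure maps are prescribed on homogeneous generators, which together with
  linearity and extensionality determines them. The associator has the zested form; for comodules
  over \<open>zested\<close> this form must be derived from the action of the associator
  form.\<close>

locale tensor_cat = tensor_model H G \<pi> \<Gamma> \<gamma> \<Lambda> \<omega> T pr dc U e sc
  for H :: "('k::field, 'h, 'm) hopf_scheme" and G :: "'g monoid" and \<pi> and \<Gamma> and \<gamma> and \<Lambda> and \<omega>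
    and T :: "('k, 'h, 'x) comod \<Rightarrow> ('k, 'h, 'x) comod \<Rightarrow> ('k, 'h, 'x) comod" and pr and dc and U and e and sc +
  fixes C :: "('k, ('k, 'h, 'x) comod, 'x \<Rightarrow> 'x) moncat"
  assumes C: "comod_like H C" and TOb: "TOb C = T" and UOb: "UOb C = U"
    and TMor_ext: "\<And>X X' Y Y' f g. comodule H X \<Longrightarrow> comodule H X' \<Longrightarrow> comodule H Y \<Longrightarrow> comodule H Y'
      \<Longrightarrow> f \<in> carrier (comod_hom H X X') \<Longrightarrow> g \<in> carrier (comod_hom H Y Y')
      \<Longrightarrow> TMor C X X' Y Y' f g \<in> extensional (carrier (T X Y))"
    and TMor_lin: "\<And>X X' Y Y' f g. comodule H X \<Longrightarrow> comodule H X' \<Longrightarrow> comodule H Y \<Longrightarrow> comodule H Y'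
      \<Longrightarrow> f \<in> carrier (comod_hom H X X') \<Longrightarrow> g \<in> carrier (comod_hom H Y Y')
      \<Longrightarrow> lin (T X Y) (T X' Y') (TMor C X X' Y Y' f g)"
    and TMor_homog: "\<And>X X' Y Y' f g a b x y. comodule H X \<Longrightarrow> comodule H X' \<Longrightarrow> comodule H Y \<Longrightarrow> comodule H Y'
      \<Longrightarrow> f \<in> carrier (comod_hom H X X') \<Longrightarrow> g \<in> carrier (comod_hom H Y Y')
      \<Longrightarrow> a \<in> carrier G \<Longrightarrow> b \<in> carrier G \<Longrightarrow> x \<in> comod_grade G \<pi> X a \<Longrightarrow> y \<in> comod_grade G \<pi> Y b
      \<Longrightarrow> TMor C X X' Y Y' f g (pr X Y x y) = pr X' Y' (f x) (g y)"
    and Asc_ext: "\<And>X Y Z. comodule H X \<Longrightarrow> comodule H Y \<Longrightarrow> comodule H Z \<Longrightarrow> Asc C X Y Z \<in> extensional (carrier (T (T X Y) Z))"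
    and Asc_lin: "\<And>X Y Z. comodule H X \<Longrightarrow> comodule H Y \<Longrightarrow> comodule H Z \<Longrightarrow> lin (T (T X Y) Z) (T X (T Y Z)) (Asc C X Y Z)"
    and Asc_homog: "\<And>X Y Z a b c x y z. comodule H X \<Longrightarrow> comodule H Y \<Longrightarrow> comodule H Z
      \<Longrightarrow> a \<in> carrier G \<Longrightarrow> b \<in> carrier G \<Longrightarrow> c \<in> carrier G
      \<Longrightarrow> x \<in> comod_grade G \<pi> X a \<Longrightarrow> y \<in> comod_grade G \<pi> Y b \<Longrightarrow> z \<in> comod_grade G \<pi> Z c
      \<Longrightarrow> Asc C X Y Z (pr (T X Y) Z (pr X Y x y) z)
          = \<omega> a b c \<odot>\<^bsub>T X (T Y Z)\<^esub> pr X (T Y Z) x (pr Y Z y (half_braid (\<gamma> (\<Lambda> a b)) Z z))"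
    and LUn_ext: "\<And>X. comodule H X \<Longrightarrow> LUn C X \<in> extensional (carrier (T U X))"
    and LUn_lin: "\<And>X. comodule H X \<Longrightarrow> lin (T U X) X (LUn C X)"
    and LUn_homog: "\<And>X u a x. comodule H X \<Longrightarrow> u \<in> carrier U \<Longrightarrow> a \<in> carrier G \<Longrightarrow> x \<in> comod_grade G \<pi> X a
      \<Longrightarrow> LUn C X (pr U X u x) = sc u \<odot>\<^bsub>X\<^esub> x"
    and RUn_ext: "\<And>X. comodule H X \<Longrightarrow> RUn C X \<in> extensional (carrier (T X U))"
    and RUn_lin: "\<And>X. comodule H X \<Longrightarrow> lin (T X U) X (RUn C X)"
    and RUn_homog: "\<And>X u a x. comodule H X \<Longrightarrow> u \<in> carrier U \<Longrightarrow> a \<in> carrier G \<Longrightarrow> x \<in> comod_grade G \<pi> X a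
      \<Longrightarrow> RUn C X (pr X U x u) = sc u \<odot>\<^bsub>X\<^esub> x"
begin

interpretation R: ring H by (rule ringH)
interpretation Gr: group G by (rule grp)

lemma C_simps [simp]:
  "Ob C = {X. comodule H X}" "Hom C = comod_hom H" "Cmp C = (\<lambda>X Y Z g f. compose (carrier X) g f)"
  "Idn C = (\<lambda>X. \<lambda>x\<in>carrier X. x)" "TOb C = T" "UOb C = U"
  using C TOb UOb by (auto simp: comod_like_def)

text \<open>Both sides are bilinear in \<open>x\<close> and \<open>y\<close>, so the homogeneous
  case extends to all elements.\<close>

lemma TMor_pr:
  assumes X: "comodule H X" and X': "comodule H X'" and Y: "comodule H Y" and Y': "comodule H Y'"
    and f: "f \<in> carrier (comod_hom H X X')" and g: "g \<in> carrier (comod_hom H Y Y')"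
    and x: "x \<in> carrier X" and y: "y \<in> carrier Y"
  shows "TMor C X X' Y Y' f g (pr X Y x y) = pr X' Y' (f x) (g y)"
proof (rule bilin_homog_ext[OF X Y T_vspace[OF X' Y'] bilinI bilinI x y])
  note lM = lin_comp[OF TMor_lin[OF X X' Y Y' f g]] and lf = mor_lin[OF f] and lg = mor_lin[OF g]
  show "lin X (T X' Y') (\<lambda>x. TMor C X X' Y Y' f g (pr X Y x y))" if "y \<in> carrier Y" for y
    by (rule lM linr X Y that)+
  show "lin Y (T X' Y') (\<lambda>y. TMor C X X' Y Y' f g (pr X Y x y))" if "x \<in> carrier X" for x
    by (rule lM linr X Y that)+
  show "lin X (T X' Y') (\<lambda>x. pr X' Y' (f x) (g y))" if "y \<in> carrier Y" for y
    by (rule lf linr X' Y' lin_closed[OF lg that])+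
  show "lin Y (T X' Y') (\<lambda>y. pr X' Y' (f x) (g y))" if "x \<in> carrier X" for x
    by (rule lg linr X' Y' lin_closed[OF lf that])+
qed (rule TMor_homog[OF X X' Y Y' f g])

lemma TMor_mor:
  assumes X: "comodule H X" and X': "comodule H X'" and Y: "comodule H Y" and Y': "comodule H Y'"
    and f: "f \<in> carrier (comod_hom H X X')" and g: "g \<in> carrier (comod_hom H Y Y')"
  shows "TMor C X X' Y Y' f g \<in> carrier (comod_hom H (T X Y) (T X' Y'))"
proof (rule morI)
  let ?M = "TMor C X X' Y Y' f g" and ?T = "T X Y" and ?T' = "T X' Y'"
  let ?N = "tensor H ?T'"
  note lM = TMor_lin[OF X X' Y Y' f g] and lf = mor_lin[OF f] and lg = mor_lin[OF g] and Mp = TMor_pr[OF X X' Y Y' f g]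
  note lM' = lin_comp[OF lM] and cM = lin_closed[OF lM]
  note T = T_comodule[OF X Y] and T' = T_comodule[OF X' Y'] and vT = T_vspace[OF X Y] and vT' = T_vspace[OF X' Y']
  have vN: "vspace ?N" by (rule linr vT')+
  show "?M \<in> extensional (carrier ?T)" by (rule TMor_ext[OF X X' Y Y' f g])
  show "lin ?T ?T' ?M" by (rule lM)
  fix u assume u: "u \<in> carrier ?T"
  show "coact ?T' (?M u) = tsum ?N (coact ?T u) (\<lambda>h v. pure H ?T' h (?M v))"
  proof (rule T_ext_all[OF X Y vN _ _ u, where f="\<lambda>u. coact ?T' (?M u)"])
    show "lin ?T ?N (\<lambda>u. coact ?T' (?M u))" "lin ?T ?N (\<lambda>u. tsum ?N (coact ?T u) (\<lambda>h v. pure H ?T' h (?M v)))"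
      by (rule lM lM' cM linr X Y X' Y' | assumption)+
    fix x y assume x: "x \<in> carrier X" and y: "y \<in> carrier Y"
    note fx = lin_closed[OF lf x] and gy = lin_closed[OF lg y]
    have "coact ?T' (?M (pr X Y x y)) = tsum ?N (coact X' (f x)) (\<lambda>h x\<^sub>0. tsum ?N (coact Y' (g y)) (\<lambda>k y\<^sub>0. pure H ?T' (zmult h k) (pr X' Y' x\<^sub>0 y\<^sub>0)))"
      unfolding Mp[OF x y] by (rule coact_pr[OF X' Y' fx gy])
    also have "\<dots> = tsum ?N (coact X x) (\<lambda>h x\<^sub>0. tsum ?N (coact Y' (g y)) (\<lambda>k y\<^sub>0. pure H ?T' (zmult h k) (pr X' Y' (f x\<^sub>0) y\<^sub>0)))"
      by (rule tsum_coact_mor[OF X X' vN f bilinI x]) (rule linr X' Y' gy vT' | assumption)+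
    also have "\<dots> = tsum ?N (coact X x) (\<lambda>h x\<^sub>0. tsum ?N (coact Y y) (\<lambda>k y\<^sub>0. pure H ?T' (zmult h k) (pr X' Y' (f x\<^sub>0) (g y\<^sub>0))))"
      by (rule tsum_coact_cong[OF X x], rule tsum_coact_mor[OF Y Y' vN g bilinI y]) (rule linr X' Y' lin_closed[OF lf] vT' | assumption)+
    also have "\<dots> = tsum ?N (coact X x) (\<lambda>h x\<^sub>0. tsum ?N (coact Y y) (\<lambda>k y\<^sub>0. pure H ?T' (zmult h k) (?M (pr X Y x\<^sub>0 y\<^sub>0))))"
      by (rule tsum_coact_cong[OF X x], rule tsum_coact_cong[OF Y y]) (simp add: Mp)
    also have "\<dots> = tsum ?N (coact ?T (pr X Y x y)) (\<lambda>h v. pure H ?T' h (?M v))"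
      by (rule tsum_coact_pr[OF X Y vN bilinI x y, symmetric]) (rule lM lM' cM linr X' Y' vT' | assumption)+
    finally show "coact ?T' (?M (pr X Y x y)) = tsum ?N (coact ?T (pr X Y x y)) (\<lambda>h v. pure H ?T' h (?M v))" .
  qed
qed

lemma mor_eq_T:
  assumes X: "comodule H X" and Y: "comodule H Y" and Z: "comodule H Z"
    and f: "f \<in> carrier (comod_hom H (T X Y) Z)" and g: "g \<in> carrier (comod_hom H (T X Y) Z)"
    and eq: "\<And>x y. x \<in> carrier X \<Longrightarrow> y \<in> carrier Y \<Longrightarrow> f (pr X Y x y) = g (pr X Y x y)"
  shows "f = g"
  by (rule mor_ext[OF f g], rule T_ext_all[OF X Y comodule_vspace[OF Z] mor_lin[OF f] mor_lin[OF g] _ eq])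

lemma TMor_bilin:
  assumes X: "comodule H X" and X': "comodule H X'" and Y: "comodule H Y" and Y': "comodule H Y'"
  shows "\<And>f. f \<in> carrier (comod_hom H X X') \<Longrightarrow> lin (comod_hom H Y Y') (comod_hom H (T X Y) (T X' Y')) (\<lambda>g. TMor C X X' Y Y' f g)"
    and "\<And>g. g \<in> carrier (comod_hom H Y Y') \<Longrightarrow> lin (comod_hom H X X') (comod_hom H (T X Y) (T X' Y')) (\<lambda>f. TMor C X X' Y Y' f g)"
proof -
  note T = T_comodule[OF X Y] and T' = T_comodule[OF X' Y']
  note M = TMor_mor[OF X X' Y Y'] and Mp = TMor_pr[OF X X' Y Y']
  have ops: "f \<oplus>\<^bsub>comod_hom H X Y\<^esub> g = (\<lambda>x\<in>carrier X. f x \<oplus>\<^bsub>Y\<^esub> g x)" "c \<odot>\<^bsub>comod_hom H X Y\<^esub> f = (\<lambda>x\<in>carrier X. c \<odot>\<^bsub>Y\<^esub> f x)"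
    for X Y :: "('k, 'h, 'x) comod" and f g c
    by (simp_all add: comod_hom_def mk_vspace_def)
  note add = mor_plus[OF X X', folded ops] mor_plus[OF Y Y', folded ops] mor_plus[OF T T', folded ops]
  note scale = mor_scale[OF X X', folded ops] mor_scale[OF Y Y', folded ops] mor_scale[OF T T', folded ops]
  note pl = bilin_left[OF pr_bilin[OF X' Y']] and pR = bilin_right[OF pr_bilin[OF X' Y']]
  note pc = pr_closed[OF _ _ X Y]
  { fix f assume f: "f \<in> carrier (comod_hom H X X')"
    note fc = lin_closed[OF mor_lin[OF f]]
    show "lin (comod_hom H Y Y') (comod_hom H (T X Y) (T X' Y')) (\<lambda>g. TMor C X X' Y Y' f g)"
    proof (rule linI)
      fix g assume g: "g \<in> carrier (comod_hom H Y Y')"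
      show "TMor C X X' Y Y' f g \<in> carrier (comod_hom H (T X Y) (T X' Y'))" by (rule M[OF f g])
      fix c
      show "TMor C X X' Y Y' f (c \<odot>\<^bsub>comod_hom H Y Y'\<^esub> g) = c \<odot>\<^bsub>comod_hom H (T X Y) (T X' Y')\<^esub> TMor C X X' Y Y' f g"
        by (rule mor_eq_T[OF X Y T' M[OF f scale(2)[OF g]] scale(3)[OF M[OF f g]]])
          (simp add: Mp[OF f scale(2)[OF g], unfolded ops] Mp[OF f g] ops pc lin_smult[OF pR[OF fc]] lin_closed[OF mor_lin[OF g]])
    next
      fix g g' assume g: "g \<in> carrier (comod_hom H Y Y')" and g': "g' \<in> carrier (comod_hom H Y Y')"
      show "TMor C X X' Y Y' f (g \<oplus>\<^bsub>comod_hom H Y Y'\<^esub> g') = TMor C X X' Y Y' f g \<oplus>\<^bsub>comod_hom H (T X Y) (T X' Y')\<^esub> TMor C X X' Y Y' f g'"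
        by (rule mor_eq_T[OF X Y T' M[OF f add(2)[OF g g']] add(3)[OF M[OF f g] M[OF f g']]])
          (simp add: Mp[OF f add(2)[OF g g'], unfolded ops] Mp[OF f g] Mp[OF f g'] ops pc lin_add[OF pR[OF fc]]
            lin_closed[OF mor_lin[OF g]] lin_closed[OF mor_lin[OF g']])
    qed }
  { fix g assume g: "g \<in> carrier (comod_hom H Y Y')"
    note gc = lin_closed[OF mor_lin[OF g]]
    show "lin (comod_hom H X X') (comod_hom H (T X Y) (T X' Y')) (\<lambda>f. TMor C X X' Y Y' f g)"
    proof (rule linI)
      fix f assume f: "f \<in> carrier (comod_hom H X X')"
      show "TMor C X X' Y Y' f g \<in> carrier (comod_hom H (T X Y) (T X' Y'))" by (rule M[OF f g])
      fix c
      show "TMor C X X' Y Y' (c \<odot>\<^bsub>comod_hom H X X'\<^esub> f) g = c \<odot>\<^bsub>comod_hom H (T X Y) (T X' Y')\<^esub> TMor C X X' Y Y' f g"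
        by (rule mor_eq_T[OF X Y T' M[OF scale(1)[OF f] g] scale(3)[OF M[OF f g]]])
          (simp add: Mp[OF scale(1)[OF f] g, unfolded ops] Mp[OF f g] ops pc lin_smult[OF pl[OF gc]] lin_closed[OF mor_lin[OF f]])
    next
      fix f f' assume f: "f \<in> carrier (comod_hom H X X')" and f': "f' \<in> carrier (comod_hom H X X')"
      show "TMor C X X' Y Y' (f \<oplus>\<^bsub>comod_hom H X X'\<^esub> f') g = TMor C X X' Y Y' f g \<oplus>\<^bsub>comod_hom H (T X Y) (T X' Y')\<^esub> TMor C X X' Y Y' f' g"
        by (rule mor_eq_T[OF X Y T' M[OF add(1)[OF f f'] g] add(3)[OF M[OF f g] M[OF f' g]]])
          (simp add: Mp[OF add(1)[OF f f'] g, unfolded ops] Mp[OF f g] Mp[OF f' g] ops pc lin_add[OF pl[OF gc]]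
            lin_closed[OF mor_lin[OF f]] lin_closed[OF mor_lin[OF f']])
    qed }
qed

lemma TMor_id:
  assumes X: "comodule H X" and Y: "comodule H Y"
  shows "TMor C X X Y Y (\<lambda>x\<in>carrier X. x) (\<lambda>y\<in>carrier Y. y) = (\<lambda>u\<in>carrier (T X Y). u)"
  by (rule mor_eq_T[OF X Y T_comodule[OF X Y] TMor_mor[OF X X Y Y idn_mor[OF X] idn_mor[OF Y]] idn_mor[OF T_comodule[OF X Y]]])
    (simp add: TMor_pr[OF X X Y Y idn_mor[OF X] idn_mor[OF Y]] pr_closed X Y)

lemma TMor_comp:
  assumes X: "comodule H X" "comodule H X'" "comodule H X''" and Y: "comodule H Y" "comodule H Y'" "comodule H Y''"
    and f: "f \<in> carrier (comod_hom H X X')" "f' \<in> carrier (comod_hom H X' X'')"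
    and g: "g \<in> carrier (comod_hom H Y Y')" "g' \<in> carrier (comod_hom H Y' Y'')"
  shows "TMor C X X'' Y Y'' (compose (carrier X) f' f) (compose (carrier Y) g' g)
    = compose (carrier (T X Y)) (TMor C X' X'' Y' Y'' f' g') (TMor C X X' Y Y' f g)"
proof -
  note ff = compose_mor[OF X f] and gg = compose_mor[OF Y g]
  note T = T_comodule[OF X(1) Y(1)] and T' = T_comodule[OF X(2) Y(2)] and T'' = T_comodule[OF X(3) Y(3)]
  note M = TMor_mor[OF X(1,2) Y(1,2) f(1) g(1)] and M' = TMor_mor[OF X(2,3) Y(2,3) f(2) g(2)]
  show ?thesis
  proof (rule mor_eq_T[OF X(1) Y(1) T'' TMor_mor[OF X(1,3) Y(1,3) ff gg] compose_mor[OF T T' T'' M M']])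
    fix x y assume x: "x \<in> carrier X" and y: "y \<in> carrier Y"
    show "TMor C X X'' Y Y'' (compose (carrier X) f' f) (compose (carrier Y) g' g) (pr X Y x y)
        = compose (carrier (T X Y)) (TMor C X' X'' Y' Y'' f' g') (TMor C X X' Y Y' f g) (pr X Y x y)"
      using x y pr_closed[OF x y X(1) Y(1)] lin_closed[OF mor_lin[OF f(1)] x] lin_closed[OF mor_lin[OF g(1)] y]
      by (simp add: TMor_pr[OF X(1,3) Y(1,3) ff gg] compose_eq TMor_pr[OF X(1,2) Y(1,2) f(1) g(1)] TMor_pr[OF X(2,3) Y(2,3) f(2) g(2)])
  qed
qed

text \<open>Makes \<open>zmult\<close> explicit in known degrees, so that associativity in
  \<open>H\<close> can be used under the Sweedler sums.\<close>

lemma coact_homog_tensor: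
  assumes Y: "comodule H Y" and Z: "comodule H Z" and b: "b \<in> carrier G" and c: "c \<in> carrier G" and N: "vspace N"
    and y: "y \<in> gr Y b" and z: "z \<in> gr Z c"
    and F: "bilin H (T Y Z) N F"
  shows "tsum N (coact (T Y Z) (pr Y Z y z)) F = tsum N (coact Y y) (\<lambda>k y\<^sub>0. tsum N (coact Z z) (\<lambda>l z\<^sub>0. F (k \<otimes>\<^bsub>H\<^esub> l \<otimes>\<^bsub>H\<^esub> \<Lambda> b c) (pr Y Z y\<^sub>0 z\<^sub>0)))"
proof -
  note yY = gr_carrier[OF y] and zZ = gr_carrier[OF z] and LH = Lambda_H[OF b c] and vT = T_vspace[OF Y Z]
  note l = lin_comp[OF bilin_left[OF F]] and r = lin_comp[OF bilin_right[OF F]] and cl = bilin_closed[OF F]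
  have "tsum N (coact (T Y Z) (pr Y Z y z)) F = tsum N (coact Y y) (\<lambda>k y\<^sub>0. tsum N (coact Z z) (\<lambda>l z\<^sub>0. F (zmult k l) (pr Y Z y\<^sub>0 z\<^sub>0)))"
    by (rule tsum_coact_pr[OF Y Z N F yY zZ])
  also have "\<dots> = tsum N (coact Y y) (\<lambda>k y\<^sub>0. tsum N (coact Z z) (\<lambda>l z\<^sub>0. F (k \<otimes>\<^bsub>H\<^esub> l \<otimes>\<^bsub>H\<^esub> \<Lambda> b c) (pr Y Z y\<^sub>0 z\<^sub>0)))"
  proof (rule tsum_coact_homog_cong[OF Y N b y bilinI bilinI])
    fix k y\<^sub>0 assume k: "k \<in> gH b" and y0: "y\<^sub>0 \<in> gr Y b"
    note kH = gH_carrier[OF k] and y0Y = gr_carrier[OF y0]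
    show "tsum N (coact Z z) (\<lambda>l z\<^sub>0. F (zmult k l) (pr Y Z y\<^sub>0 z\<^sub>0)) = tsum N (coact Z z) (\<lambda>l z\<^sub>0. F (k \<otimes>\<^bsub>H\<^esub> l \<otimes>\<^bsub>H\<^esub> \<Lambda> b c) (pr Y Z y\<^sub>0 z\<^sub>0))"
      by (rule tsum_coact_homog_cong[OF Z N c z bilinI bilinI])
        (rule l r cl linr Y Z N kH y0Y LH | assumption | simp add: zmult_homog[OF b c k])+
  qed (rule l r cl linr Y Z N zZ LH | assumption)+
  finally show ?thesis .
qed

text \<open>Colinearity rests on the two facts behind \<open>quasi_assoc\<close>: the cocycle
  condition rewrites the product of group-likes, and \<open>compat\<close> moves
  \<open>\<Lambda> a b\<close> past the leg of \<open>z\<close>, which is the colinearity of the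
  half-braiding.\<close>

lemma Asc_mor:
  assumes X: "comodule H X" and Y: "comodule H Y" and Z: "comodule H Z"
  shows "Asc C X Y Z \<in> carrier (comod_hom H (T (T X Y) Z) (T X (T Y Z)))"
proof (rule morI)
  let ?A = "Asc C X Y Z" and ?S = "T (T X Y) Z" and ?D = "T X (T Y Z)"
  let ?N = "tensor H ?D"
  note lA = Asc_lin[OF X Y Z]
  note lA' = lin_comp[OF lA] and cA = lin_closed[OF lA] and XY = T_comodule[OF X Y] and YZ = T_comodule[OF Y Z]
  note S = T_comodule[OF XY Z] and D = T_comodule[OF X YZ]
  note vD = comodule_vspace[OF D]
  have vN: "vspace ?N" by (rule linr vD)+
  show "?A \<in> extensional (carrier ?S)" by (rule Asc_ext[OF X Y Z])
  show "lin ?S ?D ?A" by (rule lA)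
  fix u assume u: "u \<in> carrier ?S"
  show "coact ?D (?A u) = tsum ?N (coact ?S u) (\<lambda>h v. pure H ?D h (?A v))"
  proof (rule T_ext3[OF X Y Z vN _ _ u, where f="\<lambda>u. coact ?D (?A u)"])
    show "lin ?S ?N (\<lambda>u. coact ?D (?A u))" "lin ?S ?N (\<lambda>u. tsum ?N (coact ?S u) (\<lambda>h v. pure H ?D h (?A v)))"
      by (rule lA lA' cA linr S D vD | assumption)+
    fix a b c x y z
    assume a: "a \<in> carrier G" and b: "b \<in> carrier G" and c: "c \<in> carrier G" and x: "x \<in> gr X a" and y: "y \<in> gr Y b" and z: "z \<in> gr Z c"
    let ?s = "\<Lambda> a b" and ?t = "\<Lambda> (a \<otimes>\<^bsub>G\<^esub> b) c" and ?u = "\<Lambda> b c" and ?v = "\<Lambda> a (b \<otimes>\<^bsub>G\<^esub> c)" and ?w = "\<omega> a b c"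
    let ?hb = "half_braid (\<gamma> ?s) Z"
    have ab: "a \<otimes>\<^bsub>G\<^esub> b \<in> carrier G" and bc: "b \<otimes>\<^bsub>G\<^esub> c \<in> carrier G" using a b c by auto
    note sG = Lambda_closed[OF a b] and sH = Lambda_H[OF a b] and tH = Lambda_H[OF ab c] and uH = Lambda_H[OF b c] and vH = Lambda_H[OF a bc]
    note lg = lin_gamma[OF sG]
    note xX = gr_carrier[OF x] and yY = gr_carrier[OF y] and zZ = gr_carrier[OF z]
    have hz: "?hb z \<in> gr Z c" by (rule half_braid_gr[OF Z c z lg])
    note hzZ = gr_carrier[OF hz] and yz = pr_gr[OF Y Z b c y hz] and xy = pr_gr[OF X Y a b x y]
    note st = X Y Z XY YZ S D vD sH tH uH vH sG lg
    let ?P = "\<lambda>m x y z. pure H ?D m (?w \<odot>\<^bsub>?D\<^esub> pr X (T Y Z) x (pr Y Z y z))"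
    have "coact ?D (?A (pr (T X Y) Z (pr X Y x y) z)) = ?w \<odot>\<^bsub>?N\<^esub> coact ?D (pr X (T Y Z) x (pr Y Z y (?hb z)))"
      unfolding Asc_homog[OF X Y Z a b c x y z]
      by (rule lin_smult[OF lin_coact[OF D]]) (rule linr st xX yY hzZ)+
    also have "\<dots> = tsum ?N (coact ?D (pr X (T Y Z) x (pr Y Z y (?hb z)))) (\<lambda>h v. pure H ?D h (?w \<odot>\<^bsub>?D\<^esub> v))"
    proof -
      have v: "pr X (T Y Z) x (pr Y Z y (?hb z)) \<in> carrier ?D" (is "?p \<in> _") by (rule linr st xX yY hzZ)+
      have "?w \<odot>\<^bsub>?N\<^esub> coact ?D ?p = ?w \<odot>\<^bsub>?N\<^esub> tsum ?N (coact ?D ?p) (pure H ?D)" by (simp add: coact_tsum_pure[OF D v])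
      also have "\<dots> = tsum ?N (coact ?D ?p) (\<lambda>h v. ?w \<odot>\<^bsub>?N\<^esub> pure H ?D h v)"
        by (rule tsum_scale[OF vsH vD vN coact_closed[OF v D], symmetric]) (rule linr vD | assumption)+
      also have "\<dots> = tsum ?N (coact ?D ?p) (\<lambda>h v. pure H ?D h (?w \<odot>\<^bsub>?D\<^esub> v))"
        by (rule tsum_coact_cong[OF D v]) (simp add: lin_smult[OF bilin_right[OF bilin_pure[OF vsH vD]]])
      finally show ?thesis .
    qed
    also have "\<dots> = tsum ?N (coact X x) (\<lambda>h x\<^sub>0. tsum ?N (coact (T Y Z) (pr Y Z y (?hb z))) (\<lambda>k v.
        pure H ?D (h \<otimes>\<^bsub>H\<^esub> k \<otimes>\<^bsub>H\<^esub> ?v) (?w \<odot>\<^bsub>?D\<^esub> pr X (T Y Z) x\<^sub>0 v)))"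
      by (rule coact_homog_tensor[OF X YZ a bc vN x yz bilinI]) (rule linr st | assumption)+
    also have "\<dots> = tsum ?N (coact X x) (\<lambda>h x\<^sub>0. tsum ?N (coact Y y) (\<lambda>k y\<^sub>0. tsum ?N (coact Z (?hb z)) (\<lambda>l z\<^sub>0.
        ?P (h \<otimes>\<^bsub>H\<^esub> (k \<otimes>\<^bsub>H\<^esub> l \<otimes>\<^bsub>H\<^esub> ?u) \<otimes>\<^bsub>H\<^esub> ?v) x\<^sub>0 y\<^sub>0 z\<^sub>0)))"
      by (rule tsum_coact_cong[OF X xX], rule coact_homog_tensor[OF Y Z b c vN y hz bilinI]) (rule linr st | assumption)+
    \<comment> \<open>The half-braiding applied to \<open>z\<close> puts its character on the first
      leg of \<open>l\<close> and leaves the second leg for the product.\<close>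
    also have "\<dots> = tsum ?N (coact X x) (\<lambda>h x\<^sub>0. tsum ?N (coact Y y) (\<lambda>k y\<^sub>0. tsum ?N (coact Z z) (\<lambda>l z\<^sub>0.
        tsum ?N (comult H l) (\<lambda>l\<^sub>1 l\<^sub>2. \<gamma> ?s l\<^sub>1 \<odot>\<^bsub>?N\<^esub> ?P (h \<otimes>\<^bsub>H\<^esub> (k \<otimes>\<^bsub>H\<^esub> l\<^sub>2 \<otimes>\<^bsub>H\<^esub> ?u) \<otimes>\<^bsub>H\<^esub> ?v) x\<^sub>0 y\<^sub>0 z\<^sub>0))))"
      by (rule tsum_coact_cong[OF X xX], rule tsum_coact_cong[OF Y yY], rule tsum_coact_half_braid[OF Z vN zZ lg bilinI]) (rule linr st | assumption)+
    also have "\<dots> = tsum ?N (coact X x) (\<lambda>h x\<^sub>0. tsum ?N (coact Y y) (\<lambda>k y\<^sub>0. tsum ?N (coact Z z) (\<lambda>l z\<^sub>0.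
        tsum ?N (comult H l) (\<lambda>l\<^sub>1 l\<^sub>2. \<gamma> ?s l\<^sub>2 \<odot>\<^bsub>?N\<^esub> ?P (h \<otimes>\<^bsub>H\<^esub> k \<otimes>\<^bsub>H\<^esub> ?s \<otimes>\<^bsub>H\<^esub> l\<^sub>1 \<otimes>\<^bsub>H\<^esub> ?t) x\<^sub>0 y\<^sub>0 z\<^sub>0))))"
    proof (rule tsum_coact_cong[OF X xX], rule tsum_coact_cong[OF Y yY], rule tsum_coact_cong[OF Z zZ])
      fix h x\<^sub>0 k y\<^sub>0 l z\<^sub>0 assume *: "h \<in> carrier H" "x\<^sub>0 \<in> carrier X" "k \<in> carrier H" "y\<^sub>0 \<in> carrier Y" "l \<in> carrier H" "z\<^sub>0 \<in> carrier Z"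
      let ?g = "\<lambda>m. ?P (h \<otimes>\<^bsub>H\<^esub> k \<otimes>\<^bsub>H\<^esub> m \<otimes>\<^bsub>H\<^esub> ?t) x\<^sub>0 y\<^sub>0 z\<^sub>0"
      have "tsum ?N (comult H l) (\<lambda>l\<^sub>1 l\<^sub>2. \<gamma> ?s l\<^sub>1 \<odot>\<^bsub>?N\<^esub> ?P (h \<otimes>\<^bsub>H\<^esub> (k \<otimes>\<^bsub>H\<^esub> l\<^sub>2 \<otimes>\<^bsub>H\<^esub> ?u) \<otimes>\<^bsub>H\<^esub> ?v) x\<^sub>0 y\<^sub>0 z\<^sub>0)
          = tsum ?N (comult H l) (\<lambda>l\<^sub>1 l\<^sub>2. \<gamma> ?s l\<^sub>1 \<odot>\<^bsub>?N\<^esub> ?g (l\<^sub>2 \<otimes>\<^bsub>H\<^esub> ?s))"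
      proof (rule tsum_comult_cong[OF *(5)])
        fix l\<^sub>1 l\<^sub>2 assume l12: "l\<^sub>1 \<in> carrier H" "l\<^sub>2 \<in> carrier H"
        have "h \<otimes>\<^bsub>H\<^esub> (k \<otimes>\<^bsub>H\<^esub> l\<^sub>2 \<otimes>\<^bsub>H\<^esub> ?u) \<otimes>\<^bsub>H\<^esub> ?v = h \<otimes>\<^bsub>H\<^esub> k \<otimes>\<^bsub>H\<^esub> l\<^sub>2 \<otimes>\<^bsub>H\<^esub> (?u \<otimes>\<^bsub>H\<^esub> ?v)"
          using * l12 uH vH by (simp add: R.m_assoc)
        also have "\<dots> = h \<otimes>\<^bsub>H\<^esub> k \<otimes>\<^bsub>H\<^esub> (l\<^sub>2 \<otimes>\<^bsub>H\<^esub> ?s) \<otimes>\<^bsub>H\<^esub> ?t"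
          unfolding cocycle[OF a b c, symmetric] using * l12 sH tH by (simp add: R.m_assoc)
        finally show "\<gamma> ?s l\<^sub>1 \<odot>\<^bsub>?N\<^esub> ?P (h \<otimes>\<^bsub>H\<^esub> (k \<otimes>\<^bsub>H\<^esub> l\<^sub>2 \<otimes>\<^bsub>H\<^esub> ?u) \<otimes>\<^bsub>H\<^esub> ?v) x\<^sub>0 y\<^sub>0 z\<^sub>0 = \<gamma> ?s l\<^sub>1 \<odot>\<^bsub>?N\<^esub> ?g (l\<^sub>2 \<otimes>\<^bsub>H\<^esub> ?s)"
          by simp
      qed
      also have "\<dots> = tsum ?N (comult H l) (\<lambda>l\<^sub>1 l\<^sub>2. \<gamma> ?s l\<^sub>2 \<odot>\<^bsub>?N\<^esub> ?g (?s \<otimes>\<^bsub>H\<^esub> l\<^sub>1))"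
        by (rule compat[OF sG *(5) vN, of ?g]) (rule linr st * | assumption)+
      also have "\<dots> = tsum ?N (comult H l) (\<lambda>l\<^sub>1 l\<^sub>2. \<gamma> ?s l\<^sub>2 \<odot>\<^bsub>?N\<^esub> ?P (h \<otimes>\<^bsub>H\<^esub> k \<otimes>\<^bsub>H\<^esub> ?s \<otimes>\<^bsub>H\<^esub> l\<^sub>1 \<otimes>\<^bsub>H\<^esub> ?t) x\<^sub>0 y\<^sub>0 z\<^sub>0)"
        by (rule tsum_comult_cong[OF *(5)]) (use * sH tH in \<open>simp add: R.m_assoc\<close>)
      finally show "tsum ?N (comult H l) (\<lambda>l\<^sub>1 l\<^sub>2. \<gamma> ?s l\<^sub>1 \<odot>\<^bsub>?N\<^esub> ?P (h \<otimes>\<^bsub>H\<^esub> (k \<otimes>\<^bsub>H\<^esub> l\<^sub>2 \<otimes>\<^bsub>H\<^esub> ?u) \<otimes>\<^bsub>H\<^esub> ?v) x\<^sub>0 y\<^sub>0 z\<^sub>0)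
        = tsum ?N (comult H l) (\<lambda>l\<^sub>1 l\<^sub>2. \<gamma> ?s l\<^sub>2 \<odot>\<^bsub>?N\<^esub> ?P (h \<otimes>\<^bsub>H\<^esub> k \<otimes>\<^bsub>H\<^esub> ?s \<otimes>\<^bsub>H\<^esub> l\<^sub>1 \<otimes>\<^bsub>H\<^esub> ?t) x\<^sub>0 y\<^sub>0 z\<^sub>0)" .
    qed
    \<comment> \<open>By coassociativity the character, now on the second leg, acts on the comodule
      component and becomes the half-braiding again.\<close>
    also have "\<dots> = tsum ?N (coact X x) (\<lambda>h x\<^sub>0. tsum ?N (coact Y y) (\<lambda>k y\<^sub>0. tsum ?N (coact Z z) (\<lambda>l z\<^sub>0.
        pure H ?D (h \<otimes>\<^bsub>H\<^esub> k \<otimes>\<^bsub>H\<^esub> ?s \<otimes>\<^bsub>H\<^esub> l \<otimes>\<^bsub>H\<^esub> ?t) (?w \<odot>\<^bsub>?D\<^esub> pr X (T Y Z) x\<^sub>0 (pr Y Z y\<^sub>0 (?hb z\<^sub>0))))))"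
    proof (rule tsum_coact_cong[OF X xX], rule tsum_coact_cong[OF Y yY])
      fix h x\<^sub>0 k y\<^sub>0 assume *: "h \<in> carrier H" "x\<^sub>0 \<in> carrier X" "k \<in> carrier H" "y\<^sub>0 \<in> carrier Y"
      have "tsum ?N (coact Z z) (\<lambda>l z\<^sub>0. ?P (h \<otimes>\<^bsub>H\<^esub> k \<otimes>\<^bsub>H\<^esub> ?s \<otimes>\<^bsub>H\<^esub> l \<otimes>\<^bsub>H\<^esub> ?t) x\<^sub>0 y\<^sub>0 (?hb z\<^sub>0))
          = tsum ?N (coact Z z) (\<lambda>l z\<^sub>0. tsum ?N (coact Z z\<^sub>0) (\<lambda>l' z\<^sub>1. \<gamma> ?s l' \<odot>\<^bsub>?N\<^esub> ?P (h \<otimes>\<^bsub>H\<^esub> k \<otimes>\<^bsub>H\<^esub> ?s \<otimes>\<^bsub>H\<^esub> l \<otimes>\<^bsub>H\<^esub> ?t) x\<^sub>0 y\<^sub>0 z\<^sub>1))"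
        by (rule tsum_coact_cong[OF Z zZ], rule tsum_half_braid[OF Z vN _ lg, symmetric]) (rule linr st * | assumption)+
      also have "\<dots> = tsum ?N (coact Z z) (\<lambda>l z\<^sub>0. tsum ?N (comult H l) (\<lambda>l\<^sub>1 l\<^sub>2. \<gamma> ?s l\<^sub>2 \<odot>\<^bsub>?N\<^esub> ?P (h \<otimes>\<^bsub>H\<^esub> k \<otimes>\<^bsub>H\<^esub> ?s \<otimes>\<^bsub>H\<^esub> l\<^sub>1 \<otimes>\<^bsub>H\<^esub> ?t) x\<^sub>0 y\<^sub>0 z\<^sub>0))"
        by (rule coact_coassoc[OF Z vN zZ]) (rule linr st * | assumption)+
      finally show "tsum ?N (coact Z z) (\<lambda>l z\<^sub>0. tsum ?N (comult H l) (\<lambda>l\<^sub>1 l\<^sub>2. \<gamma> ?s l\<^sub>2 \<odot>\<^bsub>?N\<^esub> ?P (h \<otimes>\<^bsub>H\<^esub> k \<otimes>\<^bsub>H\<^esub> ?s \<otimes>\<^bsub>H\<^esub> l\<^sub>1 \<otimes>\<^bsub>H\<^esub> ?t) x\<^sub>0 y\<^sub>0 z\<^sub>0))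
        = tsum ?N (coact Z z) (\<lambda>l z\<^sub>0. ?P (h \<otimes>\<^bsub>H\<^esub> k \<otimes>\<^bsub>H\<^esub> ?s \<otimes>\<^bsub>H\<^esub> l \<otimes>\<^bsub>H\<^esub> ?t) x\<^sub>0 y\<^sub>0 (?hb z\<^sub>0))" by simp
    qed
    \<comment> \<open>The summand becomes the associator on components, whose formula is known for
      homogeneous components; hence the congruences for homogeneous legs.\<close>
    also have "\<dots> = tsum ?N (coact X x) (\<lambda>h x\<^sub>0. tsum ?N (coact Y y) (\<lambda>k y\<^sub>0. tsum ?N (coact Z z) (\<lambda>l z\<^sub>0.
        pure H ?D (h \<otimes>\<^bsub>H\<^esub> k \<otimes>\<^bsub>H\<^esub> ?s \<otimes>\<^bsub>H\<^esub> l \<otimes>\<^bsub>H\<^esub> ?t) (?A (pr (T X Y) Z (pr X Y x\<^sub>0 y\<^sub>0) z\<^sub>0)))))"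
    proof (rule tsum_coact_homog_cong[OF X vN a x bilinI bilinI])
      fix h x\<^sub>0 assume h: "h \<in> gH a" and x0: "x\<^sub>0 \<in> gr X a"
      note hx = gH_carrier[OF h] gr_carrier[OF x0]
      show "tsum ?N (coact Y y) (\<lambda>k y\<^sub>0. tsum ?N (coact Z z) (\<lambda>l z\<^sub>0.
        pure H ?D (h \<otimes>\<^bsub>H\<^esub> k \<otimes>\<^bsub>H\<^esub> ?s \<otimes>\<^bsub>H\<^esub> l \<otimes>\<^bsub>H\<^esub> ?t) (?w \<odot>\<^bsub>?D\<^esub> pr X (T Y Z) x\<^sub>0 (pr Y Z y\<^sub>0 (?hb z\<^sub>0)))))
        = tsum ?N (coact Y y) (\<lambda>k y\<^sub>0. tsum ?N (coact Z z) (\<lambda>l z\<^sub>0.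
        pure H ?D (h \<otimes>\<^bsub>H\<^esub> k \<otimes>\<^bsub>H\<^esub> ?s \<otimes>\<^bsub>H\<^esub> l \<otimes>\<^bsub>H\<^esub> ?t) (?A (pr (T X Y) Z (pr X Y x\<^sub>0 y\<^sub>0) z\<^sub>0))))"
      proof (rule tsum_coact_homog_cong[OF Y vN b y bilinI bilinI])
        fix k y\<^sub>0 assume k: "k \<in> gH b" and y0: "y\<^sub>0 \<in> gr Y b"
        note ky = gH_carrier[OF k] gr_carrier[OF y0]
        show "tsum ?N (coact Z z) (\<lambda>l z\<^sub>0.
          pure H ?D (h \<otimes>\<^bsub>H\<^esub> k \<otimes>\<^bsub>H\<^esub> ?s \<otimes>\<^bsub>H\<^esub> l \<otimes>\<^bsub>H\<^esub> ?t) (?w \<odot>\<^bsub>?D\<^esub> pr X (T Y Z) x\<^sub>0 (pr Y Z y\<^sub>0 (?hb z\<^sub>0))))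
          = tsum ?N (coact Z z) (\<lambda>l z\<^sub>0. pure H ?D (h \<otimes>\<^bsub>H\<^esub> k \<otimes>\<^bsub>H\<^esub> ?s \<otimes>\<^bsub>H\<^esub> l \<otimes>\<^bsub>H\<^esub> ?t) (?A (pr (T X Y) Z (pr X Y x\<^sub>0 y\<^sub>0) z\<^sub>0)))"
          by (rule tsum_coact_homog_cong[OF Z vN c z bilinI bilinI])
            (rule lA' cA linr st hx ky | assumption | simp add: Asc_homog[OF X Y Z a b c x0 y0])+
      qed (rule lA' cA linr st hx zZ | assumption)+
    qed (rule lA' cA linr st yY zZ | assumption)+
    also have "\<dots> = tsum ?N (coact (T X Y) (pr X Y x y)) (\<lambda>h v. tsum ?N (coact Z z) (\<lambda>l z\<^sub>0.
        pure H ?D (h \<otimes>\<^bsub>H\<^esub> l \<otimes>\<^bsub>H\<^esub> ?t) (?A (pr (T X Y) Z v z\<^sub>0))))"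
      by (rule coact_homog_tensor[OF X Y a b vN x y bilinI, symmetric]) (rule lA' cA linr st zZ | assumption)+
    also have "\<dots> = tsum ?N (coact ?S (pr (T X Y) Z (pr X Y x y) z)) (\<lambda>h v. pure H ?D h (?A v))"
      by (rule coact_homog_tensor[OF XY Z ab c vN xy z bilinI, symmetric]) (rule lA lA' cA linr st | assumption)+
    finally show "coact ?D (?A (pr (T X Y) Z (pr X Y x y) z)) = tsum ?N (coact ?S (pr (T X Y) Z (pr X Y x y) z)) (\<lambda>h v. pure H ?D h (?A v))" .
  qed
qed

text \<open>A linear inverse suffices. The half-braidings by \<Lambda>(a,b) and by its inverse
  cancel, as do the nonzero scalars; since half-braiding keeps the degree of \<open>z\<close>, the
  homogeneous formulas apply one after the other.\<close>

lemma Asc_iso: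
  assumes X: "comodule H X" and Y: "comodule H Y" and Z: "comodule H Z"
  shows "iso_in C (T (T X Y) Z) (T X (T Y Z)) (Asc C X Y Z)"
proof -
  let ?S = "T (T X Y) Z" and ?D = "T X (T Y Z)" and ?B = "asc_inv X Y Z" and ?A = "Asc C X Y Z"
  have XY: "comodule H (T X Y)" and YZ: "comodule H (T Y Z)" and S: "comodule H ?S" and D: "comodule H ?D" by (rule T_comodule X Y Z)+
  note vS = comodule_vspace[OF S] and vD = comodule_vspace[OF D]
  note lA = Asc_lin[OF X Y Z] and lB = asc_inv(1)[OF X Y Z]
  show ?thesis
  proof (rule comod_iso[OF C S D Asc_mor[OF X Y Z] lB])
    fix u assume u: "u \<in> carrier ?S"
    show "?B (?A u) = u"
    proof (rule T_ext3[OF X Y Z vS lin_comp[OF lB lA] lin_id u])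
      fix a b c x y z
      assume *: "a \<in> carrier G" "b \<in> carrier G" "c \<in> carrier G" "x \<in> gr X a" "y \<in> gr Y b" "z \<in> gr Z c"
      note xX = gr_carrier[OF *(4)] and yY = gr_carrier[OF *(5)] and zZ = gr_carrier[OF *(6)]
      note sG = Lambda_closed[OF *(1,2)]
      note hz = half_braid_gr[OF Z *(3,6) lin_gamma[OF sG]]
      have p: "pr X (T Y Z) x (pr Y Z y (half_braid (\<gamma> (\<Lambda> a b)) Z z)) \<in> carrier ?D" by (rule linr X Y Z xX yY gr_carrier[OF hz])+
      have q: "pr (T X Y) Z (pr X Y x y) z \<in> carrier ?S" by (rule linr X Y Z xX yY zZ)+
      show "?B (?A (pr (T X Y) Z (pr X Y x y) z)) = pr (T X Y) Z (pr X Y x y) z"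
        unfolding Asc_homog[OF X Y Z *] lin_smult[OF lB p] asc_inv(2)[OF X Y Z *(1-5) hz] half_braid_inverse(2)[OF Z zZ sG]
        using q omega_nonzero[OF *(1-3)] by (simp add: vs_smult_smult[OF vS] vs_one[OF vS])
    qed
  next
    fix u assume u: "u \<in> carrier ?D"
    show "?A (?B u) = u"
    proof (rule T_ext3'[OF X Y Z vD lin_comp[OF lA lB] lin_id u])
      fix a b c x y z
      assume *: "a \<in> carrier G" "b \<in> carrier G" "c \<in> carrier G" "x \<in> gr X a" "y \<in> gr Y b" "z \<in> gr Z c"
      note xX = gr_carrier[OF *(4)] and yY = gr_carrier[OF *(5)] and zZ = gr_carrier[OF *(6)]
      note sG = Lambda_closed[OF *(1,2)]
      note hz = half_braid_gr[OF Z *(3,6) lin_gamma[OF Gamma_inv[OF sG]]]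
      have p: "pr (T X Y) Z (pr X Y x y) (half_braid (\<gamma> (inv\<^bsub>GL\<^esub> (\<Lambda> a b))) Z z) \<in> carrier ?S" by (rule linr X Y Z xX yY gr_carrier[OF hz])+
      have q: "pr X (T Y Z) x (pr Y Z y z) \<in> carrier ?D" by (rule linr X Y Z xX yY zZ)+
      show "?A (?B (pr X (T Y Z) x (pr Y Z y z))) = pr X (T Y Z) x (pr Y Z y z)"
        unfolding asc_inv(2)[OF X Y Z *] lin_smult[OF lA p] Asc_homog[OF X Y Z *(1-5) hz] half_braid_inverse(1)[OF Z zZ sG]
        using q omega_nonzero[OF *(1-3)] by (simp add: vs_smult_smult[OF vD] vs_one[OF vD])
    qed
  qed
qed

end

context tensor_cat
begin

interpretation R: ring H by (rule ringH)
interpretation Gr: group G by (rule grp)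

text \<open>Morphisms preserve degrees, so both sides involve the same \<omega> and the same
  group-like; what remains is the naturality of the half-braiding.\<close>

lemma Asc_natural:
  assumes X: "comodule H X" "comodule H X'" and Y: "comodule H Y" "comodule H Y'" and Z: "comodule H Z" "comodule H Z'"
    and f: "f \<in> carrier (comod_hom H X X')" and g: "g \<in> carrier (comod_hom H Y Y')" and h: "h \<in> carrier (comod_hom H Z Z')"
  shows "compose (carrier (T (T X Y) Z)) (Asc C X' Y' Z') (TMor C (T X Y) (T X' Y') Z Z' (TMor C X X' Y Y' f g) h)
    = compose (carrier (T (T X Y) Z)) (TMor C X X' (T Y Z) (T Y' Z') f (TMor C Y Y' Z Z' g h)) (Asc C X Y Z)"
proof -
  note XY = T_comodule[OF X(1) Y(1)] and XY' = T_comodule[OF X(2) Y(2)] and YZ = T_comodule[OF Y(1) Z(1)] and YZ' = T_comodule[OF Y(2) Z(2)]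
  note S = T_comodule[OF XY Z(1)] and S' = T_comodule[OF XY' Z(2)] and D = T_comodule[OF X(1) YZ] and D' = T_comodule[OF X(2) YZ']
  note fg = TMor_mor[OF X Y f g] and gh = TMor_mor[OF Y Z g h]
  note A = Asc_mor[OF X(1) Y(1) Z(1)] and A' = Asc_mor[OF X(2) Y(2) Z(2)]
  note M = TMor_mor[OF XY XY' Z fg h] and M' = TMor_mor[OF X YZ YZ' f gh]
  note L = compose_mor[OF S S' D' M A'] and R = compose_mor[OF S D D' A M']
  show ?thesis
  proof (rule mor_ext[OF L R], rule T_ext3[OF X(1) Y(1) Z(1) comodule_vspace[OF D'] mor_lin[OF L] mor_lin[OF R]])
    fix a b c x y z
    assume *: "a \<in> carrier G" "b \<in> carrier G" "c \<in> carrier G" "x \<in> gr X a" "y \<in> gr Y b" "z \<in> gr Z c"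
    let ?hb = "half_braid (\<gamma> (\<Lambda> a b))"
    note xX = gr_carrier[OF *(4)] and yY = gr_carrier[OF *(5)] and zZ = gr_carrier[OF *(6)]
    note lg = lin_gamma[OF Lambda_closed[OF *(1,2)]]
    note hz = gr_carrier[OF half_braid_gr[OF Z(1) *(3,6) lg]]
    note xy = pr_closed[OF xX yY X(1) Y(1)] and yz = pr_closed[OF yY hz Y(1) Z(1)]
    note p = pr_closed[OF xy zZ XY Z(1)] and q = pr_closed[OF xX yz X(1) YZ]
    have "Asc C X' Y' Z' (TMor C (T X Y) (T X' Y') Z Z' (TMor C X X' Y Y' f g) h (pr (T X Y) Z (pr X Y x y) z))
        = \<omega> a b c \<odot>\<^bsub>T X' (T Y' Z')\<^esub> pr X' (T Y' Z') (f x) (pr Y' Z' (g y) (?hb Z' (h z)))"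
      unfolding TMor_pr[OF XY XY' Z fg h xy zZ] TMor_pr[OF X Y f g xX yY]
      by (rule Asc_homog[OF X(2) Y(2) Z(2) *(1-3) mor_gr[OF X f *(1,4)] mor_gr[OF Y g *(2,5)] mor_gr[OF Z h *(3,6)]])
    moreover have "TMor C X X' (T Y Z) (T Y' Z') f (TMor C Y Y' Z Z' g h) (Asc C X Y Z (pr (T X Y) Z (pr X Y x y) z))
        = \<omega> a b c \<odot>\<^bsub>T X' (T Y' Z')\<^esub> pr X' (T Y' Z') (f x) (pr Y' Z' (g y) (h (?hb Z z)))"
      unfolding Asc_homog[OF X(1) Y(1) Z(1) *] lin_smult[OF mor_lin[OF M'] q] TMor_pr[OF X YZ YZ' f gh xX yz] TMor_pr[OF Y Z g h yY hz] ..
    ultimately show "compose (carrier (T (T X Y) Z)) (Asc C X' Y' Z') (TMor C (T X Y) (T X' Y') Z Z' (TMor C X X' Y Y' f g) h) (pr (T X Y) Z (pr X Y x y) z)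
      = compose (carrier (T (T X Y) Z)) (TMor C X X' (T Y Z) (T Y' Z') f (TMor C Y Y' Z Z' g h)) (Asc C X Y Z) (pr (T X Y) Z (pr X Y x y) z)"
      using p half_braid_mor[OF Z h lg zZ] by (simp add: compose_eq)
  qed
qed

section \<open>Unit constraints\<close>

lemma LUn_pr:
  assumes X: "comodule H X" and u: "u \<in> carrier U" and x: "x \<in> carrier X"
  shows "LUn C X (pr U X u x) = sc u \<odot>\<^bsub>X\<^esub> x"
  by (rule homog_ext[OF X comodule_vspace[OF X] _ _ x, where f="\<lambda>x. LUn C X (pr U X u x)" and g="\<lambda>x. sc u \<odot>\<^bsub>X\<^esub> x"])
    (rule lin_comp[OF LUn_lin[OF X]] linr X U u LUn_homog[OF X u] | assumption)+

lemma RUn_pr: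
  assumes X: "comodule H X" and u: "u \<in> carrier U" and x: "x \<in> carrier X"
  shows "RUn C X (pr X U x u) = sc u \<odot>\<^bsub>X\<^esub> x"
  by (rule homog_ext[OF X comodule_vspace[OF X] _ _ x, where f="\<lambda>x. RUn C X (pr X U x u)" and g="\<lambda>x. sc u \<odot>\<^bsub>X\<^esub> x"])
    (rule lin_comp[OF RUn_lin[OF X]] linr X U u RUn_homog[OF X u] | assumption)+

lemma LUn_mor:
  assumes X: "comodule H X"
  shows "LUn C X \<in> carrier (comod_hom H (T U X) X)"
proof (rule morI[OF LUn_ext[OF X] LUn_lin[OF X]])
  let ?N = "tensor H X"
  note vX = comodule_vspace[OF X] and vU = comodule_vspace[OF U] and lL = LUn_lin[OF X]
  note lL' = lin_comp[OF lL] and cL = lin_closed[OF lL] and TU = T_comodule[OF U X]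
  have vN: "vspace ?N" by (rule linr vX)+
  fix v assume v: "v \<in> carrier (T U X)"
  show "coact X (LUn C X v) = tsum ?N (coact (T U X) v) (\<lambda>h w. pure H X h (LUn C X w))"
  proof (rule T_ext_all[OF U X vN _ _ v, where f="\<lambda>v. coact X (LUn C X v)"])
    show "lin (T U X) ?N (\<lambda>v. coact X (LUn C X v))" "lin (T U X) ?N (\<lambda>v. tsum ?N (coact (T U X) v) (\<lambda>h w. pure H X h (LUn C X w)))"
      by (rule lL lL' cL linr X TU vX | assumption)+
    fix u x assume u: "u \<in> carrier U" and x: "x \<in> carrier X"
    have "tsum ?N (coact (T U X) (pr U X u x)) (\<lambda>h w. pure H X h (LUn C X w))
        = tsum ?N (coact U u) (\<lambda>h u\<^sub>0. tsum ?N (coact X x) (\<lambda>k x\<^sub>0. pure H X (zmult h k) (LUn C X (pr U X u\<^sub>0 x\<^sub>0))))"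
      by (rule tsum_coact_pr[OF U X vN bilinI u x]) (rule lL lL' cL linr X U vX | assumption)+
    also have "\<dots> = tsum ?N (coact X x) (\<lambda>k x\<^sub>0. pure H X (zmult \<one>\<^bsub>H\<^esub> k) (LUn C X (pr U X u x\<^sub>0)))"
      unfolding coact_U[OF u] by (rule tsum_pure[OF vsH vU vN bilinI one_closed u]) (rule lL lL' cL linr X U vX x | assumption)+
    also have "\<dots> = tsum ?N (coact X x) (\<lambda>k x\<^sub>0. sc u \<odot>\<^bsub>?N\<^esub> pure H X k x\<^sub>0)"
      by (rule tsum_coact_cong[OF X x]) (simp add: zmult_one LUn_pr[OF X u] lin_smult[OF bilin_right[OF bilin_pure[OF vsH vX]]])
    also have "\<dots> = sc u \<odot>\<^bsub>?N\<^esub> coact X x"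
      using tsum_scale[OF vsH vX vN coact_closed[OF x X], of "pure H X"] pure_closed[OF vsH vX] by (simp add: coact_tsum_pure[OF X x])
    finally show "coact X (LUn C X (pr U X u x)) = tsum ?N (coact (T U X) (pr U X u x)) (\<lambda>h w. pure H X h (LUn C X w))"
      by (simp add: LUn_pr[OF X u x] lin_smult[OF lin_coact[OF X] x])
  qed
qed

lemma RUn_mor:
  assumes X: "comodule H X"
  shows "RUn C X \<in> carrier (comod_hom H (T X U) X)"
proof (rule morI[OF RUn_ext[OF X] RUn_lin[OF X]])
  let ?N = "tensor H X"
  note vX = comodule_vspace[OF X] and vU = comodule_vspace[OF U] and lL = RUn_lin[OF X]
  note lL' = lin_comp[OF lL] and cL = lin_closed[OF lL] and TU = T_comodule[OF X U]
  have vN: "vspace ?N" by (rule linr vX)+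
  fix v assume v: "v \<in> carrier (T X U)"
  show "coact X (RUn C X v) = tsum ?N (coact (T X U) v) (\<lambda>h w. pure H X h (RUn C X w))"
  proof (rule T_ext_all[OF X U vN _ _ v, where f="\<lambda>v. coact X (RUn C X v)"])
    show "lin (T X U) ?N (\<lambda>v. coact X (RUn C X v))" "lin (T X U) ?N (\<lambda>v. tsum ?N (coact (T X U) v) (\<lambda>h w. pure H X h (RUn C X w)))"
      by (rule lL lL' cL linr X TU vX | assumption)+
    fix x u assume x: "x \<in> carrier X" and u: "u \<in> carrier U"
    have "tsum ?N (coact (T X U) (pr X U x u)) (\<lambda>h w. pure H X h (RUn C X w))
        = tsum ?N (coact X x) (\<lambda>h x\<^sub>0. tsum ?N (coact U u) (\<lambda>k u\<^sub>0. pure H X (zmult h k) (RUn C X (pr X U x\<^sub>0 u\<^sub>0))))"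
      by (rule tsum_coact_pr[OF X U vN bilinI x u]) (rule lL lL' cL linr X U vX | assumption)+
    also have "\<dots> = tsum ?N (coact X x) (\<lambda>h x\<^sub>0. pure H X (zmult h \<one>\<^bsub>H\<^esub>) (RUn C X (pr X U x\<^sub>0 u)))"
      unfolding coact_U[OF u] by (rule tsum_coact_cong[OF X x], rule tsum_pure[OF vsH vU vN bilinI one_closed u]) (rule lL lL' cL linr X U vX x | assumption)+
    also have "\<dots> = tsum ?N (coact X x) (\<lambda>k x\<^sub>0. sc u \<odot>\<^bsub>?N\<^esub> pure H X k x\<^sub>0)"
      by (rule tsum_coact_cong[OF X x]) (simp add: zmult_one RUn_pr[OF X u] lin_smult[OF bilin_right[OF bilin_pure[OF vsH vX]]])
    also have "\<dots> = sc u \<odot>\<^bsub>?N\<^esub> coact X x"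
      using tsum_scale[OF vsH vX vN coact_closed[OF x X], of "pure H X"] pure_closed[OF vsH vX] by (simp add: coact_tsum_pure[OF X x])
    finally show "coact X (RUn C X (pr X U x u)) = tsum ?N (coact (T X U) (pr X U x u)) (\<lambda>h w. pure H X h (RUn C X w))"
      by (simp add: RUn_pr[OF X u x] lin_smult[OF lin_coact[OF X] x])
  qed
qed

text \<open>The inverse tensors with \<open>e\<close>; since \<open>e\<close> spans the unit object,
  the coordinate \<open>sc\<close> can be moved across \<open>pr\<close>.\<close>

lemma LUn_iso:
  assumes X: "comodule H X"
  shows "iso_in C (T U X) X (LUn C X)"
proof (rule comod_iso[OF C T_comodule[OF U X] X LUn_mor[OF X], where g="pr U X e"])
  note vX = comodule_vspace[OF X]
  show lp: "lin X (T U X) (pr U X e)" by (rule bilin_right[OF pr_bilin[OF U X] e])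
  show "LUn C X (pr U X e x) = x" if "x \<in> carrier X" for x using that vX by (simp add: LUn_pr[OF X e] sc_e)
  show "pr U X e (LUn C X v) = v" if v: "v \<in> carrier (T U X)" for v
  proof (rule T_ext_all[OF U X T_vspace[OF U X] lin_comp[OF lp LUn_lin[OF X]] lin_id v])
    fix u x assume u: "u \<in> carrier U" and x: "x \<in> carrier X"
    have "pr U X e (LUn C X (pr U X u x)) = pr U X (sc u \<odot>\<^bsub>U\<^esub> e) x"
      using pr_smult[OF U X e x] by (simp add: LUn_pr[OF X u x])
    then show "pr U X e (LUn C X (pr U X u x)) = pr U X u x" using e_sc[OF u] by simp
  qed
qed

lemma RUn_iso:
  assumes X: "comodule H X"
  shows "iso_in C (T X U) X (RUn C X)"
proof (rule comod_iso[OF C T_comodule[OF X U] X RUn_mor[OF X], where g="\<lambda>x. pr X U x e"])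
  note vX = comodule_vspace[OF X]
  show lp: "lin X (T X U) (\<lambda>x. pr X U x e)" by (rule bilin_left[OF pr_bilin[OF X U] e])
  show "RUn C X (pr X U x e) = x" if "x \<in> carrier X" for x using that vX by (simp add: RUn_pr[OF X e] sc_e)
  show "pr X U (RUn C X v) e = v" if v: "v \<in> carrier (T X U)" for v
  proof (rule T_ext_all[OF X U T_vspace[OF X U] lin_comp[OF lp RUn_lin[OF X]] lin_id v])
    fix x u assume x: "x \<in> carrier X" and u: "u \<in> carrier U"
    have "pr X U (RUn C X (pr X U x u)) e = pr X U x (sc u \<odot>\<^bsub>U\<^esub> e)"
      using pr_smult[OF X U x e] by (simp add: RUn_pr[OF X u x])
    then show "pr X U (RUn C X (pr X U x u)) e = pr X U x u" using e_sc[OF u] by simp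
  qed
qed

lemma LUn_natural:
  assumes X: "comodule H X" and X': "comodule H X'" and f: "f \<in> carrier (comod_hom H X X')"
  shows "compose (carrier (T U X)) (LUn C X') (TMor C U U X X' (\<lambda>u\<in>carrier U. u) f) = compose (carrier (T U X)) f (LUn C X)"
proof (rule mor_eq_T[OF U X X'])
  note i = idn_mor[OF U] and TX = T_comodule[OF U X] and TX' = T_comodule[OF U X']
  note M = TMor_mor[OF U U X X' i f]
  show "compose (carrier (T U X)) (LUn C X') (TMor C U U X X' (\<lambda>u\<in>carrier U. u) f) \<in> carrier (comod_hom H (T U X) X')"
    by (rule compose_mor[OF TX TX' X' M LUn_mor[OF X']])
  show "compose (carrier (T U X)) f (LUn C X) \<in> carrier (comod_hom H (T U X) X')" by (rule compose_mor[OF TX X X' LUn_mor[OF X] f])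
  fix u x assume u: "u \<in> carrier U" and x: "x \<in> carrier X"
  show "compose (carrier (T U X)) (LUn C X') (TMor C U U X X' (\<lambda>u\<in>carrier U. u) f) (pr U X u x) = compose (carrier (T U X)) f (LUn C X) (pr U X u x)"
    using u x pr_closed[OF u x U X] lin_closed[OF mor_lin[OF f] x]
    by (simp add: compose_eq TMor_pr[OF U U X X' i f] LUn_pr[OF X] LUn_pr[OF X'] lin_smult[OF mor_lin[OF f]])
qed

lemma RUn_natural:
  assumes X: "comodule H X" and X': "comodule H X'" and f: "f \<in> carrier (comod_hom H X X')"
  shows "compose (carrier (T X U)) (RUn C X') (TMor C X X' U U f (\<lambda>u\<in>carrier U. u)) = compose (carrier (T X U)) f (RUn C X)"
proof (rule mor_eq_T[OF X U X'])
  note i = idn_mor[OF U] and TX = T_comodule[OF X U] and TX' = T_comodule[OF X' U]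
  note M = TMor_mor[OF X X' U U f i]
  show "compose (carrier (T X U)) (RUn C X') (TMor C X X' U U f (\<lambda>u\<in>carrier U. u)) \<in> carrier (comod_hom H (T X U) X')"
    by (rule compose_mor[OF TX TX' X' M RUn_mor[OF X']])
  show "compose (carrier (T X U)) f (RUn C X) \<in> carrier (comod_hom H (T X U) X')" by (rule compose_mor[OF TX X X' RUn_mor[OF X] f])
  fix x u assume x: "x \<in> carrier X" and u: "u \<in> carrier U"
  show "compose (carrier (T X U)) (RUn C X') (TMor C X X' U U f (\<lambda>u\<in>carrier U. u)) (pr X U x u) = compose (carrier (T X U)) f (RUn C X) (pr X U x u)"
    using u x pr_closed[OF x u X U] lin_closed[OF mor_lin[OF f] x]
    by (simp add: compose_eq TMor_pr[OF X X' U U f i] RUn_pr[OF X] RUn_pr[OF X'] lin_smult[OF mor_lin[OF f]])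
qed

text \<open>The middle factor has trivial degree, where the normalizations make \<omega> and
  \<Lambda> trivial and \<gamma>(1) is the counit; the associator is then the bare
  rebracketing.\<close>

lemma triangle:
  assumes X: "comodule H X" and Y: "comodule H Y"
  shows "compose (carrier (T (T X U) Y)) (TMor C X X (T U Y) Y (\<lambda>x\<in>carrier X. x) (LUn C Y)) (Asc C X U Y)
    = TMor C (T X U) X Y Y (RUn C X) (\<lambda>y\<in>carrier Y. y)"
proof -
  note XU = T_comodule[OF X U] and UY = T_comodule[OF U Y]
  note S = T_comodule[OF XU Y] and D = T_comodule[OF X UY] and XY = T_comodule[OF X Y]
  note iX = idn_mor[OF X] and iY = idn_mor[OF Y] and A = Asc_mor[OF X U Y]
  note M = TMor_mor[OF X X UY Y iX LUn_mor[OF Y]] and M' = TMor_mor[OF XU X Y Y RUn_mor[OF X] iY]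
  note L = compose_mor[OF S D XY A M]
  show ?thesis
  proof (rule mor_ext[OF L M'], rule T_ext3[OF X U Y comodule_vspace[OF XY] mor_lin[OF L] mor_lin[OF M']])
    fix a b c x u y
    assume *: "a \<in> carrier G" "b \<in> carrier G" "c \<in> carrier G" "x \<in> gr X a" "u \<in> gr U b" "y \<in> gr Y c"
    note xX = gr_carrier[OF *(4)] and uU = gr_carrier[OF *(5)] and yY = gr_carrier[OF *(6)]
    note uy = pr_closed[OF uU yY U Y] and xu = pr_closed[OF xX uU X U]
    note p = pr_closed[OF xu yY XU Y] and q = pr_closed[OF xX uy X UY]
    have "Asc C X U Y (pr (T X U) Y (pr X U x u) y) = pr X (T U Y) x (pr U Y u y)"
      using Asc_homog[OF X U Y *(1) Gr.one_closed *(3,4) U_gr[OF uU] *(6)] q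
      by (simp add: omega_one[OF *(1,3)] Lambda_one(1)[OF *(1)] half_braid_one[OF Y yY] vs_one[OF comodule_vspace[OF D]])
    then show "compose (carrier (T (T X U) Y)) (TMor C X X (T U Y) Y (\<lambda>x\<in>carrier X. x) (LUn C Y)) (Asc C X U Y) (pr (T X U) Y (pr X U x u) y)
        = TMor C (T X U) X Y Y (RUn C X) (\<lambda>y\<in>carrier Y. y) (pr (T X U) Y (pr X U x u) y)"
      using p xX yY by (simp add: compose_eq TMor_pr[OF X X UY Y iX LUn_mor[OF Y] xX uy] TMor_pr[OF XU X Y Y RUn_mor[OF X] iY xu yY]
        LUn_pr[OF Y uU yY] RUn_pr[OF X uU xX] pr_smult[OF X Y])
  qed
qed

text \<open>Both composites send a homogeneous generator to a scalar multiple of the same element,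
  and the scalars are the two sides of \<open>omega_eq\<close>.\<close>

lemma pentagon:
  assumes W: "comodule H W" and X: "comodule H X" and Y: "comodule H Y" and Z: "comodule H Z"
  shows "compose (carrier (T (T (T W X) Y) Z)) (Asc C W X (T Y Z)) (Asc C (T W X) Y Z)
    = compose (carrier (T (T (T W X) Y) Z)) (TMor C W W (T (T X Y) Z) (T X (T Y Z)) (\<lambda>w\<in>carrier W. w) (Asc C X Y Z))
        (compose (carrier (T (T (T W X) Y) Z)) (Asc C W (T X Y) Z) (TMor C (T (T W X) Y) (T W (T X Y)) Z Z (Asc C W X Y) (\<lambda>z\<in>carrier Z. z)))"
proof -
  note WX = T_comodule[OF W X] and XY = T_comodule[OF X Y] and YZ = T_comodule[OF Y Z]
  note WXY = T_comodule[OF WX Y] and W_XY = T_comodule[OF W XY] and XYZ = T_comodule[OF XY Z] and X_YZ = T_comodule[OF X YZ]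
  note S = T_comodule[OF WXY Z] and D = T_comodule[OF W X_YZ] and P1 = T_comodule[OF WX YZ] and P2 = T_comodule[OF W_XY Z] and P3 = T_comodule[OF W XYZ]
  note iW = idn_mor[OF W] and iZ = idn_mor[OF Z]
  note A1 = Asc_mor[OF WX Y Z] and A2 = Asc_mor[OF W X YZ] and A3 = Asc_mor[OF W X Y] and A4 = Asc_mor[OF W XY Z] and A5 = Asc_mor[OF X Y Z]
  note M3 = TMor_mor[OF WXY W_XY Z Z A3 iZ] and M5 = TMor_mor[OF W W XYZ X_YZ iW A5]
  note L = compose_mor[OF S P1 D A1 A2] and C4 = compose_mor[OF S P2 P3 M3 A4]
  note R = compose_mor[OF S P3 D C4 M5]
  note vD = comodule_vspace[OF D]
  show ?thesis
  proof (rule mor_ext[OF L R], rule T_ext4[OF W X Y Z vD mor_lin[OF L] mor_lin[OF R]])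
    fix a b c d w x y z
    assume a: "a \<in> carrier G" and b: "b \<in> carrier G" and c: "c \<in> carrier G" and d: "d \<in> carrier G"
      and w: "w \<in> gr W a" and x: "x \<in> gr X b" and y: "y \<in> gr Y c" and z: "z \<in> gr Z d"
    let ?s = "\<Lambda> a b" and ?s' = "\<Lambda> (a \<otimes>\<^bsub>G\<^esub> b) c" and ?u = "\<Lambda> b c" and ?v = "\<Lambda> a (b \<otimes>\<^bsub>G\<^esub> c)"
    let ?hb = "\<lambda>s. half_braid (\<gamma> s)"
    have ab: "a \<otimes>\<^bsub>G\<^esub> b \<in> carrier G" and bc: "b \<otimes>\<^bsub>G\<^esub> c \<in> carrier G" and cd: "c \<otimes>\<^bsub>G\<^esub> d \<in> carrier G" using a b c d by auto
    note sG = Lambda_closed[OF a b] and s'G = Lambda_closed[OF ab c] and uG = Lambda_closed[OF b c] and vG = Lambda_closed[OF a bc]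
    note hy = half_braid_gr[OF Y c y lin_gamma[OF sG]] and hz' = half_braid_gr[OF Z d z lin_gamma[OF s'G]] and hzv = half_braid_gr[OF Z d z lin_gamma[OF vG]]
    note hz = half_braid_gr[OF Z d hz' lin_gamma[OF sG]]
    note cr = gr_carrier[OF w] gr_carrier[OF x] gr_carrier[OF y] gr_carrier[OF z] gr_carrier[OF hy] gr_carrier[OF hz'] gr_carrier[OF hzv] gr_carrier[OF hz]
    let ?p = "pr (T (T W X) Y) Z (pr (T W X) Y (pr W X w x) y) z"
    let ?q = "pr W (T X (T Y Z)) w (pr X (T Y Z) x (pr Y Z (?hb ?s Y y) (?hb ?s Z (?hb ?s' Z z))))"
    have p: "?p \<in> carrier (T (T (T W X) Y) Z)" by (rule linr W X Y Z cr)+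
    have q: "?q \<in> carrier (T W (T X (T Y Z)))" by (rule linr W X Y Z cr)+
    have "Asc C W X (T Y Z) (Asc C (T W X) Y Z ?p) = (\<omega> (a \<otimes>\<^bsub>G\<^esub> b) c d * \<omega> a b (c \<otimes>\<^bsub>G\<^esub> d) * \<gamma> ?s (\<Lambda> c d)) \<odot>\<^bsub>T W (T X (T Y Z))\<^esub> ?q"
    proof -
      let ?r = "pr Y Z y (?hb ?s' Z z)" and ?r' = "pr Y Z (?hb ?s Y y) (?hb ?s Z (?hb ?s' Z z))"
      have rr: "pr (T W X) (T Y Z) (pr W X w x) ?r \<in> carrier (T (T W X) (T Y Z))" by (rule linr W X Y Z cr)+
      have r'c: "?r' \<in> carrier (T Y Z)" "pr X (T Y Z) x ?r' \<in> carrier (T X (T Y Z))" by (rule linr W X Y Z cr)+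
      have "Asc C W X (T Y Z) (Asc C (T W X) Y Z ?p) = \<omega> (a \<otimes>\<^bsub>G\<^esub> b) c d \<odot>\<^bsub>T W (T X (T Y Z))\<^esub> Asc C W X (T Y Z) (pr (T W X) (T Y Z) (pr W X w x) ?r)"
        unfolding Asc_homog[OF WX Y Z ab c d pr_gr[OF W X a b w x] y z] lin_smult[OF mor_lin[OF A2] rr] ..
      also have "Asc C W X (T Y Z) (pr (T W X) (T Y Z) (pr W X w x) ?r)
          = \<omega> a b (c \<otimes>\<^bsub>G\<^esub> d) \<odot>\<^bsub>T W (T X (T Y Z))\<^esub> pr W (T X (T Y Z)) w (pr X (T Y Z) x (?hb ?s (T Y Z) ?r))"
        by (rule Asc_homog[OF W X YZ a b cd w x pr_gr[OF Y Z c d y hz']])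
      \<comment> \<open>Here the half-braiding passes a tensor product and produces the scalar
        \<gamma>(\<Lambda>(a,b))(\<Lambda>(c,d)).\<close>
      also have "?hb ?s (T Y Z) ?r = \<gamma> ?s (\<Lambda> c d) \<odot>\<^bsub>T Y Z\<^esub> ?r'"
        by (rule half_braid_pr[OF Y Z c d y hz' sG])
      also have "pr W (T X (T Y Z)) w (pr X (T Y Z) x (\<gamma> ?s (\<Lambda> c d) \<odot>\<^bsub>T Y Z\<^esub> ?r')) = \<gamma> ?s (\<Lambda> c d) \<odot>\<^bsub>T W (T X (T Y Z))\<^esub> ?q"
        unfolding pr_smult(2)[OF X YZ cr(2) r'c(1)] by (rule pr_smult(2)[OF W X_YZ cr(1) r'c(2)])
      finally show ?thesis using q by (simp add: vs_smult_smult[OF vD] vs_smult[OF vD] mult.assoc)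
    qed
    moreover have "TMor C W W (T (T X Y) Z) (T X (T Y Z)) (\<lambda>w\<in>carrier W. w) (Asc C X Y Z) (Asc C W (T X Y) Z
        (TMor C (T (T W X) Y) (T W (T X Y)) Z Z (Asc C W X Y) (\<lambda>z\<in>carrier Z. z) ?p))
      = (\<omega> a b c * \<omega> a (b \<otimes>\<^bsub>G\<^esub> c) d * \<omega> b c d) \<odot>\<^bsub>T W (T X (T Y Z))\<^esub> ?q"
    proof -
      let ?r = "pr X Y x (?hb ?s Y y)" and ?z = "?hb ?v Z z"
      have c1: "pr (T W X) Y (pr W X w x) y \<in> carrier (T (T W X) Y)" "pr W (T X Y) w ?r \<in> carrier (T W (T X Y))"
        "pr (T W (T X Y)) Z (pr W (T X Y) w ?r) z \<in> carrier (T (T W (T X Y)) Z)"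
        "pr (T X Y) Z ?r ?z \<in> carrier (T (T X Y) Z)" "pr W (T (T X Y) Z) w (pr (T X Y) Z ?r ?z) \<in> carrier (T W (T (T X Y) Z))"
        by (rule linr W X Y Z cr)+
      have "TMor C (T (T W X) Y) (T W (T X Y)) Z Z (Asc C W X Y) (\<lambda>z\<in>carrier Z. z) ?p
          = \<omega> a b c \<odot>\<^bsub>T (T W (T X Y)) Z\<^esub> pr (T W (T X Y)) Z (pr W (T X Y) w ?r) z"
        using cr(4) by (simp add: TMor_pr[OF WXY W_XY Z Z A3 iZ c1(1) cr(4)] Asc_homog[OF W X Y a b c w x y] pr_smult(1)[OF W_XY Z c1(2) cr(4)])
      then have "Asc C W (T X Y) Z (TMor C (T (T W X) Y) (T W (T X Y)) Z Z (Asc C W X Y) (\<lambda>z\<in>carrier Z. z) ?p)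
          = \<omega> a b c \<odot>\<^bsub>T W (T (T X Y) Z)\<^esub> (\<omega> a (b \<otimes>\<^bsub>G\<^esub> c) d \<odot>\<^bsub>T W (T (T X Y) Z)\<^esub> pr W (T (T X Y) Z) w (pr (T X Y) Z ?r ?z))"
        by (simp add: lin_smult[OF mor_lin[OF A4] c1(3)] Asc_homog[OF W XY Z a bc d w pr_gr[OF X Y b c x hy] z])
      also have "\<dots> = (\<omega> a b c * \<omega> a (b \<otimes>\<^bsub>G\<^esub> c) d) \<odot>\<^bsub>T W (T (T X Y) Z)\<^esub> pr W (T (T X Y) Z) w (pr (T X Y) Z ?r ?z)"
        by (rule vs_smult_smult[OF comodule_vspace[OF P3] c1(5)])
      finally have 1: "Asc C W (T X Y) Z (TMor C (T (T W X) Y) (T W (T X Y)) Z Z (Asc C W X Y) (\<lambda>z\<in>carrier Z. z) ?p)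
          = (\<omega> a b c * \<omega> a (b \<otimes>\<^bsub>G\<^esub> c) d) \<odot>\<^bsub>T W (T (T X Y) Z)\<^esub> pr W (T (T X Y) Z) w (pr (T X Y) Z ?r ?z)" .
      \<comment> \<open>On \<open>z\<close> the two paths act by different pairs of characters;
        commutativity of \<Gamma> and the cocycle condition show that the products agree.\<close>
      have 2: "?hb ?u Z ?z = ?hb ?s Z (?hb ?s' Z z)"
        unfolding half_braid_gamma[OF Z cr(4) uG vG] half_braid_gamma[OF Z cr(4) sG s'G]
        using Gamma_commute[OF sG s'G] Gamma_commute[OF uG vG] cocycle[OF a b c] by simp
      have c2: "pr X (T Y Z) x (pr Y Z (?hb ?s Y y) (?hb ?s Z (?hb ?s' Z z))) \<in> carrier (T X (T Y Z))" by (rule linr W X Y Z cr)+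
      have "TMor C W W (T (T X Y) Z) (T X (T Y Z)) (\<lambda>w\<in>carrier W. w) (Asc C X Y Z) (pr W (T (T X Y) Z) w (pr (T X Y) Z ?r ?z)) = \<omega> b c d \<odot>\<^bsub>T W (T X (T Y Z))\<^esub> ?q"
        using cr(1) by (simp add: TMor_pr[OF W W XYZ X_YZ iW A5 cr(1) c1(4)] Asc_homog[OF X Y Z b c d x hy hzv] 2 pr_smult(2)[OF W X_YZ cr(1) c2])
      then show ?thesis unfolding 1 lin_smult[OF mor_lin[OF M5] c1(5)] using vs_smult_smult[OF vD q] by simp
    qed
    ultimately show "compose (carrier (T (T (T W X) Y) Z)) (Asc C W X (T Y Z)) (Asc C (T W X) Y Z) ?p
      = compose (carrier (T (T (T W X) Y) Z)) (TMor C W W (T (T X Y) Z) (T X (T Y Z)) (\<lambda>w\<in>carrier W. w) (Asc C X Y Z))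
        (compose (carrier (T (T (T W X) Y) Z)) (Asc C W (T X Y) Z) (TMor C (T (T W X) Y) (T W (T X Y)) Z Z (Asc C W X Y) (\<lambda>z\<in>carrier Z. z))) ?p"
      using p by (simp add: compose_eq omega_eq[OF a b c d])
  qed
qed

theorem monoidal: "monoidal_category C"
  unfolding monoidal_category_def Let_def mor_def C_simps
  by (intro conjI ballI linear_category_comod[OF C]; (unfold mem_Collect_eq)?;
    (rule U T_comodule TMor_bilin TMor_id TMor_comp Asc_iso Asc_natural LUn_iso RUn_iso LUn_natural RUn_natural pentagon triangle; assumption?)?)

end

section \<open>Equivalence of two models\<close>

locale tensor_cat_pair =
  C: tensor_cat H G \<pi> \<Gamma> \<gamma> \<Lambda> \<omega> T pr dc U e sc C + D: tensor_cat H G \<pi> \<Gamma> \<gamma> \<Lambda> \<omega> T' pr' dc' U e sc D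
  for H :: "('k::field, 'h, 'm) hopf_scheme" and G :: "'g monoid" and \<pi> and \<Gamma> and \<gamma> and \<Lambda> and \<omega>
    and T :: "('k, 'h, 'x) comod \<Rightarrow> ('k, 'h, 'x) comod \<Rightarrow> ('k, 'h, 'x) comod" and pr and dc and U and e and sc and C
    and T' and pr' and dc' and D
begin

text \<open>Runs from the product of \<open>D\<close> to that of \<open>C\<close>, as a monoidal
  structure on the identity functor from \<open>C\<close> to \<open>D\<close> requires. It is the
  identity of X \<otimes> Y seen through the two models.\<close>

definition J :: "('k, 'h, 'x) comod \<Rightarrow> ('k, 'h, 'x) comod \<Rightarrow> 'x \<Rightarrow> 'x" where
  "J X Y = (\<lambda>u\<in>carrier (T' X Y). tsum (T X Y) (dc' X Y u) (pr X Y))"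

lemma J_lin:
  assumes X: "comodule H X" and Y: "comodule H Y"
  shows "lin (T' X Y) (T X Y) (J X Y)"
  unfolding J_def
  using lin_cong[OF D.T_vspace[OF X Y], of "\<lambda>u\<in>carrier (T' X Y). tsum (T X Y) (dc' X Y u) (pr X Y)" "\<lambda>u. tsum (T X Y) (dc' X Y u) (pr X Y)" "T X Y"]
    D.tlift(1)[OF X Y C.T_vspace[OF X Y] C.pr_bilin[OF X Y]] by simp

lemma J_pr:
  assumes X: "comodule H X" and Y: "comodule H Y" and x: "x \<in> carrier X" and y: "y \<in> carrier Y"
  shows "J X Y (pr' X Y x y) = pr X Y x y"
  using D.tlift(2)[OF X Y C.T_vspace[OF X Y] C.pr_bilin[OF X Y] x y] D.pr_closed[OF x y X Y] by (simp add: J_def)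

text \<open>Both coactions are given on generators by the same formula in \<open>zmult\<close>, so
  the map that matches generators is colinear.\<close>

lemma J_mor:
  assumes X: "comodule H X" and Y: "comodule H Y"
  shows "J X Y \<in> carrier (comod_hom H (T' X Y) (T X Y))"
proof (rule C.morI)
  let ?J = "J X Y" and ?N = "tensor H (T X Y)"
  note lJ = J_lin[OF X Y] and vT = C.T_vspace[OF X Y] and TX = C.T_comodule[OF X Y] and TX' = D.T_comodule[OF X Y]
  note lJ' = lin_comp[OF lJ] and cJ = lin_closed[OF lJ]
  have vN: "vspace ?N" by (rule linr vT C.vsH)+
  show "?J \<in> extensional (carrier (T' X Y))" by (simp add: J_def)
  show "lin (T' X Y) (T X Y) ?J" by (rule lJ)
  fix u assume u: "u \<in> carrier (T' X Y)"
  show "coact (T X Y) (?J u) = tsum ?N (coact (T' X Y) u) (\<lambda>h v. pure H (T X Y) h (?J v))"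
  proof (rule D.T_ext_all[OF X Y vN _ _ u, where f="\<lambda>u. coact (T X Y) (?J u)"])
    show "lin (T' X Y) ?N (\<lambda>u. coact (T X Y) (?J u))" "lin (T' X Y) ?N (\<lambda>u. tsum ?N (coact (T' X Y) u) (\<lambda>h v. pure H (T X Y) h (?J v)))"
      by (rule lJ lJ' cJ linr TX TX' vT | assumption)+
    fix x y assume x: "x \<in> carrier X" and y: "y \<in> carrier Y"
    have "coact (T X Y) (?J (pr' X Y x y)) = tsum ?N (coact X x) (\<lambda>h x\<^sub>0. tsum ?N (coact Y y) (\<lambda>k y\<^sub>0. pure H (T X Y) (C.zmult h k) (pr X Y x\<^sub>0 y\<^sub>0)))"
      unfolding J_pr[OF X Y x y] by (rule C.coact_pr[OF X Y x y])
    also have "\<dots> = tsum ?N (coact X x) (\<lambda>h x\<^sub>0. tsum ?N (coact Y y) (\<lambda>k y\<^sub>0. pure H (T X Y) (C.zmult h k) (?J (pr' X Y x\<^sub>0 y\<^sub>0))))"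
      by (rule C.tsum_coact_cong[OF X x], rule C.tsum_coact_cong[OF Y y]) (simp add: J_pr[OF X Y])
    also have "\<dots> = tsum ?N (coact (T' X Y) (pr' X Y x y)) (\<lambda>h v. pure H (T X Y) h (?J v))"
      by (rule D.tsum_coact_pr[OF X Y vN bilinI x y, symmetric]) (rule lJ lJ' cJ linr vT C.vsH | assumption)+
    finally show "coact (T X Y) (?J (pr' X Y x y)) = tsum ?N (coact (T' X Y) (pr' X Y x y)) (\<lambda>h v. pure H (T X Y) h (?J v))" .
  qed
qed

lemma J_iso:
  assumes X: "comodule H X" and Y: "comodule H Y"
  shows "iso_in D (T' X Y) (T X Y) (J X Y)"
proof (rule C.comod_iso[OF D.C D.T_comodule[OF X Y] C.T_comodule[OF X Y] J_mor[OF X Y]])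
  let ?K = "\<lambda>u. tsum (T' X Y) (dc X Y u) (pr' X Y)"
  note K = C.tlift[OF X Y D.T_vspace[OF X Y] D.pr_bilin[OF X Y]]
  show "lin (T X Y) (T' X Y) ?K" by (rule K(1))
  show "?K (J X Y u) = u" if "u \<in> carrier (T' X Y)" for u
    by (rule D.T_ext_all[OF X Y D.T_vspace[OF X Y] lin_comp[OF K(1) J_lin[OF X Y]] lin_id that]) (simp add: J_pr[OF X Y] K(2))
  show "J X Y (?K u) = u" if "u \<in> carrier (T X Y)" for u
    by (rule C.T_ext_all[OF X Y C.T_vspace[OF X Y] lin_comp[OF J_lin[OF X Y] K(1)] lin_id that]) (simp add: J_pr[OF X Y] K(2))
qed

lemma J_natural:
  assumes X: "comodule H X" and X': "comodule H X'" and Y: "comodule H Y" and Y': "comodule H Y'"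
    and f: "f \<in> carrier (comod_hom H X X')" and g: "g \<in> carrier (comod_hom H Y Y')"
  shows "compose (carrier (T' X Y)) (J X' Y') (TMor D X X' Y Y' f g) = compose (carrier (T' X Y)) (TMor C X X' Y Y' f g) (J X Y)"
proof (rule D.mor_eq_T[OF X Y C.T_comodule[OF X' Y']])
  note TX = C.T_comodule[OF X Y] and TX' = D.T_comodule[OF X Y] and S = C.T_comodule[OF X' Y'] and S' = D.T_comodule[OF X' Y']
  note M = C.TMor_mor[OF X X' Y Y' f g] and M' = D.TMor_mor[OF X X' Y Y' f g]
  show "compose (carrier (T' X Y)) (J X' Y') (TMor D X X' Y Y' f g) \<in> carrier (comod_hom H (T' X Y) (T X' Y'))"
    by (rule C.compose_mor[OF TX' S' S M' J_mor[OF X' Y']])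
  show "compose (carrier (T' X Y)) (TMor C X X' Y Y' f g) (J X Y) \<in> carrier (comod_hom H (T' X Y) (T X' Y'))"
    by (rule C.compose_mor[OF TX' TX S J_mor[OF X Y] M])
  fix x y assume x: "x \<in> carrier X" and y: "y \<in> carrier Y"
  show "compose (carrier (T' X Y)) (J X' Y') (TMor D X X' Y Y' f g) (pr' X Y x y) = compose (carrier (T' X Y)) (TMor C X X' Y Y' f g) (J X Y) (pr' X Y x y)"
    using D.pr_closed[OF x y X Y] lin_closed[OF C.mor_lin[OF f] x] lin_closed[OF C.mor_lin[OF g] y]
    by (simp add: compose_eq D.TMor_pr[OF X X' Y Y' f g x y] C.TMor_pr[OF X X' Y Y' f g x y] J_pr[OF X' Y'] J_pr[OF X Y x y])
qed

text \<open>Both associators have the same formula on homogeneous generators, and \<open>J\<close>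
  matches generators; the two paths therefore agree on generators.\<close>

lemma J_assoc:
  assumes X: "comodule H X" and Y: "comodule H Y" and Z: "comodule H Z"
  shows "compose (carrier (T' (T' X Y) Z)) (Asc C X Y Z) (compose (carrier (T' (T' X Y) Z)) (J (T X Y) Z)
            (TMor D (T' X Y) (T X Y) Z Z (J X Y) (\<lambda>z\<in>carrier Z. z)))
    = compose (carrier (T' (T' X Y) Z)) (compose (carrier (T' X (T' Y Z))) (J X (T Y Z)) (TMor D X X (T' Y Z) (T Y Z) (\<lambda>x\<in>carrier X. x) (J Y Z)))
        (Asc D X Y Z)"
proof -
  note XY = C.T_comodule[OF X Y] and XY' = D.T_comodule[OF X Y] and YZ = C.T_comodule[OF Y Z] and YZ' = D.T_comodule[OF Y Z]
  note S' = D.T_comodule[OF XY' Z] and S1 = D.T_comodule[OF XY Z] and S = C.T_comodule[OF XY Z]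
  note D' = D.T_comodule[OF X YZ'] and D1 = D.T_comodule[OF X YZ] and E = C.T_comodule[OF X YZ]
  note iX = C.idn_mor[OF X] and iZ = C.idn_mor[OF Z] and Jxy = J_mor[OF X Y] and Jyz = J_mor[OF Y Z]
  note M = D.TMor_mor[OF XY' XY Z Z Jxy iZ] and M' = D.TMor_mor[OF X X YZ' YZ iX Jyz]
  note c1 = C.compose_mor[OF S' S1 S M J_mor[OF XY Z]] and c2 = C.compose_mor[OF D' D1 E M' J_mor[OF X YZ]]
  note L = C.compose_mor[OF S' S E c1 C.Asc_mor[OF X Y Z]] and R = C.compose_mor[OF S' D' E D.Asc_mor[OF X Y Z] c2]
  show ?thesis
  proof (rule C.mor_ext[OF L R], rule D.T_ext3[OF X Y Z C.comodule_vspace[OF E] C.mor_lin[OF L] C.mor_lin[OF R]])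
    fix a b c x y z
    assume *: "a \<in> carrier G" "b \<in> carrier G" "c \<in> carrier G" "x \<in> C.gr X a" "y \<in> C.gr Y b" "z \<in> C.gr Z c"
    note xX = C.gr_carrier[OF *(4)] and yY = C.gr_carrier[OF *(5)] and zZ = C.gr_carrier[OF *(6)]
    let ?hz = "half_braid (\<gamma> (\<Lambda> a b)) Z z"
    note hz = C.gr_carrier[OF C.half_braid_gr[OF Z *(3,6) C.lin_gamma[OF C.Lambda_closed[OF *(1,2)]]]]
    note xy = C.pr_closed[OF xX yY X Y] and xy' = D.pr_closed[OF xX yY X Y] and yz = C.pr_closed[OF yY hz Y Z] and yz' = D.pr_closed[OF yY hz Y Z]
    note p = D.pr_closed[OF xy' zZ XY' Z] and q = D.pr_closed[OF xX yz' X YZ'] and q1 = D.pr_closed[OF xX yz X YZ]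
    have l: "Asc C X Y Z (J (T X Y) Z (TMor D (T' X Y) (T X Y) Z Z (J X Y) (\<lambda>z\<in>carrier Z. z) (pr' (T' X Y) Z (pr' X Y x y) z)))
        = \<omega> a b c \<odot>\<^bsub>T X (T Y Z)\<^esub> pr X (T Y Z) x (pr Y Z y ?hz)"
      using zZ by (simp add: D.TMor_pr[OF XY' XY Z Z Jxy iZ xy' zZ] J_pr[OF X Y xX yY] J_pr[OF XY Z xy zZ] C.Asc_homog[OF X Y Z *])
    have r: "J X (T Y Z) (TMor D X X (T' Y Z) (T Y Z) (\<lambda>x\<in>carrier X. x) (J Y Z) (Asc D X Y Z (pr' (T' X Y) Z (pr' X Y x y) z)))
        = \<omega> a b c \<odot>\<^bsub>T X (T Y Z)\<^esub> pr X (T Y Z) x (pr Y Z y ?hz)"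
      using xX by (simp add: D.Asc_homog[OF X Y Z *] lin_smult[OF C.mor_lin[OF M'] q] D.TMor_pr[OF X X YZ' YZ iX Jyz xX yz'] J_pr[OF Y Z yY hz]
        lin_smult[OF J_lin[OF X YZ] q1] J_pr[OF X YZ xX yz])
    have A: "Asc D X Y Z (pr' (T' X Y) Z (pr' X Y x y) z) \<in> carrier (T' X (T' Y Z))" by (rule lin_closed[OF D.Asc_lin[OF X Y Z] p])
    show "compose (carrier (T' (T' X Y) Z)) (Asc C X Y Z) (compose (carrier (T' (T' X Y) Z)) (J (T X Y) Z)
            (TMor D (T' X Y) (T X Y) Z Z (J X Y) (\<lambda>z\<in>carrier Z. z))) (pr' (T' X Y) Z (pr' X Y x y) z)
      = compose (carrier (T' (T' X Y) Z)) (compose (carrier (T' X (T' Y Z))) (J X (T Y Z)) (TMor D X X (T' Y Z) (T Y Z) (\<lambda>x\<in>carrier X. x) (J Y Z)))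
        (Asc D X Y Z) (pr' (T' X Y) Z (pr' X Y x y) z)"
      using p A l r by (simp add: compose_eq)
  qed
qed

lemma J_LUn:
  assumes X: "comodule H X"
  shows "compose (carrier (T' U X)) (LUn C X) (compose (carrier (T' U X)) (J U X) (TMor D U U X X (\<lambda>u\<in>carrier U. u) (\<lambda>x\<in>carrier X. x))) = LUn D X"
proof (rule D.mor_eq_T[OF C.U X X _ D.LUn_mor[OF X]])
  note U = C.U
  note iX = C.idn_mor[OF X] and iU = C.idn_mor[OF U] and TU = C.T_comodule[OF U X] and TU' = D.T_comodule[OF U X]
  note M = D.TMor_mor[OF U U X X iU iX]
  show "compose (carrier (T' U X)) (LUn C X) (compose (carrier (T' U X)) (J U X) (TMor D U U X X (\<lambda>u\<in>carrier U. u) (\<lambda>x\<in>carrier X. x))) \<in> carrier (comod_hom H (T' U X) X)"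
    by (rule C.compose_mor[OF TU' TU X C.compose_mor[OF TU' TU' TU M J_mor[OF U X]] C.LUn_mor[OF X]])
  fix u x assume u: "u \<in> carrier U" and x: "x \<in> carrier X"
  show "compose (carrier (T' U X)) (LUn C X) (compose (carrier (T' U X)) (J U X) (TMor D U U X X (\<lambda>u\<in>carrier U. u) (\<lambda>x\<in>carrier X. x))) (pr' U X u x) = LUn D X (pr' U X u x)"
    using u x D.pr_closed[OF u x U X]
    by (simp add: compose_eq D.TMor_pr[OF U U X X iU iX] J_pr[OF U X] C.LUn_pr[OF X] D.LUn_pr[OF X])
qed

lemma J_RUn:
  assumes X: "comodule H X"
  shows "compose (carrier (T' X U)) (RUn C X) (compose (carrier (T' X U)) (J X U) (TMor D X X U U (\<lambda>x\<in>carrier X. x) (\<lambda>u\<in>carrier U. u))) = RUn D X"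
proof (rule D.mor_eq_T[OF X C.U X _ D.RUn_mor[OF X]])
  note U = C.U
  note iX = C.idn_mor[OF X] and iU = C.idn_mor[OF U] and TU = C.T_comodule[OF X U] and TU' = D.T_comodule[OF X U]
  note M = D.TMor_mor[OF X X U U iX iU]
  show "compose (carrier (T' X U)) (RUn C X) (compose (carrier (T' X U)) (J X U) (TMor D X X U U (\<lambda>x\<in>carrier X. x) (\<lambda>u\<in>carrier U. u))) \<in> carrier (comod_hom H (T' X U) X)"
    by (rule C.compose_mor[OF TU' TU X C.compose_mor[OF TU' TU' TU M J_mor[OF X U]] C.RUn_mor[OF X]])
  fix x u assume x: "x \<in> carrier X" and u: "u \<in> carrier U"
  show "compose (carrier (T' X U)) (RUn C X) (compose (carrier (T' X U)) (J X U) (TMor D X X U U (\<lambda>x\<in>carrier X. x) (\<lambda>u\<in>carrier U. u))) (pr' X U x u) = RUn D X (pr' X U x u)"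
    using u x D.pr_closed[OF x u X U]
    by (simp add: compose_eq D.TMor_pr[OF X X U U iX iU] J_pr[OF X U] C.RUn_pr[OF X] D.RUn_pr[OF X])
qed

lemma idn_iso: "comodule H X \<Longrightarrow> iso_in C X X (\<lambda>x\<in>carrier X. x)" "comodule H X \<Longrightarrow> iso_in D X X (\<lambda>x\<in>carrier X. x)"
  by (rule C.comod_iso[OF C.C _ _ C.idn_mor, where g="\<lambda>x. x"] C.comod_iso[OF D.C _ _ C.idn_mor, where g="\<lambda>x. x"]; simp add: lin_id)+

lemma compose_idn:
  assumes f: "f \<in> carrier (comod_hom H X Y)"
  shows "compose (carrier X) (\<lambda>y\<in>carrier Y. y) f = compose (carrier X) f (\<lambda>x\<in>carrier X. x)"
  using lin_closed[OF C.mor_lin[OF f]] by (intro ext) (simp add: compose_def)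

lemma equivalence: "equivalence_functor C D (\<lambda>X. X) (\<lambda>X Y f. f)"
proof -
  have lf: "linear_functor C D (\<lambda>X. X) (\<lambda>X Y f. f)" "linear_functor D C (\<lambda>X. X) (\<lambda>X Y f. f)"
    by (simp_all add: linear_functor_def lin_id)
  have ni: "natural_iso C C (\<lambda>X. X) (\<lambda>X Y f. f) (\<lambda>X. X) (\<lambda>X Y f. f) (\<lambda>X. \<lambda>x\<in>carrier X. x)"
    "natural_iso D D (\<lambda>X. X) (\<lambda>X Y f. f) (\<lambda>X. X) (\<lambda>X Y f. f) (\<lambda>X. \<lambda>x\<in>carrier X. x)"
    by (simp_all add: natural_iso_def mor_def idn_iso compose_idn)
  show ?thesis unfolding equivalence_functor_def using lf ni by blast
qed

lemma monoidal_structure: "monoidal_structure C D (\<lambda>X. X) (\<lambda>X Y f. f) J (\<lambda>u\<in>carrier U. u)"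
  unfolding monoidal_structure_def Let_def mor_def C.C_simps D.C_simps
  by (intro conjI ballI; (unfold mem_Collect_eq)?; rule J_iso J_natural J_assoc J_LUn J_RUn idn_iso(2)[OF C.U]; assumption)

theorem tensor_equivalent: "tensor_equivalent C D"
  unfolding tensor_equivalent_def using C.monoidal D.monoidal equivalence monoidal_structure by blast

end

section \<open>Internal tensor products\<close>

context
  fixes X :: "('k::field, ('k, 'h, 'a) univ, 'm) module_scheme" and Y :: "('k, ('k, 'h, 'a) univ, 'n) module_scheme"
  assumes X: "vspace X" and Y: "vspace Y"
begin

text \<open>The encoding stores a representative, and the class of that representative is the
  original tensor.\<close>

lemma udec_uenc: "t \<in> carrier (tensor X Y) \<Longrightarrow> udec X Y (uenc t) = t"
  by (simp add: udec_def uenc_def tens_class_rep[OF X Y])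

lemma utensor_simps:
  "carrier (utensor X Y) = uenc ` carrier (tensor X Y)" "\<zero>\<^bsub>utensor X Y\<^esub> = uenc \<zero>\<^bsub>tensor X Y\<^esub>"
  "u \<oplus>\<^bsub>utensor X Y\<^esub> v = uenc (udec X Y u \<oplus>\<^bsub>tensor X Y\<^esub> udec X Y v)"
  "c \<odot>\<^bsub>utensor X Y\<^esub> u = uenc (c \<odot>\<^bsub>tensor X Y\<^esub> udec X Y u)"
  by (simp_all add: utensor_def mk_vspace_def)

lemma udec_closed: "u \<in> carrier (utensor X Y) \<Longrightarrow> udec X Y u \<in> carrier (tensor X Y)"
  by (auto simp: utensor_simps udec_uenc)

lemma uenc_udec: "u \<in> carrier (utensor X Y) \<Longrightarrow> uenc (udec X Y u) = u"
  by (auto simp: utensor_simps udec_uenc)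

lemma vspace_utensor: "vspace (utensor X Y)"
proof -
  note vT = vspace_tensor[OF X Y]
  interpret T: module base "tensor X Y" by (rule vT)
  let ?U = "utensor X Y"
  show ?thesis
  proof (rule vspaceI)
    show "abelian_group ?U"
    proof (rule abelian_groupI)
      fix u assume u: "u \<in> carrier ?U"
      let ?v = "uenc ((-1) \<odot>\<^bsub>tensor X Y\<^esub> udec X Y u)"
      have v: "?v \<in> carrier ?U" using u udec_closed vT by (auto simp: utensor_simps(1))
      have "(-1) \<odot>\<^bsub>tensor X Y\<^esub> udec X Y u \<oplus>\<^bsub>tensor X Y\<^esub> 1 \<odot>\<^bsub>tensor X Y\<^esub> udec X Y u = \<zero>\<^bsub>tensor X Y\<^esub>"
        using vs_add_smult[OF vT udec_closed[OF u], of "-1" 1] vs_zero_smult[OF vT udec_closed[OF u]] by simp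
      then have "?v \<oplus>\<^bsub>?U\<^esub> u = \<zero>\<^bsub>?U\<^esub>"
        using udec_closed[OF u] vT by (simp add: utensor_simps udec_uenc)
      then show "\<exists>v\<in>carrier ?U. v \<oplus>\<^bsub>?U\<^esub> u = \<zero>\<^bsub>?U\<^esub>" using v by blast
    qed (use vT in \<open>auto simp: utensor_simps udec_uenc T.M.add.m_ac\<close>)
  qed (use vT in \<open>auto simp: utensor_simps udec_uenc vs_add_smult vs_smult_add vs_smult_smult\<close>)
qed

lemma lin_uenc: "lin (tensor X Y) (utensor X Y) uenc"
  by (rule linI) (auto simp: utensor_simps udec_uenc)

lemma lin_udec: "lin (utensor X Y) (tensor X Y) (udec X Y)"
  using vspace_tensor[OF X Y] by (intro linI) (auto simp: utensor_simps udec_uenc)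

lemma bilin_upure: "bilin X Y (utensor X Y) (upure X Y)"
  unfolding upure_def[abs_def]
  by (rule bilinI; rule lin_comp[OF lin_uenc]) (rule bilin_left[OF bilin_pure[OF X Y]] bilin_right[OF bilin_pure[OF X Y]]; assumption)+

lemma udec_upure: "x \<in> carrier X \<Longrightarrow> y \<in> carrier Y \<Longrightarrow> udec X Y (upure X Y x y) = pure X Y x y"
  by (simp add: upure_def udec_uenc pure_closed[OF X Y])

lemma tsum_udec_upure:
  assumes u: "u \<in> carrier (utensor X Y)"
  shows "tsum (utensor X Y) (udec X Y u) (upure X Y) = u"
proof -
  have "uenc (tsum (tensor X Y) (udec X Y u) (pure X Y)) = tsum (utensor X Y) (udec X Y u) (\<lambda>x y. uenc (pure X Y x y))"
    by (rule tsum_image[OF X Y vspace_tensor[OF X Y] vspace_utensor lin_uenc udec_closed[OF u]]) (rule pure_closed[OF X Y])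
  then show ?thesis by (simp add: tsum_pure_id[OF X Y udec_closed[OF u]] uenc_udec[OF u] upure_def[abs_def])
qed

end

lemma lin_upure_left: "lin M X F \<Longrightarrow> vspace X \<Longrightarrow> vspace Y \<Longrightarrow> y \<in> carrier Y \<Longrightarrow> lin M (utensor X Y) (\<lambda>x. upure X Y (F x) y)"
  by (rule lin_bilin_left[OF bilin_upure])

lemma lin_upure_right: "lin M Y F \<Longrightarrow> vspace X \<Longrightarrow> vspace Y \<Longrightarrow> x \<in> carrier X \<Longrightarrow> lin M (utensor X Y) (\<lambda>y. upure X Y x (F y))"
  by (rule lin_bilin_right[OF bilin_upure])

lemma upure_closed: "x \<in> carrier X \<Longrightarrow> y \<in> carrier Y \<Longrightarrow> vspace X \<Longrightarrow> vspace Y \<Longrightarrow> upure X Y x y \<in> carrier (utensor X Y)"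
  by (rule bilin_closed[OF bilin_upure])

lemmas [linr] = lin_upure_left lin_upure_right upure_closed vspace_utensor

lemma mk_comod_simps [simp]:
  "carrier (mk_comod M \<rho>) = carrier M" "zero (mk_comod M \<rho>) = zero M" "add (mk_comod M \<rho>) = add M"
  "smult (mk_comod M \<rho>) = smult M" "coact (mk_comod M \<rho>) = \<rho>"
  by (simp_all add: mk_comod_def)

lemma comod_tensor_simps [simp]:
  "carrier (comod_tensor H X Y) = carrier (utensor X Y)" "zero (comod_tensor H X Y) = zero (utensor X Y)"
  "add (comod_tensor H X Y) = add (utensor X Y)" "smult (comod_tensor H X Y) = smult (utensor X Y)"
  by (simp_all add: comod_tensor_def Let_def)

lemma tensor_comod_tensor [simp]:
  "tensor N (comod_tensor H X Y) = tensor N (utensor X Y)" "pure N (comod_tensor H X Y) = pure N (utensor X Y)"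
  by (rule tensor_transfer; simp)+

lemma lin_comod_tensor [simp]:
  "lin (comod_tensor H X Y) N f = lin (utensor X Y) N f" "lin M (comod_tensor H X Y) g = lin M (utensor X Y) g"
  by (simp_all add: lin_def)

lemma bilin_comod_tensor [simp]:
  "bilin M N (comod_tensor H X Y) f = bilin M N (utensor X Y) f"
  "bilin (comod_tensor H X Y) N P g = bilin (utensor X Y) N P g"
  by (simp_all add: bilin_def)

lemma tsum_comod_tensor [simp]: "tsum (comod_tensor H X Y) t f = tsum (utensor X Y) t f"
  by (simp add: tsum_def)

lemma vspace_comod_tensor: "vspace X \<Longrightarrow> vspace Y \<Longrightarrow> vspace (comod_tensor H X Y)"
  by (rule vspace_transfer[OF vspace_utensor]) simp_all

context coalg_struct
begin

text \<open>The ambient space X \<otimes> Y \<otimes> H enters only through linearity of its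
  coaction, so this is all that is recorded for it; the comodule axioms of the zested product come
  from \<open>T_comodule\<close>.\<close>

definition precomod :: "('k, 'h, 'x, 'n) comod_scheme \<Rightarrow> bool" where
  "precomod X \<longleftrightarrow> vspace X \<and> lin X (tensor H X) (coact X)"

lemma comodule_precomod: "comodule H X \<Longrightarrow> precomod X"
  by (simp add: precomod_def comodule_vspace lin_coact)

lemma precomod_vspace: "precomod X \<Longrightarrow> vspace X"
  and precomod_lin: "lin M X F \<Longrightarrow> precomod X \<Longrightarrow> lin M (tensor H X) (\<lambda>x. coact X (F x))"
  and precomod_closed: "x \<in> carrier X \<Longrightarrow> precomod X \<Longrightarrow> coact X x \<in> carrier (tensor H X)"
  unfolding precomod_def using lin_comp[of X "tensor H X" "coact X" M F] lin_closed[of X "tensor H X" "coact X" x] by auto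

end

context bialg_struct
begin

lemma comod_tensor_coact:
  fixes X Y :: "('k, 'h, 'a) ucomod"
  assumes X: "precomod X" and Y: "precomod Y"
  shows "lin (utensor X Y) (tensor H (utensor X Y)) (coact (comod_tensor H X Y))"
    and "\<And>x y. x \<in> carrier X \<Longrightarrow> y \<in> carrier Y \<Longrightarrow> coact (comod_tensor H X Y) (upure X Y x y)
      = tsum (tensor H (utensor X Y)) (coact X x) (\<lambda>h x\<^sub>0. tsum (tensor H (utensor X Y)) (coact Y y) (\<lambda>k y\<^sub>0.
          pure H (utensor X Y) (h \<otimes>\<^bsub>H\<^esub> k) (upure X Y x\<^sub>0 y\<^sub>0)))"
proof -
  note vX = precomod_vspace[OF X] and vY = precomod_vspace[OF Y]
  let ?N = "tensor H (utensor X Y)"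
  let ?f = "\<lambda>x y. tsum ?N (coact X x) (\<lambda>h x\<^sub>0. tsum ?N (coact Y y) (\<lambda>k y\<^sub>0. pure H (utensor X Y) (h \<otimes>\<^bsub>H\<^esub> k) (upure X Y x\<^sub>0 y\<^sub>0)))"
  have co: "coact (comod_tensor H X Y) = (\<lambda>u. tsum ?N (udec X Y u) ?f)" by (simp add: comod_tensor_def Let_def)
  have vN: "vspace ?N" by (rule linr vX vY)+
  have b: "bilin X Y ?N ?f" by (rule bilinI) (rule precomod_lin precomod_closed X Y vX vY linr | assumption)+
  show "lin (utensor X Y) ?N (coact (comod_tensor H X Y))"
    unfolding co by (rule lin_comp[OF lin_tsum[OF vX vY vN b] lin_udec[OF vX vY]])
  show "coact (comod_tensor H X Y) (upure X Y x y) = ?f x y" if "x \<in> carrier X" "y \<in> carrier Y" for x y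
    unfolding co using that by (simp add: udec_upure[OF vX vY] tsum_pure[OF vX vY vN b])
qed

lemma comod_unit_simps:
  "carrier (comod_unit H) = range Scal" "zero (comod_unit H) = Scal 0"
  "u \<oplus>\<^bsub>comod_unit H\<^esub> v = Scal (unscal u + unscal v)" "c \<odot>\<^bsub>comod_unit H\<^esub> u = Scal (c * unscal u)"
  by (simp_all add: comod_unit_def Let_def mk_vspace_def)

lemma coact_comod_unit:
  fixes u :: "('k, 'h, 'a) univ"
  shows "coact (comod_unit H) u = pure H (comod_unit H) \<one>\<^bsub>H\<^esub> u"
proof -
  let ?K = "mk_vspace (range Scal) (Scal 0) (\<lambda>u v. Scal (unscal u + unscal v)) (\<lambda>c u. Scal (c * unscal u))
    :: ('k, ('k, 'h, 'a) univ) module"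
  have "pure H ?K = pure H (comod_unit H)"
    by (rule tensor_transfer(2)) (simp_all add: comod_unit_def Let_def)
  moreover have "coact (comod_unit H) u = pure H ?K \<one>\<^bsub>H\<^esub> u" by (simp add: comod_unit_def Let_def)
  ultimately show ?thesis by simp
qed

lemma vspace_comod_unit: "vspace (comod_unit H :: ('k, 'h, 'a) ucomod)"
proof (rule vspaceI)
  let ?U = "comod_unit H :: ('k, 'h, 'a) ucomod"
  show "abelian_group ?U"
  proof (rule abelian_groupI)
    fix u :: "('k, 'h, 'a) univ" assume "u \<in> carrier ?U"
    then show "\<exists>v\<in>carrier ?U. v \<oplus>\<^bsub>?U\<^esub> u = \<zero>\<^bsub>?U\<^esub>"
      by (intro bexI[of _ "Scal (- unscal u)"]) (simp_all add: comod_unit_simps)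
  qed (auto simp: comod_unit_simps algebra_simps)
qed (auto simp: comod_unit_simps algebra_simps)

lemma comodule_comod_unit: "comodule H (comod_unit H :: ('k, 'h, 'a) ucomod)"
proof -
  let ?U = "comod_unit H :: ('k, 'h, 'a) ucomod"
  let ?N = "tensor H (tensor H ?U)"
  note vU = vspace_comod_unit
  have lc: "lin ?U (tensor H ?U) (coact ?U)" unfolding coact_comod_unit by (rule linr vU)+
  have vN: "vspace ?N" by (rule linr vU)+
  have "tsum ?N (coact ?U u) (\<lambda>h x\<^sub>0. tsum ?N (coact ?U x\<^sub>0) (\<lambda>k x\<^sub>1. pure H (tensor H ?U) h (pure H ?U k x\<^sub>1)))
      = tsum ?N (coact ?U u) (\<lambda>h x\<^sub>0. tsum ?N (comult H h) (\<lambda>h\<^sub>1 h\<^sub>2. pure H (tensor H ?U) h\<^sub>1 (pure H ?U h\<^sub>2 x\<^sub>0)))"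
    if u: "u \<in> carrier ?U" for u
  proof -
    have "tsum ?N (pure H ?U \<one>\<^bsub>H\<^esub> u) (\<lambda>h x\<^sub>0. tsum ?N (pure H ?U \<one>\<^bsub>H\<^esub> x\<^sub>0) (\<lambda>k x\<^sub>1. pure H (tensor H ?U) h (pure H ?U k x\<^sub>1)))
        = tsum ?N (pure H ?U \<one>\<^bsub>H\<^esub> u) (\<lambda>k x\<^sub>1. pure H (tensor H ?U) \<one>\<^bsub>H\<^esub> (pure H ?U k x\<^sub>1))"
      by (rule tsum_pure[OF vsH vU vN bilinI one_closed u]) (rule linr vU u | assumption)+
    also have "\<dots> = pure H (tensor H ?U) \<one>\<^bsub>H\<^esub> (pure H ?U \<one>\<^bsub>H\<^esub> u)"
      by (rule tsum_pure[OF vsH vU vN bilinI one_closed u]) (rule linr vU u | assumption)+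
    finally have 1: "tsum ?N (pure H ?U \<one>\<^bsub>H\<^esub> u) (\<lambda>h x\<^sub>0. tsum ?N (pure H ?U \<one>\<^bsub>H\<^esub> x\<^sub>0) (\<lambda>k x\<^sub>1. pure H (tensor H ?U) h (pure H ?U k x\<^sub>1)))
        = pure H (tensor H ?U) \<one>\<^bsub>H\<^esub> (pure H ?U \<one>\<^bsub>H\<^esub> u)" .
    have "tsum ?N (pure H ?U \<one>\<^bsub>H\<^esub> u) (\<lambda>h x\<^sub>0. tsum ?N (comult H h) (\<lambda>h\<^sub>1 h\<^sub>2. pure H (tensor H ?U) h\<^sub>1 (pure H ?U h\<^sub>2 x\<^sub>0)))
        = tsum ?N (comult H \<one>\<^bsub>H\<^esub>) (\<lambda>h\<^sub>1 h\<^sub>2. pure H (tensor H ?U) h\<^sub>1 (pure H ?U h\<^sub>2 u))"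
      by (rule tsum_pure[OF vsH vU vN bilinI one_closed u]) (rule linr vU u | assumption)+
    also have "\<dots> = pure H (tensor H ?U) \<one>\<^bsub>H\<^esub> (pure H ?U \<one>\<^bsub>H\<^esub> u)"
      by (rule tsum_comult_grouplike[OF comult_one one_closed vN bilinI]) (rule linr vU u | assumption)+
    finally show ?thesis using 1 by (simp add: coact_comod_unit)
  qed
  moreover have "tsum ?U (coact ?U u) (\<lambda>h x\<^sub>0. counit H h \<odot>\<^bsub>?U\<^esub> x\<^sub>0) = u" if u: "u \<in> carrier ?U" for u
  proof -
    have "tsum ?U (coact ?U u) (\<lambda>h x\<^sub>0. counit H h \<odot>\<^bsub>?U\<^esub> x\<^sub>0) = counit H \<one>\<^bsub>H\<^esub> \<odot>\<^bsub>?U\<^esub> u"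
      unfolding coact_comod_unit by (rule tsum_pure[OF vsH vU vU bilinI one_closed u]) (rule linr vU u | assumption)+
    then show ?thesis using vs_one[OF vU u] by (simp add: counit_one)
  qed
  ultimately show ?thesis unfolding comodule_def using vU lc by blast
qed

lemma lin_unscal: "lin (comod_unit H) base unscal"
  by (rule linI) (auto simp: comod_unit_simps)

end

section \<open>Comodules over the zested coquasi-bialgebra\<close>

context zesting
begin

lemma bialg_zested: "bialg_struct zested"
  using coquasi_bialgebra_zested unfolding coquasi_bialgebra_def Let_def by unfold_locales simp_all

text \<open>The coalgebra is unchanged and comodules involve nothing else; this is why the
  comparison functor can be the identity on objects and morphisms.\<close>

lemma comodule_zested: "comodule zested X = comodule H X"
  by (simp add: comodule_def)

lemma comod_hom_zested: "comod_hom zested X Y = comod_hom H X Y"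
  by (simp add: comod_hom_def tmap_def)

lemma comod_unit_zested: "comod_unit zested = comod_unit H"
  by (simp add: comod_unit_def)

lemma model_comod_cat:
  "tensor_model H G \<pi> \<Gamma> \<gamma> \<Lambda> \<omega> (comod_tensor zested :: ('k, 'h, 'a) ucomod \<Rightarrow> ('k, 'h, 'a) ucomod \<Rightarrow> _) upure udec (comod_unit H) (Scal 1) unscal"
proof -
  interpret Q: bialg_struct zested by (rule bialg_zested)
  have pc: "Q.precomod X" if "comodule H X" for X :: "('k, 'h, 'a) ucomod"
    using that by (intro Q.comodule_precomod) (simp add: comodule_zested)
  show ?thesis
  proof (rule tensor_model.intro[OF zesting_axioms], rule tensor_model_axioms.intro, goal_cases)
    case (1 X Y) then show ?case by (intro vspace_comod_tensor comodule_vspace)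
  next
    case (2 X Y) then show ?case using Q.comod_tensor_coact(1)[OF pc pc, of X Y] by simp
  next
    case (3 X Y) then show ?case using bilin_upure[OF comodule_vspace comodule_vspace, of X Y] by simp
  next
    case (4 X Y) then show ?case using lin_udec[OF comodule_vspace comodule_vspace, of X Y] by simp
  next
    case (5 X Y x y) then show ?case by (intro udec_upure comodule_vspace)
  next
    case (6 X Y u) then show ?case using tsum_udec_upure[OF comodule_vspace comodule_vspace, of X Y u] by simp
  next
    case (7 X Y x y) then show ?case using Q.comod_tensor_coact(2)[OF pc pc, of X Y x y] by simp
  qed (use comodule_comod_unit lin_unscal in \<open>auto simp: comod_unit_simps coact_comod_unit\<close>)
qed

text \<open>The main content is the associator: on homogeneous components the counits in the
  associator form absorb the coactions of \<open>x\<close> and \<open>y\<close>, and the remaining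
  form acts on \<open>z\<close> as a scalar times the half-braiding.\<close>

lemma cat_comod_cat:
  "tensor_cat H G \<pi> \<Gamma> \<gamma> \<Lambda> \<omega> (comod_tensor zested :: ('k, 'h, 'a) ucomod \<Rightarrow> ('k, 'h, 'a) ucomod \<Rightarrow> _) upure udec (comod_unit H) (Scal 1) unscal
    (comod_cat zested)"
proof -
  interpret m: tensor_model H G \<pi> \<Gamma> \<gamma> \<Lambda> \<omega> "comod_tensor zested :: ('k, 'h, 'a) ucomod \<Rightarrow> ('k, 'h, 'a) ucomod \<Rightarrow> _" upure udec "comod_unit H" "Scal 1" unscal
    by (rule model_comod_cat)
  let ?T = "comod_tensor zested :: ('k, 'h, 'a) ucomod \<Rightarrow> ('k, 'h, 'a) ucomod \<Rightarrow> ('k, 'h, 'a) ucomod"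
  let ?C = "comod_cat zested :: ('k, ('k, 'h, 'a) ucomod, ('k, 'h, 'a) univ \<Rightarrow> ('k, 'h, 'a) univ) moncat"
  let ?U = "comod_unit H :: ('k, 'h, 'a) ucomod"
  have like: "comod_like H ?C"
    by (simp add: comod_like_def comod_cat_def Let_def comod_lincat_def comodule_zested comod_hom_zested[abs_def])
  have T: "comodule H (?T X Y)" if "comodule H X" "comodule H Y" for X Y by (rule m.T_comodule[OF that])
  have vT: "vspace (?T X Y)" if "comodule H X" "comodule H Y" for X Y by (rule m.T_vspace[OF that])
  have resc: "restrict f (carrier S) \<in> extensional (carrier S)" for f and S :: "('k, 'h, 'a) ucomod" by simp
  have resl: "lin S N (restrict f (carrier S)) = lin S N f" if "vspace S" for f N and S :: "('k, 'h, 'a) ucomod"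
    by (rule lin_cong[OF that]) simp
  have M: "TMor ?C X X' Y Y' f g = restrict (umap X Y X' Y' f g) (carrier (?T X Y))" for X X' Y Y' f g
    by (simp add: comod_cat_def Let_def)
  define asc where "asc X Y Z u = tsum (?T X (?T Y Z)) (udec (?T X Y) Z u) (\<lambda>v z. tsum (?T X (?T Y Z)) (udec X Y v) (\<lambda>x y.
          tsum (?T X (?T Y Z)) (coact X x) (\<lambda>h x\<^sub>0. tsum (?T X (?T Y Z)) (coact Y y) (\<lambda>k y\<^sub>0. tsum (?T X (?T Y Z)) (coact Z z) (\<lambda>l z\<^sub>0.
            \<Omega> h k l \<odot>\<^bsub>?T X (?T Y Z)\<^esub> upure X (?T Y Z) x\<^sub>0 (upure Y Z y\<^sub>0 z\<^sub>0))))))" for X Y Z u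
  have A: "Asc ?C X Y Z = restrict (asc X Y Z) (carrier (?T (?T X Y) Z))" for X Y Z
    by (simp add: comod_cat_def Let_def asc_def[abs_def])
  define lu where "lu X u = tsum X (udec ?U X u) (\<lambda>c x. unscal c \<odot>\<^bsub>X\<^esub> x)" for X :: "('k, 'h, 'a) ucomod" and u
  define ru where "ru X u = tsum X (udec X ?U u) (\<lambda>x c. unscal c \<odot>\<^bsub>X\<^esub> x)" for X :: "('k, 'h, 'a) ucomod" and u
  have LR: "LUn ?C X = restrict (lu X) (carrier (?T ?U X))" "RUn ?C X = restrict (ru X) (carrier (?T X ?U))" for X
    by (simp_all add: comod_cat_def Let_def comod_unit_zested lu_def[abs_def] ru_def[abs_def])
  have um: "umap X Y X' Y' f g u = tsum (?T X' Y') (udec X Y u) (\<lambda>x y. upure X' Y' (f x) (g y))" for X Y X' Y' :: "('k, 'h, 'a) ucomod" and f g u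
    by (simp add: umap_def)
  have bM: "bilin X Y (?T X' Y') (\<lambda>x y. upure X' Y' (f x) (g y))"
    if X: "comodule H X" and X': "comodule H X'" and Y: "comodule H Y" and Y': "comodule H Y'"
      and f: "f \<in> carrier (comod_hom H X X')" and g: "g \<in> carrier (comod_hom H Y Y')" for X X' Y Y' :: "('k, 'h, 'a) ucomod" and f g
    by (rule bilinI) (rule m.lin_pr_left m.lin_pr_right mor_lin[OF f] mor_lin[OF g] X' Y' lin_closed[OF mor_lin[OF f]] lin_closed[OF mor_lin[OF g]] | assumption)+
  have vU: "vspace ?U" by (rule vspace_comod_unit)
  have bL: "bilin ?U X X (\<lambda>c x. unscal c \<odot>\<^bsub>X\<^esub> x)" and bR: "bilin X ?U X (\<lambda>x c. unscal c \<odot>\<^bsub>X\<^esub> x)" if X: "comodule H X" for X :: "('k, 'h, 'a) ucomod"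
    by (rule bilinI; (rule linr X lin_unscal comodule_vspace[OF X] | assumption)+)+
  have bA: "bilin X Y (?T X (?T Y Z)) (\<lambda>x y. tsum (?T X (?T Y Z)) (coact X x) (\<lambda>h x\<^sub>0. tsum (?T X (?T Y Z)) (coact Y y) (\<lambda>k y\<^sub>0. tsum (?T X (?T Y Z)) (coact Z z) (\<lambda>l z\<^sub>0.
            \<Omega> h k l \<odot>\<^bsub>?T X (?T Y Z)\<^esub> upure X (?T Y Z) x\<^sub>0 (upure Y Z y\<^sub>0 z\<^sub>0)))))"
    if X: "comodule H X" and Y: "comodule H Y" and Z: "comodule H Z" and z: "z \<in> carrier Z" for X Y Z z
    by (rule bilinI) (rule m.lin_pr_left m.lin_pr_right m.pr_closed linr vT X Y Z T z | assumption)+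
  have bA': "bilin (?T X Y) Z (?T X (?T Y Z)) (\<lambda>v z. tsum (?T X (?T Y Z)) (udec X Y v) (\<lambda>x y. tsum (?T X (?T Y Z)) (coact X x) (\<lambda>h x\<^sub>0.
        tsum (?T X (?T Y Z)) (coact Y y) (\<lambda>k y\<^sub>0. tsum (?T X (?T Y Z)) (coact Z z) (\<lambda>l z\<^sub>0.
            \<Omega> h k l \<odot>\<^bsub>?T X (?T Y Z)\<^esub> upure X (?T Y Z) x\<^sub>0 (upure Y Z y\<^sub>0 z\<^sub>0))))))"
    if X: "comodule H X" and Y: "comodule H Y" and Z: "comodule H Z" for X Y Z
    by (rule bilinI) (rule m.lin_dc m.dc_closed m.lin_pr_left m.lin_pr_right m.pr_closed linr vT X Y Z T | assumption)+
  show ?thesis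
  proof (rule tensor_cat.intro[OF model_comod_cat], rule tensor_cat_axioms.intro, goal_cases)
    case 1 show ?case by (rule like)
  next
    case 2 show ?case by (simp add: comod_cat_def Let_def)
  next
    case 3 show ?case by (simp add: comod_cat_def Let_def comod_unit_zested)
  next
    case (4 X X' Y Y' f g) show ?case unfolding M by (rule resc)
  next
    case (5 X X' Y Y' f g)
    show ?case unfolding M resl[OF vT[OF 5(1,3)]] um[abs_def]
      by (rule m.tlift(1)[OF 5(1,3) vT[OF 5(2,4)] bM[OF 5]])
  next
    case (6 X X' Y Y' f g a b x y)
    note xX = gr_carrier[OF 6(9)] and yY = gr_carrier[OF 6(10)]
    show ?case unfolding M restrict_apply if_P[OF m.pr_closed[OF xX yY 6(1,3)]] um
      by (rule m.tlift(2)[OF 6(1,3) vT[OF 6(2,4)] bM[OF 6(1-6)] xX yY])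
  next
    case (7 X Y Z) show ?case unfolding A by (rule resc)
  next
    case (8 X Y Z)
    note XY = T[OF 8(1,2)] and N = vT[OF 8(1) T[OF 8(2,3)]]
    show ?case unfolding A resl[OF vT[OF XY 8(3)]] asc_def[abs_def]
      by (rule m.tlift(1)[OF XY 8(3) N bA'[OF 8]])
  next
    case (9 X Y Z a b c x y z)
    note X = 9(1) and Y = 9(2) and Z = 9(3)
    note xX = gr_carrier[OF 9(7)] and yY = gr_carrier[OF 9(8)] and zZ = gr_carrier[OF 9(9)]
    note XY = T[OF X Y] and N = vT[OF X T[OF Y Z]] and xy = m.pr_closed[OF xX yY X Y]
    note sG = Lambda_closed[OF 9(4,5)]
    note lg = lin_gamma[OF sG]
    let ?N = "?T X (?T Y Z)" and ?w = "\<omega> a b c"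
    let ?hb = "half_braid (\<gamma> (\<Lambda> a b)) Z"
    have hz: "?hb z \<in> carrier Z" by (rule half_braid_closed[OF Z lg zZ])
    let ?p = "\<lambda>x y z. upure X (?T Y Z) x (upure Y Z y z)"
    note st = m.lin_pr_left m.lin_pr_right m.pr_closed linr X Y Z T sG N
    have pc: "?p x y z \<in> carrier ?N" if "x \<in> carrier X" "y \<in> carrier Y" "z \<in> carrier Z" for x y z
      by (rule m.pr_closed X Y Z T that)+
    have "Asc ?C X Y Z (upure (?T X Y) Z (upure X Y x y) z)
        = tsum ?N (coact X x) (\<lambda>h x\<^sub>0. tsum ?N (coact Y y) (\<lambda>k y\<^sub>0. tsum ?N (coact Z z) (\<lambda>l z\<^sub>0. \<Omega> h k l \<odot>\<^bsub>?N\<^esub> ?p x\<^sub>0 y\<^sub>0 z\<^sub>0)))"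
      unfolding A restrict_apply if_P[OF m.pr_closed[OF xy zZ XY Z]] asc_def
        m.tlift(2)[OF XY Z N bA'[OF X Y Z] xy zZ] by (rule m.tlift(2)[OF X Y N bA[OF X Y Z zZ] xX yY])
    \<comment> \<open>The sums are evaluated from the inside out: the coaction of \<open>z\<close>
      becomes the half-braiding, those of \<open>y\<close> and \<open>x\<close> disappear by the
      counit law.\<close>
    also have "\<dots> = tsum ?N (coact X x) (\<lambda>h x\<^sub>0. counit H h \<odot>\<^bsub>?N\<^esub> (?w \<odot>\<^bsub>?N\<^esub> ?p x\<^sub>0 y (?hb z)))"
    proof (rule tsum_coact_homog_cong[OF X N 9(4,7) bilinI bilinI])
      fix h x\<^sub>0 assume h: "h \<in> gH a" and x0: "x\<^sub>0 \<in> gr X a"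
      note hc = gH_carrier[OF h] gr_carrier[OF x0]
      have "tsum ?N (coact Y y) (\<lambda>k y\<^sub>0. tsum ?N (coact Z z) (\<lambda>l z\<^sub>0. \<Omega> h k l \<odot>\<^bsub>?N\<^esub> ?p x\<^sub>0 y\<^sub>0 z\<^sub>0))
          = tsum ?N (coact Y y) (\<lambda>k y\<^sub>0. counit H k \<odot>\<^bsub>?N\<^esub> (counit H h \<odot>\<^bsub>?N\<^esub> (?w \<odot>\<^bsub>?N\<^esub> ?p x\<^sub>0 y\<^sub>0 (?hb z))))"
      proof (rule tsum_coact_homog_cong[OF Y N 9(5,8) bilinI bilinI])
        fix k y\<^sub>0 assume k: "k \<in> gH b" and y0: "y\<^sub>0 \<in> gr Y b"
        note kc = gH_carrier[OF k] gr_carrier[OF y0]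
        have "tsum ?N (coact Z z) (\<lambda>l z\<^sub>0. \<Omega> h k l \<odot>\<^bsub>?N\<^esub> ?p x\<^sub>0 y\<^sub>0 z\<^sub>0)
            = tsum ?N (coact Z z) (\<lambda>l z\<^sub>0. \<gamma> (\<Lambda> a b) l \<odot>\<^bsub>?N\<^esub> (counit H k \<odot>\<^bsub>?N\<^esub> (counit H h \<odot>\<^bsub>?N\<^esub> (?w \<odot>\<^bsub>?N\<^esub> ?p x\<^sub>0 y\<^sub>0 z\<^sub>0))))"
        proof (rule tsum_coact_homog_cong[OF Z N 9(6,9) bilinI bilinI])
          fix l z\<^sub>0 assume l: "l \<in> gH c" and z0: "z\<^sub>0 \<in> gr Z c"
          show "\<Omega> h k l \<odot>\<^bsub>?N\<^esub> ?p x\<^sub>0 y\<^sub>0 z\<^sub>0 = \<gamma> (\<Lambda> a b) l \<odot>\<^bsub>?N\<^esub> (counit H k \<odot>\<^bsub>?N\<^esub> (counit H h \<odot>\<^bsub>?N\<^esub> (?w \<odot>\<^bsub>?N\<^esub> ?p x\<^sub>0 y\<^sub>0 z\<^sub>0)))"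
            unfolding Omega_homog(1)[OF 9(4-6) h k l] vs_smult_smult[OF N pc[OF hc(2) kc(2) gr_carrier[OF z0]]]
            by (simp only: mult_ac)
        qed (rule st hc kc | assumption)+
        also have "\<dots> = counit H k \<odot>\<^bsub>?N\<^esub> (counit H h \<odot>\<^bsub>?N\<^esub> (?w \<odot>\<^bsub>?N\<^esub> ?p x\<^sub>0 y\<^sub>0 (?hb z)))"
          by (rule tsum_half_braid[OF Z N zZ lg]) (rule st hc kc | assumption)+
        finally show "tsum ?N (coact Z z) (\<lambda>l z\<^sub>0. \<Omega> h k l \<odot>\<^bsub>?N\<^esub> ?p x\<^sub>0 y\<^sub>0 z\<^sub>0)
            = counit H k \<odot>\<^bsub>?N\<^esub> (counit H h \<odot>\<^bsub>?N\<^esub> (?w \<odot>\<^bsub>?N\<^esub> ?p x\<^sub>0 y\<^sub>0 (?hb z)))" .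
      qed (rule st hc zZ hz | assumption)+
      also have "\<dots> = counit H h \<odot>\<^bsub>?N\<^esub> (?w \<odot>\<^bsub>?N\<^esub> ?p x\<^sub>0 y (?hb z))"
        by (rule coact_counit[OF Y N yY]) (rule st hc hz | assumption)+
      finally show "tsum ?N (coact Y y) (\<lambda>k y\<^sub>0. tsum ?N (coact Z z) (\<lambda>l z\<^sub>0. \<Omega> h k l \<odot>\<^bsub>?N\<^esub> ?p x\<^sub>0 y\<^sub>0 z\<^sub>0))
          = counit H h \<odot>\<^bsub>?N\<^esub> (?w \<odot>\<^bsub>?N\<^esub> ?p x\<^sub>0 y (?hb z))" .
    qed (rule st yY zZ hz | assumption)+
    also have "\<dots> = ?w \<odot>\<^bsub>?N\<^esub> ?p x y (?hb z)"
      by (rule coact_counit[OF X N xX]) (rule st yY hz | assumption)+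
    finally show ?case .
  next
    case (10 X) show ?case unfolding LR by (rule resc)
  next
    case (11 X)
    show ?case unfolding LR resl[OF vT[OF m.U 11]] lu_def[abs_def] by (rule m.tlift(1)[OF m.U 11 comodule_vspace[OF 11] bL[OF 11]])
  next
    case (12 X u a x)
    note xX = gr_carrier[OF 12(4)]
    show ?case unfolding LR restrict_apply if_P[OF m.pr_closed[OF 12(2) xX m.U 12(1)]] lu_def
      by (rule m.tlift(2)[OF m.U 12(1) comodule_vspace[OF 12(1)] bL[OF 12(1)] 12(2) xX])
  next
    case (13 X) show ?case unfolding LR by (rule resc)
  next
    case (14 X)
    show ?case unfolding LR resl[OF vT[OF 14 m.U]] ru_def[abs_def] by (rule m.tlift(1)[OF 14 m.U comodule_vspace[OF 14] bR[OF 14]])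
  next
    case (15 X u a x)
    note xX = gr_carrier[OF 15(4)]
    show ?case unfolding LR restrict_apply if_P[OF m.pr_closed[OF xX 15(2) 15(1) m.U]] ru_def
      by (rule m.tlift(2)[OF 15(1) m.U comodule_vspace[OF 15(1)] bR[OF 15(1)] xX 15(2)])
  qed
qed

end

section \<open>The zested category\<close>

context coalg_struct
begin

section \<open>The regular comodule\<close>

abbreviation R :: "('k, 'h, 'a) ucomod" where "R \<equiv> regular_comod H"

lemma regular_simps:
  "carrier R = Elem ` carrier H" "\<zero>\<^bsub>R\<^esub> = Elem \<zero>\<^bsub>H\<^esub>"
  "u \<oplus>\<^bsub>R\<^esub> v = Elem (unelem u \<oplus>\<^bsub>H\<^esub> unelem v)" "c \<odot>\<^bsub>R\<^esub> u = Elem (c \<odot>\<^bsub>H\<^esub> unelem u)"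
  by (simp_all add: regular_comod_def Let_def mk_vspace_def)

lemma vspace_regular: "vspace R"
proof (rule vspaceI)
  interpret H: module base H by (rule vsH)
  show "abelian_group R"
  proof (rule abelian_groupI)
    fix u assume u: "u \<in> carrier R"
    then show "\<exists>v\<in>carrier R. v \<oplus>\<^bsub>R\<^esub> u = \<zero>\<^bsub>R\<^esub>"
      by (intro bexI[of _ "Elem (\<ominus>\<^bsub>H\<^esub> unelem u)"]) (auto simp: regular_simps H.M.l_neg)
  qed (auto simp: regular_simps H.M.add.m_ac)
qed (auto simp: regular_simps vs_add_smult vs_smult_add vs_smult_smult)

lemma lin_Elem: "lin H R Elem" and lin_unelem: "lin R H unelem"
  by (auto intro!: linI simp: regular_simps)

lemma coact_regular:
  fixes u :: "('k, 'h, 'a) univ"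
  shows "coact R u = tmap H R (\<lambda>h. h) Elem (comult H (unelem u))"
proof -
  let ?S = "regular_comod H :: ('k, 'h, 'a) ucomod"
  let ?R = "mk_vspace (Elem ` carrier H) (Elem \<zero>\<^bsub>H\<^esub>)
       (\<lambda>u v. Elem (unelem u \<oplus>\<^bsub>H\<^esub> unelem v)) (\<lambda>c u. Elem (c \<odot>\<^bsub>H\<^esub> unelem u))
       :: ('k, ('k, 'h, 'a) univ) module"
  have "tensor H ?R = tensor H ?S" "pure H ?R = pure H ?S"
    by (rule tensor_transfer; simp add: regular_comod_def Let_def)+
  then have "tmap H ?R (\<lambda>h. h) Elem t = tmap H ?S (\<lambda>h. h) Elem t" for t :: "('h \<times> 'h) list set" by (simp add: tmap_def)
  moreover have "coact ?S u = tmap H ?R (\<lambda>h. h) Elem (comult H (unelem u))" by (simp add: regular_comod_def Let_def)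
  ultimately show ?thesis by simp
qed

lemma precomod_regular: "precomod R"
proof -
  have "lin R (tensor H R) (\<lambda>u. tmap H R (\<lambda>h. h) Elem (comult H (unelem u)))"
    by (rule lin_comp[OF lin_tmap[OF lin_id lin_Elem vsH vsH vsH vspace_regular]], rule lin_comult'[OF lin_unelem])
  then show ?thesis by (simp add: precomod_def vspace_regular coact_regular[abs_def])
qed

lemma coact_regular_grouplike:
  assumes "s \<in> carrier H" "comult H s = pure H H s s"
  shows "coact R (Elem s) = pure H R s (Elem s)"
  using tmap_pure[OF lin_id lin_Elem vsH vsH vsH vspace_regular assms(1,1)] by (simp add: coact_regular assms(2))

end

context bialg_struct
begin

lemma bilin_comod_tensor_right [simp]: "bilin M (comod_tensor H X Y) N f = bilin M (utensor X Y) N f"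
  by (simp add: bilin_def)

lemma tsum_comod_tensor_coact:
  fixes X Y :: "('k, 'h, 'a) ucomod"
  assumes X: "precomod X" and Y: "precomod Y" and N: "vspace N" and f: "bilin H (utensor X Y) N f"
    and x: "x \<in> carrier X" and y: "y \<in> carrier Y"
  shows "tsum N (coact (comod_tensor H X Y) (upure X Y x y)) f
    = tsum N (coact X x) (\<lambda>h x\<^sub>0. tsum N (coact Y y) (\<lambda>k y\<^sub>0. f (h \<otimes>\<^bsub>H\<^esub> k) (upure X Y x\<^sub>0 y\<^sub>0)))"
proof -
  let ?T = "utensor X Y"
  let ?N = "tensor H ?T"
  note vX = precomod_vspace[OF X] and vY = precomod_vspace[OF Y]
  note vT = vspace_utensor[OF vX vY]
  have vN: "vspace ?N" by (rule linr vT)+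
  note L = lin_tsum[OF vsH vT N f] and cx = precomod_closed[OF x X] and cy = precomod_closed[OF y Y]
  have "tsum N (coact (comod_tensor H X Y) (upure X Y x y)) f
      = tsum N (coact X x) (\<lambda>h x\<^sub>0. tsum N (tsum ?N (coact Y y) (\<lambda>k y\<^sub>0. pure H ?T (h \<otimes>\<^bsub>H\<^esub> k) (upure X Y x\<^sub>0 y\<^sub>0))) f)"
    unfolding comod_tensor_coact(2)[OF X Y x y]
    by (rule tsum_image[OF vsH vX vN N L cx]) (rule tsum_closed[OF vsH vY vN cy] linr vX vY vT | assumption)+
  also have "\<dots> = tsum N (coact X x) (\<lambda>h x\<^sub>0. tsum N (coact Y y) (\<lambda>k y\<^sub>0. tsum N (pure H ?T (h \<otimes>\<^bsub>H\<^esub> k) (upure X Y x\<^sub>0 y\<^sub>0)) f))"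
    by (rule tsum_cong[OF vsH vX cx], rule tsum_image[OF vsH vY vN N L cy]) (rule linr vX vY vT | assumption)+
  also have "\<dots> = tsum N (coact X x) (\<lambda>h x\<^sub>0. tsum N (coact Y y) (\<lambda>k y\<^sub>0. f (h \<otimes>\<^bsub>H\<^esub> k) (upure X Y x\<^sub>0 y\<^sub>0)))"
    by (rule tsum_cong[OF vsH vX cx], rule tsum_cong[OF vsH vY cy], rule tsum_pure[OF vsH vT N f]) (rule linr vX vY | assumption)+
  finally show ?thesis .
qed

lemma precomod_comod_tensor:
  fixes X Y :: "('k, 'h, 'a) ucomod"
  shows "precomod X \<Longrightarrow> precomod Y \<Longrightarrow> precomod (comod_tensor H X Y)"
  using comod_tensor_coact(1)[of X Y] vspace_comod_tensor[OF precomod_vspace precomod_vspace, of X Y] by (simp add: precomod_def)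

end

context zesting
begin

section \<open>The zested tensor product as a subspace of X \<otimes> Y \<otimes> H\<close>

definition ambient :: "('k, 'h, 'a) ucomod \<Rightarrow> ('k, 'h, 'a) ucomod \<Rightarrow> ('k, 'h, 'a) ucomod" where
  "ambient X Y = comod_tensor H (comod_tensor H X Y) R"

text \<open>The third factor depends on the degrees of \<open>x\<close> and \<open>y\<close>, so the
  generators are glued over degrees into one bilinear map; this is the \<open>pr\<close> of the
  model.\<close>

definition zpr :: "('k, 'h, 'a) ucomod \<Rightarrow> ('k, 'h, 'a) ucomod \<Rightarrow> ('k, 'h, 'a) univ \<Rightarrow> ('k, 'h, 'a) univ \<Rightarrow> ('k, 'h, 'a) univ" where
  "zpr X Y x y = gsum (ambient X Y) X (\<lambda>a x. gsum (ambient X Y) Y (\<lambda>b y. zpure H X Y x y (\<Lambda> a b)) y) x"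

text \<open>Applies the counit to the third factor, which discards \<Lambda>(a,b) because
  group-likes have counit 1.\<close>

definition zdc :: "('k, 'h, 'a) ucomod \<Rightarrow> ('k, 'h, 'a) ucomod \<Rightarrow> ('k, 'h, 'a) univ \<Rightarrow> (('k, 'h, 'a) univ \<times> ('k, 'h, 'a) univ) list set" where
  "zdc X Y u = tsum (tensor X Y) (udec (comod_tensor H X Y) R u) (\<lambda>v r. counit H (unelem r) \<odot>\<^bsub>tensor X Y\<^esub> udec X Y v)"

definition zcar :: "('k, 'h, 'a) ucomod \<Rightarrow> ('k, 'h, 'a) ucomod \<Rightarrow> ('k, 'h, 'a) univ set" where
  "zcar X Y = lspan (ambient X Y) {zpure H X Y x y (\<Lambda> a b) | x y a b.
       a \<in> carrier G \<and> b \<in> carrier G \<and> x \<in> gr X a \<and> y \<in> gr Y b}"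

abbreviation zV :: "('k, 'h, 'a) ucomod \<Rightarrow> ('k, 'h, 'a) ucomod \<Rightarrow> ('k, 'h, 'a) ucomod" where
  "zV X Y \<equiv> (ambient X Y)\<lparr>carrier := zcar X Y\<rparr>"

abbreviation zT :: "('k, 'h, 'a) ucomod \<Rightarrow> ('k, 'h, 'a) ucomod \<Rightarrow> ('k, 'h, 'a) ucomod" where
  "zT \<equiv> zested_tensor H G \<pi> \<Lambda>"

lemma zT_eq: "zT X Y = mk_comod (zV X Y) (\<lambda>u. THE t. t \<in> carrier (tensor H (zV X Y)) \<and> tmap H (ambient X Y) (\<lambda>h. h) (\<lambda>x. x) t = coact (ambient X Y) u)"
  by (simp add: zested_tensor_def subcomod_def ambient_def zcar_def Let_def)

lemma sub_lin:
  assumes "S \<subseteq> carrier W"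
  shows "lin W N f \<Longrightarrow> lin (W\<lparr>carrier := S\<rparr>) N f"
    and "lin M W g \<Longrightarrow> (\<And>x. x \<in> carrier M \<Longrightarrow> g x \<in> S) \<Longrightarrow> lin M (W\<lparr>carrier := S\<rparr>) g"
    and "lin M (W\<lparr>carrier := S\<rparr>) g \<Longrightarrow> lin M W g"
  using assms by (auto simp: lin_def Pi_iff subset_iff)

lemma tsum_sub: "tsum (W\<lparr>carrier := S\<rparr>) t f = tsum W t f"
  by (simp add: tsum_def)

context
  fixes X Y :: "('k, 'h, 'a) ucomod"
  assumes X: "comodule H X" and Y: "comodule H Y"
begin

abbreviation W :: "('k, 'h, 'a) ucomod" where "W \<equiv> ambient X Y"
abbreviation P :: "('k, 'h, 'a) ucomod" where "P \<equiv> comod_tensor H X Y"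

lemma vX: "vspace X" and vY: "vspace Y" and vXY: "vspace (tensor X Y)" and vU: "vspace (utensor X Y)"
  and vP: "vspace P" and vR: "vspace R" and vW: "vspace W"
proof -
  show "vspace X" "vspace Y" by (rule comodule_vspace X Y)+
  then show "vspace (tensor X Y)" "vspace (utensor X Y)" "vspace P" by (rule vspace_tensor vspace_utensor vspace_comod_tensor; assumption)+
  show "vspace R" by (rule vspace_regular)
  then show "vspace W" unfolding ambient_def using \<open>vspace P\<close> by (rule vspace_comod_tensor[rotated])
qed

lemma pP: "precomod P" and pW: "precomod W"
proof -
  show "precomod P" by (rule precomod_comod_tensor comodule_precomod X Y)+
  then show "precomod W" unfolding ambient_def by (rule precomod_comod_tensor[OF _ precomod_regular])
qed

lemma lin_zpure:
  "lin M X F \<Longrightarrow> y \<in> carrier Y \<Longrightarrow> s \<in> carrier H \<Longrightarrow> lin M W (\<lambda>x. zpure H X Y (F x) y s)"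
  "lin M Y F' \<Longrightarrow> x \<in> carrier X \<Longrightarrow> s \<in> carrier H \<Longrightarrow> lin M W (\<lambda>y. zpure H X Y x (F' y) s)"
proof -
  have E: "Elem s \<in> carrier R" if "s \<in> carrier H" for s using that by (simp add: regular_simps)
  show "lin M X F \<Longrightarrow> y \<in> carrier Y \<Longrightarrow> s \<in> carrier H \<Longrightarrow> lin M W (\<lambda>x. zpure H X Y (F x) y s)"
    unfolding zpure_def ambient_def lin_comod_tensor(2)
    by (rule lin_upure_left[OF _ vP vR E], unfold lin_comod_tensor(2), rule lin_upure_left[OF _ vX vY]) assumption+
  show "lin M Y F' \<Longrightarrow> x \<in> carrier X \<Longrightarrow> s \<in> carrier H \<Longrightarrow> lin M W (\<lambda>y. zpure H X Y x (F' y) s)"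
    unfolding zpure_def ambient_def lin_comod_tensor(2)
    by (rule lin_upure_left[OF _ vP vR E], unfold lin_comod_tensor(2), rule lin_upure_right[OF _ vX vY]) assumption+
qed

lemma zpure_closed: "x \<in> carrier X \<Longrightarrow> y \<in> carrier Y \<Longrightarrow> s \<in> carrier H \<Longrightarrow> zpure H X Y x y s \<in> carrier W"
  by (rule lin_closed[OF lin_zpure(1)[OF lin_id]])

lemma bilin_zpr: "bilin X Y W (zpr X Y)"
  unfolding zpr_def[abs_def]
  by (rule bilinI) (rule lin_zpure linr Lambda_H X Y vW vX vY | assumption)+

lemma zpr_homog:
  assumes a: "a \<in> carrier G" and b: "b \<in> carrier G" and x: "x \<in> gr X a" and y: "y \<in> gr Y b"
  shows "zpr X Y x y = zpure H X Y x y (\<Lambda> a b)"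
proof -
  note xX = gr_carrier[OF x] and yY = gr_carrier[OF y]
  have "zpr X Y x y = gsum W Y (\<lambda>b y. zpure H X Y x y (\<Lambda> a b)) y"
    unfolding zpr_def by (rule gsum_homog[OF X vW a x]) (rule lin_zpure linr Lambda_H X Y vW vX yY | assumption)+
  also have "\<dots> = zpure H X Y x y (\<Lambda> a b)"
    by (rule gsum_homog[OF Y vW b y]) (rule lin_zpure linr Lambda_H a xX | assumption)+
  finally show ?thesis .
qed

lemma bilin_zdc_aux: "bilin P R (tensor X Y) (\<lambda>v r. counit H (unelem r) \<odot>\<^bsub>tensor X Y\<^esub> udec X Y v)"
proof (rule bilinI)
  fix r assume "r \<in> carrier R"
  then show "lin P (tensor X Y) (\<lambda>v. counit H (unelem r) \<odot>\<^bsub>tensor X Y\<^esub> udec X Y v)"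
    by (intro lin_scale[OF vXY]) (simp add: lin_udec[OF vX vY])
next
  fix v assume "v \<in> carrier P"
  then show "lin R (tensor X Y) (\<lambda>r. counit H (unelem r) \<odot>\<^bsub>tensor X Y\<^esub> udec X Y v)"
    by (intro lin_scalar[OF vXY lin_counit'[OF lin_unelem]]) (simp add: udec_closed[OF vX vY])
qed

lemma zdc_lin: "lin W (tensor X Y) (zdc X Y)"
  unfolding zdc_def[abs_def] ambient_def lin_comod_tensor(1)
  by (rule lin_comp[OF lin_tsum[OF vP vR vXY bilin_zdc_aux] lin_udec[OF vP vR]])

lemma zdc_zpure:
  assumes "x \<in> carrier X" "y \<in> carrier Y" "s \<in> carrier H"
  shows "zdc X Y (zpure H X Y x y s) = counit H s \<odot>\<^bsub>tensor X Y\<^esub> pure X Y x y"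
proof -
  have u: "upure X Y x y \<in> carrier P" using upure_closed[OF assms(1,2) vX vY] by simp
  have r: "Elem s \<in> carrier R" using assms(3) by (simp add: regular_simps)
  show ?thesis
    unfolding zdc_def zpure_def udec_upure[OF vP vR u r] tsum_pure[OF vP vR vXY bilin_zdc_aux u r] udec_upure[OF vX vY assms(1,2)] by simp
qed

lemma zdc_zpr:
  assumes x: "x \<in> carrier X" and y: "y \<in> carrier Y"
  shows "zdc X Y (zpr X Y x y) = pure X Y x y"
proof (rule bilin_homog_ext[OF X Y vXY _ bilin_pure[OF vX vY] x y])
  show "bilin X Y (tensor X Y) (\<lambda>x y. zdc X Y (zpr X Y x y))"
    by (rule bilinI) (rule lin_comp[OF zdc_lin] bilin_left[OF bilin_zpr] bilin_right[OF bilin_zpr] | assumption)+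
  fix a b x y assume *: "a \<in> carrier G" "b \<in> carrier G" "x \<in> gr X a" "y \<in> gr Y b"
  show "zdc X Y (zpr X Y x y) = pure X Y x y"
    unfolding zpr_homog[OF *] zdc_zpure[OF gr_carrier[OF *(3)] gr_carrier[OF *(4)] Lambda_H[OF *(1,2)]]
    using pure_closed[OF vX vY gr_carrier[OF *(3)] gr_carrier[OF *(4)]] vXY by (simp add: Gamma_counit[OF Lambda_closed[OF *(1,2)]])
qed

text \<open>The linear section of \<open>zdc X Y\<close> induced by \<open>zpr\<close>, an embedding
  of X \<otimes> Y into X \<otimes> Y \<otimes> H.\<close>

definition zkap :: "(('k, 'h, 'a) univ \<times> ('k, 'h, 'a) univ) list set \<Rightarrow> ('k, 'h, 'a) univ" where
  "zkap t = tsum W t (zpr X Y)"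

lemma zkap_lin: "lin (tensor X Y) W zkap"
  unfolding zkap_def[abs_def] by (rule lin_tsum[OF vX vY vW bilin_zpr])

lemma zkap_pure: "x \<in> carrier X \<Longrightarrow> y \<in> carrier Y \<Longrightarrow> zkap (pure X Y x y) = zpr X Y x y"
  unfolding zkap_def by (rule tsum_pure[OF vX vY vW bilin_zpr])

lemma zdc_zkap: "t \<in> carrier (tensor X Y) \<Longrightarrow> zdc X Y (zkap t) = t"
  by (rule tensor_ext[OF vX vY vXY lin_comp[OF zdc_lin zkap_lin] lin_id]) (simp_all add: zkap_pure zdc_zpr)

text \<open>The span of the homogeneous generators is the image of the section \<open>zkap\<close> of \<open>zdc X Y\<close>; in
  particular it is a direct summand, which makes the coaction of the subcomodule well defined.\<close>

lemma zcar_eq: "zcar X Y = zkap ` carrier (tensor X Y)"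
proof
  interpret W: module base W by (rule vW)
  let ?S = "zkap ` carrier (tensor X Y)"
  let ?B = "{zpure H X Y x y (\<Lambda> a b) | x y a b. a \<in> carrier G \<and> b \<in> carrier G \<and> x \<in> gr X a \<and> y \<in> gr Y b}"
  have neg: "\<ominus>\<^bsub>W\<^esub> w = (-1) \<odot>\<^bsub>W\<^esub> w" if w: "w \<in> carrier W" for w
  proof -
    have "(-1) \<odot>\<^bsub>W\<^esub> w \<oplus>\<^bsub>W\<^esub> 1 \<odot>\<^bsub>W\<^esub> w = \<zero>\<^bsub>W\<^esub>" using vs_add_smult[OF vW w, of "-1" 1] vs_zero_smult[OF vW w] by simp
    then show ?thesis using W.M.minus_equality[of "(-1) \<odot>\<^bsub>W\<^esub> w" w] vs_smult[OF vW w] vs_one[OF vW w] w by simp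
  qed
  have sub: "submodule ?S base W"
  proof (rule W.submoduleI)
    show "?S \<subseteq> carrier W" using lin_closed[OF zkap_lin] by auto
    show "\<zero>\<^bsub>W\<^esub> \<in> ?S" using lin_zero[OF vXY vW zkap_lin] vs_zero[OF vXY] by (metis imageI)
    have sm: "c \<odot>\<^bsub>W\<^esub> w \<in> ?S" if "w \<in> ?S" for c w
      using that lin_smult[OF zkap_lin, symmetric] vs_smult[OF vXY] by auto
    then show "c \<odot>\<^bsub>W\<^esub> w \<in> ?S" if "w \<in> ?S" for c w using that .
    show "v \<oplus>\<^bsub>W\<^esub> w \<in> ?S" if "v \<in> ?S" "w \<in> ?S" for v w
      using that lin_add[OF zkap_lin, symmetric] vs_add[OF vXY] by auto
    show "\<ominus>\<^bsub>W\<^esub> w \<in> ?S" if "w \<in> ?S" for w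
      using neg[of w] sm[OF that, of "-1"] that lin_closed[OF zkap_lin] by auto
  qed
  have "?B \<subseteq> ?S"
  proof
    fix w assume "w \<in> ?B"
    then obtain x y a b where *: "a \<in> carrier G" "b \<in> carrier G" "x \<in> gr X a" "y \<in> gr Y b" and w: "w = zpure H X Y x y (\<Lambda> a b)" by auto
    have "w = zkap (pure X Y x y)" using zkap_pure[OF gr_carrier[OF *(3)] gr_carrier[OF *(4)]] zpr_homog[OF *] w by simp
    then show "w \<in> ?S" using pure_closed[OF vX vY gr_carrier[OF *(3)] gr_carrier[OF *(4)]] by blast
  qed
  then show "zcar X Y \<subseteq> ?S" using sub unfolding zcar_def lspan_def by blast
  \<comment> \<open>The image must lie in every submodule \<open>S\<close> that contains the
    generators. As \<open>zpr\<close> is a glued sum in the ambient space, it is rebuilt as a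
    bilinear map \<open>g\<close> into \<open>S\<close>, which shows that its values lie
    there.\<close>
  show "?S \<subseteq> zcar X Y"
    unfolding zcar_def lspan_def
  proof (intro Inter_greatest)
    fix S assume "S \<in> {S. submodule S base W \<and> ?B \<subseteq> S}"
    then have S: "submodule S base W" and B: "?B \<subseteq> S" by auto
    let ?V = "W\<lparr>carrier := S\<rparr>"
    have SW: "S \<subseteq> carrier W" by (rule W.submoduleE(1)[OF S])
    have vV: "vspace ?V" by (rule submodule.submodule_is_module[OF S vW])
    \<comment> \<open>Projecting the arguments to degrees \<open>a\<close> and \<open>b\<close>
      makes the value a generator for all \<open>x\<close> and \<open>y\<close>, hence an element of
      \<open>S\<close>.\<close>
    let ?f = "\<lambda>a x b y. zpure H X Y (hom_part a X x) (hom_part b Y y) (\<Lambda> a b)"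
    have fS: "?f a x b y \<in> S" if "a \<in> carrier G" "b \<in> carrier G" "x \<in> carrier X" "y \<in> carrier Y" for a b x y
      using B that hom_part_gr[OF X _ that(3)] hom_part_gr[OF Y _ that(4)] by blast
    have l1: "lin X ?V (\<lambda>x. ?f a x b y)" if "a \<in> carrier G" "b \<in> carrier G" "y \<in> carrier Y" for a b y
      by (rule sub_lin(2)[OF SW lin_zpure(1)]) (rule half_braid_lin half_braid_closed X Y lin_pg that Lambda_H fS | assumption)+
    have l2: "lin Y ?V (\<lambda>y. ?f a x b y)" if "a \<in> carrier G" "b \<in> carrier G" "x \<in> carrier X" for a b x
      by (rule sub_lin(2)[OF SW lin_zpure(2)]) (rule half_braid_lin half_braid_closed X Y lin_pg that Lambda_H fS | assumption)+
    define g where "g x y = gsum ?V X (\<lambda>a x. gsum ?V Y (\<lambda>b y. ?f a x b y) y) x" for x y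
    have bg: "bilin X Y ?V g"
      unfolding g_def[abs_def] by (rule bilinI) (rule l1 l2 lin_gsum_param lin_gsum lin_id X Y vV vX vY | assumption)+
    have bgW: "bilin X Y W g" using bg sub_lin(3)[OF SW] by (auto simp: bilin_def)
    have gz: "g x y = zpr X Y x y" if x: "x \<in> carrier X" and y: "y \<in> carrier Y" for x y
    proof (rule bilin_homog_ext[OF X Y vW bgW bilin_zpr x y])
      fix a b x y assume *: "a \<in> carrier G" "b \<in> carrier G" "x \<in> gr X a" "y \<in> gr Y b"
      note xX = gr_carrier[OF *(3)] and yY = gr_carrier[OF *(4)]
      have "g x y = gsum ?V Y (\<lambda>b y. ?f a x b y) y"
        unfolding g_def by (rule gsum_homog[OF X vV *(1,3)]) (rule l1 lin_gsum_param X Y vV vX yY | assumption)+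
      also have "\<dots> = ?f a x b y" by (rule gsum_homog[OF Y vV *(2,4)]) (rule l2 * xX | assumption)+
      also have "\<dots> = zpr X Y x y"
        using *(3,4) zpr_homog[OF *] unfolding gr_iff[OF X *(1)] gr_iff[OF Y *(2)] by simp
      finally show "g x y = zpr X Y x y" .
    qed
    show "?S \<subseteq> S"
    proof
      fix w assume "w \<in> ?S"
      then obtain t where t: "t \<in> carrier (tensor X Y)" and w: "w = zkap t" by auto
      have "w = tsum ?V t g" unfolding w zkap_def tsum_sub by (rule tsum_cong[OF vX vY t gz[symmetric]])
      moreover have "tsum ?V t g \<in> carrier ?V" by (rule tsum_closed[OF vX vY vV t bilin_closed[OF bg]])
      ultimately show "w \<in> S" by simp
    qed
  qed
qed

abbreviation V :: "('k, 'h, 'a) ucomod" where "V \<equiv> zV X Y"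

lemma zcar_sub: "zcar X Y \<subseteq> carrier W"
  unfolding zcar_eq using lin_closed[OF zkap_lin] by auto

lemma lin_VI: "lin M W g \<Longrightarrow> (\<And>x. x \<in> carrier M \<Longrightarrow> g x \<in> zcar X Y) \<Longrightarrow> lin M V g"
  by (rule sub_lin(2)[OF zcar_sub])

lemma lin_zkap_V: "lin (tensor X Y) V zkap"
  by (rule lin_VI[OF zkap_lin]) (simp add: zcar_eq)

lemma vV: "vspace V"
proof -
  have z: "\<zero>\<^bsub>W\<^esub> \<in> zcar X Y" unfolding zcar_eq using lin_zero[OF vXY vW zkap_lin] vs_zero[OF vXY] by (metis imageI)
  have add: "u \<oplus>\<^bsub>W\<^esub> v \<in> zcar X Y" if "u \<in> zcar X Y" "v \<in> zcar X Y" for u v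
    using that lin_add[OF zkap_lin, symmetric] vs_add[OF vXY] unfolding zcar_eq by auto
  have sm: "c \<odot>\<^bsub>W\<^esub> u \<in> zcar X Y" if "u \<in> zcar X Y" for c u
    using that lin_smult[OF zkap_lin, symmetric] vs_smult[OF vXY] unfolding zcar_eq by auto
  note S = subsetD[OF zcar_sub]
  interpret W: module base W by (rule vW)
  have "abelian_group V"
  proof (rule abelian_groupI)
    fix u assume "u \<in> carrier V"
    then have u: "u \<in> zcar X Y" by simp
    have "(-1) \<odot>\<^bsub>W\<^esub> u \<oplus>\<^bsub>W\<^esub> u = \<zero>\<^bsub>W\<^esub>"
      using vs_add_smult[OF vW S[OF u], of "-1" 1] vs_zero_smult[OF vW S[OF u]] vs_one[OF vW S[OF u]] by simp
    then show "\<exists>v\<in>carrier V. v \<oplus>\<^bsub>V\<^esub> u = \<zero>\<^bsub>V\<^esub>" using sm[OF u, of "-1"] by auto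
  qed (simp_all add: z add S W.M.add.m_ac)
  then show ?thesis
    by (rule vspaceI) (simp_all add: sm S vs_add_smult[OF vW] vs_smult_add[OF vW] vs_smult_smult[OF vW] vs_one[OF vW])
qed

lemma zkap_zdc: "u \<in> zcar X Y \<Longrightarrow> zkap (zdc X Y u) = u"
  unfolding zcar_eq by (auto simp: zdc_zkap)

text \<open>A linear retraction of X \<otimes> Y \<otimes> H onto the span, which it fixes pointwise
  by \<open>zkap_zdc\<close>.\<close>

abbreviation ret :: "('k, 'h, 'a) univ \<Rightarrow> ('k, 'h, 'a) univ" where "ret u \<equiv> zkap (zdc X Y u)"

lemma ret_lin: "lin W V ret"
  by (rule lin_comp[OF lin_zkap_V zdc_lin])

lemma ret_zpure: "x \<in> carrier X \<Longrightarrow> y \<in> carrier Y \<Longrightarrow> s \<in> \<Gamma> \<Longrightarrow> ret (zpure H X Y x y s) = zpr X Y x y"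
  using zdc_zpure[OF _ _ Gamma_closed, of x y s] pure_closed[OF vX vY, of x y] vXY by (simp add: Gamma_counit zkap_pure)

lemma bilin_W: "bilin H (utensor P R) N F = bilin H W N F"
  by (simp add: ambient_def)

text \<open>Since \<open>s\<close> is group-like, the third factor is left alone by the coaction and
  only multiplies the \<open>H\<close> component by \<open>s\<close>.\<close>

lemma tsum_coact_zpure:
  assumes x: "x \<in> carrier X" and y: "y \<in> carrier Y" and s: "s \<in> \<Gamma>" and N: "vspace N" and F: "bilin H W N F"
  shows "tsum N (coact W (zpure H X Y x y s)) F
    = tsum N (coact X x) (\<lambda>h x\<^sub>0. tsum N (coact Y y) (\<lambda>k y\<^sub>0. F (h \<otimes>\<^bsub>H\<^esub> k \<otimes>\<^bsub>H\<^esub> s) (zpure H X Y x\<^sub>0 y\<^sub>0 s)))"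
proof -
  note sH = Gamma_closed[OF s]
  have r: "Elem s \<in> carrier R" using sH by (simp add: regular_simps)
  have u: "upure X Y x y \<in> carrier P" using upure_closed[OF x y vX vY] by simp
  have F': "bilin H (utensor P R) N F" using F by (simp add: bilin_W)
  note pX = comodule_precomod[OF X] and pY = comodule_precomod[OF Y]
  note lF = lin_comp[OF bilin_left[OF F']] and rF = lin_comp[OF bilin_right[OF F']] and cF = bilin_closed[OF F']
  have "tsum N (coact W (zpure H X Y x y s)) F
      = tsum N (coact P (upure X Y x y)) (\<lambda>m v. tsum N (coact R (Elem s)) (\<lambda>k r. F (m \<otimes>\<^bsub>H\<^esub> k) (upure P R v r)))"
    unfolding ambient_def zpure_def by (rule tsum_comod_tensor_coact[OF pP precomod_regular N F' u r])
  also have "\<dots> = tsum N (coact P (upure X Y x y)) (\<lambda>m v. F (m \<otimes>\<^bsub>H\<^esub> s) (upure P R v (Elem s)))"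
    unfolding coact_regular_grouplike[OF sH Gamma_comult[OF s]]
    by (rule tsum_cong[OF vsH vP precomod_closed[OF u pP]], rule tsum_pure[OF vsH vR N bilinI sH r])
      (rule lF rF linr vP vR | assumption)+
  also have "\<dots> = tsum N (coact X x) (\<lambda>h x\<^sub>0. tsum N (coact Y y) (\<lambda>k y\<^sub>0. F (h \<otimes>\<^bsub>H\<^esub> k \<otimes>\<^bsub>H\<^esub> s) (upure P R (upure X Y x\<^sub>0 y\<^sub>0) (Elem s))))"
  proof (rule tsum_comod_tensor_coact[OF pX pY N _ x y])
    have "bilin H P N (\<lambda>m v. F (m \<otimes>\<^bsub>H\<^esub> s) (upure P R v (Elem s)))"
      by (rule bilinI) (rule lF rF linr vP vR sH r | assumption)+
    then show "bilin H (utensor X Y) N (\<lambda>m v. F (m \<otimes>\<^bsub>H\<^esub> s) (upure P R v (Elem s)))" by simp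
  qed
  finally show ?thesis by (simp add: zpure_def)
qed

text \<open>Candidate for the corestricted coaction: the retraction pushes the second leg of the
  ambient coaction into the span.\<close>

abbreviation coV :: "('k, 'h, 'a) univ \<Rightarrow> ('h \<times> ('k, 'h, 'a) univ) list set" where
  "coV u \<equiv> tmap H V (\<lambda>h. h) ret (coact W u)"

lemma cW: "u \<in> carrier W \<Longrightarrow> coact W u \<in> carrier (tensor H W)"
  by (rule precomod_closed[OF _ pW])

lemma coV_lin: "lin W (tensor H V) coV"
  by (rule lin_comp[OF lin_tmap[OF lin_id ret_lin vsH vW vsH vV] precomod_lin[OF lin_id pW]])

lemma coV_zpure:
  assumes x: "x \<in> carrier X" and y: "y \<in> carrier Y" and s: "s \<in> \<Gamma>"
  shows "coV (zpure H X Y x y s) = tsum (tensor H V) (coact X x) (\<lambda>h x\<^sub>0. tsum (tensor H V) (coact Y y) (\<lambda>k y\<^sub>0.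
    pure H V (h \<otimes>\<^bsub>H\<^esub> k \<otimes>\<^bsub>H\<^esub> s) (zpr X Y x\<^sub>0 y\<^sub>0)))"
proof -
  have vN: "vspace (tensor H V)" by (rule linr vV)+
  have "coV (zpure H X Y x y s) = tsum (tensor H V) (coact X x) (\<lambda>h x\<^sub>0. tsum (tensor H V) (coact Y y) (\<lambda>k y\<^sub>0.
      pure H V (h \<otimes>\<^bsub>H\<^esub> k \<otimes>\<^bsub>H\<^esub> s) (ret (zpure H X Y x\<^sub>0 y\<^sub>0 s))))"
    unfolding tmap_def by (rule tsum_coact_zpure[OF x y s vN bilinI]) (rule linr ret_lin vV lin_closed[OF ret_lin] | assumption)+
  also have "\<dots> = tsum (tensor H V) (coact X x) (\<lambda>h x\<^sub>0. tsum (tensor H V) (coact Y y) (\<lambda>k y\<^sub>0.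
      pure H V (h \<otimes>\<^bsub>H\<^esub> k \<otimes>\<^bsub>H\<^esub> s) (zpr X Y x\<^sub>0 y\<^sub>0)))"
    by (rule tsum_coact_cong[OF X x], rule tsum_coact_cong[OF Y y]) (simp add: ret_zpure s)
  finally show ?thesis .
qed

lemma V_W_id: "lin V W (\<lambda>x. x)"
  by (rule sub_lin(1)[OF zcar_sub lin_id])

lemma incl_lin: "lin (tensor H V) (tensor H W) (tmap H W (\<lambda>h. h) (\<lambda>x. x))"
  by (rule lin_tmap[OF lin_id V_W_id vsH vV vsH vW])

text \<open>The definite description asks for a unique preimage under the inclusion of the second
  factor. Existence: on homogeneous generators the coaction already takes values in the span, so the
  retraction changes nothing. Uniqueness: the retraction gives a left inverse of the
  inclusion.\<close>

lemma coact_zT: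
  assumes u: "u \<in> zcar X Y"
  shows "coact (zT X Y) u = coV u"
proof -
  have vN: "vspace (tensor H W)" by (rule linr vW)+
  have vNV: "vspace (tensor H V)" by (rule linr vV)+
  note lc = precomod_lin[OF _ pW]
  have uW: "u \<in> carrier W" using u zcar_sub by auto
  have 1: "tmap H W (\<lambda>h. h) (\<lambda>x. x) (coV (zkap t)) = coact W (zkap t)" if t: "t \<in> carrier (tensor X Y)" for t
  proof (rule tensor_ext[OF vX vY vN lin_comp[OF incl_lin lin_comp[OF coV_lin zkap_lin]] lc[OF zkap_lin] _ t])
    fix x y assume xy: "x \<in> carrier X" "y \<in> carrier Y"
    show "tmap H W (\<lambda>h. h) (\<lambda>x. x) (coV (zkap (pure X Y x y))) = coact W (zkap (pure X Y x y))"
      unfolding zkap_pure[OF xy]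
    proof (rule bilin_homog_ext[OF X Y vN _ _ xy, where f="\<lambda>x y. tmap H W (\<lambda>h. h) (\<lambda>x. x) (coV (zpr X Y x y))"])
      show "bilin X Y (tensor H W) (\<lambda>x y. tmap H W (\<lambda>h. h) (\<lambda>x. x) (coV (zpr X Y x y)))"
        by (rule bilinI) (rule lin_comp[OF incl_lin] lin_comp[OF coV_lin] bilin_left[OF bilin_zpr] bilin_right[OF bilin_zpr] | assumption)+
      show "bilin X Y (tensor H W) (\<lambda>x y. coact W (zpr X Y x y))"
        by (rule bilinI) (rule lc bilin_left[OF bilin_zpr] bilin_right[OF bilin_zpr] | assumption)+
      fix a b x y assume *: "a \<in> carrier G" "b \<in> carrier G" "x \<in> gr X a" "y \<in> gr Y b"
      let ?s = "\<Lambda> a b"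
      note xX = gr_carrier[OF *(3)] and yY = gr_carrier[OF *(4)] and sG = Lambda_closed[OF *(1,2)] and sH = Lambda_H[OF *(1,2)]
      let ?z = "zpure H X Y x y ?s"
      have z: "?z \<in> carrier W" by (rule zpure_closed[OF xX yY sH])
      have b2: "bilin H W (tensor H W) (\<lambda>m w. pure H W m (ret w))"
        by (rule bilinI) (rule linr vW sub_lin(3)[OF zcar_sub ret_lin] lin_closed[OF sub_lin(3)[OF zcar_sub ret_lin]] | assumption)+
      have "tmap H W (\<lambda>h. h) (\<lambda>x. x) (coV ?z) = tsum (tensor H W) (coact W ?z) (\<lambda>m w. pure H W m (ret w))"
        unfolding tmap_def[of H W]
        by (rule tsum_tmap[OF lin_id ret_lin vsH vW vsH vV vN _ cW[OF z]], rule bilinI) (rule linr vW V_W_id lin_closed[OF V_W_id] | assumption)+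
      also have "\<dots> = tsum (tensor H W) (coact X x) (\<lambda>h x\<^sub>0. tsum (tensor H W) (coact Y y) (\<lambda>k y\<^sub>0. pure H W (h \<otimes>\<^bsub>H\<^esub> k \<otimes>\<^bsub>H\<^esub> ?s) (ret (zpure H X Y x\<^sub>0 y\<^sub>0 ?s))))"
        by (rule tsum_coact_zpure[OF xX yY sG vN b2])
      also have "\<dots> = tsum (tensor H W) (coact X x) (\<lambda>h x\<^sub>0. tsum (tensor H W) (coact Y y) (\<lambda>k y\<^sub>0. pure H W (h \<otimes>\<^bsub>H\<^esub> k \<otimes>\<^bsub>H\<^esub> ?s) (zpr X Y x\<^sub>0 y\<^sub>0)))"
        by (rule tsum_coact_cong[OF X xX], rule tsum_coact_cong[OF Y yY]) (simp add: ret_zpure sG)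
      \<comment> \<open>Homogeneity of the components matters here: for them \<open>zpr\<close>
        returns the generator with the same group-like \<open>?s\<close>.\<close>
      also have "\<dots> = tsum (tensor H W) (coact X x) (\<lambda>h x\<^sub>0. tsum (tensor H W) (coact Y y) (\<lambda>k y\<^sub>0. pure H W (h \<otimes>\<^bsub>H\<^esub> k \<otimes>\<^bsub>H\<^esub> ?s) (zpure H X Y x\<^sub>0 y\<^sub>0 ?s)))"
      proof (rule tsum_coact_homog_cong[OF X vN *(1,3) bilinI bilinI])
        fix h x\<^sub>0 assume h: "h \<in> gH a" and x0: "x\<^sub>0 \<in> gr X a"
        note hc = gH_carrier[OF h] gr_carrier[OF x0]
        show "tsum (tensor H W) (coact Y y) (\<lambda>k y\<^sub>0. pure H W (h \<otimes>\<^bsub>H\<^esub> k \<otimes>\<^bsub>H\<^esub> ?s) (zpr X Y x\<^sub>0 y\<^sub>0))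
            = tsum (tensor H W) (coact Y y) (\<lambda>k y\<^sub>0. pure H W (h \<otimes>\<^bsub>H\<^esub> k \<otimes>\<^bsub>H\<^esub> ?s) (zpure H X Y x\<^sub>0 y\<^sub>0 ?s))"
          by (rule tsum_coact_homog_cong[OF Y vN *(2,4) bilinI bilinI])
            (rule lin_zpure zpure_closed bilin_closed[OF bilin_zpr] bilin_right[OF bilin_zpr] linr vW sH hc | assumption | simp add: zpr_homog[OF *(1,2) x0])+
      qed (rule lin_zpure zpure_closed bilin_closed[OF bilin_zpr] bilin_left[OF bilin_zpr] bilin_right[OF bilin_zpr] linr vW sH X Y yY | assumption)+
      also have "\<dots> = tsum (tensor H W) (coact W ?z) (pure H W)"
        by (rule tsum_coact_zpure[OF xX yY sG vN bilin_pure[OF vsH vW], symmetric])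
      also have "\<dots> = coact W ?z" by (rule tsum_pure_id[OF vsH vW cW[OF z]])
      finally show "tmap H W (\<lambda>h. h) (\<lambda>x. x) (coV (zpr X Y x y)) = coact W (zpr X Y x y)" unfolding zpr_homog[OF *] .
    qed
  qed
  have ex: "coV u \<in> carrier (tensor H V) \<and> tmap H W (\<lambda>h. h) (\<lambda>x. x) (coV u) = coact W u"
    using 1 u lin_closed[OF coV_lin uW] unfolding zcar_eq by auto
  have uniq: "t = coV u" if t: "t \<in> carrier (tensor H V)" and eq: "tmap H W (\<lambda>h. h) (\<lambda>x. x) t = coact W u" for t
  proof -
    have lr: "lin (tensor H W) (tensor H V) (tmap H V (\<lambda>h. h) ret)" by (rule lin_tmap[OF lin_id ret_lin vsH vW vsH vV])
    have "tmap H V (\<lambda>h. h) ret (tmap H W (\<lambda>h. h) (\<lambda>x. x) t) = t"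
    proof (rule tensor_ext[OF vsH vV vNV lin_comp[OF lr incl_lin] lin_id _ t])
      fix h v assume hv: "h \<in> carrier H" "v \<in> carrier V"
      have vW': "v \<in> carrier W" using hv(2) zcar_sub by auto
      show "tmap H V (\<lambda>h. h) ret (tmap H W (\<lambda>h. h) (\<lambda>x. x) (pure H V h v)) = pure H V h v"
        using hv by (simp add: tmap_pure[OF lin_id V_W_id vsH vV vsH vW hv] tmap_pure[OF lin_id ret_lin vsH vW vsH vV hv(1) vW'] zkap_zdc)
    qed
    then show ?thesis using eq by simp
  qed
  have "(THE t. t \<in> carrier (tensor H V) \<and> tmap H W (\<lambda>h. h) (\<lambda>x. x) t = coact W u) = coV u"
    by (rule the_equality, rule ex, erule conjE, rule uniq)
  then show ?thesis by (simp add: zT_eq)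
qed

lemma zT_simps:
  "carrier (zT X Y) = zcar X Y" "zero (zT X Y) = zero W" "add (zT X Y) = add W" "smult (zT X Y) = smult W"
  by (simp_all add: zT_eq)

lemma zT_transfer:
  "tensor H (zT X Y) = tensor H V" "pure H (zT X Y) = pure H V" "lin (zT X Y) N f = lin V N f" "lin M (zT X Y) g = lin M V g"
  "bilin M M' (zT X Y) k = bilin M M' V k" "tsum (zT X Y) t l = tsum W t l"
proof -
  show "tensor H (zT X Y) = tensor H V" "pure H (zT X Y) = pure H V" by (rule tensor_transfer; simp add: zT_simps)+
qed (simp_all add: lin_def bilin_def tsum_def zT_simps)

lemma zpr_zcar: "x \<in> carrier X \<Longrightarrow> y \<in> carrier Y \<Longrightarrow> zpr X Y x y \<in> zcar X Y"
  unfolding zcar_eq using zkap_pure[of x y] pure_closed[OF vX vY, of x y] by (metis imageI)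

text \<open>The assumptions of the abstract model. In the coaction law the factor \<Lambda>(a,b) of
  the diagonal coaction is absorbed into \<open>zmult\<close>, since the components of
  \<open>x\<close> and \<open>y\<close> keep the degrees a and b.\<close>

lemma zT_model:
  "vspace (zT X Y)" "lin (zT X Y) (tensor H (zT X Y)) (coact (zT X Y))" "bilin X Y (zT X Y) (zpr X Y)"
  "lin (zT X Y) (tensor X Y) (zdc X Y)"
  "x \<in> carrier X \<Longrightarrow> y \<in> carrier Y \<Longrightarrow> zdc X Y (zpr X Y x y) = pure X Y x y"
  "u \<in> carrier (zT X Y) \<Longrightarrow> tsum (zT X Y) (zdc X Y u) (zpr X Y) = u"
  "x \<in> carrier X \<Longrightarrow> y \<in> carrier Y \<Longrightarrow> coact (zT X Y) (zpr X Y x y) = tsum (tensor H (zT X Y)) (coact X x) (\<lambda>h x\<^sub>0.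
            tsum (tensor H (zT X Y)) (coact Y y) (\<lambda>k y\<^sub>0. pure H (zT X Y) (zmult h k) (zpr X Y x\<^sub>0 y\<^sub>0)))"
proof -
  show "vspace (zT X Y)" by (rule vspace_transfer[OF vV]) (simp_all add: zT_simps)
  show "lin (zT X Y) (tensor H (zT X Y)) (coact (zT X Y))"
    unfolding zT_transfer
    by (subst lin_cong[OF vV, where g=coV]) (simp_all add: coact_zT sub_lin(1)[OF zcar_sub coV_lin])
  show b: "bilin X Y (zT X Y) (zpr X Y)"
    unfolding zT_transfer
    by (rule bilinI; rule lin_VI) (rule bilin_left[OF bilin_zpr] bilin_right[OF bilin_zpr] zpr_zcar | assumption)+
  show "lin (zT X Y) (tensor X Y) (zdc X Y)" unfolding zT_transfer by (rule sub_lin(1)[OF zcar_sub zdc_lin])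
  show "zdc X Y (zpr X Y x y) = pure X Y x y" if "x \<in> carrier X" "y \<in> carrier Y" using that by (rule zdc_zpr)
  show "tsum (zT X Y) (zdc X Y u) (zpr X Y) = u" if "u \<in> carrier (zT X Y)"
    using that zkap_zdc[of u] by (simp add: zT_transfer zT_simps zkap_def)
  note bV = b[unfolded zT_transfer]
  have vN: "vspace (tensor H V)" by (rule linr vV)+
  show "coact (zT X Y) (zpr X Y x y) = tsum (tensor H (zT X Y)) (coact X x) (\<lambda>h x\<^sub>0.
            tsum (tensor H (zT X Y)) (coact Y y) (\<lambda>k y\<^sub>0. pure H (zT X Y) (zmult h k) (zpr X Y x\<^sub>0 y\<^sub>0)))"
    if xy: "x \<in> carrier X" "y \<in> carrier Y"
    unfolding zT_transfer coact_zT[OF zpr_zcar[OF xy]]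
  proof (rule bilin_homog_ext[OF X Y vN _ _ xy, where f="\<lambda>x y. coV (zpr X Y x y)"])
    show "bilin X Y (tensor H V) (\<lambda>x y. coV (zpr X Y x y))"
      by (rule bilinI) (rule lin_comp[OF coV_lin] bilin_left[OF bilin_zpr] bilin_right[OF bilin_zpr] | assumption)+
    note st = bilin_left[OF bV] bilin_right[OF bV] bilin_closed[OF bV] linr vV X Y
    show "bilin X Y (tensor H V) (\<lambda>x y. tsum (tensor H V) (coact X x) (\<lambda>h x\<^sub>0. tsum (tensor H V) (coact Y y) (\<lambda>k y\<^sub>0. pure H V (zmult h k) (zpr X Y x\<^sub>0 y\<^sub>0))))"
      by (rule bilinI) (rule st | assumption)+
    fix a b x y assume *: "a \<in> carrier G" "b \<in> carrier G" "x \<in> gr X a" "y \<in> gr Y b"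
    let ?s = "\<Lambda> a b"
    note xX = gr_carrier[OF *(3)] and yY = gr_carrier[OF *(4)] and sG = Lambda_closed[OF *(1,2)] and sH = Lambda_H[OF *(1,2)]
    have "coV (zpr X Y x y) = tsum (tensor H V) (coact X x) (\<lambda>h x\<^sub>0. tsum (tensor H V) (coact Y y) (\<lambda>k y\<^sub>0. pure H V (h \<otimes>\<^bsub>H\<^esub> k \<otimes>\<^bsub>H\<^esub> ?s) (zpr X Y x\<^sub>0 y\<^sub>0)))"
      unfolding zpr_homog[OF *] by (rule coV_zpure[OF xX yY sG])
    also have "\<dots> = tsum (tensor H V) (coact X x) (\<lambda>h x\<^sub>0. tsum (tensor H V) (coact Y y) (\<lambda>k y\<^sub>0. pure H V (zmult h k) (zpr X Y x\<^sub>0 y\<^sub>0)))"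
    proof (rule tsum_coact_homog_cong[OF X vN *(1,3) bilinI bilinI])
      fix h x\<^sub>0 assume h: "h \<in> gH a" and x0: "x\<^sub>0 \<in> gr X a"
      note hc = gH_carrier[OF h] gr_carrier[OF x0]
      show "tsum (tensor H V) (coact Y y) (\<lambda>k y\<^sub>0. pure H V (h \<otimes>\<^bsub>H\<^esub> k \<otimes>\<^bsub>H\<^esub> ?s) (zpr X Y x\<^sub>0 y\<^sub>0))
          = tsum (tensor H V) (coact Y y) (\<lambda>k y\<^sub>0. pure H V (zmult h k) (zpr X Y x\<^sub>0 y\<^sub>0))"
        by (rule tsum_coact_homog_cong[OF Y vN *(2,4) bilinI bilinI])
          (rule st sH hc | assumption | simp add: zmult_homog[OF *(1,2) h])+
    qed (rule st sH yY | assumption)+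
    finally show "coV (zpr X Y x y) = tsum (tensor H V) (coact X x) (\<lambda>h x\<^sub>0. tsum (tensor H V) (coact Y y) (\<lambda>k y\<^sub>0. pure H V (zmult h k) (zpr X Y x\<^sub>0 y\<^sub>0)))" .
  qed
qed

end

end

context zesting
begin

lemma model_zested:
  "tensor_model H G \<pi> \<Gamma> \<gamma> \<Lambda> \<omega> (zT :: ('k, 'h, 'a) ucomod \<Rightarrow> ('k, 'h, 'a) ucomod \<Rightarrow> _) zpr zdc (comod_unit H) (Scal 1) unscal"
proof (rule tensor_model.intro[OF zesting_axioms], rule tensor_model_axioms.intro, goal_cases)
  case (1 X Y) then show ?case by (rule zT_model(1))
next
  case (2 X Y) then show ?case by (rule zT_model(2))
next
  case (3 X Y) then show ?case by (rule zT_model(3))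
next
  case (4 X Y) then show ?case by (rule zT_model(4))
next
  case (5 X Y x y) then show ?case by (rule zT_model(5))
next
  case (6 X Y u) then show ?case by (rule zT_model(6))
next
  case (7 X Y x y) then show ?case by (rule zT_model(7))
qed (use comodule_comod_unit lin_unscal in \<open>auto simp: comod_unit_simps coact_comod_unit\<close>)

text \<open>Evaluates a trilinear \<open>k\<close> on the ambient space, given there by two nested
  sums. The unit constraints are of this shape, with the counit on the third factor.\<close>

lemma zlift:
  fixes X Y :: "('k, 'h, 'a) ucomod"
  assumes X: "comodule H X" and Y: "comodule H Y" and N: "vspace N"
    and b: "\<And>s. s \<in> carrier H \<Longrightarrow> bilin X Y N (\<lambda>x y. k x y s)"
    and l: "\<And>x y. x \<in> carrier X \<Longrightarrow> y \<in> carrier Y \<Longrightarrow> lin H N (k x y)"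
  defines "L \<equiv> \<lambda>u. tsum N (udec (comod_tensor H X Y) R u) (\<lambda>v r. tsum N (udec X Y v) (\<lambda>x y. k x y (unelem r)))"
  shows "lin (ambient X Y) N L"
    and "\<And>x y s. x \<in> carrier X \<Longrightarrow> y \<in> carrier Y \<Longrightarrow> s \<in> carrier H \<Longrightarrow> L (zpure H X Y x y s) = k x y s"
proof -
  note vX = vX[OF X Y] and vY = vY[OF X Y] and vP = vP[OF X Y] and vR = vspace_regular
  let ?P = "comod_tensor H X Y"
  have B: "bilin ?P R N (\<lambda>v (r :: ('k, 'h, 'a) univ). tsum N (udec X Y v) (\<lambda>x y. k x y (unelem r)))"
  proof (rule bilinI)
    fix r :: "('k, 'h, 'a) univ" assume "r \<in> carrier R"
    then show "lin ?P N (\<lambda>v. tsum N (udec X Y v) (\<lambda>x y. k x y (unelem r)))"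
      unfolding lin_comod_tensor by (intro lin_comp[OF lin_tsum[OF vX vY N b] lin_udec[OF vX vY]] lin_closed[OF lin_unelem])
  next
    fix v assume "v \<in> carrier ?P"
    then have "udec X Y v \<in> carrier (tensor X Y)" by (simp add: udec_closed[OF vX vY])
    then show "lin R N (\<lambda>r. tsum N (udec X Y v) (\<lambda>x y. k x y (unelem r)))"
      by (rule lin_tsum_ker[OF _ vX vY N lin_comp[OF l lin_unelem]])
  qed
  show "lin (ambient X Y) N L"
    unfolding L_def ambient_def lin_comod_tensor by (rule lin_comp[OF lin_tsum[OF vP vR N B] lin_udec[OF vP vR]])
  fix x y s assume x: "x \<in> carrier X" and y: "y \<in> carrier Y" and s: "s \<in> carrier H"
  have u: "upure X Y x y \<in> carrier ?P" using upure_closed[OF x y vX vY] by simp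
  have r: "Elem s \<in> carrier R" using s by (simp add: regular_simps)
  show "L (zpure H X Y x y s) = k x y s"
    unfolding L_def zpure_def udec_upure[OF vP vR u r] tsum_pure[OF vP vR N B u r] udec_upure[OF vX vY x y] univ.sel
    by (rule tsum_pure[OF vX vY N b[OF s] x y])
qed

abbreviation zmap :: "('k, 'h, 'a) ucomod \<Rightarrow> ('k, 'h, 'a) ucomod \<Rightarrow> ('k, 'h, 'a) ucomod \<Rightarrow> ('k, 'h, 'a) ucomod
    \<Rightarrow> (('k, 'h, 'a) univ \<Rightarrow> ('k, 'h, 'a) univ) \<Rightarrow> (('k, 'h, 'a) univ \<Rightarrow> ('k, 'h, 'a) univ) \<Rightarrow> ('k, 'h, 'a) univ \<Rightarrow> ('k, 'h, 'a) univ" where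
  "zmap X X' Y Y' f g \<equiv> umap (comod_tensor H X Y) R (comod_tensor H X' Y') R (umap X Y X' Y' f g) (\<lambda>s. s)"

text \<open>Morphisms preserve degrees, so f \<otimes> g \<otimes> id maps generators to generators
  with the same group-like and restricts to the zested products.\<close>

lemma zmap:
  fixes X X' Y Y' :: "('k, 'h, 'a) ucomod"
  assumes X: "comodule H X" and X': "comodule H X'" and Y: "comodule H Y" and Y': "comodule H Y'"
    and f: "f \<in> carrier (comod_hom H X X')" and g: "g \<in> carrier (comod_hom H Y Y')"
  shows "lin (zT X Y) (zT X' Y') (zmap X X' Y Y' f g)"
    and "\<And>x y. x \<in> carrier X \<Longrightarrow> y \<in> carrier Y \<Longrightarrow> zmap X X' Y Y' f g (zpr X Y x y) = zpr X' Y' (f x) (g y)"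
proof -
  let ?W = "ambient X Y" and ?W' = "ambient X' Y'" and ?P = "comod_tensor H X Y" and ?P' = "comod_tensor H X' Y'"
  let ?h = "umap X Y X' Y' f g" and ?F = "zmap X X' Y Y' f g"
  note vX' = comodule_vspace[OF X'] and vY' = comodule_vspace[OF Y'] and vP' = vP[OF X' Y'] and vW' = vW[OF X' Y'] and vU' = vU[OF X' Y']
  note vX = comodule_vspace[OF X] and vY = comodule_vspace[OF Y] and vP = vP[OF X Y] and vR = vspace_regular and vW = vW[OF X Y]
  note lf = mor_lin[OF f] and lg = mor_lin[OF g]
  have b: "bilin X Y (utensor X' Y') (\<lambda>x y. upure X' Y' (f x) (g y))"
    by (rule bilinI) (rule lf lg linr vX' vY' lin_closed[OF lf] lin_closed[OF lg] | assumption)+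
  have lh: "lin ?P ?P' ?h"
    unfolding umap_def[abs_def] lin_comod_tensor by (rule lin_comp[OF lin_tsum[OF vX vY vU' b] lin_udec[OF vX vY]])
  have hp: "?h (upure X Y x y) = upure X' Y' (f x) (g y)" if "x \<in> carrier X" "y \<in> carrier Y" for x y
    unfolding umap_def udec_upure[OF vX vY that] by (rule tsum_pure[OF vX vY vU' b that])
  have vN: "vspace (utensor ?P' R)" by (rule vspace_utensor[OF vP' vR])
  have b2: "bilin ?P R (utensor ?P' R) (\<lambda>v r. upure ?P' R (?h v) r)"
    by (rule bilinI) (rule lh lin_id lin_upure_left lin_upure_right vP' vR lin_closed[OF lh] | assumption)+
  have lF: "lin ?W ?W' ?F"
    unfolding umap_def[of ?P R, abs_def] ambient_def lin_comod_tensor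
    by (rule lin_comp[OF lin_tsum[OF vP vR vN b2] lin_udec[OF vP vR]])
  have Fz: "?F (zpure H X Y x y s) = zpure H X' Y' (f x) (g y) s" if "x \<in> carrier X" "y \<in> carrier Y" "s \<in> carrier H" for x y s
  proof -
    have u: "upure X Y x y \<in> carrier ?P" using upure_closed[OF that(1,2) vX vY] by simp
    have r: "Elem s \<in> carrier R" using that(3) by (simp add: regular_simps)
    show ?thesis
      unfolding umap_def[of ?P R] zpure_def udec_upure[OF vP vR u r] tsum_pure[OF vP vR vN b2 u r] hp[OF that(1,2)] ..
  qed
  have bz: "bilin X Y (zT X' Y') (\<lambda>x y. zpr X' Y' (f x) (g y))"
    by (rule bilinI) (rule lin_bilin_left[OF zT_model(3)[OF X' Y']] lin_bilin_right[OF zT_model(3)[OF X' Y']] lf lg lin_closed[OF lf] lin_closed[OF lg] | assumption)+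
  have bz': "bilin X Y ?W' (\<lambda>x y. zpr X' Y' (f x) (g y))"
    by (rule bilinI) (rule lin_bilin_left[OF bilin_zpr[OF X' Y']] lin_bilin_right[OF bilin_zpr[OF X' Y']] lf lg lin_closed[OF lf] lin_closed[OF lg] | assumption)+
  show Fp: "?F (zpr X Y x y) = zpr X' Y' (f x) (g y)" if "x \<in> carrier X" "y \<in> carrier Y" for x y
  proof (rule bilin_homog_ext[OF X Y vW' _ bz' that])
    show "bilin X Y ?W' (\<lambda>x y. ?F (zpr X Y x y))"
      by (rule bilinI) (rule lin_comp[OF lF] bilin_left[OF bilin_zpr[OF X Y]] bilin_right[OF bilin_zpr[OF X Y]] | assumption)+
    fix a b x y assume *: "a \<in> carrier G" "b \<in> carrier G" "x \<in> gr X a" "y \<in> gr Y b"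
    show "?F (zpr X Y x y) = zpr X' Y' (f x) (g y)"
      unfolding zpr_homog[OF X Y *] zpr_homog[OF X' Y' *(1,2) mor_gr[OF X X' f *(1,3)] mor_gr[OF Y Y' g *(2,4)]]
      by (rule Fz[OF gr_carrier[OF *(3)] gr_carrier[OF *(4)] Lambda_H[OF *(1,2)]])
  qed
  \<comment> \<open>Linearity into the ambient space does not give membership in the subspace; for
    that the element is expanded along \<open>zpr\<close>.\<close>
  have cF: "?F u \<in> carrier (zT X' Y')" if u: "u \<in> carrier (zT X Y)" for u
  proof -
    have d: "zdc X Y u \<in> carrier (tensor X Y)" by (rule lin_closed[OF zT_model(4)[OF X Y] u])
    have "?F u = ?F (tsum ?W (zdc X Y u) (zpr X Y))" using zT_model(6)[OF X Y u] by (simp add: zT_transfer[OF X Y])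
    also have "\<dots> = tsum ?W' (zdc X Y u) (\<lambda>x y. ?F (zpr X Y x y))"
      by (rule tsum_image[OF vX vY vW vW' lF d bilin_closed[OF bilin_zpr[OF X Y]]])
    also have "\<dots> = tsum (zT X' Y') (zdc X Y u) (\<lambda>x y. zpr X' Y' (f x) (g y))"
      unfolding zT_transfer[OF X' Y'] by (rule tsum_cong[OF vX vY d Fp])
    also have "\<dots> \<in> carrier (zT X' Y')"
      by (rule tsum_closed[OF vX vY zT_model(1)[OF X' Y'] d bilin_closed[OF bz]])
    finally show ?thesis .
  qed
  show "lin (zT X Y) (zT X' Y') ?F"
    using sub_lin(1)[OF zcar_sub[OF X Y] lF] cF unfolding lin_def by (simp add: zT_simps[OF X Y] zT_simps[OF X' Y'] Pi_iff)
qed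

text \<open>The associator is a definite description in terms of generators: \<open>asc_map\<close>
  satisfies it, and extensionality on homogeneous triples makes it unique. The unit constraints are
  restrictions of maps on the ambient space, where the counit removes the group-like factor.\<close>

lemma cat_zested:
  "tensor_cat H G \<pi> \<Gamma> \<gamma> \<Lambda> \<omega> (zT :: ('k, 'h, 'a) ucomod \<Rightarrow> ('k, 'h, 'a) ucomod \<Rightarrow> _) zpr zdc (comod_unit H) (Scal 1) unscal
    (zested_cat H G \<pi> \<gamma> \<Lambda> \<omega>)"
proof -
  interpret m: tensor_model H G \<pi> \<Gamma> \<gamma> \<Lambda> \<omega> "zT :: ('k, 'h, 'a) ucomod \<Rightarrow> ('k, 'h, 'a) ucomod \<Rightarrow> _" zpr zdc "comod_unit H" "Scal 1" unscal
    by (rule model_zested)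
  let ?C = "zested_cat H G \<pi> \<gamma> \<Lambda> \<omega> :: ('k, ('k, 'h, 'a) ucomod, ('k, 'h, 'a) univ \<Rightarrow> ('k, 'h, 'a) univ) moncat"
  let ?U = "comod_unit H :: ('k, 'h, 'a) ucomod"
  have like: "comod_like H ?C"
    by (simp add: comod_like_def zested_cat_def Let_def comod_lincat_def)
  have resl: "lin S N (restrict f (carrier S)) = lin S N f" if "vspace S" for f N and S :: "('k, 'h, 'a) ucomod"
    by (rule lin_cong[OF that]) simp
  have M: "TMor ?C X X' Y Y' f g = restrict (zmap X X' Y Y' f g) (carrier (zT X Y))" for X X' Y Y' f g
    by (simp add: zested_cat_def Let_def)
  have A: "Asc ?C X Y Z = restrict (m.asc_map X Y Z) (carrier (zT (zT X Y) Z))"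
    if X: "comodule H X" and Y: "comodule H Y" and Z: "comodule H Z" for X Y Z
  proof -
    note XY = m.T_comodule[OF X Y] and YZ = m.T_comodule[OF Y Z]
    let ?S = "zT (zT X Y) Z" and ?N = "zT X (zT Y Z)"
    note vS = m.T_vspace[OF XY Z] and vN = m.T_vspace[OF X YZ]
    let ?w = "\<lambda>a b c x y z. \<omega> a b c \<odot>\<^bsub>?N\<^esub> zpure H X (zT Y Z) x (zpure H Y Z y (half_braid (\<gamma> (\<Lambda> a b)) Z z) (\<Lambda> b c)) (\<Lambda> a (b \<otimes>\<^bsub>G\<^esub> c))"
    let ?u = "\<lambda>a b c x y z. zpure H (zT X Y) Z (zpure H X Y x y (\<Lambda> a b)) z (\<Lambda> (a \<otimes>\<^bsub>G\<^esub> b) c)"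
    interpret Gr: group G by (rule grp)
    \<comment> \<open>The iterated generators of the description are iterated values of
      \<open>zpr\<close>, because \<open>zpr X Y x y\<close> is homogeneous of the product degree
      and the half-braiding keeps the degree of \<open>z\<close>.\<close>
    have left: "?u a b c x y z = zpr (zT X Y) Z (zpr X Y x y) z"
      and right: "?w a b c x y z = \<omega> a b c \<odot>\<^bsub>?N\<^esub> zpr X (zT Y Z) x (zpr Y Z y (half_braid (\<gamma> (\<Lambda> a b)) Z z))"
      if *: "a \<in> carrier G" "b \<in> carrier G" "c \<in> carrier G" "x \<in> gr X a" "y \<in> gr Y b" "z \<in> gr Z c" for a b c x y z
    proof -
      show "?u a b c x y z = zpr (zT X Y) Z (zpr X Y x y) z"
        using zpr_homog[OF XY Z Gr.m_closed[OF *(1,2)] *(3) m.pr_gr[OF X Y *(1,2,4,5)] *(6)] zpr_homog[OF X Y *(1,2,4,5)] by simp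
      note hz = half_braid_gr[OF Z *(3,6) lin_gamma[OF Lambda_closed[OF *(1,2)]]]
      show "?w a b c x y z = \<omega> a b c \<odot>\<^bsub>?N\<^esub> zpr X (zT Y Z) x (zpr Y Z y (half_braid (\<gamma> (\<Lambda> a b)) Z z))"
        using zpr_homog[OF X YZ *(1) Gr.m_closed[OF *(2,3)] *(4) m.pr_gr[OF Y Z *(2,3,5) hz]] zpr_homog[OF Y Z *(2,3,5) hz] by simp
    qed
    let ?a = "restrict (m.asc_map X Y Z) (carrier ?S)"
    have pc: "zpr (zT X Y) Z (zpr X Y x y) z \<in> carrier ?S" if "x \<in> carrier X" "y \<in> carrier Y" "z \<in> carrier Z" for x y z
      by (rule m.pr_closed X Y Z XY that)+
    have la: "lin ?S ?N ?a" using m.asc_map(1)[OF X Y Z] by (simp add: resl[OF vS])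
    have ha: "?a (?u a b c x y z) = ?w a b c x y z"
      if *: "a \<in> carrier G" "b \<in> carrier G" "c \<in> carrier G" "x \<in> gr X a" "y \<in> gr Y b" "z \<in> gr Z c" for a b c x y z
      unfolding left[OF *] right[OF *] restrict_apply if_P[OF pc[OF gr_carrier[OF *(4)] gr_carrier[OF *(5)] gr_carrier[OF *(6)]]]
      by (rule m.asc_map(2)[OF X Y Z *])
    have "zested_assoc H G \<pi> \<gamma> \<Lambda> \<omega> X Y Z = ?a"
      unfolding zested_assoc_def Let_def
    proof (rule the_equality, intro conjI ballI)
      show "?a \<in> extensional (carrier ?S)" by simp
      show "lin ?S ?N ?a" by (rule la)
      show "?a (?u a b c x y z) = ?w a b c x y z"
        if "a \<in> carrier G" "b \<in> carrier G" "c \<in> carrier G" "x \<in> gr X a" "y \<in> gr Y b" "z \<in> gr Z c" for a b c x y z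
        by (rule ha[OF that])
    next
      fix f assume f: "f \<in> extensional (carrier ?S) \<and> lin ?S ?N f \<and> (\<forall>a\<in>carrier G. \<forall>b\<in>carrier G. \<forall>c\<in>carrier G.
            \<forall>x\<in>gr X a. \<forall>y\<in>gr Y b. \<forall>z\<in>gr Z c. f (?u a b c x y z) = ?w a b c x y z)"
      then have fe: "f \<in> extensional (carrier ?S)" and lf: "lin ?S ?N f" by (rule conjunct1, rule conjunct1[OF conjunct2])
      have fh: "f (?u a b c x y z) = ?w a b c x y z"
        if "a \<in> carrier G" "b \<in> carrier G" "c \<in> carrier G" "x \<in> gr X a" "y \<in> gr Y b" "z \<in> gr Z c" for a b c x y z
        using f that by blast
      show "f = ?a"
      proof (rule extensionalityI[OF fe])
        show "?a \<in> extensional (carrier ?S)" by simp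
        fix u assume u: "u \<in> carrier ?S"
        show "f u = ?a u"
        proof (rule m.T_ext3[OF X Y Z vN lf la u])
          fix a b c x y z assume *: "a \<in> carrier G" "b \<in> carrier G" "c \<in> carrier G" "x \<in> gr X a" "y \<in> gr Y b" "z \<in> gr Z c"
          show "f (zpr (zT X Y) Z (zpr X Y x y) z) = ?a (zpr (zT X Y) Z (zpr X Y x y) z)"
            unfolding left[OF *, symmetric] fh[OF *] ha[OF *] ..
        qed
      qed
    qed
    then show ?thesis by (simp add: zested_cat_def Let_def)
  qed
  define lu where "lu X u = tsum X (udec (comod_tensor H ?U X) R u) (\<lambda>v s. tsum X (udec ?U X v) (\<lambda>c x. (counit H (unelem s) * unscal c) \<odot>\<^bsub>X\<^esub> x))"
    for X :: "('k, 'h, 'a) ucomod" and u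
  define ru where "ru X u = tsum X (udec (comod_tensor H X ?U) R u) (\<lambda>v s. tsum X (udec X ?U v) (\<lambda>x c. (counit H (unelem s) * unscal c) \<odot>\<^bsub>X\<^esub> x))"
    for X :: "('k, 'h, 'a) ucomod" and u
  have LR: "LUn ?C X = restrict (lu X) (carrier (zT ?U X))" "RUn ?C X = restrict (ru X) (carrier (zT X ?U))" for X
    by (simp_all add: zested_cat_def Let_def lu_def[abs_def] ru_def[abs_def])
  have lu: "lin (ambient ?U X) X (lu X)" "u \<in> carrier ?U \<Longrightarrow> x \<in> carrier X \<Longrightarrow> s \<in> carrier H \<Longrightarrow> lu X (zpure H ?U X u x s) = (counit H s * unscal u) \<odot>\<^bsub>X\<^esub> x"
    and ru: "lin (ambient X ?U) X (ru X)" "u \<in> carrier ?U \<Longrightarrow> x \<in> carrier X \<Longrightarrow> s \<in> carrier H \<Longrightarrow> ru X (zpure H X ?U x u s) = (counit H s * unscal u) \<odot>\<^bsub>X\<^esub> x"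
    if X: "comodule H X" for X u x s
  proof -
    note vX = comodule_vspace[OF X]
    have b1: "bilin ?U X X (\<lambda>c x. (counit H s * unscal c) \<odot>\<^bsub>X\<^esub> x)" and b2: "bilin X ?U X (\<lambda>x c. (counit H s * unscal c) \<odot>\<^bsub>X\<^esub> x)" for s
      by (rule bilinI; (rule lin_scale[OF vX] lin_scalar[OF vX] lin_mult_left lin_id lin_unscal vX | assumption)+)+
    have l: "lin H X (\<lambda>s. (counit H s * unscal c) \<odot>\<^bsub>X\<^esub> x)" if "x \<in> carrier X" for c x
      by (rule lin_scalar[OF vX lin_mult_right[OF lin_counit'[OF lin_id]] that])
    show "lin (ambient ?U X) X (lu X)" unfolding lu_def[abs_def] by (rule zlift(1)[OF m.U X vX b1 l])
    show "lin (ambient X ?U) X (ru X)" unfolding ru_def[abs_def] by (rule zlift(1)[OF X m.U vX b2 l])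
    show "lu X (zpure H ?U X u x s) = (counit H s * unscal u) \<odot>\<^bsub>X\<^esub> x" if "u \<in> carrier ?U" "x \<in> carrier X" "s \<in> carrier H"
      unfolding lu_def by (rule zlift(2)[OF m.U X vX b1 l that])
    show "ru X (zpure H X ?U x u s) = (counit H s * unscal u) \<odot>\<^bsub>X\<^esub> x" if "u \<in> carrier ?U" "x \<in> carrier X" "s \<in> carrier H"
      unfolding ru_def by (rule zlift(2)[OF X m.U vX b2 l that(2,1,3)])
  qed
  interpret Gr: group G by (rule grp)
  show ?thesis
  proof (rule tensor_cat.intro[OF model_zested], rule tensor_cat_axioms.intro, goal_cases)
    case 1 show ?case by (rule like)
  next
    case 2 show ?case by (simp add: zested_cat_def Let_def)
  next
    case 3 show ?case by (simp add: zested_cat_def Let_def)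
  next
    case (4 X X' Y Y' f g) show ?case unfolding M by simp
  next
    case (5 X X' Y Y' f g)
    show ?case unfolding M resl[OF m.T_vspace[OF 5(1,3)]] by (rule zmap(1)[OF 5])
  next
    case (6 X X' Y Y' f g a b x y)
    note xX = gr_carrier[OF 6(9)] and yY = gr_carrier[OF 6(10)]
    show ?case unfolding M restrict_apply if_P[OF m.pr_closed[OF xX yY 6(1,3)]] by (rule zmap(2)[OF 6(1-6) xX yY])
  next
    case (7 X Y Z) show ?case unfolding A[OF 7] by simp
  next
    case (8 X Y Z)
    show ?case unfolding A[OF 8] resl[OF m.T_vspace[OF m.T_comodule[OF 8(1,2)] 8(3)]] by (rule m.asc_map(1)[OF 8])
  next
    case (9 X Y Z a b c x y z)
    note xX = gr_carrier[OF 9(7)] and yY = gr_carrier[OF 9(8)] and zZ = gr_carrier[OF 9(9)]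
    have pc: "zpr (zT X Y) Z (zpr X Y x y) z \<in> carrier (zT (zT X Y) Z)"
      by (rule m.pr_closed m.T_comodule 9(1-3) xX yY zZ)+
    show ?case unfolding A[OF 9(1-3)] restrict_apply if_P[OF pc] by (rule m.asc_map(2)[OF 9])
  next
    case (10 X) show ?case unfolding LR by simp
  next
    case (11 X)
    show ?case unfolding LR resl[OF m.T_vspace[OF m.U 11]] unfolding zT_transfer[OF m.U 11] by (rule sub_lin(1)[OF zcar_sub[OF m.U 11] lu(1)[OF 11]])
  next
    case (12 X u a x)
    note xX = gr_carrier[OF 12(4)]
    show ?case
      unfolding LR restrict_apply if_P[OF m.pr_closed[OF 12(2) xX m.U 12(1)]]
      unfolding zpr_homog[OF m.U 12(1) Gr.one_closed 12(3) m.U_gr[OF 12(2)] 12(4)]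
        lu(2)[OF 12(1,2) xX Lambda_H[OF Gr.one_closed 12(3)]]
      by (simp add: Gamma_counit[OF Lambda_closed] 12(3))
  next
    case (13 X) show ?case unfolding LR by simp
  next
    case (14 X)
    show ?case unfolding LR resl[OF m.T_vspace[OF 14 m.U]] unfolding zT_transfer[OF 14 m.U] by (rule sub_lin(1)[OF zcar_sub[OF 14 m.U] ru(1)[OF 14]])
  next
    case (15 X u a x)
    note xX = gr_carrier[OF 15(4)]
    show ?case
      unfolding LR restrict_apply if_P[OF m.pr_closed[OF xX 15(2,1) m.U]]
      unfolding zpr_homog[OF 15(1) m.U 15(3) Gr.one_closed 15(4) m.U_gr[OF 15(2)]]
        ru(2)[OF 15(1,2) xX Lambda_H[OF 15(3) Gr.one_closed]]
      by (simp add: Gamma_counit[OF Lambda_closed] 15(3))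
  qed
qed

lemma zested_equivalent:
  "tensor_equivalent (comod_cat zested :: ('k, ('k, 'h, 'a) ucomod, ('k, 'h, 'a) univ \<Rightarrow> ('k, 'h, 'a) univ) moncat)
    (zested_cat H G \<pi> \<gamma> \<Lambda> \<omega> :: ('k, ('k, 'h, 'a) ucomod, ('k, 'h, 'a) univ \<Rightarrow> ('k, 'h, 'a) univ) moncat)"
  by (rule tensor_cat_pair.tensor_equivalent[OF tensor_cat_pair.intro[OF cat_comod_cat cat_zested]])

end

theorem theorem3p7:
  fixes H :: "('k::field, 'h) hopf"
    and G :: "'g monoid"
    and \<pi> :: "'h \<Rightarrow> 'g \<Rightarrow> 'k"
    and \<Gamma>\<^sub>0 :: "'h set"
    and \<gamma> :: "'h \<Rightarrow> 'h \<Rightarrow> 'k"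
    and \<Lambda> :: "'g \<Rightarrow> 'g \<Rightarrow> 'h"
    and \<omega> :: "'g \<Rightarrow> 'g \<Rightarrow> 'g \<Rightarrow> 'k"
  assumes "hopf_algebra H"
    and "group G"
    and "hopf_map H (group_alg G) \<pi>"
    and "\<pi> ` carrier H = carrier (group_alg G :: ('k, 'g \<Rightarrow> 'k) hopf)"
    and "cocentral H (group_alg G) \<pi>"
    and "zesting_datum H G \<pi> \<Gamma>\<^sub>0 \<gamma> \<Lambda> \<omega>"
  shows "\<exists>Q :: ('k, 'h) coquasi.
      coquasi_bialgebra Q
    \<and> carrier Q = carrier H \<and> zero Q = zero H \<and> add Q = add H \<and> smult Q = smult H
    \<and> comult Q = comult H \<and> counit Q = counit H
    \<and> (\<forall>g\<^sub>1\<in>carrier G. \<forall>g\<^sub>2\<in>carrier G. \<forall>h\<in>grade H G \<pi> g\<^sub>1. \<forall>k\<in>grade H G \<pi> g\<^sub>2.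
         h \<otimes>\<^bsub>Q\<^esub> k = h \<otimes>\<^bsub>H\<^esub> k \<otimes>\<^bsub>H\<^esub> \<Lambda> g\<^sub>1 g\<^sub>2)
    \<and> (\<forall>g\<^sub>1\<in>carrier G. \<forall>g\<^sub>2\<in>carrier G. \<forall>g\<^sub>3\<in>carrier G.
         \<forall>h\<in>grade H G \<pi> g\<^sub>1. \<forall>k\<in>grade H G \<pi> g\<^sub>2. \<forall>l\<in>grade H G \<pi> g\<^sub>3.
           reassociator Q h k l = counit H (h \<otimes>\<^bsub>H\<^esub> k) * \<omega> g\<^sub>1 g\<^sub>2 g\<^sub>3 * \<gamma> (\<Lambda> g\<^sub>1 g\<^sub>2) l)
    \<and> tensor_equivalent
        (comod_cat Q :: ('k, ('k, 'h, 'a) ucomod, ('k, 'h, 'a) univ \<Rightarrow> ('k, 'h, 'a) univ) moncat)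
        (zested_cat H G \<pi> \<gamma> \<Lambda> \<omega> :: ('k, ('k, 'h, 'a) ucomod, ('k, 'h, 'a) univ \<Rightarrow> ('k, 'h, 'a) univ) moncat)"
proof -
  interpret zesting H G \<pi> \<Gamma>\<^sub>0 \<gamma> \<Lambda> \<omega>
    by (intro zesting.intro graded.intro bialg_struct.intro coalg_struct.intro bialg_struct_axioms.intro graded_axioms.intro zesting_axioms.intro)
      (use assms in \<open>simp_all add: hopf_algebra_def bialgebra_def\<close>)
  show ?thesis
  proof (intro exI[of _ zested] conjI ballI)
    fix a b h k assume "a \<in> carrier G" "b \<in> carrier G" "h \<in> grade H G \<pi> a" "k \<in> grade H G \<pi> b"
    then show "h \<otimes>\<^bsub>zested\<^esub> k = h \<otimes>\<^bsub>H\<^esub> k \<otimes>\<^bsub>H\<^esub> \<Lambda> a b" unfolding gr_self by (simp add: zmult_homog)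
  next
    fix a b c h k l assume *: "a \<in> carrier G" "b \<in> carrier G" "c \<in> carrier G" "h \<in> grade H G \<pi> a" "k \<in> grade H G \<pi> b" "l \<in> grade H G \<pi> c"
    note * = *[unfolded gr_self]
    \<comment> \<open>Multiplicativity of the counit merges the two counits in the form into the
      counit of the product in \<open>H\<close>.\<close>
    show "reassociator zested h k l = counit H (h \<otimes>\<^bsub>H\<^esub> k) * \<omega> a b c * \<gamma> (\<Lambda> a b) l"
      by (simp add: Omega_homog(1)[OF *] counit_mult gH_carrier[OF *(4)] gH_carrier[OF *(5)])
  qed (simp_all add: coquasi_bialgebra_zested zested_equivalent)
qed

end
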